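(* Assume the Small Set Expansion Hypothesis. For every integer $r\geq 2$ and every $\mu<2^{-r}$, given an $r$-uniform hypergraph $H=(V,E)$, it is NP-hard to distinguish between \[\text{YES: } \delta^{(r)}_{\mu|V|}(H)\geq c\,\frac{\mu}{r^3\log(1/\mu)} \qquad\text{and}\qquad \text{NO: } \delta^{(r)}_{\mu|V|}(H)\leq C\mu^r,\] where $c,C>0$ are absolute constants.
   Context: For an $r$-uniform hypergraph $H=(V,E)$, $\delta^{(r)}_{\mu|V|}(H)$ denotes the optimal value of Densest-$k$-SubHypergraph with $k=\mu|V|$: the maximum, over $S\subseteq V$ with $|S|=\mu|V|$, of the fraction of hyperedges of $H$ contained in $S$. Small Set Expansion Hypothesis (SSEH): for a regular graph $G$ and $S\subseteq V(G)$, let ${\sf Vol}(S)$ be the uniform (stationary) measure of $S$ and $\phi_G(S)=\Pr_{(i,j)\sim E}[i\in S,j\notin S]/\min\{{\sf Vol}(S),{\sf Vol}(S^c)\}$; SSEH states that for every $\epsilon\in(0,1)$ and $M\in[1,1/\sqrt\epsilon]$ there is $\delta=\delta(\epsilon,M)$ such that it is NP-hard to distinguish regular graphs having a set $S$ with ${\sf Vol}(S)=\delta$ and $\phi_G(S)\leq\epsilon$ from those in which every $S$ with ${\sf Vol}(S)\in[\delta/M,M\delta]$ has $\phi_G(S)\geq1-\epsilon$. *)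

theory Defs
  imports Complex_Main
begin

section \<open>Polynomial time\<close>

text \<open>
  Deterministic multi-tape Turing machines. Tape symbols are \<open>0\<close> (blank), \<open>1\<close> and \<open>2\<close> (the two
  bits), and further work symbols below \<open>symbols M\<close>. The start state is \<open>0\<close>, the working states
  are those below \<open>states M\<close>, and the state \<open>states M\<close> is the halting state. Tapes are infinite
  in both directions; a tape is a pair of contents and head position. An action writes a symbol
  and moves the head by \<open>-1\<close>, \<open>0\<close> or \<open>1\<close>.
\<close>

record tm =
  tapes :: nat
  symbols :: nat
  states :: nat
  delta :: "nat \<Rightarrow> nat list \<Rightarrow> nat \<times> (nat \<times> int) list"

type_synonym tape = "(int \<Rightarrow> nat) \<times> int"

definition well_formed_tm :: "tm \<Rightarrow> bool" where
  "well_formed_tm M \<longleftrightarrow>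
     1 \<le> tapes M \<and> 3 \<le> symbols M \<and>
     (\<forall>q < states M. \<forall>xs. length xs = tapes M \<and> set xs \<subseteq> {..<symbols M} \<longrightarrow>
        fst (delta M q xs) \<le> states M \<and>
        length (snd (delta M q xs)) = tapes M \<and>
        set (snd (delta M q xs)) \<subseteq> {..<symbols M} \<times> {-1, 0, 1})"

fun act :: "nat \<times> int \<Rightarrow> tape \<Rightarrow> tape" where
  "act (a, m) (contents, h) = (contents(h := a), h + m)"

fun step :: "tm \<Rightarrow> nat \<times> tape list \<Rightarrow> nat \<times> tape list" where
  "step M (q, ts) =
     (if q < states M then
        (let (q', acts) = delta M q (map (\<lambda>(contents, h). contents h) ts)
         in (q', map2 act acts ts))
      else (q, ts))"

definition word_contents :: "bool list \<Rightarrow> int \<Rightarrow> nat" where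
  "word_contents x i =
     (if 0 \<le> i \<and> i < int (length x) then (if x ! nat i then 2 else 1) else 0)"

definition initial_config :: "tm \<Rightarrow> bool list \<Rightarrow> nat \<times> tape list" where
  "initial_config M x =
     (0, (word_contents x, 0) # replicate (tapes M - 1) (word_contents [], 0))"

text \<open>The input is on the first tape and the output on the last one. Halted configurations are
  fixed by \<open>step\<close>, so the machine halts within \<open>t\<close> steps iff it is halted after \<open>t\<close> iterations.\<close>

definition computes_within :: "tm \<Rightarrow> bool list \<Rightarrow> bool list \<Rightarrow> nat \<Rightarrow> bool" where
  "computes_within M x y t \<longleftrightarrow>
     (let (q, ts) = (step M ^^ t) (initial_config M x)
      in q = states M \<and> fst (last ts) = word_contents y)"

definition poly_time :: "(bool list \<Rightarrow> bool list) \<Rightarrow> bool" where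
  "poly_time f \<longleftrightarrow>
     (\<exists>M a d. well_formed_tm M \<and>
        (\<forall>x. computes_within M x (f x) (a * length x ^ d + a)))"


section \<open>NP and NP-hard promise problems\<close>

definition pair_word :: "bool list \<Rightarrow> bool list \<Rightarrow> bool list" where
  "pair_word x w = concat (map (\<lambda>b. [b, b]) x) @ [False, True] @ w"

definition NP :: "bool list set set" where
  "NP = {L. \<exists>V a d. poly_time V \<and>
     (\<forall>x. x \<in> L \<longleftrightarrow> (\<exists>w. length w \<le> a * length x ^ d + a \<and> V (pair_word x w) = [True]))}"

text \<open>It is NP-hard to distinguish YES from NO: every language in NP has a polynomial-time
  many-one reduction to the promise problem.\<close>

definition NP_hard_to_distinguish :: "bool list set \<Rightarrow> bool list set \<Rightarrow> bool" where
  "NP_hard_to_distinguish YES NO \<longleftrightarrow>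
     (\<forall>L \<in> NP. \<exists>f. poly_time f \<and>
        (\<forall>x. (x \<in> L \<longrightarrow> f x \<in> YES) \<and> (x \<notin> L \<longrightarrow> f x \<in> NO)))"


section \<open>Hypergraphs and their encoding\<close>

definition uniform_hypergraph :: "nat \<Rightarrow> 'a set \<Rightarrow> 'a set set \<Rightarrow> bool" where
  "uniform_hypergraph r V E \<longleftrightarrow> finite V \<and> V \<noteq> {} \<and> (\<forall>e \<in> E. e \<subseteq> V \<and> card e = r)"

text \<open>A word encodes the hypergraph with vertex set \<open>{..<n}\<close> and edge set \<open>E\<close> if it consists of
  \<open>n\<close> in unary followed by the rows of an edge-vertex incidence matrix, in any order of the edges.\<close>

definition encodes :: "bool list \<Rightarrow> nat \<Rightarrow> nat set set \<Rightarrow> bool" where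
  "encodes x n E \<longleftrightarrow>
     (\<exists>es. distinct es \<and> set es = E \<and>
        x = replicate n True @ [False] @ concat (map (\<lambda>e. map (\<lambda>v. v \<in> e) [0..<n]) es))"


section \<open>Small Set Expansion Hypothesis\<close>

text \<open>Graphs are 2-uniform hypergraphs.\<close>

definition regular_graph :: "'a set \<Rightarrow> 'a set set \<Rightarrow> bool" where
  "regular_graph V E \<longleftrightarrow>
     uniform_hypergraph 2 V E \<and> (\<exists>d > 0. \<forall>v \<in> V. card {e \<in> E. v \<in> e} = d)"

definition vol :: "'a set \<Rightarrow> 'a set \<Rightarrow> real" where
  "vol V S = real (card S) / real (card V)"

text \<open>A random edge \<open>(i, j)\<close> is a uniformly random edge with a uniformly random orientation.\<close>

definition arcs :: "'a set set \<Rightarrow> ('a \<times> 'a) set" where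
  "arcs E = {(i, j). {i, j} \<in> E}"

definition expansion :: "'a set \<Rightarrow> 'a set set \<Rightarrow> 'a set \<Rightarrow> real" where
  "expansion V E S =
     (real (card {(i, j) \<in> arcs E. i \<in> S \<and> j \<notin> S}) / real (card (arcs E)))
       / min (vol V S) (vol V (V - S))"

definition sse_yes :: "real \<Rightarrow> real \<Rightarrow> bool list set" where
  "sse_yes \<epsilon> \<delta> = {x. \<exists>n E. encodes x n E \<and> regular_graph {..<n} E \<and>
     (\<exists>S \<subseteq> {..<n}. vol {..<n} S = \<delta> \<and> expansion {..<n} E S \<le> \<epsilon>)}"

definition sse_no :: "real \<Rightarrow> real \<Rightarrow> real \<Rightarrow> bool list set" where
  "sse_no \<epsilon> M \<delta> = {x. \<exists>n E. encodes x n E \<and> regular_graph {..<n} E \<and>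
     (\<forall>S \<subseteq> {..<n}. vol {..<n} S \<in> {\<delta> / M .. M * \<delta>} \<longrightarrow> expansion {..<n} E S \<ge> 1 - \<epsilon>)}"

definition SSEH :: bool where
  "SSEH \<longleftrightarrow>
     (\<forall>\<epsilon> M. 0 < \<epsilon> \<and> \<epsilon> < 1 \<and> 1 \<le> M \<and> M \<le> 1 / sqrt \<epsilon> \<longrightarrow>
        (\<exists>\<delta>. 0 < \<delta> \<and> \<delta> < 1 \<and> NP_hard_to_distinguish (sse_yes \<epsilon> \<delta>) (sse_no \<epsilon> M \<delta>)))"


section \<open>Densest-k-SubHypergraph\<close>

definition densest_value :: "'a set \<Rightarrow> 'a set set \<Rightarrow> nat \<Rightarrow> real" where
  "densest_value V E k =
     Max {real (card {e \<in> E. e \<subseteq> S}) / real (card E) | S. S \<subseteq> V \<and> card S = k}"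

text \<open>
  Instances have at least one hyperedge, so that the fraction of hyperedges is defined. For
  rational \<open>\<mu>\<close> the number \<open>\<mu> |V|\<close> is required to be an integer, so that \<open>k = \<mu> |V|\<close> exactly; for
  irrational \<open>\<mu>\<close> this is impossible and \<open>\<mu> |V|\<close> is rounded down.
\<close>

definition dksh_instance :: "nat \<Rightarrow> real \<Rightarrow> nat \<Rightarrow> nat set set \<Rightarrow> bool" where
  "dksh_instance r \<mu> n E \<longleftrightarrow>
     uniform_hypergraph r {..<n} E \<and> E \<noteq> {} \<and> (\<mu> \<in> \<rat> \<longrightarrow> \<mu> * real n \<in> \<int>)"

definition dksh_at_least :: "nat \<Rightarrow> real \<Rightarrow> real \<Rightarrow> bool list set" where
  "dksh_at_least r \<mu> \<alpha> = {x. \<exists>n E. encodes x n E \<and> dksh_instance r \<mu> n E \<and>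
     densest_value {..<n} E (nat \<lfloor>\<mu> * real n\<rfloor>) \<ge> \<alpha>}"

definition dksh_at_most :: "nat \<Rightarrow> real \<Rightarrow> real \<Rightarrow> bool list set" where
  "dksh_at_most r \<mu> \<beta> = {x. \<exists>n E. encodes x n E \<and> dksh_instance r \<mu> n E \<and>
     densest_value {..<n} E (nat \<lfloor>\<mu> * real n\<rfloor>) \<le> \<beta>}"

end

theory Submission
  imports Defs "HOL-Analysis.Convex" "HOL-Combinatorics.Permutations"
begin

text \<open>
  Small set expansion is reduced to Densest-\<open>k\<close>-SubHypergraph. Write \<open>\<epsilon> = 1 / A\<^sup>2\<close> with \<open>A\<close> huge in terms
  of \<open>r\<close> and \<open>\<mu>\<close>, take \<open>M = A\<close>, and let \<open>\<delta>\<close> be the measure that the hypothesis provides.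

  If \<open>\<delta> > 2 / A\<^sup>3\<close>, averaging over all sets of a fixed size shows that NO instances have bounded size, so a
  finite table suffices. Otherwise put \<open>t = \<lfloor>\<mu> / \<delta>\<rfloor>\<close> and \<open>m = \<lfloor>t / (r\<^sup>2 ln (2 r / \<mu>))\<rfloor>\<close>. The vertices of the
  hypergraph are triples \<open>(j, b, x)\<close> of a part \<open>j < r\<close>, a label \<open>b < B\<close> and \<open>x \<in> V\<^sup>t\<close>. The first two labels of
  a transversal select permutations \<open>\<tau>\<^sub>0, \<dots>, \<tau>\<^sub>r\<^sub>-\<^sub>1\<close> of the coordinates, and the transversal is a hyperedge if
  coordinate \<open>\<tau>\<^sub>j i\<close> of \<open>x\<^sub>j\<close> is adjacent to coordinate \<open>\<tau>\<^sub>0 i\<close> of \<open>x\<^sub>0\<close> for all \<open>i < m\<close> and \<open>1 \<le> j < r\<close>.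

  For a nonexpanding \<open>S\<close> of measure \<open>\<delta>\<close>, the tuples that meet \<open>S\<close> have measure at most \<open>t \<delta> \<le> \<mu>\<close>, and each of
  the \<open>m\<close> linked coordinates lands in \<open>S\<close> in all parts simultaneously with probability at least \<open>\<delta> / 2\<close>.

  In the NO case, the labels are quasirandom, which allows replacing the indicator of a vertex set by its
  average over labels and coordinate permutations. A symmetric function on \<open>V\<^sup>t\<close> with values in \<open>[\<theta>, 2]\<close> has
  nearly constant one-coordinate marginals: by Gibbs' inequality their relative entropy is at most
  \<open>ln (2 / \<theta>) / t\<close>. The parts of the marginals above \<open>1 + 1 / r\<close> live on sets of measure \<open>O(r\<^sup>2 ln (2 r / \<mu>) / t)\<close>,
  which is below \<open>A \<delta>\<close>, hence expansion makes them invisible along the edges. Revealing the \<open>m\<close>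
  linked coordinates one at a time therefore costs a factor \<open>1 + O(r\<^sup>2 ln (2 r / \<mu>) / t)\<close> each, in total a
  constant, over the product of the measures of the parts, which by AM-GM is at most \<open>\<mu>\<^sup>r\<close>.
\<close>

section \<open>Structured programs for Turing machines\<close>

text \<open>A vertex set may favour some coordinates, whereas the entropy bound speaks of symmetric
  functions only, so the construction itself has to symmetrise. Hyperedges form a set without
  multiplicities, so this cannot be done by repeating edges: each transversal uses one family of
  permutations, read off from its labels, and quasirandomness of the label table makes this family
  look uniform to every vertex set. Independent permutations per part let the average factor into
  separate symmetrisations. A part of tiny measure y would spoil the entropy bound ln (2 / y) / t;
  hence the floor \<theta> = \<mu> / r, which costs a factor (1 + 1 / r)^r \<le> 3 only. The size of
  A comes from the exceptional vertices: there only the trivial bound of order (2 r / \<mu>)^(r+1)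
  is available, and \<epsilon> M = 1 / A has to beat it. The condition \<mu> < 2^(-r) gives 2 r
  \<le> 1 / \<mu>, which makes ln (2 r / \<mu>) comparable to ln (1 / \<mu>). Although \<delta> is
  merely known to exist, it is a constant, so t, m and the labels are hardwired and the reduction is
  a fixed nest of loops over V. It runs on the output of an unknown machine, which is why programs
  that can be appended to any machine are needed.\<close>

datatype prog =
    Act nat "nat option" int
  | Then prog prog (infixr \<open>;;\<close> 60)
  | Cond nat "nat \<Rightarrow> bool" prog prog
  | Loop nat "nat \<Rightarrow> bool" prog

fun rd :: "tape \<Rightarrow> nat" where
  "rd (c, h) = c h"

fun put :: "nat option \<Rightarrow> int \<Rightarrow> tape \<Rightarrow> tape" where
  "put None m (c, h) = (c, h + m)"
| "put (Some a) m (c, h) = (c(h := a), h + m)"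

text \<open>The number counts machine steps exactly. A test costs one step because the head of
  \<open>Cond\<close> and of \<open>Loop\<close> is compiled to a state of its own.\<close>

inductive runs :: "prog \<Rightarrow> (nat \<Rightarrow> tape) \<Rightarrow> nat \<Rightarrow> (nat \<Rightarrow> tape) \<Rightarrow> bool" where
  Act: "runs (Act i w m) T 1 (T(i := put w m (T i)))"
| Then: "runs p T a T' \<Longrightarrow> runs q T' b T'' \<Longrightarrow> runs (p ;; q) T (a + b) T''"
| CondT: "P (rd (T i)) \<Longrightarrow> runs p T a T' \<Longrightarrow> runs (Cond i P p q) T (Suc a) T'"
| CondF: "\<not> P (rd (T i)) \<Longrightarrow> runs q T a T' \<Longrightarrow> runs (Cond i P p q) T (Suc a) T'"
| LoopF: "\<not> P (rd (T i)) \<Longrightarrow> runs (Loop i P p) T 1 T"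
| LoopT: "P (rd (T i)) \<Longrightarrow> runs p T a T' \<Longrightarrow> runs (Loop i P p) T' b T'' \<Longrightarrow>
    runs (Loop i P p) T (Suc (a + b)) T''"

text \<open>The number of states that the compiled program occupies.\<close>

fun len :: "prog \<Rightarrow> nat" where
  "len (Act i w m) = 1"
| "len (p ;; q) = len p + len q"
| "len (Cond i P p q) = 1 + len p + len q"
| "len (Loop i P p) = 1 + len p"

lemma len_pos: "0 < len p"
  by (induction p) auto

definition idle :: "nat list \<Rightarrow> (nat \<times> int) list" where
  "idle xs = map (\<lambda>x. (x, 0)) xs"

text \<open>Compilation in continuation style: the block owns the \<open>len p\<close> states from
  \<open>s\<close> on, and \<open>e\<close> is the state entered on exit. The body of a
  \<open>Loop\<close> exits to the test at \<open>s\<close>.\<close>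

fun code :: "prog \<Rightarrow> nat \<Rightarrow> nat \<Rightarrow> nat \<Rightarrow> nat list \<Rightarrow> nat \<times> (nat \<times> int) list" where
  "code (Act i w m) s e q xs =
     (e, (idle xs)[i := (case w of None \<Rightarrow> xs ! i | Some a \<Rightarrow> a, m)])"
| "code (p ;; p') s e q xs =
     (if q < s + len p then code p s (s + len p) q xs else code p' (s + len p) e q xs)"
| "code (Cond i P p p') s e q xs =
     (if q = s then (if P (xs ! i) then s + 1 else s + 1 + len p, idle xs)
      else if q < s + 1 + len p then code p (s + 1) e q xs
      else code p' (s + 1 + len p) e q xs)"
| "code (Loop i P p) s e q xs =
     (if q = s then (if P (xs ! i) then s + 1 else e, idle xs) else code p (s + 1) s q xs)"

text \<open>Programs write only 0, 1 and 2, which belong to the alphabet of every well-formed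
  machine; other work symbols left on a tape can still be read and kept.\<close>

fun wfp :: "nat \<Rightarrow> prog \<Rightarrow> bool" where
  "wfp k (Act i w m) \<longleftrightarrow> i < k \<and> (case w of None \<Rightarrow> True | Some a \<Rightarrow> a < 3) \<and> m \<in> {-1, 0, 1}"
| "wfp k (p ;; q) \<longleftrightarrow> wfp k p \<and> wfp k q"
| "wfp k (Cond i P p q) \<longleftrightarrow> i < k \<and> wfp k p \<and> wfp k q"
| "wfp k (Loop i P p) \<longleftrightarrow> i < k \<and> wfp k p"

lemma code_wf:
  assumes "wfp k p" "length xs = k" "set xs \<subseteq> {..<S}" "3 \<le> S" "e \<le> N" "s + len p \<le> N"
    "s \<le> q" "q < s + len p"
  shows "fst (code p s e q xs) \<le> N \<and> length (snd (code p s e q xs)) = k \<and>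
    set (snd (code p s e q xs)) \<subseteq> {..<S} \<times> {-1, 0, 1}"
  using assms
proof (induction p arbitrary: s e)
  case (Act i w m)
  have "xs ! i < S" using Act.prems by (metis lessThan_iff nth_mem subsetD wfp.simps(1))
  then have "(case w of None \<Rightarrow> xs ! i | Some a \<Rightarrow> a, m) \<in> {..<S} \<times> {-1, 0, 1}"
    using Act.prems by (auto split: option.splits)
  moreover have "set (idle xs) \<subseteq> {..<S} \<times> {-1, 0, 1}"
    using Act.prems by (auto simp: idle_def)
  ultimately have "set ((idle xs)[i := (case w of None \<Rightarrow> xs ! i | Some a \<Rightarrow> a, m)]) \<subseteq> {..<S} \<times> {-1, 0, 1}"
    using set_update_subset_insert by fastforce
  then show ?case using Act.prems by (simp add: idle_def)
next
  case (Then p1 p2)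
  then show ?case by (cases "q < s + len p1") auto
next
  case (Cond i P p1 p2)
  consider "q = s" | "s < q" "q < s + 1 + len p1" | "s + 1 + len p1 \<le> q"
    using Cond.prems by linarith
  then show ?case
  proof cases
    case 1
    then show ?thesis using Cond.prems len_pos[of p2] by (auto simp: idle_def)
  next
    case 2
    then show ?thesis using Cond.prems Cond.IH(1)[of e "s+1"] by auto
  next
    case 3
    then show ?thesis using Cond.prems Cond.IH(2)[of e "s+1+len p1"] by auto
  qed
next
  case (Loop i P p)
  show ?case
  proof (cases "q = s")
    case True
    then show ?thesis using Loop.prems by (auto simp: idle_def)
  next
    case False
    then show ?thesis using Loop.prems Loop.IH[of s "s+1"] by auto
  qed
qed

lemma map2_act_idle: "map2 act (idle (map (\<lambda>(c, h). c h) ts)) ts = ts"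
proof (induction ts)
  case (Cons a ts)
  then show ?case by (cases a) (auto simp: idle_def)
qed (simp add: idle_def)

lemma step_idle:
  assumes "q < states M" "delta M q (map (\<lambda>(c, h). c h) ts) = (q', idle (map (\<lambda>(c, h). c h) ts))"
  shows "step M (q, ts) = (q', ts)"
  using assms map2_act_idle by (simp add: Let_def)

lemma map2_list_update:
  "map2 f (xs[i := a]) ys = (map2 f xs ys)[i := f a (ys ! i)]" if "length xs = length ys"
  using zip_update[of xs i a ys "ys ! i"] by (simp add: map_update)

text \<open>The transition function has to agree with \<open>code\<close> on the states of the block
  only, and \<open>s\<close> and \<open>e\<close> are arbitrary in the induction; so each subprogram
  inherits the hypotheses with its own entry and exit.\<close>

lemma code_correct:
  assumes "runs p T a T'" "wfp k p"
    "\<And>q xs. s \<le> q \<Longrightarrow> q < s + len p \<Longrightarrow> length xs = k \<Longrightarrow> delta M q xs = code p s e q xs"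
    "s + len p \<le> states M"
  shows "(step M ^^ a) (s, map T [0..<k]) = (e, map T' [0..<k])"
  using assms
proof (induction arbitrary: s e rule: runs.induct)
  case (Act i w m T)
  define xs where "xs = map (\<lambda>(c, h). c h) (map T [0..<k])"
  let ?ts = "map T [0..<k]"
  have lxs: "length xs = k" by (simp add: xs_def)
  have i: "i < k" using Act.prems by simp
  obtain c h where ch: "T i = (c, h)" by force
  have "delta M s xs = (e, (idle xs)[i := (case w of None \<Rightarrow> xs ! i | Some a \<Rightarrow> a, m)])"
    using Act.prems(2)[of s xs] lxs by simp
  moreover have "map2 act ((idle xs)[i := (case w of None \<Rightarrow> xs ! i | Some a \<Rightarrow> a, m)]) ?ts
      = (map2 act (idle xs) ?ts)[i := act (case w of None \<Rightarrow> xs ! i | Some a \<Rightarrow> a, m) (?ts ! i)]"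
    by (rule map2_list_update) (simp add: idle_def lxs)
  moreover have "\<dots> = map (T(i := put w m (T i))) [0..<k]"
    unfolding xs_def map2_act_idle using i ch
    by (intro nth_equalityI) (auto simp: nth_list_update split: option.splits)
  ultimately have "step M (s, ?ts) = (e, map (T(i := put w m (T i))) [0..<k])"
    using Act.prems unfolding xs_def step.simps by (simp only: Let_def split: if_split) auto
  then show ?case by simp
next
  case (Then p T a T' q b T'')
  have "(step M ^^ a) (s, map T [0..<k]) = (s + len p, map T' [0..<k])"
    using Then.prems by (intro Then.IH(1)) auto
  moreover have "(step M ^^ b) (s + len p, map T' [0..<k]) = (e, map T'' [0..<k])"
    using Then.prems by (intro Then.IH(2)) auto
  ultimately show ?case by (simp add: add.commute[of a] funpow_add)
next
  case (CondT P T i p a T' q)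
  have rd: "(map (\<lambda>(c, h). c h) (map T [0..<k])) ! i = rd (T i)"
    using CondT.prems by (simp split: prod.splits)
  have "step M (s, map T [0..<k]) = (s + 1, map T [0..<k])"
    using CondT.prems CondT.hyps rd by (intro step_idle) auto
  moreover have "(step M ^^ a) (s + 1, map T [0..<k]) = (e, map T' [0..<k])"
    using CondT.prems by (intro CondT.IH) auto
  ultimately show ?case by (simp add: funpow_Suc_right del: funpow.simps)
next
  case (CondF P T i q a T' p)
  have rd: "(map (\<lambda>(c, h). c h) (map T [0..<k])) ! i = rd (T i)"
    using CondF.prems by (simp split: prod.splits)
  have "step M (s, map T [0..<k]) = (s + 1 + len p, map T [0..<k])"
    using CondF.prems CondF.hyps rd by (intro step_idle) auto
  moreover have "(step M ^^ a) (s + 1 + len p, map T [0..<k]) = (e, map T' [0..<k])"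
    using CondF.prems by (intro CondF.IH) auto
  ultimately show ?case by (simp add: funpow_Suc_right del: funpow.simps)
next
  case (LoopF P T i p)
  have rd: "(map (\<lambda>(c, h). c h) (map T [0..<k])) ! i = rd (T i)"
    using LoopF.prems by (simp split: prod.splits)
  have "step M (s, map T [0..<k]) = (e, map T [0..<k])"
    using LoopF.prems LoopF.hyps rd by (intro step_idle) auto
  then show ?case by simp
next
  case (LoopT P T i p a T' b T'')
  have rd: "(map (\<lambda>(c, h). c h) (map T [0..<k])) ! i = rd (T i)"
    using LoopT.prems by (simp split: prod.splits)
  have "step M (s, map T [0..<k]) = (s + 1, map T [0..<k])"
    using LoopT.prems LoopT.hyps rd by (intro step_idle) auto
  moreover have "(step M ^^ a) (s + 1, map T [0..<k]) = (s, map T' [0..<k])"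
    using LoopT.prems by (intro LoopT.IH(1)) auto
  moreover have "(step M ^^ b) (s, map T' [0..<k]) = (e, map T'' [0..<k])"
    using LoopT.prems by (intro LoopT.IH(2)) auto
  ultimately show ?case
    by (simp add: funpow_Suc_right add.commute[of a] funpow_add del: funpow.simps)
qed

section \<open>Total correctness with time bounds\<close>

definition triple :: "((nat \<Rightarrow> tape) \<Rightarrow> bool) \<Rightarrow> prog \<Rightarrow> nat \<Rightarrow> ((nat \<Rightarrow> tape) \<Rightarrow> bool) \<Rightarrow> bool" where
  "triple A p b B \<longleftrightarrow> (\<forall>T. A T \<longrightarrow> (\<exists>a T'. a \<le> b \<and> runs p T a T' \<and> B T'))"

lemma triple_conseq:
  assumes "triple A p b B" "\<And>T. A' T \<Longrightarrow> A T" "\<And>T. B T \<Longrightarrow> B' T" "b \<le> b'"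
  shows "triple A' p b' B'"
  using assms unfolding triple_def by (meson le_trans)

lemma triple_Act:
  assumes "\<And>T. A T \<Longrightarrow> B (T(i := put w m (T i)))"
  shows "triple A (Act i w m) 1 B"
  using assms runs.Act unfolding triple_def by blast

lemma triple_Then:
  assumes "triple A p a B" "triple B q b C"
  shows "triple A (p ;; q) (a + b) C"
  unfolding triple_def
proof (intro allI impI)
  fix T assume "A T"
  then obtain x T' where 1: "x \<le> a" "runs p T x T'" "B T'" using assms unfolding triple_def by blast
  then obtain y T'' where "y \<le> b" "runs q T' y T''" "C T''" using assms unfolding triple_def by blast
  then show "\<exists>x T'. x \<le> a + b \<and> runs (p ;; q) T x T' \<and> C T'"
    using 1 runs.Then by (intro exI[of _ "x + y"] exI[of _ T'']) auto
qed

lemma triple_Cond: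
  assumes "triple (\<lambda>T. A T \<and> P (rd (T i))) p b B" "triple (\<lambda>T. A T \<and> \<not> P (rd (T i))) q b B"
  shows "triple A (Cond i P p q) (Suc b) B"
  unfolding triple_def
proof (intro allI impI)
  fix T assume T: "A T"
  show "\<exists>a T'. a \<le> Suc b \<and> runs (Cond i P p q) T a T' \<and> B T'"
  proof (cases "P (rd (T i))")
    case True
    then obtain x T' where "x \<le> b" "runs p T x T'" "B T'" using T assms unfolding triple_def by blast
    then show ?thesis using runs.CondT[of P T i, OF True] by (intro exI[of _ "Suc x"] exI[of _ T']) auto
  next
    case False
    then obtain x T' where "x \<le> b" "runs q T x T'" "B T'" using T assms unfolding triple_def by blast
    then show ?thesis using runs.CondF[of P T i, OF False] by (intro exI[of _ "Suc x"] exI[of _ T']) auto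
  qed
qed

text \<open>The number \<open>N\<close> of passes is known beforehand and the invariant is indexed
  by the passes done, so the induction runs downwards from \<open>N\<close>.\<close>

lemma triple_Loop:
  assumes "\<And>j. j < N \<Longrightarrow> triple (I j) p b (I (Suc j))"
    "\<And>j T. j < N \<Longrightarrow> I j T \<Longrightarrow> P (rd (T i))" "\<And>T. I N T \<Longrightarrow> \<not> P (rd (T i))"
  shows "triple (I 0) (Loop i P p) (N * Suc b + 1) (I N)"
proof -
  have "triple (I j) (Loop i P p) ((N - j) * Suc b + 1) (I N)" if "j \<le> N" for j
    using that
  proof (induction rule: inc_induct)
    case base
    show ?case unfolding triple_def
    proof (intro allI impI)
      fix T assume T: "I N T"
      then show "\<exists>a T'. a \<le> (N - N) * Suc b + 1 \<and> runs (Loop i P p) T a T' \<and> I N T'"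
        using runs.LoopF[of P T i p, OF assms(3)[OF T]] by (intro exI[of _ 1] exI[of _ T]) simp
    qed
  next
    case (step j)
    show ?case unfolding triple_def
    proof (intro allI impI)
      fix T assume T: "I j T"
      then obtain a T' where 1: "a \<le> b" "runs p T a T'" "I (Suc j) T'"
        using assms(1) step unfolding triple_def by blast
      then obtain a' T'' where 2: "a' \<le> (N - Suc j) * Suc b + 1" "runs (Loop i P p) T' a' T''" "I N T''"
        using step unfolding triple_def by blast
      have "(N - j) * Suc b = (N - Suc j) * Suc b + Suc b"
        using step(2) by (metis Suc_diff_Suc add.commute mult_Suc)
      then have "Suc (a + a') \<le> (N - j) * Suc b + 1" using 1 2 by linarith
      moreover have "runs (Loop i P p) T (Suc (a + a')) T''"
        using runs.LoopT[of P T i, OF assms(2)[OF step(2) T] 1(2) 2(2)] .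
      ultimately show "\<exists>a T'. a \<le> (N - j) * Suc b + 1 \<and> runs (Loop i P p) T a T' \<and> I N T'"
        using 2(3) by blast
    qed
  qed
  from this[of 0] show ?thesis by simp
qed

text \<open>Runs \<open>M\<close> and then \<open>p\<close>. Tape \<open>tapes M\<close> moves in parallel with the last tape of \<open>M\<close> and records the visited
  cells (\<open>2\<close> at the origin, \<open>1\<close> elsewhere), so that \<open>p\<close> can find the origin of the output of \<open>M\<close> again.\<close>

definition comp_tm :: "tm \<Rightarrow> nat \<Rightarrow> prog \<Rightarrow> tm" where
  "comp_tm M k p = \<lparr>tapes = k, symbols = symbols M, states = Suc (states M) + len p,
     delta = (\<lambda>q xs.
       if q = 0 then (1, (idle xs)[tapes M := (2, 0)])
       else if q \<le> states M then
         (let (q', as) = delta M (q - 1) (take (tapes M) xs)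
          in (Suc q', as @ (if xs ! tapes M = 0 then 1 else xs ! tapes M, snd (last as))
                # idle (drop (Suc (tapes M)) xs)))
       else code p (Suc (states M)) (Suc (states M) + len p) q xs)\<rparr>"

lemma comp_tm_wf:
  assumes M: "well_formed_tm M" and p: "wfp k p" and k: "tapes M < k"
  shows "well_formed_tm (comp_tm M k p)"
  unfolding well_formed_tm_def
proof (intro conjI allI impI)
  show "1 \<le> tapes (comp_tm M k p)" using k by (simp add: comp_tm_def)
  show "3 \<le> symbols (comp_tm M k p)" using M by (simp add: comp_tm_def well_formed_tm_def)
  fix q xs
  assume q: "q < states (comp_tm M k p)"
    and xs: "length xs = tapes (comp_tm M k p) \<and> set xs \<subseteq> {..<symbols (comp_tm M k p)}"
  have S: "3 \<le> symbols M" and tM: "1 \<le> tapes M" using M by (auto simp: well_formed_tm_def)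
  have lxs: "length xs = k" and sxs: "set xs \<subseteq> {..<symbols M}"
    using xs by (auto simp: comp_tm_def)
  let ?d = "delta (comp_tm M k p) q xs"
  have id: "set (idle ys) \<subseteq> {..<symbols M} \<times> {-1, 0, 1}" if "set ys \<subseteq> {..<symbols M}" for ys
    using that by (auto simp: idle_def)
  have "fst ?d \<le> Suc (states M) + len p \<and> length (snd ?d) = k \<and>
      set (snd ?d) \<subseteq> {..<symbols M} \<times> {-1, 0, 1}"
  proof -
    consider "q = 0" | "0 < q" "q \<le> states M" | "states M < q" by linarith
    then show ?thesis
    proof cases
      case 1
      have "set ((idle xs)[tapes M := (2, 0)]) \<subseteq> {..<symbols M} \<times> {-1, 0, 1}"
        using set_update_subset_insert[of "idle xs" "tapes M" "(2,0)"] id[OF sxs] S by fastforce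
      then show ?thesis using 1 lxs by (simp add: comp_tm_def idle_def)
    next
      case 2
      obtain q' as where d: "delta M (q - 1) (take (tapes M) xs) = (q', as)" by force
      have tk: "set (take (tapes M) xs) \<subseteq> {..<symbols M}" using sxs set_take_subset by fastforce
      have "q - 1 < states M" using 2 by linarith
      then have as: "q' \<le> states M" "length as = tapes M" "set as \<subseteq> {..<symbols M} \<times> {-1, 0, 1}"
        using M d k lxs tk unfolding well_formed_tm_def
        by (metis fst_conv snd_conv length_take less_imp_le min.absorb2)+
      have "as \<noteq> []" using as tM by auto
      then have "last as \<in> set as" by simp
      then have "snd (last as) \<in> {-1, 0, 1}" using as(3) by (auto simp: mem_Times_iff)
      moreover have "xs ! tapes M < symbols M" using sxs k lxs by (metis lessThan_iff nth_mem subsetD)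
      moreover have "set (drop (Suc (tapes M)) xs) \<subseteq> {..<symbols M}"
        using sxs set_drop_subset by fastforce
      ultimately show ?thesis using 2 d as id S k lxs
        by (auto simp: comp_tm_def idle_def)
    next
      case 3
      then have "?d = code p (Suc (states M)) (Suc (states M) + len p) q xs"
        by (simp add: comp_tm_def)
      then show ?thesis
        using code_wf[OF p lxs sxs S, of "Suc (states M) + len p" "Suc (states M) + len p" "Suc (states M)" q] 3 q
        by (simp add: comp_tm_def)
    qed
  qed
  then show "fst ?d \<le> states (comp_tm M k p)" "length (snd ?d) = tapes (comp_tm M k p)"
    "set (snd ?d) \<subseteq> {..<symbols (comp_tm M k p)} \<times> {-1, 0, 1}"
    by (simp_all add: comp_tm_def)
qed

text \<open>Here \<open>l\<close> is the input length and \<open>a\<close> the number of steps made.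
  The last clause will bound the length of the output by the running time.\<close>

definition config_ok :: "tm \<Rightarrow> nat \<Rightarrow> nat \<Rightarrow> nat \<times> tape list \<Rightarrow> bool" where
  "config_ok M l a cf \<longleftrightarrow> fst cf \<le> states M \<and> length (snd cf) = tapes M \<and>
     (\<forall>tp \<in> set (snd cf). (\<forall>i. fst tp i < symbols M) \<and> \<bar>snd tp\<bar> \<le> int a \<and>
        (\<forall>i. \<bar>i\<bar> > int (l + a) \<longrightarrow> fst tp i = 0))"

lemma delta_ok:
  assumes M: "well_formed_tm M" and ok: "config_ok M l a (q, ts)" and q: "q < states M"
  defines "d \<equiv> delta M q (map (\<lambda>(c, h). c h) ts)"
  shows "fst d \<le> states M" "length (snd d) = tapes M" "set (snd d) \<subseteq> {..<symbols M} \<times> {-1, 0, 1}"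
proof -
  have "length (map (\<lambda>(c, h). c h) ts) = tapes M" "set (map (\<lambda>(c, h). c h) ts) \<subseteq> {..<symbols M}"
    using ok by (fastforce simp: config_ok_def)+
  then show "fst d \<le> states M" "length (snd d) = tapes M" "set (snd d) \<subseteq> {..<symbols M} \<times> {-1, 0, 1}"
    using M q unfolding well_formed_tm_def d_def by blast+
qed

lemma config_ok_step:
  assumes M: "well_formed_tm M" and ok: "config_ok M l a cf"
  shows "config_ok M l (Suc a) (step M cf)"
proof -
  obtain q ts where cf: "cf = (q, ts)" by force
  show ?thesis
  proof (cases "q < states M")
    case False
    then show ?thesis using ok cf by (fastforce simp: config_ok_def)
  next
    case True
    obtain q' as where d: "delta M q (map (\<lambda>(c, h). c h) ts) = (q', as)" by force
    note dk = delta_ok[OF M ok[unfolded cf] True, unfolded d fst_conv snd_conv]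
    have st: "step M cf = (q', map2 act as ts)" using True d cf by simp
    have "(\<forall>i. fst tp i < symbols M) \<and> \<bar>snd tp\<bar> \<le> int (Suc a) \<and>
        (\<forall>i. \<bar>i\<bar> > int (l + Suc a) \<longrightarrow> fst tp i = 0)" if tp: "tp \<in> set (map2 act as ts)" for tp
    proof -
      obtain b m c h where 1: "tp = act (b, m) (c, h)" "(b, m) \<in> set as" "(c, h) \<in> set ts"
        using tp by (force dest: set_zip_leftD set_zip_rightD)
      have "b < symbols M" "m \<in> {-1, 0, 1}" using dk 1 by auto
      moreover have "\<forall>i. c i < symbols M" "\<bar>h\<bar> \<le> int a" "\<forall>i. \<bar>i\<bar> > int (l + a) \<longrightarrow> c i = 0"
        using ok 1 cf by (auto simp: config_ok_def)
      ultimately show ?thesis using 1 by auto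
    qed
    then show ?thesis using st dk ok cf by (simp add: config_ok_def)
  qed
qed

lemma config_ok_initial:
  assumes "well_formed_tm M"
  shows "config_ok M (length x) 0 (initial_config M x)"
  using assms by (auto simp: config_ok_def initial_config_def word_contents_def well_formed_tm_def)

lemma config_ok_reach:
  assumes "well_formed_tm M"
  shows "config_ok M (length x) a ((step M ^^ a) (initial_config M x))"
  by (induction a) (auto simp: assms config_ok_initial intro!: config_ok_step simp del: step.simps)

definition trail :: "int \<Rightarrow> int \<Rightarrow> int \<Rightarrow> nat" where
  "trail lo hi i = (if i = 0 then 2 else if lo \<le> i \<and> i \<le> hi then 1 else 0)"

definition blank :: tape where "blank = (word_contents [], 0)"

text \<open>The composed machine lags by the one step that marks the origin. A cell is recorded when
  the head leaves it, so the current cell may still be missing from the trail; this is why the head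
  ranges from \<open>lo - 1\<close> to \<open>hi + 1\<close>.\<close>

lemma comp_tm_sim:
  assumes M: "well_formed_tm M" and p: "wfp k p" and k: "tapes M < k"
    and run: "\<And>b. b < a \<Longrightarrow> fst ((step M ^^ b) (initial_config M x)) \<noteq> states M"
  shows "\<exists>lo hi. lo \<le> 0 \<and> 0 \<le> hi \<and> hi - lo \<le> int a \<and>
    (let (q, ts) = (step M ^^ a) (initial_config M x) in
      lo - 1 \<le> snd (last ts) \<and> snd (last ts) \<le> hi + 1 \<and>
      (step (comp_tm M k p) ^^ Suc a) (initial_config (comp_tm M k p) x)
       = (Suc q, ts @ (trail lo hi, snd (last ts)) # replicate (k - Suc (tapes M)) blank))"
  using run
proof (induction a)
  case 0
  let ?C = "comp_tm M k p"
  have tM: "1 \<le> tapes M" using M by (simp add: well_formed_tm_def)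
  obtain ts where ts: "initial_config M x = (0, ts)" by (simp add: initial_config_def)
  have tse: "ts = (word_contents x, 0) # replicate (tapes M - 1) blank"
    using ts by (auto simp: initial_config_def blank_def)
  have lts: "length ts = tapes M" "snd (last ts) = 0"
    using tse tM by (auto simp: blank_def last_replicate)
  have "initial_config ?C x = (0, ts @ replicate (k - tapes M) blank)"
  proof -
    have "k - 1 = (tapes M - 1) + (k - tapes M)" using tM k by simp
    then show ?thesis unfolding initial_config_def tse
      by (simp add: comp_tm_def blank_def replicate_add[symmetric])
  qed
  also have "\<dots> = (0, ts @ blank # replicate (k - Suc (tapes M)) blank)"
    using k by (metis Suc_diff_Suc replicate_Suc)
  finally have init: "initial_config ?C x = (0, ts @ blank # replicate (k - Suc (tapes M)) blank)" .
  let ?ts = "ts @ blank # replicate (k - Suc (tapes M)) blank"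
  let ?xs = "map (\<lambda>(c, h). c h) ?ts"
  have "step ?C (0, ?ts) = (1, map2 act ((idle ?xs)[tapes M := (2, 0)]) ?ts)"
    by (simp add: comp_tm_def)
  also have "map2 act ((idle ?xs)[tapes M := (2, 0)]) ?ts
      = (map2 act (idle ?xs) ?ts)[tapes M := act (2, 0) (?ts ! tapes M)]"
    by (rule map2_list_update) (simp add: idle_def)
  also have "\<dots> = ts @ (trail 0 0, 0) # replicate (k - Suc (tapes M)) blank"
  proof -
    have "act (2, 0) blank = (trail 0 0, 0)"
      by (auto simp: blank_def trail_def word_contents_def)
    then show ?thesis unfolding map2_act_idle lts(1)[symmetric] by simp
  qed
  finally show ?case using init lts ts
    by (intro exI[of _ 0]) (simp del: step.simps)
next
  case (Suc a)
  let ?C = "comp_tm M k p"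
  obtain q ts where cf: "(step M ^^ a) (initial_config M x) = (q, ts)" by force
  have ok: "config_ok M (length x) a (q, ts)" using config_ok_reach[OF M, of x a] cf by simp
  have q: "q < states M" using ok Suc.prems[of a] cf by (auto simp: config_ok_def)
  have lts: "length ts = tapes M" using ok by (simp add: config_ok_def)
  have tM: "1 \<le> tapes M" using M by (simp add: well_formed_tm_def)
  obtain lo hi where IH: "lo \<le> 0" "0 \<le> hi" "hi - lo \<le> int a"
      "lo - 1 \<le> snd (last ts)" "snd (last ts) \<le> hi + 1"
      "(step ?C ^^ Suc a) (initial_config ?C x)
       = (Suc q, ts @ (trail lo hi, snd (last ts)) # replicate (k - Suc (tapes M)) blank)"
    using Suc.IH[OF Suc.prems] unfolding cf Let_def prod.case by auto
  obtain q' as where d: "delta M q (map (\<lambda>(c, h). c h) ts) = (q', as)" by force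
  note dk = delta_ok[OF M ok q, unfolded d fst_conv snd_conv]
  have st: "step M (q, ts) = (q', map2 act as ts)" using q d by simp
  have ne: "ts \<noteq> []" "as \<noteq> []" using lts tM dk by auto
  obtain c h where ch: "last ts = (c, h)" by force
  obtain b m where bm: "last as = (b, m)" by force
  have m: "m \<in> {-1, 0, 1}" using dk(3) last_in_set[OF ne(2)] bm by auto
  have lastz: "last (map2 act as ts) = act (b, m) (c, h)"
  proof -
    have "last (zip as ts) = (last as, last ts)"
      using ne dk(2) lts tM by (simp add: last_conv_nth nth_zip)
    moreover have "zip as ts \<noteq> []" using ne by (cases as; cases ts) auto
    ultimately show ?thesis using ch bm by (simp add: last_map)
  qed
  let ?R = "replicate (k - Suc (tapes M)) blank"
  let ?ts = "ts @ (trail lo hi, h) # ?R"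
  let ?xs = "map (\<lambda>(c, h). c h) ?ts"
  let ?lo = "min lo h" and ?hi = "max hi h"
  have xsM: "?xs ! tapes M = trail lo hi h" using lts by (simp add: nth_append)
  have tk: "take (tapes M) ?xs = map (\<lambda>(c, h). c h) ts" using lts by simp
  have dr: "drop (Suc (tapes M)) ?xs = map (\<lambda>(c, h). c h) ?R" using lts by simp
  have "delta ?C (Suc q) ?xs = (Suc q', as @ (if trail lo hi h = 0 then 1 else trail lo hi h, m)
      # idle (map (\<lambda>(c, h). c h) ?R))"
    using q d tk dr xsM bm by (simp add: comp_tm_def)
  then have "step ?C (Suc q, ?ts) = (Suc q', map2 act (as @ (if trail lo hi h = 0 then 1 else trail lo hi h, m)
      # idle (map (\<lambda>(c, h). c h) ?R)) ?ts)"
    using q by (simp add: comp_tm_def)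
  also have "map2 act (as @ (if trail lo hi h = 0 then 1 else trail lo hi h, m)
      # idle (map (\<lambda>(c, h). c h) ?R)) ?ts = map2 act as ts @
       act (if trail lo hi h = 0 then 1 else trail lo hi h, m) (trail lo hi, h) # ?R"
    using dk lts map2_act_idle[of ?R] by simp
  also have "act (if trail lo hi h = 0 then 1 else trail lo hi h, m) (trail lo hi, h) = (trail ?lo ?hi, h + m)"
    using IH ch by (auto simp: trail_def fun_eq_iff)
  finally have fin: "step ?C (Suc q, ?ts) = (Suc q', map2 act as ts @ (trail ?lo ?hi, h + m) # ?R)" .
  have "(step ?C ^^ Suc (Suc a)) (initial_config ?C x) = step ?C ((step ?C ^^ Suc a) (initial_config ?C x))"
    by simp
  also have "\<dots> = (Suc q', map2 act as ts @ (trail ?lo ?hi, h + m) # ?R)"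
    using fin IH(6) ch by simp
  finally have e1: "(step ?C ^^ Suc (Suc a)) (initial_config ?C x)
     = (Suc q', map2 act as ts @ (trail ?lo ?hi, h + m) # ?R)" .
  have e2: "(step M ^^ Suc a) (initial_config M x) = (q', map2 act as ts)"
    using st cf by simp
  have e3: "?lo \<le> 0" "0 \<le> ?hi" "?hi - ?lo \<le> int (Suc a)" "?lo - 1 \<le> h + m" "h + m \<le> ?hi + 1"
    using IH(1-5) m ch by auto
  have e4: "snd (last (map2 act as ts)) = h + m" using lastz by simp
  show ?case
    unfolding e2 Let_def prod.case e4
    by (intro exI[of _ ?lo] exI[of _ ?hi] conjI e1 e3)
qed

text \<open>Seen from the head, the origin can lie on either side. The current cell is therefore
  added to the trail, the head runs to the left end of the trail, and from there the mark 2 can only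
  lie at the head or to the right.\<close>

definition rewind :: "nat \<Rightarrow> prog" where
  "rewind i = Cond (Suc i) (\<lambda>s. s = 0) (Act (Suc i) (Some 1) 0) (Act (Suc i) None 0) ;;
     Loop (Suc i) (\<lambda>s. s \<noteq> 0) (Act i None (- 1) ;; Act (Suc i) None (- 1)) ;;
     (Act i None 1 ;; Act (Suc i) None 1) ;;
     Loop (Suc i) (\<lambda>s. s \<noteq> 2) (Act i None 1 ;; Act (Suc i) None 1)"

lemma rewind_triple:
  assumes lh: "lo \<le> 0" "0 \<le> hi" "hi - lo \<le> int a" "lo - 1 \<le> h" "h \<le> hi + 1"
  shows "triple (\<lambda>T. T i = (c, h) \<and> T (Suc i) = (trail lo hi, h) \<and> (\<forall>j. j \<noteq> i \<and> j \<noteq> Suc i \<longrightarrow> T j = T0 j))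
     (rewind i) (6 * a + 20)
     (\<lambda>T. T i = (c, 0) \<and> (\<forall>j. j \<noteq> i \<and> j \<noteq> Suc i \<longrightarrow> T j = T0 j))"
proof -
  define lo' hi' where "lo' = min lo h" and "hi' = max hi h"
  define J where "J z T \<longleftrightarrow> T i = (c, z) \<and> T (Suc i) = (trail lo' hi', z) \<and> (\<forall>j. j \<noteq> i \<and> j \<noteq> Suc i \<longrightarrow> T j = T0 j)"
    for z T
  have mv: "triple (J z) (Act i None m ;; Act (Suc i) None m) 2 (J (z + m))" for z m
  proof -
    have "triple (J z) (Act i None m ;; Act (Suc i) None m) (1 + 1) (J (z + m))"
      by (rule triple_Then[OF triple_Act triple_Act, where B =
         "\<lambda>T. T i = (c, z + m) \<and> T (Suc i) = (trail lo' hi', z) \<and> (\<forall>j. j \<noteq> i \<and> j \<noteq> Suc i \<longrightarrow> T j = T0 j)"])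
        (auto simp: J_def)
    then show ?thesis by (simp add: numeral_2_eq_2)
  qed
  have *: "lo' \<le> 0" "0 \<le> hi'" "lo' \<le> h" "h \<le> hi'" using lh by (auto simp: lo'_def hi'_def)
  have t1: "triple (\<lambda>T. T i = (c, h) \<and> T (Suc i) = (trail lo hi, h) \<and> (\<forall>j. j \<noteq> i \<and> j \<noteq> Suc i \<longrightarrow> T j = T0 j))
    (Cond (Suc i) (\<lambda>s. s = 0) (Act (Suc i) (Some 1) 0) (Act (Suc i) None 0)) (Suc 1) (J h)"
  proof (intro triple_Cond triple_Act)
    fix T assume "(T i = (c, h) \<and> T (Suc i) = (trail lo hi, h) \<and> (\<forall>j. j \<noteq> i \<and> j \<noteq> Suc i \<longrightarrow> T j = T0 j)) \<and> rd (T (Suc i)) = 0"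
    then show "J h (T(Suc i := put (Some 1) 0 (T (Suc i))))"
      using lh by (auto simp: J_def trail_def fun_eq_iff lo'_def hi'_def split: if_splits)
  next
    fix T assume "(T i = (c, h) \<and> T (Suc i) = (trail lo hi, h) \<and> (\<forall>j. j \<noteq> i \<and> j \<noteq> Suc i \<longrightarrow> T j = T0 j)) \<and> rd (T (Suc i)) \<noteq> 0"
    then show "J h (T(Suc i := put None 0 (T (Suc i))))"
      using lh by (auto simp: J_def trail_def fun_eq_iff lo'_def hi'_def split: if_splits)
  qed
  define N1 where "N1 = nat (h - lo' + 1)"
  have t2: "triple (J h) (Loop (Suc i) (\<lambda>s. s \<noteq> 0) (Act i None (- 1) ;; Act (Suc i) None (- 1)))
     (N1 * Suc 2 + 1) (J (lo' - 1))"
  proof -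
    have "triple (J (h - int 0)) (Loop (Suc i) (\<lambda>s. s \<noteq> 0) (Act i None (- 1) ;; Act (Suc i) None (- 1)))
       (N1 * Suc 2 + 1) (J (h - int N1))"
    proof (rule triple_Loop)
      fix j show "triple (J (h - int j)) (Act i None (- 1) ;; Act (Suc i) None (- 1)) 2 (J (h - int (Suc j)))"
        using mv[of "h - int j" "-1"] by (simp add: algebra_simps)
    next
      fix j T assume "j < N1" "J (h - int j) T"
      then show "rd (T (Suc i)) \<noteq> 0" using * by (auto simp: J_def trail_def N1_def)
    next
      fix T assume "J (h - int N1) T"
      then show "\<not> rd (T (Suc i)) \<noteq> 0" using * by (auto simp: J_def trail_def N1_def)
    qed
    then show ?thesis using * by (simp add: N1_def)
  qed
  have t3: "triple (J (lo' - 1)) (Act i None 1 ;; Act (Suc i) None 1) 2 (J lo')"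
    using mv[of "lo' - 1" 1] by simp
  define N2 where "N2 = nat (- lo')"
  have t4: "triple (J lo') (Loop (Suc i) (\<lambda>s. s \<noteq> 2) (Act i None 1 ;; Act (Suc i) None 1))
     (N2 * Suc 2 + 1) (J 0)"
  proof -
    have "triple (J (lo' + int 0)) (Loop (Suc i) (\<lambda>s. s \<noteq> 2) (Act i None 1 ;; Act (Suc i) None 1))
       (N2 * Suc 2 + 1) (J (lo' + int N2))"
    proof (rule triple_Loop)
      fix j show "triple (J (lo' + int j)) (Act i None 1 ;; Act (Suc i) None 1) 2 (J (lo' + int (Suc j)))"
        using mv[of "lo' + int j" 1] by (simp add: algebra_simps)
    next
      fix j T assume "j < N2" "J (lo' + int j) T"
      then show "rd (T (Suc i)) \<noteq> 2" using * by (auto simp: J_def trail_def N2_def)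
    next
      fix T assume "J (lo' + int N2) T"
      then show "\<not> rd (T (Suc i)) \<noteq> 2" using * by (auto simp: J_def trail_def N2_def)
    qed
    then show ?thesis using * by (simp add: N2_def)
  qed
  have "N1 \<le> a + 2" "N2 \<le> a + 1" using lh by (auto simp: N1_def N2_def lo'_def)
  then show ?thesis
    unfolding rewind_def
    by (intro triple_conseq[OF triple_Then[OF t1 triple_Then[OF t2 triple_Then[OF t3 t4]]]])
      (auto simp: J_def)
qed

lemma halted_stays: "fst cf = states M \<Longrightarrow> (step M ^^ a) cf = cf"
  by (induction a) (cases cf; simp)+

lemma computes_within_mono:
  assumes "(step M ^^ a) (initial_config M x) = (states M, ts)" "a \<le> b" "fst (last ts) = word_contents y"
  shows "computes_within M x y b"
proof -
  have "(step M ^^ b) (initial_config M x) = (step M ^^ (b - a)) ((step M ^^ a) (initial_config M x))"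
    using assms(2) by (metis (no_types, lifting) add.commute comp_apply funpow_add le_add_diff_inverse)
  then have "(step M ^^ b) (initial_config M x) = (states M, ts)"
    using halted_stays[of "(states M, ts)" M "b - a"] assms(1) by simp
  then show ?thesis using assms(3) by (simp add: computes_within_def)
qed

lemma word_contents_length_le:
  assumes "\<And>i. \<bar>i\<bar> > int N \<Longrightarrow> word_contents y i = 0"
  shows "length y \<le> Suc N"
proof (rule ccontr)
  assume "\<not> length y \<le> Suc N"
  then have "word_contents y (int (Suc N)) = 0" "Suc N < length y" using assms by auto
  then show False by (auto simp: word_contents_def split: if_splits)
qed

lemma Suc_power_le: "(n + 1) ^ d \<le> 2 ^ d * n ^ d + (2 ^ d :: nat)"
proof (cases "n = 0")
  case False
  then have "(n + 1) ^ d \<le> (2 * n) ^ d" by (intro power_mono) auto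
  then show ?thesis by (simp add: power_mult_distrib)
next
  case True
  then show ?thesis by (simp add: Suc_le_eq)
qed

text \<open>The number of tapes of the machine for \<open>f\<close> is unknown, hence a program is
  required for every position \<open>i\<close> of its output tape. Tapes below \<open>i\<close> hold
  leftovers and tape \<open>i + 1\<close> holds the trail, so only the tapes beyond are promised to
  be blank; the program needs to be correct on the range \<open>D\<close> of \<open>f\<close>
  only.\<close>

theorem compose_poly_time:
  assumes f: "poly_time f" and D: "\<And>x. f x \<in> D"
    and prog: "\<And>i. \<exists>p k a d. wfp k p \<and> i + 2 < k \<and>
       (\<forall>w \<in> D. triple (\<lambda>T. T i = (word_contents w, 0) \<and> (\<forall>j > i + 1. T j = blank)) p
          (a * (length w + 1) ^ d) (\<lambda>T. fst (T (k - 1)) = word_contents (g w)))"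
  shows "poly_time (\<lambda>x. g (f x))"
proof -
  obtain M a1 d1 where M: "well_formed_tm M"
    and Mc: "\<And>x. computes_within M x (f x) (a1 * length x ^ d1 + a1)"
    using f unfolding poly_time_def by blast
  define i where "i = tapes M - 1"
  have tM: "tapes M = Suc i" using M by (simp add: i_def well_formed_tm_def)
  obtain p k a d where p: "wfp k p" "i + 2 < k"
    and tr: "\<And>w. w \<in> D \<Longrightarrow> triple (\<lambda>T. T i = (word_contents w, 0) \<and> (\<forall>j > i + 1. T j = blank)) p
          (a * (length w + 1) ^ d) (\<lambda>T. fst (T (k - 1)) = word_contents (g w))"
    using prog[of i] by blast
  let ?p = "rewind i ;; p"
  let ?C = "comp_tm M k ?p"
  have wf: "wfp k ?p" using p by (simp add: rewind_def)
  have Cwf: "well_formed_tm ?C" using comp_tm_wf[OF M wf] p tM by simp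
  define t1 where "t1 l = a1 * l ^ d1 + a1" for l
  define tb where "tb l = 7 * t1 l + 21 + a * (l + t1 l + 2) ^ d" for l
  have main: "computes_within ?C x (g (f x)) (tb (length x))" for x
  proof -
    let ?R = "\<lambda>b. (step M ^^ b) (initial_config M x)"
    \<comment> \<open>The program starts at the first halting time, which may come before the
      guaranteed bound.\<close>
    define t0 where "t0 = (LEAST b. fst (?R b) = states M)"
    have hb: "fst (?R (t1 (length x))) = states M"
      using Mc[of x] by (simp add: computes_within_def t1_def split: prod.splits)
    have t0: "fst (?R t0) = states M" "t0 \<le> t1 (length x)"
      unfolding t0_def
      by (rule LeastI[where P = "\<lambda>b. fst (?R b) = states M", OF hb],
          rule Least_le[where P = "\<lambda>b. fst (?R b) = states M", OF hb])
    have nh: "\<And>b. b < t0 \<Longrightarrow> fst (?R b) \<noteq> states M" unfolding t0_def using not_less_Least by blast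
    obtain ts where ts: "?R t0 = (states M, ts)" using t0 by (cases "?R t0") auto
    have "?R (t1 (length x)) = (step M ^^ (t1 (length x) - t0)) (?R t0)"
      using t0(2) by (metis (no_types, lifting) add.commute comp_apply funpow_add le_add_diff_inverse)
    then have "?R (t1 (length x)) = (states M, ts)"
      using halted_stays[of "(states M, ts)"] ts by simp
    then have fx: "fst (last ts) = word_contents (f x)"
      using Mc[of x] by (simp add: computes_within_def t1_def)
    have ok: "config_ok M (length x) t0 (states M, ts)" using config_ok_reach[OF M, of x t0] ts by simp
    have lts: "length ts = Suc i" using ok tM by (simp add: config_ok_def)
    then have "last ts \<in> set ts" by (metis Zero_not_Suc last_in_set list.size(3))
    \<comment> \<open>Cells that the head could not reach are blank, so the output is no longer than
      the input length plus the running time, up to one.\<close>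
    then have "\<And>j. \<bar>j\<bar> > int (length x + t0) \<Longrightarrow> word_contents (f x) j = 0"
      using ok fx unfolding config_ok_def by (metis snd_conv)
    then have lfx: "length (f x) \<le> Suc (length x + t0)" by (rule word_contents_length_le)
    define h where "h = snd (last ts)"
    have ltsi: "ts ! i = (word_contents (f x), h)"
      using fx lts h_def by (metis One_nat_def diff_Suc_1 last_conv_nth list.size(3) nat.distinct(1) prod.collapse)
    obtain lo hi where lh: "lo \<le> 0" "0 \<le> hi" "hi - lo \<le> int t0" "lo - 1 \<le> h" "h \<le> hi + 1"
      and run0: "(step ?C ^^ Suc t0) (initial_config ?C x)
         = (Suc (states M), ts @ (trail lo hi, h) # replicate (k - Suc (tapes M)) blank)"
      using comp_tm_sim[OF M wf _ nh, of t0] p tM unfolding ts Let_def prod.case h_def by auto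
    let ?ts = "ts @ (trail lo hi, h) # replicate (k - Suc (tapes M)) blank"
    define T where "T = (!) ?ts"
    have lk: "length ?ts = k" using lts p tM by simp
    have mapT: "map T [0..<k] = ?ts" unfolding T_def using lk map_nth by metis
    define T1 where "T1 j = (if j < k then T j else blank)" for j
    have mapT1: "map T1 [0..<k] = ?ts" unfolding mapT[symmetric] T1_def by simp
    have T1i: "T1 i = (word_contents (f x), h)" "T1 (Suc i) = (trail lo hi, h)"
      "\<And>j. j > i + 1 \<Longrightarrow> T1 j = blank"
      unfolding T1_def T_def using p lts ltsi tM
      by (auto simp: nth_append nth_Cons' simp del: replicate_Suc)
    from rewind_triple[OF lh, of i "word_contents (f x)" T1] obtain b1 T2 where
      r1: "b1 \<le> 6 * t0 + 20" "runs (rewind i) T1 b1 T2" "T2 i = (word_contents (f x), 0)"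
        "\<forall>j. j \<noteq> i \<and> j \<noteq> Suc i \<longrightarrow> T2 j = T1 j"
      unfolding triple_def using T1i by blast
    have "T2 i = (word_contents (f x), 0) \<and> (\<forall>j > i + 1. T2 j = blank)"
      using r1 T1i by auto
    then obtain b2 T3 where r2: "b2 \<le> a * (length (f x) + 1) ^ d" "runs p T2 b2 T3"
        "fst (T3 (k - 1)) = word_contents (g (f x))"
      using tr[OF D[of x]] unfolding triple_def by blast
    have r: "runs ?p T1 (b1 + b2) T3" using r1 r2 runs.Then by blast
    have "(step ?C ^^ (b1 + b2)) (Suc (states M), map T1 [0..<k])
       = (Suc (states M) + len ?p, map T3 [0..<k])"
      by (rule code_correct[OF r wf]) (auto simp: comp_tm_def simp del: code.simps len.simps)
    then have "(step ?C ^^ (b1 + b2 + Suc t0)) (initial_config ?C x) = (states ?C, map T3 [0..<k])"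
      unfolding funpow_add comp_apply run0 mapT1 by (simp add: comp_tm_def)
    moreover have "b1 + b2 + Suc t0 \<le> tb (length x)"
    proof -
      have "b2 \<le> a * (length x + t1 (length x) + 2) ^ d"
        using r2(1) lfx t0(2) by (elim order_trans) (intro mult_le_mono2 power_mono, auto)
      then show ?thesis using r1(1) t0(2) unfolding tb_def by linarith
    qed
    moreover have "fst (last (map T3 [0..<k])) = word_contents (g (f x))"
      using r2(3) p by (simp add: last_map)
    ultimately show ?thesis by (rule computes_within_mono)
  qed
  have "\<exists>A E. \<forall>l. tb l \<le> A * l ^ E + A"
  proof -
    have pw: "(l + 1) ^ e \<le> (l + 1) ^ e'" if "e \<le> e'" for l e e' :: nat
      using that by (intro power_increasing) auto
    have t1b: "t1 l \<le> 2 * a1 * (l + 1) ^ d1" for l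
    proof -
      have "l ^ d1 \<le> (l + 1) ^ d1" by (intro power_mono) auto
      moreover have "1 \<le> (l + 1) ^ d1" by simp
      ultimately have "a1 * l ^ d1 + a1 * 1 \<le> a1 * (l + 1) ^ d1 + a1 * (l + 1) ^ d1"
        by (intro add_mono mult_le_mono2)
      then show ?thesis by (simp add: t1_def)
    qed
    \<comment> \<open>Covers both the simulation, of degree \<open>d1\<close>, and the program, of
      degree \<open>d\<close> in a word whose length is bounded with degree
      \<open>Suc d1\<close>.\<close>
    define E where "E = Suc d1 * Suc d"
    define A0 where "A0 = 14 * a1 + 21 + a * (2 * a1 + 2) ^ d"
    have tbb: "tb l \<le> A0 * (l + 1) ^ E" for l
    proof -
      have 1: "7 * t1 l \<le> 14 * a1 * (l + 1) ^ E"
      proof -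
        have "(l + 1) ^ d1 \<le> (l + 1) ^ E" by (rule pw) (simp add: E_def)
        from mult_le_mono2[OF this, of "14 * a1"] show ?thesis using t1b[of l] by linarith
      qed
      have 2: "21 \<le> 21 * (l + 1) ^ E" by simp
      have "l + t1 l + 2 \<le> (2 * a1 + 2) * (l + 1) ^ Suc d1"
      proof -
        have "t1 l \<le> 2 * a1 * (l + 1) ^ Suc d1"
          using t1b[of l] pw[of d1 "Suc d1" l] by (meson le_SucI le_refl le_trans mult_le_mono2)
        moreover have "l + 2 \<le> 2 * (l + 1) ^ Suc d1"
          using pw[of 1 "Suc d1" l] by simp
        ultimately show ?thesis unfolding add_mult_distrib by linarith
      qed
      then have "(l + t1 l + 2) ^ d \<le> ((2 * a1 + 2) * (l + 1) ^ Suc d1) ^ d" by (intro power_mono) auto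
      also have "\<dots> = (2 * a1 + 2) ^ d * (l + 1) ^ (Suc d1 * d)" by (simp only: power_mult_distrib power_mult)
      also have "\<dots> \<le> (2 * a1 + 2) ^ d * (l + 1) ^ E"
        using pw[of "Suc d1 * d" E l] by (intro mult_le_mono2) (simp add: E_def)
      finally have 3: "a * (l + t1 l + 2) ^ d \<le> a * (2 * a1 + 2) ^ d * (l + 1) ^ E"
        unfolding mult.assoc by (rule mult_le_mono2)
      show ?thesis unfolding tb_def A0_def add_mult_distrib using 1 2 3 by linarith
    qed
    have "tb l \<le> (A0 * 2 ^ E) * l ^ E + A0 * 2 ^ E" for l
      using tbb[of l] mult_le_mono2[OF Suc_power_le[of l E], of A0] by (simp add: algebra_simps)
    then show ?thesis by blast
  qed
  then obtain A E where AE: "\<And>l. tb l \<le> A * l ^ E + A" by blast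
  have "computes_within ?C x (g (f x)) (A * length x ^ E + A)" for x
  proof -
    obtain q ts where e: "(step ?C ^^ tb (length x)) (initial_config ?C x) = (q, ts)" by force
    with main[of x] have "q = states ?C" "fst (last ts) = word_contents (g (f x))"
      by (auto simp: computes_within_def)
    then show ?thesis using computes_within_mono[of _ ?C x ts, OF _ AE] e by simp
  qed
  then show ?thesis unfolding poly_time_def using Cwf by blast
qed

section \<open>Basic head movements\<close>

lemma triple_state: "(\<And>T0. A T0 \<Longrightarrow> triple (\<lambda>T. T = T0) p b B) \<Longrightarrow> triple A p b B"
  unfolding triple_def by blast

lemma triple_Act_le:
  assumes "\<And>T. A T \<Longrightarrow> B (T(i := put w m (T i)))" "1 \<le> b"
  shows "triple A (Act i w m) b B"
  using triple_conseq[OF triple_Act[of A B]] assms by blast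

text \<open>For a flag that is known to decide the proposition \<open>Q\<close>: each branch may
  assume \<open>Q\<close> or its negation instead of a fact about the tape.\<close>

lemma triple_Cond_iff:
  assumes "Q \<Longrightarrow> triple A p b B" "\<not> Q \<Longrightarrow> triple A q b B"
  shows "triple (\<lambda>T. A T \<and> (P (rd (T i)) \<longleftrightarrow> Q)) (Cond i P p q) (Suc b) B"
proof (rule triple_Cond)
  show "triple (\<lambda>T. (A T \<and> (P (rd (T i)) \<longleftrightarrow> Q)) \<and> P (rd (T i))) p b B"
    using assms(1) by (cases Q) (auto simp: triple_def)
  show "triple (\<lambda>T. (A T \<and> (P (rd (T i)) \<longleftrightarrow> Q)) \<and> \<not> P (rd (T i))) q b B"
    using assms(2) by (cases Q) (auto simp: triple_def)
qed

lemma triple_Act_state: "triple (\<lambda>T. T = T0) (Act j w m) 1 (\<lambda>T. T = T0(j := put w m (T0 j)))"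
  by (rule triple_Act) simp

text \<open>The head may start on the blank behind the word, where the search loop would stop at
  once; hence the step to the left before it.\<close>

definition left_end :: "nat \<Rightarrow> prog" where
  "left_end j = Act j None (- 1) ;; Loop j (\<lambda>s. s \<noteq> 0) (Act j None (- 1)) ;; Act j None 1"

lemma left_end_triple:
  assumes "T0 j = (c, h)" "0 \<le> h" "\<And>z. 0 \<le> z \<Longrightarrow> z < h \<Longrightarrow> c z \<noteq> 0" "c (- 1) = 0" "h \<le> int b"
  shows "triple (\<lambda>T. T = T0) (left_end j) (2 * b + 3) (\<lambda>T. T = T0(j := (c, 0)))"
proof -
  have t1: "triple (\<lambda>T. T = T0) (Act j None (- 1)) 1 (\<lambda>T. T = T0(j := (c, h - 1)))"
    using triple_Act_state[of T0 j None "-1"] assms(1) by simp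
  have "triple (\<lambda>T. T = T0(j := (c, h - 1 - int 0))) (Loop j (\<lambda>s. s \<noteq> 0) (Act j None (- 1)))
      (nat h * Suc 1 + 1) (\<lambda>T. T = T0(j := (c, h - 1 - int (nat h))))"
  proof (rule triple_Loop[where I = "\<lambda>k T. T = T0(j := (c, h - 1 - int k))"])
    fix k
    show "triple (\<lambda>T. T = T0(j := (c, h - 1 - int k))) (Act j None (- 1)) 1
        (\<lambda>T. T = T0(j := (c, h - 1 - int (Suc k))))"
      using triple_Act_state[of "T0(j := (c, h - 1 - int k))" j None "-1"] by (simp add: algebra_simps)
  qed (use assms in auto)
  then have t2: "triple (\<lambda>T. T = T0(j := (c, h - 1))) (Loop j (\<lambda>s. s \<noteq> 0) (Act j None (- 1)))
      (nat h * Suc 1 + 1) (\<lambda>T. T = T0(j := (c, - 1)))" using assms by simp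
  have t3: "triple (\<lambda>T. T = T0(j := (c, - 1))) (Act j None 1) 1 (\<lambda>T. T = T0(j := (c, 0)))"
    using triple_Act_state[of "T0(j := (c, -1))" j None 1] by simp
  show ?thesis unfolding left_end_def
    by (rule triple_conseq[OF triple_Then[OF t1 triple_Then[OF t2 t3]]]) (use assms in auto)
qed

lemma seek_triple:
  assumes "T0 j = (c, h)" "h \<le> h'" "\<And>z. h \<le> z \<Longrightarrow> z < h' \<Longrightarrow> P (c z)" "\<not> P (c h')" "h' - h \<le> int b"
  shows "triple (\<lambda>T. T = T0) (Loop j P (Act j None 1)) (2 * b + 1) (\<lambda>T. T = T0(j := (c, h')))"
proof -
  have "triple (\<lambda>T. T = T0(j := (c, h + int 0))) (Loop j P (Act j None 1))
      (nat (h' - h) * Suc 1 + 1) (\<lambda>T. T = T0(j := (c, h + int (nat (h' - h)))))"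
  proof (rule triple_Loop[where I = "\<lambda>k T. T = T0(j := (c, h + int k))"])
    fix k
    show "triple (\<lambda>T. T = T0(j := (c, h + int k))) (Act j None 1) 1
        (\<lambda>T. T = T0(j := (c, h + int (Suc k))))"
      using triple_Act_state[of "T0(j := (c, h + int k))" j None 1] by (simp add: algebra_simps)
  qed (use assms in auto)
  then show ?thesis
    by (rule triple_conseq) (use assms in auto)
qed

fun seqs :: "nat \<Rightarrow> prog list \<Rightarrow> prog" where
  "seqs j [] = Act j None 0"
| "seqs j (p # ps) = p ;; seqs j ps"

lemma put_None_0 [simp]: "put None 0 tp = tp"
  by (cases tp) simp

lemma wfp_seqs: "wfp k (seqs j ps) \<longleftrightarrow> j < k \<and> (\<forall>p \<in> set ps. wfp k p)"
  by (induction ps) auto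

lemma seqs_triple:
  assumes "\<And>k. k < length ps \<Longrightarrow> triple (I k) (ps ! k) b (I (Suc k))"
  shows "triple (I 0) (seqs j ps) (length ps * b + 1) (I (length ps))"
  using assms
proof (induction ps arbitrary: I)
  case Nil
  show ?case using triple_Act[of "I 0" "I 0" j None 0] by simp
next
  case (Cons p ps)
  have "triple (I (Suc 0)) (seqs j ps) (length ps * b + 1) (I (Suc (length ps)))"
    by (rule Cons.IH[of "\<lambda>k. I (Suc k)"]) (use Cons.prems in force)
  moreover have "triple (I 0) p b (I (Suc 0))" using Cons.prems[of 0] by simp
  ultimately have "triple (I 0) (p ;; seqs j ps) (b + (length ps * b + 1)) (I (Suc (length ps)))"
    by (rule triple_Then[rotated])
  then show ?case by (simp add: algebra_simps)
qed

section \<open>A loop language over graphs\<close>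

text \<open>Just enough to write down the incidence matrix of the hypergraph: variables range over
  the vertices of the input graph, and everything that depends only on the constants of the
  reduction is unrolled into the command.\<close>

datatype cmd = Out bool | Nop | Cat cmd cmd | For nat cmd
  | IfEq nat nat cmd cmd | IfAdj nat nat cmd cmd

text \<open>\<open>IfAdj\<close> asks for an edge containing both values, which also holds when both
  are the same nonisolated vertex; adjacency proper is obtained by guarding it with
  \<open>IfEq\<close>.\<close>

fun sem :: "nat \<Rightarrow> nat set set \<Rightarrow> cmd \<Rightarrow> (nat \<Rightarrow> nat) \<Rightarrow> bool list" where
  "sem n E (Out b) env = [b]"
| "sem n E Nop env = []"
| "sem n E (Cat c d) env = sem n E c env @ sem n E d env"
| "sem n E (For v c) env = concat (map (\<lambda>x. sem n E c (env(v := x))) [0..<n])"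
| "sem n E (IfEq u v c d) env = (if env u = env v then sem n E c env else sem n E d env)"
| "sem n E (IfAdj u v c d) env =
     (if \<exists>e \<in> E. env u \<in> e \<and> env v \<in> e then sem n E c env else sem n E d env)"

text \<open>\<open>A\<close> is the set of variables bound so far. A loop needs a tape that is not
  in use, and a test needs two different tapes because the two heads move independently.\<close>

fun wfc :: "nat \<Rightarrow> nat set \<Rightarrow> cmd \<Rightarrow> bool" where
  "wfc nv A (Out b) \<longleftrightarrow> True"
| "wfc nv A Nop \<longleftrightarrow> True"
| "wfc nv A (Cat c d) \<longleftrightarrow> wfc nv A c \<and> wfc nv A d"
| "wfc nv A (For v c) \<longleftrightarrow> v < nv \<and> v \<notin> A \<and> wfc nv (insert v A) c"
| "wfc nv A (IfEq u v c d) \<longleftrightarrow> u < nv \<and> v < nv \<and> u \<in> A \<and> v \<in> A \<and> u \<noteq> v \<and> wfc nv A c \<and> wfc nv A d"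
| "wfc nv A (IfAdj u v c d) \<longleftrightarrow> u < nv \<and> v < nv \<and> u \<in> A \<and> v \<in> A \<and> u \<noteq> v \<and> wfc nv A c \<and> wfc nv A d"

text \<open>Bounds the running time on words of length at most \<open>L - 2\<close>.\<close>

fun cmd_time :: "cmd \<Rightarrow> nat \<Rightarrow> nat" where
  "cmd_time (Out b) L = 1"
| "cmd_time Nop L = 1"
| "cmd_time (Cat c d) L = cmd_time c L + cmd_time d L"
| "cmd_time (For v c) L = L * (cmd_time c L + 4) + 2 * L + 5"
| "cmd_time (IfEq u v c d) L = 20 * L + cmd_time c L + cmd_time d L"
| "cmd_time (IfAdj u v c d) L = 60 * L + cmd_time c L + cmd_time d L"

lemma cmd_time_poly: "\<exists>a e. \<forall>L \<ge> 1. cmd_time c L \<le> a * L ^ e"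
proof (induction c)
  case (Out b)
  show ?case by (intro exI[of _ 1] exI[of _ 0]) simp
next
  case Nop
  show ?case by (intro exI[of _ 1] exI[of _ 0]) simp
next
  case (Cat c d)
  then obtain a e a' e' where *: "\<And>L. 1 \<le> L \<Longrightarrow> cmd_time c L \<le> a * L ^ e" "\<And>L. 1 \<le> L \<Longrightarrow> cmd_time d L \<le> a' * L ^ e'"
    by blast
  have "cmd_time (Cat c d) L \<le> (a + a') * L ^ (e + e')" if L: "1 \<le> L" for L
  proof -
    have "L ^ e \<le> L ^ (e + e')" "L ^ e' \<le> L ^ (e + e')" using L by (auto intro: power_increasing)
    then show ?thesis using *[OF L] by (simp add: add_mult_distrib) (meson add_mono le_trans mult_le_mono2)
  qed
  then show ?case by blast
next
  case (For v c)
  then obtain a e where *: "\<And>L. 1 \<le> L \<Longrightarrow> cmd_time c L \<le> a * L ^ e" by blast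
  have "cmd_time (For v c) L \<le> (a + 11) * L ^ (Suc e)" if L: "1 \<le> L" for L
  proof -
    have "L \<le> L ^ Suc e" using L by auto
    moreover have "L * cmd_time c L \<le> a * L ^ Suc e"
      using mult_le_mono2[OF *[OF L], of L] by (simp add: mult_ac)
    ultimately show ?thesis using L unfolding cmd_time.simps add_mult_distrib add_mult_distrib2 by linarith
  qed
  then show ?case by blast
next
  case (IfEq u v c d)
  then obtain a e a' e' where *: "\<And>L. 1 \<le> L \<Longrightarrow> cmd_time c L \<le> a * L ^ e" "\<And>L. 1 \<le> L \<Longrightarrow> cmd_time d L \<le> a' * L ^ e'"
    by blast
  have "cmd_time (IfEq u v c d) L \<le> (20 + a + a') * L ^ (Suc (e + e'))" if L: "1 \<le> L" for L
  proof -
    have "L ^ e \<le> L ^ Suc (e + e')" "L ^ e' \<le> L ^ Suc (e + e')" "L \<le> L ^ Suc (e + e')"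
      using L power_increasing[of 1 "Suc (e + e')" L] by (auto intro: power_increasing simp del: power_Suc)
    then show ?thesis using *[OF L] unfolding add_mult_distrib cmd_time.simps
      by (meson add_mono le_trans mult_le_mono2)
  qed
  then show ?case by blast
next
  case (IfAdj u v c d)
  then obtain a e a' e' where *: "\<And>L. 1 \<le> L \<Longrightarrow> cmd_time c L \<le> a * L ^ e" "\<And>L. 1 \<le> L \<Longrightarrow> cmd_time d L \<le> a' * L ^ e'"
    by blast
  have "cmd_time (IfAdj u v c d) L \<le> (60 + a + a') * L ^ (Suc (e + e'))" if L: "1 \<le> L" for L
  proof -
    have "L ^ e \<le> L ^ Suc (e + e')" "L ^ e' \<le> L ^ Suc (e + e')" "L \<le> L ^ Suc (e + e')"
      using L power_increasing[of 1 "Suc (e + e')" L] by (auto intro: power_increasing simp del: power_Suc)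
    then show ?thesis using *[OF L] unfolding add_mult_distrib cmd_time.simps
      by (meson add_mono le_trans mult_le_mono2)
  qed
  then show ?case by blast
qed

text \<open>The word format of \<open>encodes\<close> with the order of the edges made
  explicit.\<close>

definition graph_word :: "nat \<Rightarrow> nat set list \<Rightarrow> bool list" where
  "graph_word n es = replicate n True @ [False] @ concat (map (\<lambda>e. map (\<lambda>v. v \<in> e) [0..<n]) es)"

lemma length_graph_word: "length (graph_word n es) = n + 1 + length es * n"
  by (simp add: graph_word_def length_concat comp_def sum_list_triv)

lemma nth_concat_rows:
  assumes "\<And>xs. xs \<in> set xss \<Longrightarrow> length xs = n" "a < length xss" "j < n"
  shows "concat xss ! (a * n + j) = xss ! a ! j"
  using assms
proof (induction xss arbitrary: a)
  case (Cons xs xss)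
  then show ?case by (cases a) (auto simp: nth_append)
qed simp

lemma graph_word_contents:
  shows "0 \<le> z \<Longrightarrow> z < int n \<Longrightarrow> word_contents (graph_word n es) z = 2"
    and "word_contents (graph_word n es) (int n) = 1"
    and "a < length es \<Longrightarrow> j < n \<Longrightarrow>
      word_contents (graph_word n es) (int n + 1 + int a * int n + int j) = (if j \<in> es ! a then 2 else 1)"
    and "z < 0 \<Longrightarrow> word_contents (graph_word n es) z = 0"
    and "0 \<le> z \<Longrightarrow> z < int n + 1 + int (length es) * int n \<Longrightarrow> word_contents (graph_word n es) z \<noteq> 0"
    and "word_contents (graph_word n es) (int n + 1 + int (length es) * int n) = 0"
proof -
  let ?w = "graph_word n es"
  have len: "int (length ?w) = int n + 1 + int (length es) * int n" by (simp add: length_graph_word)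
  show "word_contents ?w z = 2" if "0 \<le> z" "z < int n"
  proof -
    have "?w ! nat z" "z < int (length ?w)" using that by (auto simp: graph_word_def nth_append length_concat)
    then show ?thesis using that by (simp add: word_contents_def)
  qed
  show "word_contents ?w (int n) = 1"
    by (simp add: word_contents_def length_graph_word add_pos_nonneg) (simp add: graph_word_def nth_append)
  show "word_contents ?w (int n + 1 + int a * int n + int j) = (if j \<in> es ! a then 2 else 1)"
    if "a < length es" "j < n"
  proof -
    have "Suc a * n \<le> length es * n" using that by (intro mult_le_mono1) simp
    then have l: "n + 1 + (a * n + j) < length ?w" using that by (simp add: length_graph_word)
    have "?w ! (n + 1 + (a * n + j)) = concat (map (\<lambda>e. map (\<lambda>v. v \<in> e) [0..<n]) es) ! (a * n + j)"
      by (simp add: graph_word_def nth_append)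
    also have "\<dots> = (j \<in> es ! a)" using that by (subst nth_concat_rows) auto
    finally have e: "?w ! (n + 1 + (a * n + j)) = (j \<in> es ! a)" .
    have i: "int n + 1 + int a * int n + int j = int (n + 1 + (a * n + j))" by simp
    define P where "P = n + 1 + (a * n + j)"
    show ?thesis using l e unfolding i P_def[symmetric] by (simp add: word_contents_def)
  qed
  show "z < 0 \<Longrightarrow> word_contents ?w z = 0" by (simp add: word_contents_def)
  show "0 \<le> z \<Longrightarrow> z < int n + 1 + int (length es) * int n \<Longrightarrow> word_contents ?w z \<noteq> 0"
    using len by (simp add: word_contents_def)
  show "word_contents ?w (int n + 1 + int (length es) * int n) = 0"
    using len by (simp add: word_contents_def)
qed

text \<open>Tape \<open>i\<close> holds the input; the value \<open>e\<close> of a variable is stored on its own tape as the word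
  \<open>1\<^sup>n\<close> with the symbol at position \<open>e\<close> replaced by \<open>2\<close> and the head at that position.\<close>

definition ct :: "nat \<Rightarrow> nat \<Rightarrow> nat" where "ct i v = i + 2 + v"
definition fA :: "nat \<Rightarrow> nat \<Rightarrow> nat" where "fA i nv = i + 2 + nv"
definition fB :: "nat \<Rightarrow> nat \<Rightarrow> nat" where "fB i nv = i + 3 + nv"
definition fC :: "nat \<Rightarrow> nat \<Rightarrow> nat" where "fC i nv = i + 4 + nv"
definition outt :: "nat \<Rightarrow> nat \<Rightarrow> nat" where "outt i nv = i + 5 + nv"

lemmas layout = ct_def fA_def fB_def fC_def outt_def

text \<open>Starting at the left ends, both heads advance together until the first finds its mark;
  the second then reads 2 exactly if the values agree. The first head has thereby returned to its
  place, and only the second has to be restored.\<close>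

definition eqt :: "nat \<Rightarrow> nat \<Rightarrow> nat \<Rightarrow> nat \<Rightarrow> prog" where
  "eqt i nv u v = left_end (ct i u) ;; left_end (ct i v) ;;
     Loop (ct i u) (\<lambda>s. s = 1) (Act (ct i u) None 1 ;; Act (ct i v) None 1) ;;
     Cond (ct i v) (\<lambda>s. s = 2) (Act (fA i nv) (Some 2) 0) (Act (fA i nv) (Some 1) 0) ;;
     left_end (ct i v) ;; Loop (ct i v) (\<lambda>s. s = 1) (Act (ct i v) None 1)"

definition mark :: "nat \<Rightarrow> nat \<Rightarrow> nat \<Rightarrow> prog" where
  "mark a b f = Cond a (\<lambda>s. s = 2) (Cond b (\<lambda>s. s = 2) (Act f (Some 2) 0) (Act f None 0)) (Act f None 0)"

text \<open>The two variable tapes run along with one row of the incidence matrix, so the mark of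
  \<open>u\<close> meets the column of the value of \<open>u\<close>; the flags \<open>fB\<close>
  and \<open>fC\<close> remember whether a 1 was seen there. The word on the tape of
  \<open>u\<close> has length \<open>n\<close>, so its end is also the end of the row.\<close>

definition row_scan :: "nat \<Rightarrow> nat \<Rightarrow> nat \<Rightarrow> nat \<Rightarrow> prog" where
  "row_scan i nv u v = Act (fB i nv) (Some 1) 0 ;; Act (fC i nv) (Some 1) 0 ;;
     Loop (ct i u) (\<lambda>s. s \<noteq> 0)
       (mark i (ct i u) (fB i nv) ;; mark i (ct i v) (fC i nv) ;;
        Act (ct i u) None 1 ;; Act (ct i v) None 1 ;; Act i None 1) ;;
     left_end (ct i u) ;; left_end (ct i v) ;; mark (fB i nv) (fC i nv) (fA i nv)"

text \<open>The flag \<open>fA\<close> collects the answer over all rows, up to the blank behind the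
  last one. Afterwards all heads return to the places that \<open>stores\<close> prescribes; on the
  input this is the cell behind the unary number and its separator.\<close>

definition adjt :: "nat \<Rightarrow> nat \<Rightarrow> nat \<Rightarrow> nat \<Rightarrow> prog" where
  "adjt i nv u v = Act (fA i nv) (Some 1) 0 ;; left_end (ct i u) ;; left_end (ct i v) ;;
     Loop i (\<lambda>s. s \<noteq> 0) (row_scan i nv u v) ;;
     Loop (ct i u) (\<lambda>s. s = 1) (Act (ct i u) None 1) ;;
     Loop (ct i v) (\<lambda>s. s = 1) (Act (ct i v) None 1) ;;
     left_end i ;; Loop i (\<lambda>s. s = 2) (Act i None 1) ;; Act i None 1"

text \<open>A loop uses the tape of its variable as counter: the mark 2 is shifted to the right
  until the head falls off the word.\<close>

fun cp :: "nat \<Rightarrow> nat \<Rightarrow> cmd \<Rightarrow> prog" where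
  "cp i nv (Out b) = Act (outt i nv) (Some (if b then 2 else 1)) 1"
| "cp i nv Nop = Act (outt i nv) None 0"
| "cp i nv (Cat c d) = cp i nv c ;; cp i nv d"
| "cp i nv (For v c) = Act (ct i v) (Some 2) 0 ;;
     Loop (ct i v) (\<lambda>s. s \<noteq> 0) (cp i nv c ;; Act (ct i v) (Some 1) 1 ;;
        Cond (ct i v) (\<lambda>s. s \<noteq> 0) (Act (ct i v) (Some 2) 0) (Act (ct i v) None 0)) ;;
     left_end (ct i v)"
| "cp i nv (IfEq u v c d) = eqt i nv u v ;; Cond (fA i nv) (\<lambda>s. s = 2) (cp i nv c) (cp i nv d)"
| "cp i nv (IfAdj u v c d) = adjt i nv u v ;; Cond (fA i nv) (\<lambda>s. s = 2) (cp i nv c) (cp i nv d)"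

lemma wfp_cp: "wfc nv A c \<Longrightarrow> wfp (i + 6 + nv) (cp i nv c)"
  by (induction c arbitrary: A)
    (auto simp: layout eqt_def adjt_def row_scan_def mark_def left_end_def)

text \<open>For \<open>e = n\<close> no cell is marked; this is the tape of an unbound variable and
  of a loop that has run out.\<close>

definition onehot :: "nat \<Rightarrow> nat \<Rightarrow> int \<Rightarrow> nat" where
  "onehot n e z = (if 0 \<le> z \<and> z < int n then (if z = int e then 2 else 1) else 0)"

text \<open>The flag tapes are left unconstrained, since every test initialises the flags before it
  reads them.\<close>

definition stores where
  "stores i nv n w A env ob T \<longleftrightarrow> T i = (word_contents w, int n + 1) \<and>
     (\<forall>v < nv. T (ct i v) = (if v \<in> A then (onehot n (env v), int (env v)) else (onehot n n, 0))) \<and>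
     T (outt i nv) = (word_contents ob, int (length ob))"

lemma eqt_triple:
  assumes uv: "u < nv" "v < nv" "u \<in> A" "v \<in> A" "u \<noteq> v" and env: "\<And>v. v \<in> A \<Longrightarrow> env v < n"
  shows "triple (stores i nv n w A env ob) (eqt i nv u v) (12 * n + 12)
    (\<lambda>T. stores i nv n w A env ob T \<and> (rd (T (fA i nv)) = 2 \<longleftrightarrow> env u = env v))"
proof (rule triple_state)
  fix T0 assume T0: "stores i nv n w A env ob T0"
  let ?u = "ct i u" and ?v = "ct i v" and ?f = "fA i nv"
  let ?ou = "onehot n (env u)" and ?ov = "onehot n (env v)"
  have d: "?u \<noteq> ?v" "?u \<noteq> ?f" "?v \<noteq> ?f" using uv by (auto simp: layout)
  have e: "env u < n" "env v < n" using env uv by auto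
  have Tu: "T0 ?u = (?ou, int (env u))" "T0 ?v = (?ov, int (env v))"
    using T0 uv by (auto simp: stores_def)
  have t1: "triple (\<lambda>T. T = T0) (left_end ?u) (2 * n + 3) (\<lambda>T. T = T0(?u := (?ou, 0)))"
    by (rule left_end_triple) (use e Tu in \<open>auto simp: onehot_def\<close>)
  have t2: "triple (\<lambda>T. T = T0(?u := (?ou, 0))) (left_end ?v) (2 * n + 3)
     (\<lambda>T. T = T0(?u := (?ou, 0), ?v := (?ov, 0)))"
    by (rule left_end_triple[where h = "int (env v)"]) (use e Tu d in \<open>auto simp: onehot_def\<close>)
  let ?S = "\<lambda>k. T0(?u := (?ou, int k), ?v := (?ov, int k))"
  have "triple (\<lambda>T. T = ?S 0) (Loop ?u (\<lambda>s. s = 1) (Act ?u None 1 ;; Act ?v None 1)) (env u * Suc (1 + 1) + 1)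
     (\<lambda>T. T = ?S (env u))"
  proof (rule triple_Loop[where I = "\<lambda>k T. T = ?S k"])
    fix k
    show "triple (\<lambda>T. T = ?S k) (Act ?u None 1 ;; Act ?v None 1) (1 + 1) (\<lambda>T. T = ?S (Suc k))"
    proof (rule triple_Then[OF triple_Act_state])
      show "triple (\<lambda>T. T = (?S k)(?u := put None 1 (?S k ?u))) (Act ?v None 1) 1 (\<lambda>T. T = ?S (Suc k))"
        by (rule triple_Act) (use d in \<open>auto simp: fun_eq_iff algebra_simps\<close>)
    qed
  qed (use e d in \<open>auto simp: onehot_def\<close>)
  then have t3: "triple (\<lambda>T. T = T0(?u := (?ou, 0), ?v := (?ov, 0)))
     (Loop ?u (\<lambda>s. s = 1) (Act ?u None 1 ;; Act ?v None 1)) (env u * Suc (1 + 1) + 1)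
     (\<lambda>T. T = ?S (env u))" by simp
  define B where "B h T \<longleftrightarrow> T ?v = (?ov, h) \<and> (\<forall>j. j \<noteq> ?v \<and> j \<noteq> ?f \<longrightarrow> T j = T0 j) \<and>
     (rd (T ?f) = 2 \<longleftrightarrow> env u = env v)" for h T
  obtain cf hf where f: "T0 ?f = (cf, hf)" by force
  have t4: "triple (\<lambda>T. T = ?S (env u))
     (Cond ?v (\<lambda>s. s = 2) (Act ?f (Some 2) 0) (Act ?f (Some 1) 0)) (Suc 1) (B (int (env u)))"
    by (intro triple_Cond triple_Act)
      (use e d f Tu in \<open>auto simp: onehot_def B_def split: if_splits\<close>)
  have t5: "triple (B (int (env u))) (left_end ?v) (2 * n + 3) (B 0)"
  proof (rule triple_state)
    fix T1 assume T1: "B (int (env u)) T1"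
    show "triple (\<lambda>T. T = T1) (left_end ?v) (2 * n + 3) (B 0)"
      by (rule triple_conseq[OF left_end_triple[where h = "int (env u)" and b = n and c = ?ov]])
        (use T1 e d in \<open>auto simp: onehot_def B_def\<close>)
  qed
  have t6: "triple (B 0) (Loop ?v (\<lambda>s. s = 1) (Act ?v None 1)) (2 * n + 1) (B (int (env v)))"
  proof (rule triple_state)
    fix T1 assume T1: "B 0 T1"
    show "triple (\<lambda>T. T = T1) (Loop ?v (\<lambda>s. s = 1) (Act ?v None 1)) (2 * n + 1) (B (int (env v)))"
      by (rule triple_conseq[OF seek_triple[where h = 0 and h' = "int (env v)" and b = n and c = ?ov]])
        (use T1 e d in \<open>auto simp: onehot_def B_def\<close>)
  qed
  show "triple (\<lambda>T. T = T0) (eqt i nv u v) (12 * n + 12)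
    (\<lambda>T. stores i nv n w A env ob T \<and> (rd (T (fA i nv)) = 2 \<longleftrightarrow> env u = env v))"
    unfolding eqt_def
  proof (rule triple_conseq[OF triple_Then[OF t1 triple_Then[OF t2 triple_Then[OF t3 triple_Then[OF t4 triple_Then[OF t5 t6]]]]]])
    fix T assume T: "B (int (env v)) T"
    have "T j = T0 j" if "j \<noteq> ?f" for j using T Tu that by (cases "j = ?v") (auto simp: B_def)
    then show "stores i nv n w A env ob T \<and> (rd (T (fA i nv)) = 2 \<longleftrightarrow> env u = env v)"
      using T T0 by (auto simp: stores_def B_def layout)
  qed (use e in auto)
qed

lemma mark_triple:
  assumes "a \<noteq> f" "b \<noteq> f"
  shows "triple (\<lambda>T. T = T0) (mark a b f) 3
    (\<lambda>T. (\<forall>j. j \<noteq> f \<longrightarrow> T j = T0 j) \<and>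
      rd (T f) = (if rd (T0 a) = 2 \<and> rd (T0 b) = 2 then 2 else rd (T0 f)))"
proof -
  obtain cf hf where f: "T0 f = (cf, hf)" by force
  have "triple (\<lambda>T. T = T0) (mark a b f) (Suc (Suc 1))
    (\<lambda>T. (\<forall>j. j \<noteq> f \<longrightarrow> T j = T0 j) \<and>
      rd (T f) = (if rd (T0 a) = 2 \<and> rd (T0 b) = 2 then 2 else rd (T0 f)))"
    unfolding mark_def
    by (intro triple_Cond triple_Act_le) (use assms f in auto)
  then show ?thesis by (simp add: numeral_3_eq_3)
qed

lemma adjt_triple:
  assumes uv: "u < nv" "v < nv" "u \<in> A" "v \<in> A" "u \<noteq> v" and env: "\<And>v. v \<in> A \<Longrightarrow> env v < n"
  shows "triple (stores i nv n (graph_word n es) A env ob) (adjt i nv u v) (60 * (length (graph_word n es) + 1))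
    (\<lambda>T. stores i nv n (graph_word n es) A env ob T \<and>
      (rd (T (fA i nv)) = 2 \<longleftrightarrow> (\<exists>e \<in> set es. env u \<in> e \<and> env v \<in> e)))"
proof (rule triple_state)
  fix T0 assume T0: "stores i nv n (graph_word n es) A env ob T0"
  let ?wc = "word_contents (graph_word n es)"
  let ?u = "ct i u" and ?v = "ct i v" and ?f = "fA i nv" and ?g = "fB i nv" and ?h = "fC i nv"
  let ?ou = "onehot n (env u)" and ?ov = "onehot n (env v)"
  have d: "?u \<noteq> ?v" "?u \<noteq> ?f" "?v \<noteq> ?f" "?u \<noteq> ?g" "?v \<noteq> ?g" "?u \<noteq> ?h" "?v \<noteq> ?h"
    "?f \<noteq> ?g" "?f \<noteq> ?h" "?g \<noteq> ?h" "i \<noteq> ?u" "i \<noteq> ?v" "i \<noteq> ?f" "i \<noteq> ?g" "i \<noteq> ?h"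
    using uv by (auto simp: layout)
  note d' = d d[symmetric]
  have e: "env u < n" "env v < n" using env uv by auto
  have Tu: "T0 ?u = (?ou, int (env u))" "T0 ?v = (?ov, int (env v))" "T0 i = (?wc, int n + 1)"
    using T0 uv by (auto simp: stores_def)
  \<comment> \<open>\<open>a\<close> counts the finished rows; \<open>p\<close>, \<open>x\<close>
    and \<open>y\<close> are the head positions on the input and on the tapes of the two
    variables.\<close>
  define F where "F a p x y T \<longleftrightarrow> T i = (?wc, p) \<and> T ?u = (?ou, x) \<and> T ?v = (?ov, y) \<and>
     (\<forall>j. j \<notin> {i, ?u, ?v, ?f, ?g, ?h} \<longrightarrow> T j = T0 j) \<and>
     (rd (T ?f) = 2 \<longleftrightarrow> (\<exists>b < a. env u \<in> es ! b \<and> env v \<in> es ! b))" for a p x y T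
  have sc: "triple (F a (int n + 1 + int a * int n) 0 0) (row_scan i nv u v) (14 * n + 12)
       (F (Suc a) (int n + 1 + int (Suc a) * int n) 0 0)" if a: "a < length es" for a
  proof -
    \<comment> \<open>\<open>b\<close> and \<open>c\<close> count the columns that the two row flags
      have taken into account; they differ between the two calls of \<open>mark\<close>.\<close>
    define G where "G p x y b c T \<longleftrightarrow> F a p x y T \<and> (rd (T ?g) = 2 \<longleftrightarrow> env u < b \<and> env u \<in> es ! a) \<and>
      (rd (T ?h) = 2 \<longleftrightarrow> env v < c \<and> env v \<in> es ! a)" for p x y b c T
    let ?p = "int n + 1 + int a * int n"
    have t1: "triple (F a ?p 0 0) (Act ?g (Some 1) 0) 1 (\<lambda>T. F a ?p 0 0 T \<and> rd (T ?g) = 1)"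
    proof (rule triple_Act)
      fix T assume T: "F a ?p 0 0 T"
      obtain c h where "T ?g = (c, h)" by force
      then show "F a ?p 0 0 (T(?g := put (Some 1) 0 (T ?g))) \<and> rd ((T(?g := put (Some 1) 0 (T ?g))) ?g) = 1"
        using T d' by (auto simp: F_def)
    qed
    have t2: "triple (\<lambda>T. F a ?p 0 0 T \<and> rd (T ?g) = 1) (Act ?h (Some 1) 0) 1 (G ?p 0 0 0 0)"
    proof (rule triple_Act)
      fix T assume T: "F a ?p 0 0 T \<and> rd (T ?g) = 1"
      obtain c h where "T ?h = (c, h)" by force
      then show "G ?p 0 0 0 0 (T(?h := put (Some 1) 0 (T ?h)))"
        using T d' by (auto simp: F_def G_def)
    qed
    let ?body = "mark i ?u ?g ;; mark i ?v ?h ;; Act ?u None 1 ;; Act ?v None 1 ;; Act i None 1"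
    have body: "triple (G (?p + int j) (int j) (int j) j j) ?body (3 + (3 + (1 + (1 + 1))))
        (G (?p + int (Suc j)) (int (Suc j)) (int (Suc j)) (Suc j) (Suc j))" if j: "j < n" for j
    proof -
      have wcj: "?wc (?p + int j) = (if j \<in> es ! a then 2 else 1)"
        using graph_word_contents(3)[OF a j] by simp
      have m1: "triple (G (?p + int j) (int j) (int j) j j) (mark i ?u ?g) 3
          (G (?p + int j) (int j) (int j) (Suc j) j)"
      proof (rule triple_state, rule triple_conseq[OF mark_triple])
        fix T1 T assume "G (?p + int j) (int j) (int j) j j T1"
          "(\<forall>k. k \<noteq> ?g \<longrightarrow> T k = T1 k) \<and> rd (T ?g) = (if rd (T1 i) = 2 \<and> rd (T1 ?u) = 2 then 2 else rd (T1 ?g))"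
        then show "G (?p + int j) (int j) (int j) (Suc j) j T"
          using d' wcj j by (auto simp: G_def F_def onehot_def less_Suc_eq split: if_splits)
      qed (use d' in auto)
      have m2: "triple (G (?p + int j) (int j) (int j) (Suc j) j) (mark i ?v ?h) 3
          (G (?p + int j) (int j) (int j) (Suc j) (Suc j))"
      proof (rule triple_state, rule triple_conseq[OF mark_triple])
        fix T1 T assume "G (?p + int j) (int j) (int j) (Suc j) j T1"
          "(\<forall>k. k \<noteq> ?h \<longrightarrow> T k = T1 k) \<and> rd (T ?h) = (if rd (T1 i) = 2 \<and> rd (T1 ?v) = 2 then 2 else rd (T1 ?h))"
        then show "G (?p + int j) (int j) (int j) (Suc j) (Suc j) T"
          using d' wcj j by (auto simp: G_def F_def onehot_def less_Suc_eq split: if_splits)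
      qed (use d' in auto)
      have m3: "triple (G (?p + int j) (int j) (int j) (Suc j) (Suc j)) (Act ?u None 1) 1
          (G (?p + int j) (int (Suc j)) (int j) (Suc j) (Suc j))"
        by (rule triple_Act) (use d' in \<open>auto simp: G_def F_def\<close>)
      have m4: "triple (G (?p + int j) (int (Suc j)) (int j) (Suc j) (Suc j)) (Act ?v None 1) 1
          (G (?p + int j) (int (Suc j)) (int (Suc j)) (Suc j) (Suc j))"
        by (rule triple_Act) (use d' in \<open>auto simp: G_def F_def\<close>)
      have m5: "triple (G (?p + int j) (int (Suc j)) (int (Suc j)) (Suc j) (Suc j)) (Act i None 1) 1
          (G (?p + int (Suc j)) (int (Suc j)) (int (Suc j)) (Suc j) (Suc j))"
        by (rule triple_Act) (use d' in \<open>auto simp: G_def F_def\<close>)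
      show ?thesis by (intro triple_Then[OF m1] triple_Then[OF m2] triple_Then[OF m3] triple_Then[OF m4] m5)
    qed
    have "triple (G (?p + int 0) (int 0) (int 0) 0 0) (Loop ?u (\<lambda>s. s \<noteq> 0) ?body)
        (n * Suc (3 + (3 + (1 + (1 + 1)))) + 1) (G (?p + int n) (int n) (int n) n n)"
      by (rule triple_Loop[where I = "\<lambda>j. G (?p + int j) (int j) (int j) j j", OF body])
        (auto simp: G_def F_def onehot_def)
    then have t3: "triple (G ?p 0 0 0 0) (Loop ?u (\<lambda>s. s \<noteq> 0) ?body)
        (10 * n + 1) (G (?p + int n) (int n) (int n) n n)"
      by (simp add: mult.commute)
    have t4: "triple (G (?p + int n) (int n) (int n) n n) (left_end ?u) (2 * n + 3) (G (?p + int n) 0 (int n) n n)"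
    proof (rule triple_state)
      fix T1 assume T1: "G (?p + int n) (int n) (int n) n n T1"
      show "triple (\<lambda>T. T = T1) (left_end ?u) (2 * n + 3) (G (?p + int n) 0 (int n) n n)"
        by (rule triple_conseq[OF left_end_triple[where h = "int n" and b = n and c = ?ou]])
          (use T1 d' in \<open>auto simp: onehot_def G_def F_def\<close>)
    qed
    have t5: "triple (G (?p + int n) 0 (int n) n n) (left_end ?v) (2 * n + 3) (G (?p + int n) 0 0 n n)"
    proof (rule triple_state)
      fix T1 assume T1: "G (?p + int n) 0 (int n) n n T1"
      show "triple (\<lambda>T. T = T1) (left_end ?v) (2 * n + 3) (G (?p + int n) 0 0 n n)"
        by (rule triple_conseq[OF left_end_triple[where h = "int n" and b = n and c = ?ov]])
          (use T1 d' in \<open>auto simp: onehot_def G_def F_def\<close>)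
    qed
    have t6: "triple (G (?p + int n) 0 0 n n) (mark ?g ?h ?f) 3 (F (Suc a) (?p + int n) 0 0)"
    proof (rule triple_state, rule triple_conseq[OF mark_triple])
      fix T1 T assume "G (?p + int n) 0 0 n n T1"
        "(\<forall>k. k \<noteq> ?f \<longrightarrow> T k = T1 k) \<and> rd (T ?f) = (if rd (T1 ?g) = 2 \<and> rd (T1 ?h) = 2 then 2 else rd (T1 ?f))"
      then show "F (Suc a) (?p + int n) 0 0 T"
        using d' e by (auto simp: G_def F_def less_Suc_eq split: if_splits)
    qed (use d' in auto)
    have pn: "?p + int n = int n + 1 + int (Suc a) * int n" by (simp add: algebra_simps)
    show ?thesis
      unfolding row_scan_def pn[symmetric]
      by (rule triple_conseq[OF triple_Then[OF t1 triple_Then[OF t2 triple_Then[OF t3 triple_Then[OF t4 triple_Then[OF t5 t6]]]]]])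
        auto
  qed
  let ?L = "length (graph_word n es)"
  have Lge: "length es * n + n + 1 \<le> ?L" by (simp add: length_graph_word)
  obtain cf hf where f: "T0 ?f = (cf, hf)" by force
  have t0: "triple (\<lambda>T. T = T0) (Act ?f (Some 1) 0) 1 (F 0 (int n + 1) (int (env u)) (int (env v)))"
    by (rule triple_Act) (use d' Tu f in \<open>auto simp: F_def\<close>)
  have lu: "triple (F a p x y) (left_end ?u) (2 * n + 3) (F a p 0 y)" if "0 \<le> x" "x \<le> int n" for a p x y
  proof (rule triple_state)
    fix T1 assume T1: "F a p x y T1"
    show "triple (\<lambda>T. T = T1) (left_end ?u) (2 * n + 3) (F a p 0 y)"
      by (rule triple_conseq[OF left_end_triple[where h = x and b = n and c = ?ou]])
        (use T1 d' that in \<open>auto simp: onehot_def F_def\<close>)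
  qed
  have lv: "triple (F a p x y) (left_end ?v) (2 * n + 3) (F a p x 0)" if "0 \<le> y" "y \<le> int n" for a p x y
  proof (rule triple_state)
    fix T1 assume T1: "F a p x y T1"
    show "triple (\<lambda>T. T = T1) (left_end ?v) (2 * n + 3) (F a p x 0)"
      by (rule triple_conseq[OF left_end_triple[where h = y and b = n and c = ?ov]])
        (use T1 d' that in \<open>auto simp: onehot_def F_def\<close>)
  qed
  let ?E = "length es" and ?q = "int n + 1 + int (length es) * int n"
  have "triple (F 0 (int n + 1 + int 0 * int n) 0 0) (Loop i (\<lambda>s. s \<noteq> 0) (row_scan i nv u v))
      (?E * Suc (14 * n + 12) + 1) (F ?E (int n + 1 + int ?E * int n) 0 0)"
  proof (rule triple_Loop[where I = "\<lambda>a. F a (int n + 1 + int a * int n) 0 0", OF sc])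
    fix a T assume a: "a < ?E" and T: "F a (int n + 1 + int a * int n) 0 0 T"
    have "0 < n" using e by simp
    from graph_word_contents(3)[OF a this] have "?wc (int n + 1 + int a * int n) \<noteq> 0" by simp
    then show "rd (T i) \<noteq> 0" using T by (simp add: F_def)
  qed (use graph_word_contents(6) in \<open>auto simp: F_def\<close>)
  then have t3: "triple (F 0 (int n + 1) 0 0) (Loop i (\<lambda>s. s \<noteq> 0) (row_scan i nv u v))
      (?E * Suc (14 * n + 12) + 1) (F ?E ?q 0 0)" by simp
  have t4: "triple (F ?E ?q 0 0) (Loop ?u (\<lambda>s. s = 1) (Act ?u None 1)) (2 * n + 1) (F ?E ?q (int (env u)) 0)"
  proof (rule triple_state)
    fix T1 assume T1: "F ?E ?q 0 0 T1"
    show "triple (\<lambda>T. T = T1) (Loop ?u (\<lambda>s. s = 1) (Act ?u None 1)) (2 * n + 1) (F ?E ?q (int (env u)) 0)"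
      by (rule triple_conseq[OF seek_triple[where h = 0 and h' = "int (env u)" and b = n and c = ?ou]])
        (use T1 d' e in \<open>auto simp: onehot_def F_def\<close>)
  qed
  have t5: "triple (F ?E ?q (int (env u)) 0) (Loop ?v (\<lambda>s. s = 1) (Act ?v None 1)) (2 * n + 1)
      (F ?E ?q (int (env u)) (int (env v)))"
  proof (rule triple_state)
    fix T1 assume T1: "F ?E ?q (int (env u)) 0 T1"
    show "triple (\<lambda>T. T = T1) (Loop ?v (\<lambda>s. s = 1) (Act ?v None 1)) (2 * n + 1) (F ?E ?q (int (env u)) (int (env v)))"
      by (rule triple_conseq[OF seek_triple[where h = 0 and h' = "int (env v)" and b = n and c = ?ov]])
        (use T1 d' e in \<open>auto simp: onehot_def F_def\<close>)
  qed
  have t6: "triple (F ?E ?q (int (env u)) (int (env v))) (left_end i) (2 * ?L + 3)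
      (F ?E 0 (int (env u)) (int (env v)))"
  proof (rule triple_state)
    fix T1 assume T1: "F ?E ?q (int (env u)) (int (env v)) T1"
    show "triple (\<lambda>T. T = T1) (left_end i) (2 * ?L + 3) (F ?E 0 (int (env u)) (int (env v)))"
      by (rule triple_conseq[OF left_end_triple[where h = ?q and b = ?L and c = ?wc]])
        (use T1 d' graph_word_contents(4,5)[of _ n es] in \<open>auto simp: F_def length_graph_word\<close>)
  qed
  have t7: "triple (F ?E 0 (int (env u)) (int (env v))) (Loop i (\<lambda>s. s = 2) (Act i None 1)) (2 * n + 1)
      (F ?E (int n) (int (env u)) (int (env v)))"
  proof (rule triple_state)
    fix T1 assume T1: "F ?E 0 (int (env u)) (int (env v)) T1"
    show "triple (\<lambda>T. T = T1) (Loop i (\<lambda>s. s = 2) (Act i None 1)) (2 * n + 1) (F ?E (int n) (int (env u)) (int (env v)))"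
      by (rule triple_conseq[OF seek_triple[where h = 0 and h' = "int n" and b = n and c = ?wc]])
        (use T1 d' graph_word_contents(1)[of _ n es] graph_word_contents(2)[of n es] in \<open>auto simp: F_def\<close>)
  qed
  have t8: "triple (F ?E (int n) (int (env u)) (int (env v))) (Act i None 1) 1
      (F ?E (int n + 1) (int (env u)) (int (env v)))"
    by (rule triple_Act) (use d' in \<open>auto simp: F_def\<close>)
  have tm: "1 + (2 * n + 3 + (2 * n + 3 + (?E * Suc (14 * n + 12) + 1 + (2 * n + 1 + (2 * n + 1 +
      (2 * ?L + 3 + (2 * n + 1 + 1))))))) \<le> 60 * (?L + 1)"
  proof -
    have "?E \<le> ?E * n" using e by simp
    then have le: "?E * Suc (14 * n + 12) \<le> 27 * (?E * n)" by (simp add: algebra_simps)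
    have arith: "q \<le> 27 * y \<Longrightarrow> y + n + 1 \<le> l \<Longrightarrow> 1 + (2 * n + 3 + (2 * n + 3 + (q + 1 + (2 * n + 1 + (2 * n + 1 +
      (2 * l + 3 + (2 * n + 1 + 1))))))) \<le> 60 * (l + 1)" for q y l :: nat by simp
    show ?thesis by (rule arith[OF le Lge])
  qed
  have lu': "triple (F 0 (int n + 1) (int (env u)) (int (env v))) (left_end ?u) (2 * n + 3)
      (F 0 (int n + 1) 0 (int (env v)))"
    by (rule lu) (use e in auto)
  have lv': "triple (F 0 (int n + 1) 0 (int (env v))) (left_end ?v) (2 * n + 3) (F 0 (int n + 1) 0 0)"
    by (rule lv) (use e in auto)
  note big = triple_Then[OF t0 triple_Then[OF lu' triple_Then[OF lv' triple_Then[OF t3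
      triple_Then[OF t4 triple_Then[OF t5 triple_Then[OF t6 triple_Then[OF t7 t8]]]]]]],
      folded adjt_def]
  show "triple (\<lambda>T. T = T0) (adjt i nv u v) (60 * (?L + 1))
    (\<lambda>T. stores i nv n (graph_word n es) A env ob T \<and>
      (rd (T (fA i nv)) = 2 \<longleftrightarrow> (\<exists>e \<in> set es. env u \<in> e \<and> env v \<in> e)))"
  proof (rule triple_conseq[OF big _ _ tm])
    fix T assume T: "F ?E (int n + 1) (int (env u)) (int (env v)) T"
    have "T j = T0 j" if "j \<noteq> ?f" "j \<noteq> ?g" "j \<noteq> ?h" for j
      using T Tu that by (cases "j = ?v"; cases "j = ?u"; cases "j = i") (auto simp: F_def)
    then have "T i = T0 i" "\<And>v. v < nv \<Longrightarrow> T (ct i v) = T0 (ct i v)" "T (outt i nv) = T0 (outt i nv)"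
      by (simp_all add: layout)
    then have 1: "stores i nv n (graph_word n es) A env ob T" using T0 unfolding stores_def by simp
    have "rd (T ?f) = 2 \<longleftrightarrow> (\<exists>b < ?E. env u \<in> es ! b \<and> env v \<in> es ! b)"
      using T unfolding F_def by blast
    also have "\<dots> \<longleftrightarrow> (\<exists>e \<in> set es. env u \<in> e \<and> env v \<in> e)" by (metis in_set_conv_nth)
    finally show "stores i nv n (graph_word n es) A env ob T \<and>
      (rd (T (fA i nv)) = 2 \<longleftrightarrow> (\<exists>e \<in> set es. env u \<in> e \<and> env v \<in> e))" using 1 by blast
  qed
qed

lemma cp_triple:
  assumes "wfc nv A c" "\<And>v. v \<in> A \<Longrightarrow> env v < n" "0 < n"
  shows "triple (stores i nv n (graph_word n es) A env ob) (cp i nv c)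
     (cmd_time c (length (graph_word n es) + 2))
     (stores i nv n (graph_word n es) A env (ob @ sem n (set es) c env))"
  using assms
proof (induction c arbitrary: A env ob)
  case (Out b)
  show ?case unfolding cp.simps cmd_time.simps
  proof (rule triple_Act)
    fix T assume T: "stores i nv n (graph_word n es) A env ob T"
    have "(word_contents ob)(int (length ob) := if b then 2 else 1) = word_contents (ob @ [b])"
      by (auto simp: word_contents_def fun_eq_iff nth_append)
    then show "stores i nv n (graph_word n es) A env (ob @ sem n (set es) (Out b) env)
        (T(outt i nv := put (Some (if b then 2 else 1)) 1 (T (outt i nv))))"
      using T by (auto simp: stores_def layout)
  qed
next
  case Nop
  show ?case unfolding cp.simps cmd_time.simps sem.simps append_Nil2 by (rule triple_Act) simp
next
  case (Cat c1 c2)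
  have "triple (stores i nv n (graph_word n es) A env ob) (cp i nv c1 ;; cp i nv c2)
     (cmd_time c1 (length (graph_word n es) + 2) + cmd_time c2 (length (graph_word n es) + 2))
     (stores i nv n (graph_word n es) A env ((ob @ sem n (set es) c1 env) @ sem n (set es) c2 env))"
    by (rule triple_Then[OF Cat.IH(1) Cat.IH(2)]) (use Cat.prems in auto)
  then show ?case by simp
next
  case (For v c)
  let ?L = "length (graph_word n es) + 2" and ?w = "graph_word n es" and ?v = "ct i v"
  have v: "v < nv" "v \<notin> A" "wfc nv (insert v A) c" using For.prems by auto
  define O' where "O' j = ob @ concat (map (\<lambda>x. sem n (set es) c (env(v := x))) [0..<j])" for j
  define J where "J j = stores i nv n ?w (insert v A) (env(v := j)) (O' j)" for j
  \<comment> \<open>Between erasing the old mark and writing the next one, the tape of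
    \<open>v\<close> stores no value, so the state is described as a modification of one that
    does.\<close>
  define H where "H j T \<longleftrightarrow> (\<exists>T1. stores i nv n ?w (insert v A) (env(v := j)) (O' (Suc j)) T1 \<and>
      T = T1(?v := (onehot n n, int (Suc j))))" for j T
  have J: "J j T \<longleftrightarrow> (\<exists>T1. stores i nv n ?w (insert v A) (env(v := j')) (O' j) T1 \<and>
      T = T1(?v := (onehot n j, int j)))" for j j' T
  proof
    assume "J j T"
    then show "\<exists>T1. stores i nv n ?w (insert v A) (env(v := j')) (O' j) T1 \<and> T = T1(?v := (onehot n j, int j))"
      using v by (intro exI[of _ "T(?v := (onehot n j', int j'))"]) (auto simp: J_def stores_def layout)
  qed (use v in \<open>auto simp: J_def stores_def layout\<close>)
  have t1: "triple (stores i nv n ?w A env ob) (Act ?v (Some 2) 0) 1 (J 0)"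
  proof (rule triple_Act)
    fix T assume T: "stores i nv n ?w A env ob T"
    have "(onehot n n)(0 := 2) = onehot n 0" using For.prems by (auto simp: onehot_def fun_eq_iff)
    moreover have "T ?v = (onehot n n, 0)" using T v by (auto simp: stores_def)
    ultimately show "J 0 (T(?v := put (Some 2) 0 (T ?v)))"
      using T v by (auto simp: J_def O'_def stores_def layout)
  qed
  have body: "triple (J j) (cp i nv c ;; Act ?v (Some 1) 1 ;;
        Cond ?v (\<lambda>s. s \<noteq> 0) (Act ?v (Some 2) 0) (Act ?v None 0)) (cmd_time c ?L + (1 + Suc 1)) (J (Suc j))"
    if j: "j < n" for j
  proof (rule triple_Then)
    have "triple (J j) (cp i nv c) (cmd_time c ?L)
        (stores i nv n ?w (insert v A) (env(v := j)) (O' j @ sem n (set es) c (env(v := j))))"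
      unfolding J_def by (rule For.IH) (use v j For.prems in auto)
    then show "triple (J j) (cp i nv c) (cmd_time c ?L) (stores i nv n ?w (insert v A) (env(v := j)) (O' (Suc j)))"
      by (simp add: O'_def)
    show "triple (stores i nv n ?w (insert v A) (env(v := j)) (O' (Suc j)))
       (Act ?v (Some 1) 1 ;; Cond ?v (\<lambda>s. s \<noteq> 0) (Act ?v (Some 2) 0) (Act ?v None 0)) (1 + Suc 1) (J (Suc j))"
    proof (rule triple_Then[where B = "H j"])
      show "triple (stores i nv n ?w (insert v A) (env(v := j)) (O' (Suc j))) (Act ?v (Some 1) 1) 1 (H j)"
      proof (rule triple_Act)
        fix T assume T: "stores i nv n ?w (insert v A) (env(v := j)) (O' (Suc j)) T"
        have "(onehot n j)(int j := 1) = onehot n n" using j by (auto simp: onehot_def fun_eq_iff)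
        moreover have "T ?v = (onehot n j, int j)" using T v by (auto simp: stores_def)
        ultimately show "H j (T(?v := put (Some 1) 1 (T ?v)))"
          unfolding H_def using T by (intro exI[of _ T]) (simp add: algebra_simps)
      qed
      show "triple (H j) (Cond ?v (\<lambda>s. s \<noteq> 0) (Act ?v (Some 2) 0) (Act ?v None 0)) (Suc 1) (J (Suc j))"
      proof (intro triple_Cond triple_Act)
        fix T assume T: "H j T \<and> rd (T ?v) \<noteq> 0"
        then obtain T1 where T1: "stores i nv n ?w (insert v A) (env(v := j)) (O' (Suc j)) T1"
          "T = T1(?v := (onehot n n, int (Suc j)))" by (auto simp: H_def)
        have "Suc j < n" using T T1 by (auto simp: onehot_def split: if_splits)
        then have "(onehot n n)(int (Suc j) := 2) = onehot n (Suc j)"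
          by (auto simp: onehot_def fun_eq_iff)
        then show "J (Suc j) (T(?v := put (Some 2) 0 (T ?v)))"
          unfolding J[of _ _ j] using T1 by (intro exI[of _ T1]) simp
      next
        fix T assume T: "H j T \<and> \<not> rd (T ?v) \<noteq> 0"
        then obtain T1 where T1: "stores i nv n ?w (insert v A) (env(v := j)) (O' (Suc j)) T1"
          "T = T1(?v := (onehot n n, int (Suc j)))" by (auto simp: H_def)
        have "Suc j = n" using T T1 j by (auto simp: onehot_def split: if_splits)
        then show "J (Suc j) (T(?v := put None 0 (T ?v)))"
          unfolding J[of _ _ j] using T1 by (intro exI[of _ T1]) simp
      qed
    qed
  qed
  have t2: "triple (J 0) (Loop ?v (\<lambda>s. s \<noteq> 0) (cp i nv c ;; Act ?v (Some 1) 1 ;;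
        Cond ?v (\<lambda>s. s \<noteq> 0) (Act ?v (Some 2) 0) (Act ?v None 0)))
        (n * Suc (cmd_time c ?L + (1 + Suc 1)) + 1) (J n)"
    by (rule triple_Loop[where I = J, OF body]) (use v in \<open>auto simp: J_def stores_def onehot_def\<close>)
  have t3: "triple (J n) (left_end ?v) (2 * n + 3) (stores i nv n ?w A env (O' n))"
  proof (rule triple_state)
    fix T1 assume T1: "J n T1"
    show "triple (\<lambda>T. T = T1) (left_end ?v) (2 * n + 3) (stores i nv n ?w A env (O' n))"
    proof (rule triple_conseq[OF left_end_triple[where h = "int n" and b = n and c = "onehot n n"]])
      show "T1 ?v = (onehot n n, int n)" using T1 v by (auto simp: J_def stores_def)
      show "stores i nv n ?w A env (O' n) T" if "T = T1(?v := (onehot n n, 0))" for T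
        using T1 that v by (auto simp: J_def stores_def layout)
    qed (auto simp: onehot_def)
  qed
  have "n \<le> ?L" by (simp add: length_graph_word)
  then have "n * Suc (cmd_time c ?L + (1 + Suc 1)) \<le> ?L * (cmd_time c ?L + 4)"
    by (intro mult_le_mono) auto
  then have tm: "1 + (n * Suc (cmd_time c ?L + (1 + Suc 1)) + 1 + (2 * n + 3)) \<le> cmd_time (For v c) ?L"
  proof -
    have arith: "x \<le> y \<Longrightarrow> n \<le> l \<Longrightarrow> 1 + (x + 1 + (2 * n + 3)) \<le> y + 2 * l + 5" for x y l :: nat by linarith
    show ?thesis unfolding cmd_time.simps by (rule arith) fact+
  qed
  show ?case unfolding cp.simps
    by (rule triple_conseq[OF triple_Then[OF t1 triple_Then[OF t2 t3]]])
      (use tm in \<open>auto simp: O'_def\<close>)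
next
  case (IfEq u v c d)
  let ?L = "length (graph_word n es) + 2" and ?w = "graph_word n es"
  have uv: "u < nv" "v < nv" "u \<in> A" "v \<in> A" "u \<noteq> v" using IfEq.prems by auto
  have t1: "triple (stores i nv n ?w A env ob) (eqt i nv u v) (12 * n + 12)
      (\<lambda>T. stores i nv n ?w A env ob T \<and> (rd (T (fA i nv)) = 2 \<longleftrightarrow> env u = env v))"
    by (rule eqt_triple) (use uv IfEq.prems in auto)
  have t2: "triple (\<lambda>T. stores i nv n ?w A env ob T \<and> (rd (T (fA i nv)) = 2 \<longleftrightarrow> env u = env v))
     (Cond (fA i nv) (\<lambda>s. s = 2) (cp i nv c) (cp i nv d)) (Suc (cmd_time c ?L + cmd_time d ?L))
     (stores i nv n ?w A env (ob @ sem n (set es) (IfEq u v c d) env))"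
  proof (rule triple_Cond_iff)
    assume Q: "env u = env v"
    show "triple (stores i nv n ?w A env ob) (cp i nv c) (cmd_time c ?L + cmd_time d ?L)
        (stores i nv n ?w A env (ob @ sem n (set es) (IfEq u v c d) env))"
      by (rule triple_conseq[OF IfEq.IH(1)[of A env ob]]) (use IfEq.prems Q in auto)
  next
    assume Q: "\<not> (env u = env v)"
    show "triple (stores i nv n ?w A env ob) (cp i nv d) (cmd_time c ?L + cmd_time d ?L)
        (stores i nv n ?w A env (ob @ sem n (set es) (IfEq u v c d) env))"
      by (rule triple_conseq[OF IfEq.IH(2)[of A env ob]]) (use IfEq.prems Q in auto)
  qed
  have "n + 1 \<le> ?L" by (simp add: length_graph_word)
  then show ?case unfolding cp.simps
    by (intro triple_conseq[OF triple_Then[OF t1 t2]]) auto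
next
  case (IfAdj u v c d)
  let ?L = "length (graph_word n es) + 2" and ?w = "graph_word n es"
  let ?Q = "\<exists>e \<in> set es. env u \<in> e \<and> env v \<in> e"
  have uv: "u < nv" "v < nv" "u \<in> A" "v \<in> A" "u \<noteq> v" using IfAdj.prems by auto
  have t1: "triple (stores i nv n ?w A env ob) (adjt i nv u v) (60 * (length (graph_word n es) + 1))
      (\<lambda>T. stores i nv n ?w A env ob T \<and> (rd (T (fA i nv)) = 2 \<longleftrightarrow> ?Q))"
    by (rule adjt_triple) (use uv IfAdj.prems in auto)
  have t2: "triple (\<lambda>T. stores i nv n ?w A env ob T \<and> (rd (T (fA i nv)) = 2 \<longleftrightarrow> ?Q))
     (Cond (fA i nv) (\<lambda>s. s = 2) (cp i nv c) (cp i nv d)) (Suc (cmd_time c ?L + cmd_time d ?L))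
     (stores i nv n ?w A env (ob @ sem n (set es) (IfAdj u v c d) env))"
  proof (rule triple_Cond_iff)
    assume Q: "?Q"
    show "triple (stores i nv n ?w A env ob) (cp i nv c) (cmd_time c ?L + cmd_time d ?L)
        (stores i nv n ?w A env (ob @ sem n (set es) (IfAdj u v c d) env))"
      by (rule triple_conseq[OF IfAdj.IH(1)[of A env ob]]) (use IfAdj.prems Q in auto)
  next
    assume Q: "\<not> (?Q)"
    show "triple (stores i nv n ?w A env ob) (cp i nv d) (cmd_time c ?L + cmd_time d ?L)
        (stores i nv n ?w A env (ob @ sem n (set es) (IfAdj u v c d) env))"
      by (rule triple_conseq[OF IfAdj.IH(2)[of A env ob]]) (use IfAdj.prems Q in auto)
  qed
  show ?case unfolding cp.simps
    by (intro triple_conseq[OF triple_Then[OF t1 t2]]) auto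
qed

definition setup_vars :: "nat \<Rightarrow> nat \<Rightarrow> prog" where
  "setup_vars i nv =
     Loop i (\<lambda>s. s = 2) (seqs i (map (\<lambda>v. Act (ct i v) (Some 1) 1) [0..<nv]) ;; Act i None 1) ;;
     seqs i (map (\<lambda>v. left_end (ct i v)) [0..<nv]) ;; Act i None 1"

lemma setup_vars_triple:
  "triple (\<lambda>T. T i = (word_contents (graph_word n es), 0) \<and> (\<forall>j > i + 1. T j = blank)) (setup_vars i nv)
    (n * (nv + 3) + nv * (2 * n + 3) + 3)
    (stores i nv n (graph_word n es) {} env [])"
proof -
  let ?wc = "word_contents (graph_word n es)"
  define F where "F p X T \<longleftrightarrow> T i = (?wc, p) \<and> (\<forall>v < nv. T (ct i v) = X v) \<and>
     T (outt i nv) = (word_contents [], 0)" for p :: int and X and T :: "nat \<Rightarrow> tape"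
  have upd: "F p (X(v := tp)) (T(ct i v := tp))" if "F p X T" "v < nv" for p X v tp T
    using that by (auto simp: F_def layout)
  \<comment> \<open>The word of \<open>k\<close> ones without a mark, with the head behind
    it.\<close>
  define B where "B k = (onehot k k, int k)" for k :: nat
  let ?S = "\<lambda>k. F (int k) (\<lambda>v. B k)"
  have body: "triple (?S k) (seqs i (map (\<lambda>v. Act (ct i v) (Some 1) 1) [0..<nv]) ;; Act i None 1) (nv * 1 + 1 + 1)
      (?S (Suc k))" for k
  proof (rule triple_Then)
    have "triple (F (int k) (\<lambda>v. if v < 0 then B (Suc k) else B k)) (seqs i (map (\<lambda>v. Act (ct i v) (Some 1) 1) [0..<nv]))
       (length (map (\<lambda>v. Act (ct i v) (Some 1) 1) [0..<nv]) * 1 + 1)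
       (F (int k) (\<lambda>v. if v < length (map (\<lambda>v. Act (ct i v) (Some 1) 1) [0..<nv]) then B (Suc k) else B k))"
    proof (rule seqs_triple[where I = "\<lambda>q. F (int k) (\<lambda>v. if v < q then B (Suc k) else B k)"])
      fix q assume "q < length (map (\<lambda>v. Act (ct i v) (Some 1) 1) [0..<nv])"
      then have q: "q < nv" by simp
      have "triple (F (int k) (\<lambda>v. if v < q then B (Suc k) else B k)) (Act (ct i q) (Some 1) 1) 1
         (F (int k) (\<lambda>v. if v < Suc q then B (Suc k) else B k))"
      proof (rule triple_Act)
        fix T assume T: "F (int k) (\<lambda>v. if v < q then B (Suc k) else B k) T"
        have "put (Some 1) 1 (B k) = B (Suc k)" by (auto simp: B_def onehot_def fun_eq_iff)
        moreover have "T (ct i q) = B k" using T q by (auto simp: F_def)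
        moreover have "(\<lambda>v. if v < Suc q then B (Suc k) else B k) = (\<lambda>v. if v < q then B (Suc k) else B k)(q := B (Suc k))"
          by (auto simp: fun_eq_iff)
        ultimately show "F (int k) (\<lambda>v. if v < Suc q then B (Suc k) else B k) (T(ct i q := put (Some 1) 1 (T (ct i q))))"
          using upd[OF T q, of "B (Suc k)"] by simp
      qed
      then show "triple (F (int k) (\<lambda>v. if v < q then B (Suc k) else B k)) (map (\<lambda>v. Act (ct i v) (Some 1) 1) [0..<nv] ! q) 1
         (F (int k) (\<lambda>v. if v < Suc q then B (Suc k) else B k))" using q by simp
    qed
    then show "triple (?S k) (seqs i (map (\<lambda>v. Act (ct i v) (Some 1) 1) [0..<nv])) (nv * 1 + 1)
        (F (int k) (\<lambda>v. B (Suc k)))"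
      by (rule triple_conseq) (auto simp: F_def)
    show "triple (F (int k) (\<lambda>v. B (Suc k))) (Act i None 1) 1 (?S (Suc k))"
      by (rule triple_Act) (auto simp: F_def layout)
  qed
  have t1: "triple (?S 0) (Loop i (\<lambda>s. s = 2) (seqs i (map (\<lambda>v. Act (ct i v) (Some 1) 1) [0..<nv]) ;; Act i None 1))
     (n * Suc (nv * 1 + 1 + 1) + 1) (?S n)"
    by (rule triple_Loop[where I = ?S, OF body])
      (use graph_word_contents(1)[of _ n es] graph_word_contents(2)[of n es] in \<open>auto simp: F_def\<close>)
  let ?ps = "map (\<lambda>v. left_end (ct i v)) [0..<nv]"
  have "triple (F (int n) (\<lambda>v. if v < 0 then (onehot n n, 0) else B n)) (seqs i ?ps)
       (length ?ps * (2 * n + 3) + 1)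
       (F (int n) (\<lambda>v. if v < length ?ps then (onehot n n, 0) else B n))"
  proof (rule seqs_triple[where I = "\<lambda>q. F (int n) (\<lambda>v. if v < q then (onehot n n, 0) else B n)"])
    fix q assume "q < length ?ps"
    then have q: "q < nv" by simp
    have "triple (F (int n) (\<lambda>v. if v < q then (onehot n n, 0) else B n)) (left_end (ct i q)) (2 * n + 3)
       (F (int n) (\<lambda>v. if v < Suc q then (onehot n n, 0) else B n))"
    proof (rule triple_state)
      fix T1 assume T1: "F (int n) (\<lambda>v. if v < q then (onehot n n, 0) else B n) T1"
      show "triple (\<lambda>T. T = T1) (left_end (ct i q)) (2 * n + 3)
       (F (int n) (\<lambda>v. if v < Suc q then (onehot n n, 0) else B n))"
      proof (rule triple_conseq[OF left_end_triple[where h = "int n" and b = n and c = "onehot n n"]])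
        show "T1 (ct i q) = (onehot n n, int n)" using T1 q by (auto simp: F_def B_def)
        have "(\<lambda>v. if v < Suc q then (onehot n n, 0) else B n) = (\<lambda>v. if v < q then (onehot n n, 0) else B n)(q := (onehot n n, 0))"
          by (auto simp: fun_eq_iff)
        then show "F (int n) (\<lambda>v. if v < Suc q then (onehot n n, 0) else B n) T"
          if "T = T1(ct i q := (onehot n n, 0))" for T
          using upd[OF T1 q, of "(onehot n n, 0)"] that by simp
      qed (auto simp: onehot_def)
    qed
    then show "triple (F (int n) (\<lambda>v. if v < q then (onehot n n, 0) else B n)) (?ps ! q) (2 * n + 3)
       (F (int n) (\<lambda>v. if v < Suc q then (onehot n n, 0) else B n))" using q by simp
  qed
  then have t2: "triple (?S n) (seqs i ?ps) (nv * (2 * n + 3) + 1) (F (int n) (\<lambda>v. (onehot n n, 0)))"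
    by (rule triple_conseq) (auto simp: F_def)
  have t3: "triple (F (int n) (\<lambda>v. (onehot n n, 0))) (Act i None 1) 1 (stores i nv n (graph_word n es) {} env [])"
    by (rule triple_Act) (auto simp: F_def stores_def layout)
  have z: "onehot 0 0 = word_contents []" by (auto simp: onehot_def word_contents_def fun_eq_iff)
  show ?thesis unfolding setup_vars_def
    by (rule triple_conseq[OF triple_Then[OF t1 triple_Then[OF t2 t3]]])
      (auto simp: F_def B_def layout blank_def z algebra_simps)
qed

text \<open>The leading block of ones reveals \<open>n\<close>, and then the rows can be cut off one
  by one. For \<open>n = 0\<close> all rows are empty and the number of edges would be lost.\<close>

lemma graph_word_inj:
  assumes "graph_word n es = graph_word n' es'" "0 < n"
    "\<And>e. e \<in> set es \<Longrightarrow> e \<subseteq> {..<n}" "\<And>e. e \<in> set es' \<Longrightarrow> e \<subseteq> {..<n'}"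
  shows "n = n' \<and> es = es'"
proof -
  have tw: "length (takeWhile id (graph_word m fs)) = m" for m fs
    by (simp add: graph_word_def takeWhile_append)
  have n: "n = n'" using tw[of n es] tw[of n' es'] assms(1) by simp
  let ?row = "\<lambda>e. map (\<lambda>v. v \<in> e) [0..<n]"
  have "length es * n = length es' * n"
    using arg_cong[OF assms(1), of length] n by (simp add: length_graph_word)
  then have l: "length es = length es'" using assms(2) by simp
  have "concat (map ?row es) = concat (map ?row es')" using assms(1) n by (simp add: graph_word_def)
  then have m: "map ?row es = map ?row es'"
    by (subst (asm) concat_eq_concat_iff) (auto simp: l set_zip)
  have "es ! k = es' ! k" if k: "k < length es" for k
  proof -
    have "?row (es ! k) = ?row (es' ! k)" using m k l by (metis nth_map)
    then have "\<forall>v < n. v \<in> es ! k \<longleftrightarrow> v \<in> es' ! k" by (simp add: map_eq_conv)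
    then show ?thesis using assms(3)[of "es ! k"] assms(4)[of "es' ! k"] k l n by auto
  qed
  then show ?thesis using n l by (simp add: nth_equalityI)
qed

text \<open>The semantics speaks of \<open>n\<close> and \<open>es\<close>, but composition needs a
  function of the word; by \<open>graph_word_inj\<close> the word determines both, so a definite
  description gives this function.\<close>

theorem cmd_poly_time:
  assumes f: "poly_time f" and c: "wfc nv {} c"
    and fx: "\<And>x. \<exists>n es. 0 < n \<and> (\<forall>e \<in> set es. e \<subseteq> {..<n}) \<and> f x = graph_word n es"
  shows "\<exists>h. poly_time h \<and> (\<forall>x n es. 0 < n \<longrightarrow> (\<forall>e \<in> set es. e \<subseteq> {..<n}) \<longrightarrow>
     f x = graph_word n es \<longrightarrow> h x = sem n (set es) c (\<lambda>_. 0))"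
proof -
  define D where "D = {graph_word n es | n es. 0 < n \<and> (\<forall>e \<in> set es. e \<subseteq> {..<n})}"
  define g where "g w = (THE y. \<exists>n es. 0 < n \<and> (\<forall>e \<in> set es. e \<subseteq> {..<n}) \<and> w = graph_word n es \<and>
     y = sem n (set es) c (\<lambda>_. 0))" for w
  have g: "g (graph_word n es) = sem n (set es) c (\<lambda>_. 0)"
    if "0 < n" "\<forall>e \<in> set es. e \<subseteq> {..<n}" for n es
    unfolding g_def
  proof (rule the_equality)
    show "\<exists>m fs. 0 < m \<and> (\<forall>e \<in> set fs. e \<subseteq> {..<m}) \<and> graph_word n es = graph_word m fs \<and>
       sem n (set es) c (\<lambda>_. 0) = sem m (set fs) c (\<lambda>_. 0)" using that by blast
  next
    fix y assume "\<exists>m fs. 0 < m \<and> (\<forall>e \<in> set fs. e \<subseteq> {..<m}) \<and> graph_word n es = graph_word m fs \<and>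
       y = sem m (set fs) c (\<lambda>_. 0)"
    then show "y = sem n (set es) c (\<lambda>_. 0)" using graph_word_inj[of n es] that by blast
  qed
  obtain a e where ae: "\<And>L. 1 \<le> L \<Longrightarrow> cmd_time c L \<le> a * L ^ e" using cmd_time_poly by blast
  have "poly_time (\<lambda>x. g (f x))"
  proof (rule compose_poly_time[OF f, where D = D])
    fix x show "f x \<in> D" using fx[of x] by (auto simp: D_def)
  next
    fix i
    let ?p = "setup_vars i nv ;; cp i nv c"
    have "wfp (i + 6 + nv) ?p" using wfp_cp[OF c]
      by (auto simp: setup_vars_def wfp_seqs layout left_end_def)
    moreover have "triple (\<lambda>T. T i = (word_contents w, 0) \<and> (\<forall>j > i + 1. T j = blank)) ?p
        ((3 * nv + 6 + a * 2 ^ e) * (length w + 1) ^ Suc e)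
        (\<lambda>T. fst (T (i + 6 + nv - 1)) = word_contents (g w))" if wD: "w \<in> D" for w
    proof -
      obtain n es where w: "w = graph_word n es" "0 < n" "\<forall>e \<in> set es. e \<subseteq> {..<n}"
        using wD unfolding D_def by blast
      have t: "triple (\<lambda>T. T i = (word_contents w, 0) \<and> (\<forall>j > i + 1. T j = blank)) ?p
        ((n * (nv + 3) + nv * (2 * n + 3) + 3) + cmd_time c (length w + 2))
        (stores i nv n w {} (\<lambda>_. 0) ([] @ sem n (set es) c (\<lambda>_. 0)))"
        unfolding w(1) by (rule triple_Then[OF setup_vars_triple cp_triple]) (use c w in auto)
      let ?l = "length w + 1"
      have nl: "n + 1 \<le> length w" using w by (simp add: length_graph_word)
      have 1: "n * (nv + 3) + nv * (2 * n + 3) + 3 \<le> (3 * nv + 6) * ?l"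
      proof -
        have "n * (nv + 3) \<le> ?l * (nv + 3)" using nl by (intro mult_le_mono1) linarith
        moreover have "nv * (2 * n + 3) \<le> nv * (2 * ?l)" using nl by (intro mult_le_mono2) simp
        moreover have "?l * (nv + 3) + nv * (2 * ?l) + 3 * ?l = (3 * nv + 6) * ?l" by (simp add: algebra_simps)
        moreover have "x \<le> X \<Longrightarrow> y \<le> Y \<Longrightarrow> X + Y + 3 * l = Z \<Longrightarrow> 1 \<le> l \<Longrightarrow> x + y + 3 \<le> Z"
          for x X y Y l Z :: nat by linarith
        ultimately show ?thesis by (metis le_add2)
      qed
      have "(length w + 2) ^ e \<le> (2 * ?l) ^ e" by (intro power_mono) auto
      then have 2: "cmd_time c (length w + 2) \<le> a * 2 ^ e * ?l ^ e"
      proof -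
        have "cmd_time c (length w + 2) \<le> a * (length w + 2) ^ e" by (rule ae) simp
        also have "\<dots> \<le> a * (2 * ?l) ^ e" by (rule mult_le_mono2) fact
        also have "\<dots> = a * 2 ^ e * ?l ^ e" by (simp only: power_mult_distrib mult.assoc)
        finally show ?thesis .
      qed
      have "?l ^ 1 \<le> ?l ^ Suc e" "?l ^ e \<le> ?l ^ Suc e" by (intro power_increasing; simp)+
      then have "(3 * nv + 6) * ?l \<le> (3 * nv + 6) * ?l ^ Suc e" "a * 2 ^ e * ?l ^ e \<le> a * 2 ^ e * ?l ^ Suc e"
        by (intro mult_le_mono2; simp)+
      then have le: "(n * (nv + 3) + nv * (2 * n + 3) + 3) + cmd_time c (length w + 2)
          \<le> (3 * nv + 6 + a * 2 ^ e) * ?l ^ Suc e"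
        using 1 2 unfolding add_mult_distrib[of "3 * nv + 6"] by linarith
      have idx: "i + 6 + nv - 1 = outt i nv" by (simp add: outt_def)
      have post: "fst (T (outt i nv)) = word_contents (g w)"
        if "stores i nv n w {} (\<lambda>_. 0) ([] @ sem n (set es) c (\<lambda>_. 0)) T" for T
        using that g[OF w(2,3)] w(1) by (simp add: stores_def)
      show ?thesis unfolding idx by (rule triple_conseq[OF t _ post le])
    qed
    ultimately show "\<exists>p k a d. wfp k p \<and> i + 2 < k \<and>
       (\<forall>w \<in> D. triple (\<lambda>T. T i = (word_contents w, 0) \<and> (\<forall>j > i + 1. T j = blank)) p
          (a * (length w + 1) ^ d) (\<lambda>T. fst (T (k - 1)) = word_contents (g w)))"
      by (intro exI[of _ ?p] exI[of _ "i + 6 + nv"] exI[of _ "3 * nv + 6 + a * 2 ^ e"] exI[of _ "Suc e"]) simp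
  qed
  then show ?thesis using g by (intro exI[of _ "\<lambda>x. g (f x)"]) auto
qed

section \<open>Finite tables\<close>

definition write_word :: "nat \<Rightarrow> bool list \<Rightarrow> prog" where
  "write_word j ys = seqs j (map (\<lambda>b. Act j (Some (if b then 2 else 1)) 1) ys)"

lemma write_word_triple:
  "triple (\<lambda>T. T j = blank) (write_word j ys) (length ys + 1) (\<lambda>T. fst (T j) = word_contents ys)"
proof -
  let ?ps = "map (\<lambda>b. Act j (Some (if b then 2 else 1)) 1) ys"
  have "triple (\<lambda>T. T j = (word_contents (take 0 ys), int 0)) (seqs j ?ps) (length ?ps * 1 + 1)
     (\<lambda>T. T j = (word_contents (take (length ?ps) ys), int (length ?ps)))"
  proof (rule seqs_triple[where I = "\<lambda>k T. T j = (word_contents (take k ys), int k)"])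
    fix k assume "k < length ?ps"
    then have k: "k < length ys" by simp
    have "(word_contents (take k ys))(int k := if ys ! k then 2 else 1) = word_contents (take (Suc k) ys)"
      using k by (auto simp: word_contents_def fun_eq_iff take_Suc_conv_app_nth nth_append)
    then have "triple (\<lambda>T. T j = (word_contents (take k ys), int k)) (Act j (Some (if ys ! k then 2 else 1)) 1) 1
       (\<lambda>T. T j = (word_contents (take (Suc k) ys), int (Suc k)))"
      by (intro triple_Act) simp
    then show "triple (\<lambda>T. T j = (word_contents (take k ys), int k)) (?ps ! k) 1
       (\<lambda>T. T j = (word_contents (take (Suc k) ys), int (Suc k)))"
      using k by simp
  qed
  then show ?thesis unfolding write_word_def
    by (rule triple_conseq) (auto simp: blank_def)
qed

text \<open>The finite table lives in the control: a decision tree of depth \<open>l\<close> over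
  the input bits, where \<open>P\<close> is the condition on the part not yet read. Words of length
  at least \<open>l\<close> get the default \<open>zs\<close>.\<close>

fun trie :: "nat \<Rightarrow> nat \<Rightarrow> (bool list \<Rightarrow> bool) \<Rightarrow> bool list \<Rightarrow> bool list \<Rightarrow> prog" where
  "trie i 0 P ys zs = write_word (i + 2) zs"
| "trie i (Suc l) P ys zs = Cond i (\<lambda>s. s = 0)
     (write_word (i + 2) (if P [] then ys else zs))
     (Cond i (\<lambda>s. s = 2)
        (Act i None 1 ;; trie i l (\<lambda>w. P (True # w)) ys zs)
        (Act i None 1 ;; trie i l (\<lambda>w. P (False # w)) ys zs))"

lemma trie_triple:
  "triple (\<lambda>T. T i = (word_contents (u @ w), int (length u)) \<and> T (i + 2) = blank) (trie i l P ys zs)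
    (length ys + length zs + 1 + 3 * l)
    (\<lambda>T. fst (T (i + 2)) = word_contents (if length w < l \<and> P w then ys else zs))"
proof (induction l arbitrary: u w P)
  case 0
  show ?case by (rule triple_conseq[OF write_word_triple[of "i + 2" zs, folded trie.simps(1)[of i P ys zs]]]) auto
next
  case (Suc l)
  let ?A = "\<lambda>T. T i = (word_contents (u @ w), int (length u)) \<and> T (i + 2) = blank"
  let ?t = "length ys + length zs + 1 + 3 * l"
  let ?B = "\<lambda>T. fst (T (i + 2)) = word_contents (if length w < Suc l \<and> P w then ys else zs)"
  have go: "triple (\<lambda>T. ?A T) (Act i None 1 ;; trie i l (\<lambda>w. P (b # w)) ys zs) (1 + ?t) ?B"
    if w: "w = b # w'" for b w'
  proof (rule triple_Then)
    show "triple (\<lambda>T. ?A T) (Act i None 1) 1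
       (\<lambda>T. T i = (word_contents ((u @ [b]) @ w'), int (length (u @ [b]))) \<and> T (i + 2) = blank)"
      by (rule triple_Act) (use w in auto)
    show "triple (\<lambda>T. T i = (word_contents ((u @ [b]) @ w'), int (length (u @ [b]))) \<and> T (i + 2) = blank)
       (trie i l (\<lambda>w. P (b # w)) ys zs) ?t ?B"
      by (rule triple_conseq[OF Suc.IH[of "u @ [b]" w']]) (use w in auto)
  qed
  have rd: "word_contents (u @ w) (int (length u)) = (case w of [] \<Rightarrow> 0 | b # _ \<Rightarrow> if b then 2 else 1)"
    by (cases w) (auto simp: word_contents_def)
  have e: "length ys + length zs + 1 + 3 * Suc l = Suc (Suc (1 + ?t))" by simp
  have B0: "?B T" if "w = []" "fst (T (i + 2)) = word_contents (if P [] then ys else zs)" for T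
    using that by simp
  show ?case unfolding trie.simps e
  proof (rule triple_Cond)
    show "triple (\<lambda>T. ?A T \<and> rd (T i) = 0) (write_word (i + 2) (if P [] then ys else zs)) (Suc (1 + ?t)) ?B"
    proof (cases "w = []")
      case True
      show ?thesis by (rule triple_conseq[OF write_word_triple]) (use B0 True in auto)
    next
      case False
      then obtain b w' where "w = b # w'" by (cases w) auto
      then show ?thesis using rd by (auto simp: triple_def split: if_splits)
    qed
    show "triple (\<lambda>T. ?A T \<and> rd (T i) \<noteq> 0) (Cond i (\<lambda>s. s = 2)
        (Act i None 1 ;; trie i l (\<lambda>w. P (True # w)) ys zs)
        (Act i None 1 ;; trie i l (\<lambda>w. P (False # w)) ys zs)) (Suc (1 + ?t)) ?B"
    proof (rule triple_Cond)
      show "triple (\<lambda>T. (?A T \<and> rd (T i) \<noteq> 0) \<and> rd (T i) = 2)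
        (Act i None 1 ;; trie i l (\<lambda>w. P (True # w)) ys zs) (1 + ?t) ?B"
      proof (cases "\<exists>w'. w = True # w'")
        case True
        then obtain w' where w: "w = True # w'" ..
        show ?thesis by (rule triple_conseq[OF go[OF w]]) auto
      next
        case False
        then show ?thesis using rd by (auto simp: triple_def split: list.splits if_splits)
      qed
      show "triple (\<lambda>T. (?A T \<and> rd (T i) \<noteq> 0) \<and> rd (T i) \<noteq> 2)
        (Act i None 1 ;; trie i l (\<lambda>w. P (False # w)) ys zs) (1 + ?t) ?B"
      proof (cases "\<exists>w'. w = False # w'")
        case True
        then obtain w' where w: "w = False # w'" ..
        show ?thesis by (rule triple_conseq[OF go[OF w]]) auto
      next
        case False
        then show ?thesis using rd by (auto simp: triple_def split: list.splits if_splits)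
      qed
    qed
  qed
qed

section \<open>Products of neighbourhood averages in the NO case\<close>

text \<open>The integrand of relative entropy. Compared with z ln z it is shifted by terms that
  cancel for a function of mean 1, and in exchange it is nonnegative pointwise.\<close>

definition psi :: "real \<Rightarrow> real" where
  "psi z = z * ln z - z + 1"

text \<open>Relative entropy dominates the squared Hellinger distance; pointwise this is ln x \<le>
  x - 1 at x = 1 / sqrt z.\<close>

lemma psi_ge_sqrt:
  assumes "0 < z"
  shows "(sqrt z - 1)\<^sup>2 \<le> psi z"
proof -
  define s where "s = sqrt z"
  have s: "0 < s" "z = s\<^sup>2" using assms by (auto simp: s_def)
  have "ln (1 / s) \<le> 1 / s - 1" using s by (intro ln_le_minus_one) simp
  then have "1 - 1 / s \<le> ln s" using s by (simp add: ln_div)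
  then have "2 * (s\<^sup>2 * (1 - 1 / s)) \<le> 2 * (s\<^sup>2 * ln s)" using s by (intro mult_left_mono) auto
  moreover have "s\<^sup>2 * (1 - 1 / s) = s\<^sup>2 - s" using s by (simp add: power2_eq_square field_simps)
  moreover have "ln z = 2 * ln s" using s by (simp add: ln_realpow)
  ultimately have "2 * (s\<^sup>2 - s) \<le> z * ln z" using s by (simp add: algebra_simps)
  then show ?thesis using s by (simp add: psi_def s_def[symmetric] power2_eq_square algebra_simps)
qed

lemma psi_nonneg: "0 < z \<Longrightarrow> 0 \<le> psi z"
  using psi_ge_sqrt[of z] by (meson order_trans zero_le_power2)

text \<open>Write z - 1 = (s + 1) (s - 1) with s = sqrt z; the constant is (1 + sqrt 2)^2 rounded
  up.\<close>

lemma psi_ge_square: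
  assumes "0 < z" "z \<le> 2"
  shows "(z - 1)\<^sup>2 \<le> 6 * psi z"
proof -
  define s where "s = sqrt z"
  have s: "0 < s" "z = s\<^sup>2" using assms by (auto simp: s_def)
  have "s \<le> sqrt 2" using assms by (simp add: s_def)
  moreover have "sqrt 2 \<le> 1.42" by (rule real_le_lsqrt) (auto simp: power2_eq_square)
  ultimately have "s + 1 \<le> 2.42" by simp
  then have "(s + 1)\<^sup>2 \<le> 2.42\<^sup>2" using s by (intro power_mono) auto
  then have "(s + 1)\<^sup>2 \<le> 6" by (simp add: power2_eq_square)
  then have "(s + 1)\<^sup>2 * (s - 1)\<^sup>2 \<le> 6 * (s - 1)\<^sup>2" by (intro mult_right_mono) auto
  moreover have "(z - 1)\<^sup>2 = (s + 1)\<^sup>2 * (s - 1)\<^sup>2"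
    unfolding s(2) power_mult_distrib[symmetric] by (simp add: power2_eq_square algebra_simps)
  ultimately show ?thesis using psi_ge_sqrt[OF assms(1)] unfolding s_def[symmetric] by linarith
qed

text \<open>With s = sqrt z the claim follows from (s + 1) \<rho> \<le> 6 (s - 1). This is linear in
  s, so it suffices to check it at 1 + 2 \<rho> / 5, a lower bound for sqrt (1 + \<rho>) on the unit
  interval.\<close>

lemma psi_ge_linear:
  assumes "0 < \<rho>" "\<rho> \<le> 1" "1 + \<rho> \<le> z"
  shows "\<rho> * (z - 1) \<le> 6 * psi z"
proof -
  define s where "s = sqrt z"
  have s: "0 < s" "z = s\<^sup>2" using assms by (auto simp: s_def)
  have "(1 + 2 * \<rho> / 5)\<^sup>2 \<le> 1 + \<rho>"
  proof -
    have "\<rho> * \<rho> \<le> \<rho> * 1" using assms by (intro mult_left_mono) auto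
    then have "4 * (\<rho> * \<rho>) \<le> 5 * \<rho>" using assms by linarith
    then show ?thesis by (simp add: power2_eq_square algebra_simps)
  qed
  then have "(1 + 2 * \<rho> / 5)\<^sup>2 \<le> s\<^sup>2" using assms s by linarith
  then have s1: "1 + 2 * \<rho> / 5 \<le> s" using s power2_le_imp_le by (meson less_imp_le)
  have "(s + 1) * \<rho> \<le> 6 * (s - 1)"
  proof -
    have "(6 - \<rho>) * (1 + 2 * \<rho> / 5) \<le> (6 - \<rho>) * s" using s1 assms by (intro mult_left_mono) auto
    moreover have "6 + \<rho> \<le> (6 - \<rho>) * (1 + 2 * \<rho> / 5)"
    proof -
      have "\<rho> * \<rho> \<le> \<rho> * 1" using assms by (intro mult_left_mono) auto
      then show ?thesis by (simp add: algebra_simps)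
    qed
    ultimately have "6 + \<rho> \<le> (6 - \<rho>) * s" by linarith
    then show ?thesis by (simp add: algebra_simps)
  qed
  then have "(s - 1) * ((s + 1) * \<rho>) \<le> (s - 1) * (6 * (s - 1))" using s1 assms by (intro mult_left_mono) auto
  then have "\<rho> * (z - 1) \<le> 6 * (s - 1)\<^sup>2" unfolding s(2) by (simp add: power2_eq_square algebra_simps)
  then show ?thesis using psi_ge_sqrt[of z] assms unfolding s_def[symmetric] by linarith
qed

text \<open>An upper bound without any lower restriction on \<open>x\<close>. For positive
  \<open>x\<close> the series bound, valid up to 1, is squared at x / 2; for negative
  \<open>x\<close> the Taylor bound of the reciprocal is inverted.\<close>

lemma exp_le_quadratic:
  fixes x :: real
  assumes "x \<le> 2"
  shows "exp x \<le> 1 + x + 2 * x\<^sup>2"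
proof (cases "0 \<le> x")
  case True
  define a where "a = x / 2"
  have a: "0 \<le> a" "a \<le> 1" "x = 2 * a" using True assms by (auto simp: a_def)
  have "exp x = (exp a)\<^sup>2" using a by (simp add: exp_double)
  also have "\<dots> \<le> (1 + a + a\<^sup>2)\<^sup>2" using a exp_bound[of a] by (intro power_mono) auto
  also have "\<dots> = 1 + 2 * a + 3 * a\<^sup>2 + 2 * a\<^sup>2 * a + a\<^sup>2 * a\<^sup>2" by (simp add: power2_eq_square algebra_simps)
  also have "\<dots> \<le> 1 + 2 * a + 3 * a\<^sup>2 + 2 * a\<^sup>2 * 1 + a\<^sup>2 * 1"
    using a by (intro add_mono mult_left_mono) (auto simp: power_le_one)
  also have "\<dots> \<le> 1 + x + 2 * x\<^sup>2" using a by (simp add: power_mult_distrib)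
  finally show ?thesis .
next
  case False
  define y where "y = - x"
  have y: "0 < y" "x = - y" using False by (auto simp: y_def)
  have e: "1 + y + y\<^sup>2 / 2 \<le> exp y" using y by (intro exp_lower_Taylor_quadratic) auto
  have pos: "0 \<le> 1 - y + y\<^sup>2 / 2"
    using sum_power2_ge_zero[of "y - 1" 1] by (simp add: power2_eq_square algebra_simps)
  \<comment> \<open>The product equals 1 + y^4 / 4.\<close>
  have "1 \<le> (1 - y + y\<^sup>2 / 2) * (1 + y + y\<^sup>2 / 2)"
    using zero_le_power2[of "y\<^sup>2"] by (simp add: power2_eq_square algebra_simps)
  also have "\<dots> \<le> (1 - y + y\<^sup>2 / 2) * exp y" using e pos by (intro mult_left_mono) auto
  finally have "exp x \<le> 1 - y + y\<^sup>2 / 2" using y by (simp add: exp_minus field_simps)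
  also have "\<dots> \<le> 1 + x + 2 * x\<^sup>2" using y zero_le_power2[of y] by simp
  finally show ?thesis .
qed

section \<open>Means and the random walk on a regular graph\<close>

locale regular_adj =
  fixes n d :: nat and nb :: "nat \<Rightarrow> nat set"
  assumes n_pos: "0 < n" and d_pos: "0 < d"
    and nb_sub: "\<And>u. u < n \<Longrightarrow> nb u \<subseteq> {..<n}"
    and nb_card: "\<And>u. u < n \<Longrightarrow> card (nb u) = d"
    and nb_sym: "\<And>u v. u < n \<Longrightarrow> v < n \<Longrightarrow> v \<in> nb u \<longleftrightarrow> u \<in> nb v"
begin

lemma nb_finite: "u < n \<Longrightarrow> finite (nb u)"
  using nb_sub finite_subset by blast

definition Ev :: "(nat \<Rightarrow> real) \<Rightarrow> real" where
  "Ev \<phi> = (\<Sum>v<n. \<phi> v) / real n"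

text \<open>The random walk operator. By symmetry and regularity it preserves the uniform mean
  (\<open>Ev_G\<close>), and by Cauchy-Schwarz it does not increase second moments.\<close>

definition G :: "(nat \<Rightarrow> real) \<Rightarrow> nat \<Rightarrow> real" where
  "G \<phi> u = (\<Sum>v\<in>nb u. \<phi> v) / real d"

lemma Ev_mono: "(\<And>v. v < n \<Longrightarrow> f v \<le> g v) \<Longrightarrow> Ev f \<le> Ev g"
  unfolding Ev_def by (intro divide_right_mono sum_mono) auto

lemma Ev_const [simp]: "Ev (\<lambda>_. c) = c"
  using n_pos by (simp add: Ev_def)

lemma Ev_add: "Ev (\<lambda>v. f v + g v) = Ev f + Ev g"
  by (simp add: Ev_def sum.distrib add_divide_distrib)

lemma Ev_diff: "Ev (\<lambda>v. f v - g v) = Ev f - Ev g"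
  by (simp add: Ev_def sum_subtractf diff_divide_distrib)

lemma Ev_cmult: "Ev (\<lambda>v. c * f v) = c * Ev f"
  by (simp add: Ev_def sum_distrib_left)

lemma Ev_multc: "Ev (\<lambda>v. f v * c) = Ev f * c"
  using Ev_cmult[of c f] by (simp add: mult.commute)

lemma Ev_divide: "Ev (\<lambda>v. f v / c) = Ev f / c"
  using Ev_cmult[of "1 / c" f] by simp

lemma Ev_sum: "Ev (\<lambda>v. \<Sum>j\<in>J. f j v) = (\<Sum>j\<in>J. Ev (f j))"
  by (simp add: Ev_def sum_divide_distrib) (rule sum.swap)

lemma Ev_swap: "Ev (\<lambda>u. Ev (f u)) = Ev (\<lambda>v. Ev (\<lambda>u. f u v))"
proof -
  have "(\<Sum>u<n. \<Sum>v<n. f u v) = (\<Sum>v<n. \<Sum>u<n. f u v)" by (rule sum.swap)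
  then show ?thesis by (simp add: Ev_def sum_divide_distrib[symmetric])
qed

lemma Ev_indicator: "A \<subseteq> {..<n} \<Longrightarrow> Ev (\<lambda>v. of_bool (v \<in> A)) = real (card A) / real n"
  by (simp add: Ev_def of_bool_def sum.If_cases Int_absorb1)

lemma G_mono: "u < n \<Longrightarrow> (\<And>v. v < n \<Longrightarrow> f v \<le> g v) \<Longrightarrow> G f u \<le> G g u"
  unfolding G_def using nb_sub by (intro divide_right_mono sum_mono) auto

lemma G_const: "u < n \<Longrightarrow> G (\<lambda>_. c) u = c"
  using d_pos nb_card by (simp add: G_def)

lemma G_add: "G (\<lambda>v. f v + g v) u = G f u + G g u"
  by (simp add: G_def sum.distrib add_divide_distrib)

lemma G_diff: "G (\<lambda>v. f v - g v) u = G f u - G g u"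
  by (simp add: G_def sum_subtractf diff_divide_distrib)

lemma G_divide: "G (\<lambda>v. f v / c) u = G f u / c"
  by (simp add: G_def sum_divide_distrib mult.commute)

lemma G_cmult: "G (\<lambda>v. c * f v) u = c * G f u"
  by (simp add: G_def sum_distrib_left)

lemma G_nonneg: "u < n \<Longrightarrow> (\<And>v. v < n \<Longrightarrow> 0 \<le> f v) \<Longrightarrow> 0 \<le> G f u"
  using G_mono[of u "\<lambda>_. 0" f] G_const by auto

lemma Ev_G: "Ev (G f) = Ev f"
proof -
  have "(\<Sum>u<n. \<Sum>v\<in>nb u. f v) = (\<Sum>u<n. \<Sum>v<n. if v \<in> nb u then f v else 0)"
  proof (rule sum.cong[OF refl])
    fix u assume "u \<in> {..<n}"
    then have "{..<n} \<inter> nb u = nb u" using nb_sub by auto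
    then show "(\<Sum>v\<in>nb u. f v) = (\<Sum>v<n. if v \<in> nb u then f v else 0)"
      by (simp add: sum.If_cases)
  qed
  also have "\<dots> = (\<Sum>v<n. \<Sum>u<n. if v \<in> nb u then f v else 0)" by (rule sum.swap)
  also have "\<dots> = (\<Sum>v<n. \<Sum>u<n. if u \<in> nb v then f v else 0)"
    using nb_sym by (intro sum.cong refl) auto
  also have "\<dots> = (\<Sum>v<n. real d * f v)"
  proof (rule sum.cong[OF refl])
    fix v assume "v \<in> {..<n}"
    then have "{..<n} \<inter> nb v = nb v" "card (nb v) = d" using nb_sub nb_card by auto
    then show "(\<Sum>u<n. if u \<in> nb v then f v else 0) = real d * f v"
      by (simp add: sum.If_cases)
  qed
  finally show ?thesis using d_pos by (simp add: Ev_def G_def sum_divide_distrib[symmetric] sum_distrib_left[symmetric])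
qed

lemma G_square_le: "u < n \<Longrightarrow> (G f u)\<^sup>2 \<le> G (\<lambda>v. (f v)\<^sup>2) u"
proof -
  assume u: "u < n"
  have "(\<Sum>v\<in>nb u. f v)\<^sup>2 \<le> (\<Sum>v\<in>nb u. (f v)\<^sup>2) * real d"
    using sum_squared_le_sum_of_squares[of f "nb u"] nb_card[OF u] by simp
  then show ?thesis using d_pos by (simp add: G_def power2_eq_square field_simps)
qed

lemma Ev_G_square: "Ev (\<lambda>u. (G f u)\<^sup>2) \<le> Ev (\<lambda>v. (f v)\<^sup>2)"
  using Ev_mono[of "\<lambda>u. (G f u)\<^sup>2" "G (\<lambda>v. (f v)\<^sup>2)"] G_square_le Ev_G by simp

text \<open>The probability that both ends of a random arc lie in \<open>T\<close>; for a regular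
  graph it is the measure of \<open>T\<close> minus the measure of its boundary.\<close>

definition inside :: "nat set \<Rightarrow> real" where
  "inside T = Ev (\<lambda>u. of_bool (u \<in> T) * G (\<lambda>v. of_bool (v \<in> T)) u)"

text \<open>A probability density with respect to the uniform measure, bounded by \<open>H\<close>
  and of relative entropy at most \<tau>.\<close>

definition dens :: "real \<Rightarrow> real \<Rightarrow> (nat \<Rightarrow> real) \<Rightarrow> bool" where
  "dens H \<tau> Z \<longleftrightarrow> (\<forall>v < n. 0 < Z v \<and> Z v \<le> H) \<and> Ev Z = 1 \<and> Ev (\<lambda>v. psi (Z v)) \<le> \<tau>"

context
  fixes r :: nat and \<rho> H \<tau> \<omega> :: real
  assumes r: "2 \<le> r" and rho_eq: "\<rho> = 1 / real r" and H: "1 \<le> H" and tau: "0 \<le> \<tau>"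
    and no: "\<And>T. T \<subseteq> {..<n} \<Longrightarrow> real (card T) \<le> 12 * (real r)\<^sup>2 * \<tau> * real n \<Longrightarrow> inside T \<le> \<omega>"
begin

text \<open>A density is split at \<open>1 + \<rho>\<close>: entropy controls the second moment of \<open>low Z\<close>, while small set
  expansion makes \<open>G (exc Z)\<close> small outside a negligible set.\<close>

definition low :: "(nat \<Rightarrow> real) \<Rightarrow> nat \<Rightarrow> real" where
  "low Z v = min (Z v) (1 + \<rho>)"

definition exc :: "(nat \<Rightarrow> real) \<Rightarrow> nat \<Rightarrow> real" where
  "exc Z v = max (Z v - (1 + \<rho>)) 0"

lemma low_exc: "Z v = low Z v + exc Z v"
  by (auto simp: low_def exc_def)

lemma rho: "0 < \<rho>" "\<rho> \<le> 1 / 2" "real r * \<rho> = 1"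
  using r by (auto simp: rho_eq field_simps)

text \<open>The square is at most \<open>6 * psi\<close> on both sides of the threshold: below by
  the quadratic bound, above by the linear one, since there \<rho>^2 \<le> \<rho> (z - 1).\<close>

lemma Ev_low_sq:
  assumes "dens H \<tau> Z"
  shows "Ev (\<lambda>v. (low Z v - 1)\<^sup>2) \<le> 6 * \<tau>"
proof -
  have "(low Z v - 1)\<^sup>2 \<le> 6 * psi (Z v)" if v: "v < n" for v
  proof -
    have z: "0 < Z v" using assms v by (simp add: dens_def)
    show ?thesis
    proof (cases "Z v \<le> 1 + \<rho>")
      case True
      then have "low Z v = Z v" "Z v \<le> 2" using rho by (auto simp: low_def)
      then show ?thesis using psi_ge_square[OF z] by simp
    next
      case False
      then have "\<rho> * (Z v - 1) \<le> 6 * psi (Z v)" using rho by (intro psi_ge_linear) auto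
      moreover have "\<rho> * \<rho> \<le> \<rho> * (Z v - 1)" using False rho by (intro mult_left_mono) auto
      moreover have "low Z v = 1 + \<rho>" using False by (simp add: low_def)
      ultimately show ?thesis by (simp add: power2_eq_square)
    qed
  qed
  then have "Ev (\<lambda>v. (low Z v - 1)\<^sup>2) \<le> Ev (\<lambda>v. 6 * psi (Z v))" by (rule Ev_mono)
  then show ?thesis using assms by (simp add: Ev_cmult dens_def)
qed

lemma exc_nonneg: "0 \<le> exc Z v" by (simp add: exc_def)

lemma exc_le:
  assumes "dens H \<tau> Z" "v < n"
  shows "exc Z v \<le> 6 * real r * psi (Z v)"
proof (cases "Z v \<le> 1 + \<rho>")
  case True
  then have "exc Z v = 0" by (simp add: exc_def)
  then show ?thesis using assms psi_nonneg[of "Z v"] by (simp add: dens_def)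
next
  case False
  then have "\<rho> * (Z v - 1) \<le> 6 * psi (Z v)" using rho by (intro psi_ge_linear) auto
  then have "real r * (\<rho> * (Z v - 1)) \<le> real r * (6 * psi (Z v))" by (intro mult_left_mono) auto
  then have "Z v - 1 \<le> 6 * real r * psi (Z v)" using rho(3) by (simp add: mult.assoc[symmetric]) 
  then show ?thesis using False rho by (simp add: exc_def)
qed

lemma Ev_exc:
  assumes "dens H \<tau> Z"
  shows "Ev (exc Z) \<le> 6 * real r * \<tau>"
proof -
  have "Ev (exc Z) \<le> Ev (\<lambda>v. 6 * real r * psi (Z v))" using exc_le[OF assms] by (rule Ev_mono)
  also have "\<dots> \<le> 6 * real r * \<tau>" using assms unfolding Ev_cmult dens_def by (intro mult_left_mono) auto
  finally show ?thesis .
qed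

lemma Ev_markov:
  assumes "\<And>v. v < n \<Longrightarrow> 0 \<le> f v" "0 < c" "A \<subseteq> {v. v < n \<and> c \<le> f v}"
  shows "c * (real (card A) / real n) \<le> Ev f"
proof -
  have A: "A \<subseteq> {..<n}" using assms by auto
  have "c * Ev (\<lambda>v. of_bool (v \<in> A)) \<le> Ev f"
    unfolding Ev_cmult[symmetric] using assms by (intro Ev_mono) auto
  then show ?thesis using Ev_indicator[OF A] by simp
qed

definition big :: "(nat \<Rightarrow> real) \<Rightarrow> nat set" where
  "big Z = {u. u < n \<and> G (exc Z) u > \<rho>}"

text \<open>The set \<open>A\<close>, where the density exceeds the threshold, and
  \<open>big Z\<close> each have measure at most 6 r^2 \<tau> by Markov's inequality, so the
  expansion hypothesis applies to their union \<open>T\<close>. The excess is supported on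
  \<open>A\<close> and at most \<open>H\<close>, hence the mass it sends to \<open>big Z\<close> is
  at most \<open>H * inside T\<close>, while each point of \<open>big Z\<close> receives more than 1
  / r. So the crude bound by \<tau> improves to one by \<omega>.\<close>

lemma big_card:
  assumes "dens H \<tau> Z"
  shows "real (card (big Z)) / real n \<le> real r * H * \<omega>"
proof -
  define A where "A = {v. v < n \<and> Z v > 1 + \<rho>}"
  define T where "T = A \<union> big Z"
  have sub: "A \<subseteq> {..<n}" "big Z \<subseteq> {..<n}" by (auto simp: A_def big_def)
  then have fin: "finite A" "finite (big Z)" using finite_subset by blast+
  have "real (card A) / real n \<le> 6 * (real r)\<^sup>2 * \<tau>"
  proof -
    have "(1 / (6 * (real r)\<^sup>2)) * (real (card A) / real n) \<le> Ev (\<lambda>v. psi (Z v))"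
    proof (rule Ev_markov)
      show "A \<subseteq> {v. v < n \<and> 1 / (6 * (real r)\<^sup>2) \<le> psi (Z v)}"
      proof clarify
        fix v assume v: "v \<in> A"
        then have "\<rho> * (Z v - 1) \<le> 6 * psi (Z v)" using rho by (intro psi_ge_linear) (auto simp: A_def)
        moreover have "\<rho> * \<rho> \<le> \<rho> * (Z v - 1)"
          using v rho by (intro mult_left_mono) (auto simp: A_def)
        moreover have "\<rho> * \<rho> = 1 / (real r)\<^sup>2" by (simp add: rho_eq power2_eq_square)
        ultimately have "1 / (6 * (real r)\<^sup>2) \<le> psi (Z v)" by simp
        then show "v < n \<and> 1 / (6 * (real r)\<^sup>2) \<le> psi (Z v)" using v by (simp add: A_def)
      qed
    qed (use assms r psi_nonneg in \<open>auto simp: dens_def\<close>)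
    also have "\<dots> \<le> \<tau>" using assms by (simp add: dens_def)
    finally show ?thesis using r n_pos by (simp add: field_simps)
  qed
  moreover have "real (card (big Z)) / real n \<le> 6 * (real r)\<^sup>2 * \<tau>"
  proof -
    have "\<rho> * (real (card (big Z)) / real n) \<le> Ev (G (exc Z))"
      by (rule Ev_markov) (use rho G_nonneg exc_nonneg in \<open>auto simp: big_def\<close>)
    also have "\<dots> \<le> 6 * real r * \<tau>" using Ev_exc[OF assms] by (simp add: Ev_G)
    finally have "real r * (\<rho> * (real (card (big Z)) / real n)) \<le> real r * (6 * real r * \<tau>)"
      by (intro mult_left_mono) auto
    then show ?thesis unfolding mult.assoc[symmetric] rho(3) by (simp add: power2_eq_square mult_ac)
  qed
  moreover have "real (card T) \<le> real (card A) + real (card (big Z))"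
    unfolding T_def using card_Un_le[of A "big Z"] by linarith
  ultimately have "real (card T) / real n \<le> 12 * (real r)\<^sup>2 * \<tau>"
    using divide_right_mono[of "real (card T)" "real (card A) + real (card (big Z))" "real n"]
    unfolding add_divide_distrib by linarith
  then have "real (card T) \<le> 12 * (real r)\<^sup>2 * \<tau> * real n" using n_pos by (simp add: field_simps)
  then have ins: "inside T \<le> \<omega>" using no[of T] sub by (auto simp: T_def)
  have "\<rho> * (real (card (big Z)) / real n) \<le> Ev (\<lambda>u. of_bool (u \<in> T) * G (exc Z) u)"
  proof (rule Ev_markov)
    show "\<And>v. v < n \<Longrightarrow> 0 \<le> of_bool (v \<in> T) * G (exc Z) v" using G_nonneg exc_nonneg by auto
    show "big Z \<subseteq> {v. v < n \<and> \<rho> \<le> of_bool (v \<in> T) * G (exc Z) v}"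
      by (auto simp: big_def T_def)
  qed (use rho in auto)
  also have "\<dots> \<le> Ev (\<lambda>u. H * (of_bool (u \<in> T) * G (\<lambda>v. of_bool (v \<in> T)) u))"
  proof (rule Ev_mono)
    fix u assume u: "u < n"
    have "exc Z v \<le> H * of_bool (v \<in> T)" if "v < n" for v
    proof (cases "v \<in> A")
      case True
      then have "exc Z v \<le> Z v" using rho by (auto simp: exc_def A_def)
      then show ?thesis using True assms that by (force simp: dens_def T_def)
    next
      case False
      then have "exc Z v = 0" using that by (auto simp: exc_def A_def)
      then show ?thesis using H by simp
    qed
    then have "G (exc Z) u \<le> G (\<lambda>v. H * of_bool (v \<in> T)) u" using u by (intro G_mono)
    then show "of_bool (u \<in> T) * G (exc Z) u \<le> H * (of_bool (u \<in> T) * G (\<lambda>v. of_bool (v \<in> T)) u)"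
      by (simp add: G_cmult)
  qed
  also have "\<dots> = H * inside T" by (simp add: Ev_cmult inside_def)
  also have "\<dots> \<le> H * \<omega>" using ins H by (intro mult_left_mono) auto
  finally have "real r * (\<rho> * (real (card (big Z)) / real n)) \<le> real r * (H * \<omega>)"
    by (intro mult_left_mono) auto
  then show ?thesis unfolding mult.assoc[symmetric] rho(3) by simp
qed

text \<open>On the union \<open>B\<close> of the sets \<open>big (Z j)\<close> the trivial bound H^r
  meets a tiny measure. Elsewhere the product of the factors 1 + \<eta> is at most exp X \<le> 1 + X
  + 2 X^2, where X has mean at most 0 and second moment at most 24 r^2 \<tau>; thus first-order
  terms disappear. The constant 75 is 48 from the second moment plus 27 from the excess of factor 0,
  as 54 r \<le> 27 r^2.\<close>

lemma one_step_density:
  assumes Z: "\<And>j. j < r \<Longrightarrow> dens H \<tau> (Z j)"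
  shows "Ev (\<lambda>u. Z 0 u * (\<Prod>j\<in>{1..<r}. G (Z j) u))
    \<le> 1 + 75 * (real r)\<^sup>2 * \<tau> + real r * (real r * H * \<omega>) * H ^ r"
proof -
  \<comment> \<open>For \<open>j \<noteq> 0\<close> the averaged excess is truncated at \<rho>:
    nothing is lost outside \<open>B\<close>, and \<eta> stays below 2 \<rho>, so the sum of r terms
    is at most 2. Factor 0 is not averaged over neighbours, so expansion says nothing about its
    excess, which is carried along as an additive term.\<close>
  define \<eta> where "\<eta> j u = (if j = 0 then low (Z 0) u - 1
     else G (low (Z j)) u - 1 + min (G (exc (Z j)) u) \<rho>)" for j u
  define X where "X u = (\<Sum>j<r. \<eta> j u)" for u
  define B where "B = (\<Union>j\<in>{1..<r}. big (Z j))"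
  have Bsub: "B \<subseteq> {..<n}" by (auto simp: B_def big_def)
  have Zb: "0 < Z j v" "Z j v \<le> H" if "j < r" "v < n" for j v
    using Z[OF that(1)] that(2) by (auto simp: dens_def)
  have GZb: "0 \<le> G (Z j) u" "G (Z j) u \<le> H" if "j < r" "u < n" for j u
    using G_nonneg[OF that(2), of "Z j"] G_mono[OF that(2), of "Z j" "\<lambda>_. H"] Zb[OF that(1)] G_const[OF that(2), of H]
    by force+
  have eta0: "0 \<le> 1 + \<eta> j u" if "j < r" "u < n" for j u
  proof (cases "j = 0")
    case True
    then show ?thesis using Zb[of 0 u] that rho by (simp add: \<eta>_def low_def)
  next
    case False
    have "0 \<le> G (low (Z j)) u" using that rho Zb[OF that(1)] by (intro G_nonneg) (auto simp: low_def less_imp_le)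
    moreover have "0 \<le> G (exc (Z j)) u" using that exc_nonneg by (intro G_nonneg) auto
    ultimately show ?thesis using False rho by (simp add: \<eta>_def)
  qed
  have etau: "\<eta> j u \<le> 2 * \<rho>" if "u < n" for j u
  proof (cases "j = 0")
    case True
    then show ?thesis using rho by (auto simp: \<eta>_def low_def min_def)
  next
    case False
    have "G (low (Z j)) u \<le> G (\<lambda>_. 1 + \<rho>) u" using that by (intro G_mono) (auto simp: low_def)
    then show ?thesis using False that by (simp add: \<eta>_def G_const)
  qed
  have Xle: "X u \<le> 2" if "u < n" for u
  proof -
    have "X u \<le> (\<Sum>j<r. 2 * \<rho>)" unfolding X_def using etau that by (intro sum_mono) auto
    then show ?thesis using rho by (simp add: mult.left_commute)
  qed
  have split: "{..<r} = insert 0 {1..<r}" using r by auto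
  have point: "Z 0 u * (\<Prod>j\<in>{1..<r}. G (Z j) u)
     \<le> H ^ r * of_bool (u \<in> B) + (1 + X u + 2 * (X u)\<^sup>2 + 9 * exc (Z 0) u)" if u: "u < n" for u
  proof (cases "u \<in> B")
    case True
    have "Z 0 u * (\<Prod>j\<in>{1..<r}. G (Z j) u) \<le> H * (\<Prod>j\<in>{1..<r}. H)"
      using Zb[of 0 u] GZb u r H by (intro mult_mono prod_mono prod_nonneg) auto
    also have "\<dots> = H ^ r" using r by (simp add: power_Suc[symmetric] del: power_Suc)
    finally have "Z 0 u * (\<Prod>j\<in>{1..<r}. G (Z j) u) \<le> H ^ r" .
    moreover have "0 \<le> 1 + X u + 2 * (X u)\<^sup>2" using exp_le_quadratic[OF Xle[OF u]] exp_gt_zero[of "X u"] by linarith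
    ultimately show ?thesis using True exc_nonneg[of "Z 0" u] by simp
  next
    case False
    have Gj: "G (Z j) u = 1 + \<eta> j u" if j: "j \<in> {1..<r}" for j
    proof -
      have "G (exc (Z j)) u \<le> \<rho>" using False j u by (force simp: B_def big_def not_less)
      moreover have "G (Z j) u = G (low (Z j)) u + G (exc (Z j)) u"
        using G_add[of "low (Z j)" "exc (Z j)" u] unfolding low_exc[symmetric] .
      ultimately show ?thesis using j by (simp add: \<eta>_def)
    qed
    let ?P = "\<Prod>j\<in>{1..<r}. 1 + \<eta> j u"
    have prodexp: "(\<Prod>j\<in>J. 1 + \<eta> j u) \<le> exp (\<Sum>j\<in>J. \<eta> j u)" if "J \<subseteq> {..<r}" for J
    proof -
      have fJ: "finite J" using that finite_subset by blast
      have "(\<Prod>j\<in>J. 1 + \<eta> j u) \<le> (\<Prod>j\<in>J. exp (\<eta> j u))"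
        using that eta0 u by (intro prod_mono) auto
      then show ?thesis by (simp add: exp_sum fJ)
    qed
    \<comment> \<open>9 bounds exp 2, through exp 1 \<le> 3.\<close>
    have P9: "?P \<le> 9"
    proof -
      have "(\<Sum>j\<in>{1..<r}. \<eta> j u) \<le> (\<Sum>j\<in>{1..<r}. 2 * \<rho>)" using etau u by (intro sum_mono) auto
      also have "\<dots> = 2 - 2 * \<rho>" using r rho by (simp add: of_nat_diff algebra_simps)
      also have "\<dots> \<le> 2" using rho by simp
      finally have "exp (\<Sum>j\<in>{1..<r}. \<eta> j u) \<le> exp 2" by simp
      moreover have "?P \<le> exp (\<Sum>j\<in>{1..<r}. \<eta> j u)" by (rule prodexp) auto
      ultimately have "?P \<le> exp 2" by linarith
      also have "exp (2::real) = exp 1 * exp 1" by (simp add: exp_add[symmetric])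
      also have "\<dots> \<le> 3 * 3" using exp_le by (intro mult_mono) auto
      finally show ?thesis by simp
    qed
    have "Z 0 u = 1 + \<eta> 0 u + exc (Z 0) u" 
    proof -
      have "\<eta> 0 u = low (Z 0) u - 1" by (simp add: \<eta>_def)
      then show ?thesis using low_exc[of "Z 0" u] by linarith
    qed
    then have "Z 0 u * (\<Prod>j\<in>{1..<r}. G (Z j) u) = (1 + \<eta> 0 u + exc (Z 0) u) * ?P"
      using Gj by simp
    also have "\<dots> = (\<Prod>j<r. 1 + \<eta> j u) + exc (Z 0) u * ?P"
      unfolding split by (simp add: algebra_simps)
    also have "\<dots> \<le> exp (X u) + exc (Z 0) u * 9"
      using prodexp[of "{..<r}"] P9 exc_nonneg[of "Z 0" u] unfolding X_def by (intro add_mono mult_left_mono) auto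
    also have "\<dots> \<le> 1 + X u + 2 * (X u)\<^sup>2 + 9 * exc (Z 0) u"
      using exp_le_quadratic[OF Xle[OF u]] by simp
    finally show ?thesis using False by simp
  qed
  have EX: "Ev X \<le> 0"
  proof -
    have "Ev (\<eta> j) \<le> 0" if j: "j < r" for j
    proof (cases "j = 0")
      case True
      have "Ev (low (Z 0)) \<le> Ev (Z 0)" by (intro Ev_mono) (simp add: low_def)
      moreover have "\<eta> 0 = (\<lambda>u. low (Z 0) u - 1)" by (auto simp: \<eta>_def)
      ultimately show ?thesis using True Z[OF j] by (simp add: Ev_diff dens_def)
    next
      case False
      have "Ev (\<eta> j) \<le> Ev (\<lambda>u. G (low (Z j)) u + G (exc (Z j)) u - 1)"
        using False by (intro Ev_mono) (simp add: \<eta>_def)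
      also have "\<dots> = Ev (G (\<lambda>v. low (Z j) v + exc (Z j) v)) - 1"
        unfolding Ev_diff G_add[symmetric] by simp
      also have "\<dots> = 0" using Z[OF j] unfolding Ev_G low_exc[symmetric] by (simp add: dens_def)
      finally show ?thesis .
    qed
    then show ?thesis unfolding X_def Ev_sum by (intro sum_nonpos) auto
  qed
  have EX2: "Ev (\<lambda>u. (X u)\<^sup>2) \<le> 24 * (real r)\<^sup>2 * \<tau>"
  proof -
    have e2: "Ev (\<lambda>u. (\<eta> j u)\<^sup>2) \<le> 24 * \<tau>" if j: "j < r" for j
    proof (cases "j = 0")
      case True
      then show ?thesis using Ev_low_sq[OF Z[OF j]] tau by (simp add: \<eta>_def)
    next
      case False
      let ?a = "\<lambda>u. G (\<lambda>v. low (Z j) v - 1) u" and ?b = "\<lambda>u. min (G (exc (Z j)) u) \<rho>"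
      \<comment> \<open>The truncated part is squared at the price of a factor \<rho>, which cancels
        the factor r in the mean of the excess; both halves then contribute 12 \<tau>.\<close>
      have "(\<eta> j u)\<^sup>2 \<le> 2 * (?a u)\<^sup>2 + 2 * (\<rho> * G (exc (Z j)) u)" if u: "u < n" for u
      proof -
        have eq: "\<eta> j u = ?a u + ?b u" using False u by (simp add: \<eta>_def G_diff G_const)
        have "(?a u + ?b u)\<^sup>2 \<le> 2 * (?a u)\<^sup>2 + 2 * (?b u)\<^sup>2"
          using zero_le_power2[of "?a u - ?b u"] by (simp add: power2_eq_square algebra_simps)
        moreover have "0 \<le> G (exc (Z j)) u" using u exc_nonneg by (intro G_nonneg) auto
        then have "(?b u)\<^sup>2 \<le> \<rho> * G (exc (Z j)) u"
          unfolding power2_eq_square using rho by (intro mult_mono) auto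
        ultimately show ?thesis unfolding eq by linarith
      qed
      then have "Ev (\<lambda>u. (\<eta> j u)\<^sup>2) \<le> Ev (\<lambda>u. 2 * (?a u)\<^sup>2 + 2 * (\<rho> * G (exc (Z j)) u))" by (rule Ev_mono)
      also have "\<dots> = 2 * Ev (\<lambda>u. (?a u)\<^sup>2) + 2 * (\<rho> * Ev (exc (Z j)))"
        unfolding Ev_add Ev_cmult Ev_G ..
      also have "\<dots> \<le> 2 * (6 * \<tau>) + 2 * (\<rho> * (6 * real r * \<tau>))"
        using Ev_G_square[of "\<lambda>v. low (Z j) v - 1"] Ev_low_sq[OF Z[OF j]] Ev_exc[OF Z[OF j]] rho
        by (intro add_mono mult_left_mono) auto
      also have "\<dots> = 24 * \<tau>" using r by (simp add: rho_eq)
      finally show ?thesis .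
    qed
    have "Ev (\<lambda>u. (X u)\<^sup>2) \<le> Ev (\<lambda>u. (\<Sum>j<r. (\<eta> j u)\<^sup>2) * real r)"
      unfolding X_def using sum_squared_le_sum_of_squares[of _ "{..<r}"] by (intro Ev_mono) force
    also have "\<dots> = (\<Sum>j<r. Ev (\<lambda>u. (\<eta> j u)\<^sup>2)) * real r" by (simp add: Ev_multc Ev_sum)
    also have "\<dots> \<le> (\<Sum>j<r. 24 * \<tau>) * real r" using e2 by (intro mult_right_mono sum_mono) auto
    finally show ?thesis by (simp add: power2_eq_square algebra_simps)
  qed
  have EB: "Ev (\<lambda>u. of_bool (u \<in> B)) \<le> real r * (real r * H * \<omega>)"
  proof -
    have om: "0 \<le> real r * H * \<omega>"
      using big_card[OF Z[of 0]] r by (auto intro: order_trans[rotated])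
    have "card B \<le> (\<Sum>j\<in>{1..<r}. card (big (Z j)))" unfolding B_def by (rule card_UN_le) simp
    then have "real (card B) \<le> (\<Sum>j\<in>{1..<r}. real (card (big (Z j))))"
      by (metis of_nat_le_iff of_nat_sum)
    then have "real (card B) / real n \<le> (\<Sum>j\<in>{1..<r}. real (card (big (Z j)))) / real n"
      by (intro divide_right_mono) auto
    also have "\<dots> = (\<Sum>j\<in>{1..<r}. real (card (big (Z j))) / real n)" by (rule sum_divide_distrib)
    also have "\<dots> \<le> (\<Sum>j\<in>{1..<r}. real r * H * \<omega>)" using big_card Z by (intro sum_mono) auto
    also have "\<dots> \<le> real r * (real r * H * \<omega>)" using om by (simp add: mult_right_mono)
    finally show ?thesis using Ev_indicator[OF Bsub] by simp
  qed
  have "Ev (\<lambda>u. Z 0 u * (\<Prod>j\<in>{1..<r}. G (Z j) u))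
     \<le> Ev (\<lambda>u. H ^ r * of_bool (u \<in> B) + (1 + X u + 2 * (X u)\<^sup>2 + 9 * exc (Z 0) u))"
    using point by (rule Ev_mono)
  also have "\<dots> = H ^ r * Ev (\<lambda>u. of_bool (u \<in> B)) + (1 + Ev X + 2 * Ev (\<lambda>u. (X u)\<^sup>2) + 9 * Ev (exc (Z 0)))"
    unfolding Ev_add Ev_cmult by simp
  also have "\<dots> \<le> H ^ r * (real r * (real r * H * \<omega>)) + (1 + 0 + 2 * (24 * (real r)\<^sup>2 * \<tau>) + 9 * (6 * real r * \<tau>))"
    using EB EX EX2 Ev_exc[OF Z[of 0]] r H by (intro add_mono mult_left_mono) auto
  also have "\<dots> \<le> 1 + 75 * (real r)\<^sup>2 * \<tau> + real r * (real r * H * \<omega>) * H ^ r"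
  proof -
    have "2 * (real r * \<tau>) \<le> real r * (real r * \<tau>)" using r tau by (intro mult_right_mono) auto
    then have "54 * (real r * \<tau>) \<le> 27 * (real r * (real r * \<tau>))" by linarith
    then show ?thesis by (simp add: power2_eq_square algebra_simps)
  qed
  finally show ?thesis .
qed

end

end

section \<open>Symmetric functions on tuples and their marginals\<close>

definition symm :: "(nat list \<Rightarrow> real) \<Rightarrow> bool" where
  "symm g \<longleftrightarrow> (\<forall>xs ys. mset xs = mset ys \<longrightarrow> g xs = g ys)"

lemma sum_lists_Suc:
  "(\<Sum>xs | length xs = Suc k \<and> set xs \<subseteq> A. f xs) = (\<Sum>a\<in>A. \<Sum>xs | length xs = k \<and> set xs \<subseteq> A. f (a # xs))"
proof -
  have "(\<Sum>xs | length xs = Suc k \<and> set xs \<subseteq> A. f xs)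
      = (\<Sum>(a, xs)\<in>A \<times> {xs. length xs = k \<and> set xs \<subseteq> A}. f (a # xs))"
    by (rule sum.reindex_bij_witness[of _ "\<lambda>(v, xs). v # xs" "\<lambda>xs. (hd xs, tl xs)"])
      (auto simp: length_Suc_conv)
  then show ?thesis by (simp add: sum.cartesian_product)
qed

lemma sum_lists_0: "(\<Sum>xs | length xs = 0 \<and> set xs \<subseteq> A. f xs) = f []"
proof -
  have "{xs. length xs = 0 \<and> set xs \<subseteq> A} = {[]}" by auto
  then show ?thesis by simp
qed

lemma sum_lists_prod:
  fixes F :: "nat \<Rightarrow> 'a \<Rightarrow> real"
  shows "(\<Sum>xs | length xs = k \<and> set xs \<subseteq> A. \<Prod>j<k. F j (xs ! j)) = (\<Prod>j<k. \<Sum>a\<in>A. F j a)"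
proof (induction k arbitrary: F)
  case 0
  show ?case by (subst sum_lists_0) simp
next
  case (Suc k)
  show ?case
    unfolding sum_lists_Suc prod.lessThan_Suc_shift
    by (simp add: sum_distrib_left[symmetric] Suc.IH[of "\<lambda>j. F (Suc j)"] sum_distrib_right)
qed

context regular_adj
begin

text \<open>The mean over uniformly random tuples of length \<open>t\<close>. The recursive form
  suits revealing one coordinate after the other; \<open>EL_eq_sum\<close> gives the closed
  form.\<close>

fun EL :: "nat \<Rightarrow> (nat list \<Rightarrow> real) \<Rightarrow> real" where
  "EL 0 F = F []"
| "EL (Suc t) F = Ev (\<lambda>v. EL t (\<lambda>xs. F (v # xs)))"

lemma EL_mono: "(\<And>xs. length xs = t \<Longrightarrow> set xs \<subseteq> {..<n} \<Longrightarrow> f xs \<le> g xs) \<Longrightarrow> EL t f \<le> EL t g"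
  by (induction t arbitrary: f g) (auto intro!: Ev_mono)

lemma EL_const [simp]: "EL t (\<lambda>_. c) = c"
  by (induction t) auto

lemma EL_add: "EL t (\<lambda>xs. f xs + g xs) = EL t f + EL t g"
  by (induction t arbitrary: f g) (auto simp: Ev_add)

lemma EL_diff: "EL t (\<lambda>xs. f xs - g xs) = EL t f - EL t g"
  by (induction t arbitrary: f g) (auto simp: Ev_diff)

lemma EL_cmult: "EL t (\<lambda>xs. c * f xs) = c * EL t f"
  by (induction t arbitrary: f) (auto simp: Ev_cmult)

lemma EL_sum: "EL t (\<lambda>xs. \<Sum>j\<in>J. f j xs) = (\<Sum>j\<in>J. EL t (f j))"
  by (induction t arbitrary: f) (auto simp: Ev_sum)

lemma EL_divide: "EL t (\<lambda>xs. f xs / c) = EL t f / c"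
  using EL_cmult[of t "1 / c" f] by simp

lemma EL_G: "EL t (\<lambda>xs. G (\<lambda>v. f v xs) u) = G (\<lambda>v. EL t (f v)) u"
  unfolding G_def EL_divide EL_sum ..

lemma EL_prod_list: "EL t (\<lambda>xs. prod_list (map q xs)) = Ev q ^ t"
  by (induction t) (auto simp: EL_cmult Ev_multc)

lemma EL_eq_sum: "EL t f = (\<Sum>xs | length xs = t \<and> set xs \<subseteq> {..<n}. f xs) / real n ^ t"
proof (induction t arbitrary: f)
  case 0
  show ?case by (subst sum_lists_0) simp
next
  case (Suc t)
  then show ?case
    by (simp only: sum_lists_Suc EL.simps Ev_def) (simp add: sum_divide_distrib[symmetric])
qed

lemma symm_Cons: "symm g \<Longrightarrow> symm (\<lambda>xs. g (v # xs))"
  by (auto simp: symm_def)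

lemma symm_G: "symm g \<Longrightarrow> symm (\<lambda>xs. G (\<lambda>v. g (v # xs)) u)"
  unfolding symm_def
proof (intro allI impI)
  fix xs ys :: "nat list"
  assume g: "\<forall>xs ys. mset xs = mset ys \<longrightarrow> g xs = g ys" and "mset xs = mset ys"
  then have "mset (v # xs) = mset (v # ys)" for v by simp
  then have "g (v # xs) = g (v # ys)" for v using g by blast
  then show "G (\<lambda>v. g (v # xs)) u = G (\<lambda>v. g (v # ys)) u" by simp
qed

text \<open>By symmetry every coordinate contributes as much as the first one. This factor
  \<open>Suc t\<close> later becomes the denominator of the entropy bound.\<close>

lemma EL_symm_sum_list:
  assumes "symm g"
  shows "EL (Suc t) (\<lambda>xs. g xs * sum_list (map l xs)) = real (Suc t) * Ev (\<lambda>v. EL t (\<lambda>xs. g (v # xs)) * l v)"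
  using assms
proof (induction t arbitrary: g)
  case (Suc t)
  have "EL (Suc (Suc t)) (\<lambda>xs. g xs * sum_list (map l xs))
     = Ev (\<lambda>v. EL (Suc t) (\<lambda>xs. l v * g (v # xs) + g (v # xs) * sum_list (map l xs)))"
    by (simp only: EL.simps(2)[of "Suc t"] list.map sum_list.Cons distrib_left mult.commute)
  also have "\<dots> = Ev (\<lambda>v. EL (Suc t) (\<lambda>xs. g (v # xs)) * l v)
     + Ev (\<lambda>v. EL (Suc t) (\<lambda>xs. g (v # xs) * sum_list (map l xs)))"
    unfolding EL_add EL_cmult Ev_add by (simp add: mult.commute)
  also have "Ev (\<lambda>v. EL (Suc t) (\<lambda>xs. g (v # xs) * sum_list (map l xs)))
     = Ev (\<lambda>v. real (Suc t) * Ev (\<lambda>w. EL t (\<lambda>xs. g (v # w # xs)) * l w))"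
    using Suc.IH[OF symm_Cons[OF Suc.prems]] by simp
  also have "\<dots> = real (Suc t) * Ev (\<lambda>w. Ev (\<lambda>v. EL t (\<lambda>xs. g (v # w # xs)) * l w))"
    unfolding Ev_cmult by (subst Ev_swap) simp
  also have "(\<lambda>w. Ev (\<lambda>v. EL t (\<lambda>xs. g (v # w # xs)) * l w)) = (\<lambda>w. EL (Suc t) (\<lambda>xs. g (w # xs)) * l w)"
  proof
    fix w
    have "(\<lambda>v. EL t (\<lambda>xs. g (v # w # xs))) = (\<lambda>v. EL t (\<lambda>xs. g (w # v # xs)))"
    proof
      fix v
      have "(\<lambda>xs. g (v # w # xs)) = (\<lambda>xs. g (w # v # xs))"
        using Suc.prems by (auto simp: symm_def add_mset_commute)
      then show "EL t (\<lambda>xs. g (v # w # xs)) = EL t (\<lambda>xs. g (w # v # xs))" by simp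
    qed
    from arg_cong[OF this, of Ev]
    show "Ev (\<lambda>v. EL t (\<lambda>xs. g (v # w # xs)) * l w) = EL (Suc t) (\<lambda>xs. g (w # xs)) * l w"
      unfolding Ev_multc EL.simps by simp
  qed
  finally show ?case by (simp add: algebra_simps)
qed simp

text \<open>Gibbs' inequality, comparing \<open>g\<close> with the product density \<open>\<Prod>i. \<Phi> (xs ! i) / y\<close>.\<close>

lemma marginal_entropy:
  fixes t :: nat
  assumes sy: "symm g" and g: "\<And>xs. 0 < g xs" "\<And>xs. g xs \<le> K"
  defines "\<Phi> \<equiv> \<lambda>v. EL t (\<lambda>xs. g (v # xs))"
  defines "y \<equiv> EL (Suc t) g"
  shows "Ev (\<lambda>v. psi (\<Phi> v / y)) \<le> ln (K / y) / real (Suc t)"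
proof -
  have y: "y = Ev \<Phi>" unfolding y_def EL.simps \<Phi>_def ..
  have pos: "0 < EL s h" if "\<And>xs. 0 < h xs" for s h
    using that
  proof (induction s arbitrary: h)
    case (Suc s)
    have "0 < (\<Sum>v<n. EL s (\<lambda>xs. h (v # xs)))" using Suc n_pos by (intro sum_pos) auto
    then show ?case using n_pos by (simp add: Ev_def)
  qed simp
  have y0: "0 < y" unfolding y_def using g by (intro pos) auto
  have P0: "0 < \<Phi> v" for v unfolding \<Phi>_def using g by (intro pos) auto
  define q where "q xs = prod_list (map (\<lambda>v. \<Phi> v / y) xs)" for xs
  define l where "l v = ln (\<Phi> v / y)" for v
  have q: "0 < q xs \<and> ln (q xs) = sum_list (map l xs)" for xs
  proof (induction xs)
    case (Cons a xs)
    have a: "0 < \<Phi> a / y" using P0 y0 by simp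
    have "q (a # xs) = \<Phi> a / y * q xs" by (simp add: q_def)
    moreover have "0 < \<Phi> a / y * q xs" using a Cons by (intro mult_pos_pos) auto
    moreover have "ln (\<Phi> a / y * q xs) = l a + ln (q xs)"
      unfolding l_def using a Cons by (intro ln_mult_pos) auto
    ultimately show ?case using Cons by simp
  qed (simp add: q_def)
  have Eq: "EL (Suc t) q = 1"
    unfolding q_def EL_prod_list using y y0 by (simp add: Ev_divide)
  \<comment> \<open>ln x \<le> x - 1 at x = y q / g. The last two terms cancel in the mean, because
    \<open>q\<close> has mean 1 and \<open>g\<close> has mean \<open>y\<close>.\<close>
  have pt: "g xs * sum_list (map l xs) \<le> ln (K / y) * g xs + (y * q xs - g xs)" for xs
  proof -
    have gx: "0 < g xs" "g xs \<le> K" using g by auto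
    have "ln (y * q xs / g xs) \<le> y * q xs / g xs - 1"
      using gx y0 q[of xs] by (intro ln_le_minus_one) simp
    moreover have "ln (y * q xs / g xs) = sum_list (map l xs) - ln (g xs / y)"
      using gx y0 q[of xs] by (simp add: ln_div ln_mult_pos)
    moreover have "ln (g xs / y) \<le> ln (K / y)" using gx y0 by (simp add: divide_right_mono)
    ultimately have "sum_list (map l xs) \<le> ln (K / y) + (y * q xs / g xs - 1)" by linarith
    then have "g xs * sum_list (map l xs) \<le> g xs * (ln (K / y) + (y * q xs / g xs - 1))"
      using gx by (intro mult_left_mono) auto
    also have "\<dots> = ln (K / y) * g xs + (y * q xs - g xs)" using gx by (simp add: field_simps)
    finally show ?thesis .
  qed
  have "real (Suc t) * Ev (\<lambda>v. \<Phi> v * l v) = EL (Suc t) (\<lambda>xs. g xs * sum_list (map l xs))"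
    unfolding \<Phi>_def by (rule EL_symm_sum_list[OF sy, symmetric])
  also have "\<dots> \<le> EL (Suc t) (\<lambda>xs. ln (K / y) * g xs + (y * q xs - g xs))"
    using pt by (intro EL_mono)
  also have "\<dots> = ln (K / y) * y"
    unfolding EL_add EL_cmult EL_diff y_def[symmetric] Eq by simp
  finally have main: "real (Suc t) * Ev (\<lambda>v. \<Phi> v * l v) \<le> ln (K / y) * y" .
  have "Ev (\<lambda>v. psi (\<Phi> v / y)) = Ev (\<lambda>v. (\<Phi> v * l v) / y - \<Phi> v / y + 1)"
    by (simp add: psi_def l_def)
  also have "\<dots> = Ev (\<lambda>v. \<Phi> v * l v) / y"
    unfolding Ev_add Ev_diff Ev_divide y[symmetric] using y0 by simp
  finally have e: "Ev (\<lambda>v. psi (\<Phi> v / y)) = Ev (\<lambda>v. \<Phi> v * l v) / y" .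
  have "real (Suc t) * Ev (\<lambda>v. \<Phi> v * l v) / y \<le> ln (K / y)"
    using main y0 by (simp only: pos_divide_le_eq)
  then show ?thesis unfolding e by (simp only: pos_le_divide_eq of_nat_0_less_iff zero_less_Suc) (simp add: mult.commute)
qed

text \<open>Average over the rows \<open>xs\<close> whose first \<open>m\<close> entries are adjacent to those of \<open>z\<close>.\<close>

fun Dn :: "nat \<Rightarrow> nat \<Rightarrow> (nat list \<Rightarrow> real) \<Rightarrow> nat list \<Rightarrow> real" where
  "Dn 0 t g z = EL t g"
| "Dn (Suc m) (Suc t) g (u # z) = Dn m t (\<lambda>xs. G (\<lambda>v. g (v # xs)) u) z"
| "Dn (Suc m) _ g _ = 0"

lemma Dn_nonneg:
  assumes "set z \<subseteq> {..<n}" "\<And>xs. 0 \<le> g xs"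
  shows "0 \<le> Dn m t g z"
  using assms
proof (induction m t g z rule: Dn.induct)
  case (1 t g z)
  then show ?case using EL_mono[of t "\<lambda>_. 0" g] by simp
next
  case (2 m t g u z)
  have "0 \<le> G (\<lambda>v. g (v # xs)) u" for xs using 2 by (intro G_nonneg) auto
  then show ?case using 2 by simp
qed auto

text \<open>Reveal the first linked coordinate u. Given u, row 0 is restricted to start with u and
  the other rows are averaged over the neighbours of u; these functions are again symmetric with
  values between \<theta> and K, so the induction hypothesis applies with \<open>m\<close> and
  \<open>t\<close> both lowered by one. What remains is a product of marginals at u, handled by
  \<open>one_step_density\<close> after division by the means. The entropy condition is stated with
  \<open>t - m\<close> because this difference is the same in every round.\<close>

lemma Dn_prod_bound:
  fixes g :: "nat \<Rightarrow> nat list \<Rightarrow> real"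
  assumes r: "2 \<le> r" and th: "0 < \<theta>" "\<theta> \<le> K" and tau: "0 \<le> \<tau>"
    and no: "\<And>T. T \<subseteq> {..<n} \<Longrightarrow> real (card T) \<le> 12 * (real r)\<^sup>2 * \<tau> * real n \<Longrightarrow> inside T \<le> \<omega>"
    and mt: "m \<le> t" "ln (K / \<theta>) \<le> \<tau> * real (t - m)"
    and g: "\<And>j. j < r \<Longrightarrow> symm (g j)" "\<And>j xs. j < r \<Longrightarrow> \<theta> \<le> g j xs \<and> g j xs \<le> K"
  shows "EL t (\<lambda>z. g 0 z * (\<Prod>j\<in>{1..<r}. Dn m t (g j) z))
     \<le> (\<Prod>j<r. EL t (g j)) *
        (1 + 75 * (real r)\<^sup>2 * \<tau> + real r * (real r * (K / \<theta>) * \<omega>) * (K / \<theta>) ^ r) ^ m"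
  using mt g
proof (induction m arbitrary: t g)
  have split: "{..<r} = insert 0 {1..<r}" using r by auto
  case 0
  have "EL t (\<lambda>z. g 0 z * (\<Prod>j\<in>{1..<r}. Dn 0 t (g j) z)) = (\<Prod>j\<in>{1..<r}. EL t (g j)) * EL t (g 0)"
    unfolding EL_cmult[symmetric] by (simp add: mult.commute)
  also have "\<dots> = (\<Prod>j<r. EL t (g j))" unfolding split by (simp add: mult.commute)
  finally show ?case by simp
next
  have split: "{..<r} = insert 0 {1..<r}" using r by auto
  case (Suc m)
  define \<kappa> where "\<kappa> = 1 + 75 * (real r)\<^sup>2 * \<tau> + real r * (real r * (K / \<theta>) * \<omega>) * (K / \<theta>) ^ r"
  define H where "H = K / \<theta>"
  have H1: "1 \<le> H" using th by (simp add: H_def)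
  have om: "0 \<le> \<omega>" using no[of "{}"] tau by (simp add: inside_def)
  have kap: "0 \<le> \<kappa>" using tau om th by (simp add: \<kappa>_def)
  obtain t' where t: "t = Suc t'" using Suc.prems(1) by (cases t) auto
  define \<Phi> where "\<Phi> j v = EL t' (\<lambda>xs. g j (v # xs))" for j v
  define y where "y j = EL t (g j)" for j
  have yE: "y j = Ev (\<Phi> j)" for j
    unfolding y_def t EL.simps \<Phi>_def ..
  have ELb: "\<theta> \<le> EL s h \<and> EL s h \<le> K" if "\<And>xs. \<theta> \<le> h xs \<and> h xs \<le> K" for s h
    using EL_mono[of s "\<lambda>_. \<theta>" h] EL_mono[of s h "\<lambda>_. K"] that by simp
  have Pb: "\<theta> \<le> \<Phi> j v \<and> \<Phi> j v \<le> K" if "j < r" for j v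
    unfolding \<Phi>_def using Suc.prems(4)[OF that] by (intro ELb) auto
  have yb: "\<theta> \<le> y j \<and> y j \<le> K" if "j < r" for j
    unfolding y_def using Suc.prems(4)[OF that] by (intro ELb) auto
  have dens: "dens H \<tau> (\<lambda>v. \<Phi> j v / y j)" if j: "j < r" for j
    unfolding dens_def
  proof (intro conjI allI impI)
    fix v assume "v < n"
    have "\<Phi> j v / y j \<le> K / \<theta>" using Pb[OF j, of v] yb[OF j] th by (intro frac_le) auto
    then show "\<Phi> j v / y j \<le> H" by (simp add: H_def)
    show "0 < \<Phi> j v / y j" using Pb[OF j, of v] yb[OF j] th by simp
  next
    show "Ev (\<lambda>v. \<Phi> j v / y j) = 1" using yb[OF j] th by (simp add: Ev_divide yE)
  next
    have a: "Ev (\<lambda>v. psi (\<Phi> j v / y j)) \<le> ln (K / y j) / real (Suc t')"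
      unfolding \<Phi>_def y_def t
    proof (rule marginal_entropy)
      show "symm (g j)" using Suc.prems j by simp
      show "0 < g j xs" for xs using Suc.prems(4)[OF j, of xs] th by linarith
      show "g j xs \<le> K" for xs using Suc.prems(4)[OF j] by simp
    qed
    have "ln (K / y j) \<le> ln (K / \<theta>)"
      using yb[OF j] th by (subst ln_le_cancel_iff) (auto intro!: divide_left_mono mult_pos_pos)
    also have "ln (K / \<theta>) \<le> \<tau> * real (t - Suc m)" using Suc.prems by simp
    also have "\<dots> \<le> \<tau> * real (Suc t')" using tau t by (intro mult_left_mono) auto
    finally have "ln (K / y j) / real (Suc t') \<le> \<tau>" by (subst pos_divide_le_eq) auto
    with a show "Ev (\<lambda>v. psi (\<Phi> j v / y j)) \<le> \<tau>" by linarith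
  qed
  have one: "Ev (\<lambda>u. \<Phi> 0 u * (\<Prod>j\<in>{1..<r}. G (\<Phi> j) u)) \<le> (\<Prod>j<r. y j) * \<kappa>"
  proof -
    have "Ev (\<lambda>u. \<Phi> 0 u / y 0 * (\<Prod>j\<in>{1..<r}. G (\<lambda>v. \<Phi> j v / y j) u))
       \<le> 1 + 75 * (real r)\<^sup>2 * \<tau> + real r * (real r * H * \<omega>) * H ^ r"
      by (rule one_step_density[OF r refl H1 tau no]) (use dens in auto)
    then have "Ev (\<lambda>u. \<Phi> 0 u / y 0 * (\<Prod>j\<in>{1..<r}. G (\<lambda>v. \<Phi> j v / y j) u)) \<le> \<kappa>"
      by (simp only: \<kappa>_def H_def)
    moreover have "Ev (\<lambda>u. \<Phi> 0 u / y 0 * (\<Prod>j\<in>{1..<r}. G (\<lambda>v. \<Phi> j v / y j) u))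
      = Ev (\<lambda>u. \<Phi> 0 u * (\<Prod>j\<in>{1..<r}. G (\<Phi> j) u)) / (\<Prod>j<r. y j)"
      unfolding Ev_divide[symmetric] split by (simp add: G_divide prod_dividef)
    moreover have "0 < (\<Prod>j<r. y j)" using yb th by (intro prod_pos) force
    ultimately show ?thesis by (simp add: field_simps)
  qed
  have "EL t (\<lambda>z. g 0 z * (\<Prod>j\<in>{1..<r}. Dn (Suc m) t (g j) z))
      = Ev (\<lambda>u. EL t' (\<lambda>z. g 0 (u # z) * (\<Prod>j\<in>{1..<r}. Dn m t' (\<lambda>xs. G (\<lambda>v. g j (v # xs)) u) z)))"
    by (simp add: t)
  also have "\<dots> \<le> Ev (\<lambda>u. \<Phi> 0 u * (\<Prod>j\<in>{1..<r}. G (\<Phi> j) u) * \<kappa> ^ m)"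
  proof (rule Ev_mono)
    fix u assume u: "u < n"
    define g' where "g' j xs = (if j = 0 then g 0 (u # xs) else G (\<lambda>v. g j (v # xs)) u)" for j xs
    have "EL t' (\<lambda>z. g' 0 z * (\<Prod>j\<in>{1..<r}. Dn m t' (g' j) z)) \<le> (\<Prod>j<r. EL t' (g' j)) * \<kappa> ^ m"
      unfolding \<kappa>_def
    proof (rule Suc.IH)
      show "m \<le> t'" using Suc.prems t by simp
      show "ln (K / \<theta>) \<le> \<tau> * real (t' - m)" using Suc.prems t by simp
      fix j assume j: "j < r"
      show "symm (g' j)" unfolding g'_def using symm_Cons symm_G Suc.prems(3)[OF j] by (cases "j = 0") auto
      fix xs
      show "\<theta> \<le> g' j xs \<and> g' j xs \<le> K"
      proof (cases "j = 0")
        case False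
        then show ?thesis
          using G_mono[OF u, of "\<lambda>_. \<theta>" "\<lambda>v. g j (v # xs)"] G_mono[OF u, of "\<lambda>v. g j (v # xs)" "\<lambda>_. K"]
            Suc.prems(4)[OF j] G_const[OF u] by (simp add: g'_def)
      qed (use Suc.prems(4)[OF j] in \<open>simp add: g'_def\<close>)
    qed
    moreover have "(\<Prod>j<r. EL t' (g' j)) = \<Phi> 0 u * (\<Prod>j\<in>{1..<r}. G (\<Phi> j) u)"
    proof -
      have "EL t' (g' 0) = \<Phi> 0 u" by (simp add: g'_def[abs_def] \<Phi>_def)
      moreover have "EL t' (g' j) = G (\<Phi> j) u" if "j \<in> {1..<r}" for j
        using that EL_G[of t' "\<lambda>v xs. g j (v # xs)" u] by (simp add: g'_def[abs_def] \<Phi>_def[abs_def])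
      ultimately show ?thesis unfolding split by simp
    qed
    moreover have "(\<lambda>z. g' 0 z * (\<Prod>j\<in>{1..<r}. Dn m t' (g' j) z)) =
       (\<lambda>z. g 0 (u # z) * (\<Prod>j\<in>{1..<r}. Dn m t' (\<lambda>xs. G (\<lambda>v. g j (v # xs)) u) z))"
      by (intro ext arg_cong2[where f = "(*)"] prod.cong) (auto simp: g'_def[abs_def])
    ultimately show "EL t' (\<lambda>z. g 0 (u # z) * (\<Prod>j\<in>{1..<r}. Dn m t' (\<lambda>xs. G (\<lambda>v. g j (v # xs)) u) z))
        \<le> \<Phi> 0 u * (\<Prod>j\<in>{1..<r}. G (\<Phi> j) u) * \<kappa> ^ m" by simp
  qed
  also have "\<dots> \<le> (\<Prod>j<r. y j) * \<kappa> * \<kappa> ^ m"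
    unfolding Ev_multc using one kap by (intro mult_right_mono) auto
  finally show ?case unfolding \<kappa>_def[symmetric] y_def by (simp add: mult.assoc)
qed

lemma Dn_eq_sum:
  assumes "m \<le> t" "length z = t" "set z \<subseteq> {..<n}"
  shows "(\<Sum>xs | length xs = t \<and> set xs \<subseteq> {..<n} \<and> (\<forall>i < m. xs ! i \<in> nb (z ! i)). g xs)
     = Dn m t g z * (real d ^ m * real n ^ (t - m))"
  using assms
proof (induction m arbitrary: t z g)
  case 0
  then show ?case using n_pos by (simp add: EL_eq_sum)
next
  case (Suc m)
  obtain t' where t: "t = Suc t'" using Suc.prems(1) by (cases t) auto
  obtain u z' where z: "z = u # z'" "length z' = t'" using Suc.prems(2) t by (cases z) auto
  have u: "u < n" "set z' \<subseteq> {..<n}" using Suc.prems(3) z by auto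
  let ?L = "{xs. length xs = t' \<and> set xs \<subseteq> {..<n} \<and> (\<forall>i < m. xs ! i \<in> nb (z' ! i))}"
  have "(\<Sum>xs | length xs = t \<and> set xs \<subseteq> {..<n} \<and> (\<forall>i < Suc m. xs ! i \<in> nb (z ! i)). g xs)
     = (\<Sum>(v, xs)\<in>nb u \<times> ?L. g (v # xs))"
  proof (rule sum.reindex_bij_witness[of _ "\<lambda>(v, xs). v # xs" "\<lambda>xs. (hd xs, tl xs)"])
    fix xs assume xs: "xs \<in> {xs. length xs = t \<and> set xs \<subseteq> {..<n} \<and> (\<forall>i < Suc m. xs ! i \<in> nb (z ! i))}"
    then obtain v ys where v: "xs = v # ys" "length ys = t'" using t by (cases xs) auto
    have "\<forall>i < m. (v # ys) ! Suc i \<in> nb (z ! Suc i)" using xs v by blast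
    moreover have "(v # ys) ! 0 \<in> nb (z ! 0)" using xs v by blast
    ultimately show "(hd xs, tl xs) \<in> nb u \<times> ?L" using xs v z by auto
    show "(case (hd xs, tl xs) of (v, xs) \<Rightarrow> v # xs) = xs" using v by simp
    show "(case (hd xs, tl xs) of (v, xs) \<Rightarrow> g (v # xs)) = g xs" using v by simp
  next
    fix p assume "p \<in> nb u \<times> ?L"
    then obtain v xs where p: "p = (v, xs)" "v \<in> nb u" "xs \<in> ?L" by auto
    have "(v # xs) ! i \<in> nb (z ! i)" if "i < Suc m" for i using p z that by (cases i) auto
    then show "(case p of (v, xs) \<Rightarrow> v # xs) \<in> {xs. length xs = t \<and> set xs \<subseteq> {..<n} \<and> (\<forall>i < Suc m. xs ! i \<in> nb (z ! i))}"
      using p t nb_sub[OF u(1)] by auto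
  qed auto
  also have "\<dots> = (\<Sum>xs\<in>?L. \<Sum>v\<in>nb u. g (v # xs))"
    by (subst sum.cartesian_product[symmetric]) (rule sum.swap)
  also have "\<dots> = real d * (\<Sum>xs\<in>?L. G (\<lambda>v. g (v # xs)) u)"
    using d_pos by (simp add: G_def sum_divide_distrib[symmetric])
  also have "\<dots> = real d * (Dn m t' (\<lambda>xs. G (\<lambda>v. g (v # xs)) u) z' * (real d ^ m * real n ^ (t' - m)))"
    using Suc.IH[of t' z' "\<lambda>xs. G (\<lambda>v. g (v # xs)) u"] Suc.prems(1) t z u by simp
  finally show ?case by (simp add: t z)
qed

end

section \<open>Labels and edge counts\<close>

text \<open>Labels are triples \<open>(c, a, \<beta>)\<close> with \<open>c < q\<close>, \<open>a < K\<close> and \<open>\<beta> : {..<K} \<rightarrow> P\<close>; the colour of a pair of labels is \<open>\<beta>\<close>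
  of the second one at \<open>a\<close> of the first one, and the discrepancy is bounded by a second moment argument.\<close>

lemma quasirandom_colouring:
  fixes P :: "'a set" and \<eta> :: real
  assumes P: "finite P" "P \<noteq> {}" and \<eta>: "0 < \<eta>" and q: "0 < (q::nat)"
  shows "\<exists>B h. 0 < B \<and> q dvd B \<and> (\<forall>b1 < B. \<forall>b2 < B. h b1 b2 \<in> P) \<and>
    (\<forall>\<sigma> \<in> P. \<forall>S1 \<subseteq> {..<B}. \<forall>S2 \<subseteq> {..<B}.
       (\<Sum>b1\<in>S1. \<Sum>b2\<in>S2. of_bool (h b1 b2 = \<sigma>)) \<le> real (card S1) * real (card S2) / real (card P) + \<eta> * (real B)\<^sup>2)"
proof -
  define L where "L = card P"
  have L: "0 < L" using P by (simp add: L_def card_gt_0_iff)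
  \<comment> \<open>The mean square discrepancy will be a 1 / K fraction of the trivial bound, which
    has to be at most \<eta>^2.\<close>
  obtain K :: nat where K: "1 / \<eta>\<^sup>2 < real K" using reals_Archimedean2 by blast
  have "0 < 1 / \<eta>\<^sup>2" using \<eta> by simp
  then have K0: "0 < K" using K by (metis gr0I less_trans of_nat_0 order_less_irrefl)
  define F where "F = {..<K} \<rightarrow>\<^sub>E P"
  have finF: "finite F" and cF: "card F = L ^ K"
    unfolding F_def using P by (auto intro!: finite_PiE simp: card_PiE L_def)
  \<comment> \<open>The component below \<open>q\<close> does not influence the colours; it makes
    \<open>B\<close> a multiple of \<open>q\<close>.\<close>
  define X where "X = {..<q} \<times> {..<K} \<times> F"
  define B where "B = card X"
  have BX: "B = q * K * L ^ K" by (simp add: B_def X_def card_cartesian_product cF)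
  have B0: "0 < B" using q K0 L by (simp add: BX)
  have finX: "finite X" using finF by (simp add: X_def)
  obtain \<phi> where \<phi>: "bij_betw \<phi> {..<B} X"
    using ex_bij_betw_nat_finite[OF finX] by (auto simp: B_def atLeast0LessThan)
  define a where "a b = fst (snd (\<phi> b))" for b
  define \<beta> where "\<beta> b = snd (snd (\<phi> b))" for b
  have phiX: "\<phi> b \<in> X" if "b < B" for b using \<phi> that by (auto simp: bij_betw_def)
  have aK: "a b < K" and bF: "\<beta> b \<in> F" if "b < B" for b using phiX[OF that] by (auto simp: a_def \<beta>_def X_def)
  define h where "h b1 b2 = \<beta> b2 (a b1)" for b1 b2
  have hP: "h b1 b2 \<in> P" if "b1 < B" "b2 < B" for b1 b2
    using aK[OF that(1)] bF[OF that(2)] by (auto simp: h_def F_def PiE_iff)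
  have main: "(\<Sum>b1\<in>S1. \<Sum>b2\<in>S2. of_bool (h b1 b2 = \<sigma>))
      \<le> real (card S1) * real (card S2) / real (card P) + \<eta> * (real B)\<^sup>2"
    if \<sigma>: "\<sigma> \<in> P" and S1: "S1 \<subseteq> {..<B}" and S2: "S2 \<subseteq> {..<B}" for \<sigma> S1 S2
  proof -
    have fS: "finite S1" "finite S2" using S1 S2 finite_subset by blast+
    \<comment> \<open>The centred indicator of the colour: it sums to zero over \<open>P\<close>,
      which makes the values of a random function at different points uncorrelated.\<close>
    define c where "c p = of_bool (p = \<sigma>) - 1 / real L" for p
    define w where "w k = real (card {b \<in> S1. a b = k})" for k
    define D where "D f = (\<Sum>k<K. w k * c (f k))" for f
    have csum: "(\<Sum>p\<in>P. c p) = 0"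
      using P \<sigma> L by (simp add: c_def sum_subtractf of_bool_def L_def[symmetric])
    have c1: "(c p)\<^sup>2 \<le> 1" for p
    proof -
      have "0 \<le> 1 / real L" "1 / real L \<le> 1" using L by auto
      then have "\<bar>c p\<bar> \<le> 1" unfolding c_def by (cases "p = \<sigma>") (simp_all add: abs_le_iff)
      then show ?thesis by (simp add: abs_square_le_1)
    qed
    have Dh: "(\<Sum>b1\<in>S1. c (h b1 b2)) = D (\<beta> b2)" for b2
    proof -
      have "(\<Sum>b1\<in>S1. c (h b1 b2)) = (\<Sum>k<K. \<Sum>b1\<in>{b \<in> S1. a b = k}. c (h b1 b2))"
        using fS aK S1 by (subst sum.group) auto
      also have "\<dots> = (\<Sum>k<K. w k * c (\<beta> b2 k))"
        by (intro sum.cong refl) (simp add: h_def w_def)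
      finally show ?thesis by (simp add: D_def)
    qed
    \<comment> \<open>Only a 1 / K fraction of all labels has first component \<open>k\<close>, so
      no single point of a random function carries much weight, whatever \<open>S1\<close>
      is.\<close>
    have wle: "w k \<le> real B / real K" if k: "k < K" for k
    proof -
      have "\<phi> ` {b \<in> S1. a b = k} \<subseteq> {..<q} \<times> {k} \<times> F"
        using phiX S1 by (fastforce simp: a_def X_def)
      then have "card (\<phi> ` {b \<in> S1. a b = k}) \<le> card ({..<q} \<times> {k} \<times> F)"
        using finF by (intro card_mono) auto
      moreover have "inj_on \<phi> {b \<in> S1. a b = k}"
        using \<phi> S1 by (auto simp: bij_betw_def intro: inj_on_subset)
      ultimately have "card {b \<in> S1. a b = k} \<le> q * L ^ K"
        by (simp add: card_image card_cartesian_product cF)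
      then have "w k \<le> real (q * L ^ K)" unfolding w_def by (simp only: of_nat_le_iff)
      also have "\<dots> = real B / real K" using K0 by (simp add: BX)
      finally show ?thesis .
    qed
    have cross: "(\<Sum>f\<in>F. c (f k) * c (f k')) = 0" if k: "k < K" "k' < K" "k \<noteq> k'" for k k'
    proof -
      define g where "g x p = (if x = k \<or> x = k' then c p else 1)" for x p
      have "(\<Prod>x<K. g x (f x)) = c (f k) * c (f k')" for f
      proof -
        have "(\<Prod>x<K. g x (f x)) = (\<Prod>x\<in>{k, k'}. g x (f x))"
          using k by (intro prod.mono_neutral_right) (auto simp: g_def)
        then show ?thesis using k by (simp add: g_def)
      qed
      then have "(\<Sum>f\<in>F. c (f k) * c (f k')) = (\<Sum>f\<in>F. \<Prod>x<K. g x (f x))" by simp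
      also have "\<dots> = (\<Prod>x<K. \<Sum>p\<in>P. g x p)"
        unfolding F_def using P by (subst prod_sum_PiE) auto
      also have "\<dots> = 0"
        using k csum by (intro prod_zero) (auto simp: g_def intro!: bexI[of _ k])
      finally show ?thesis .
    qed
    have "(\<Sum>f\<in>F. (D f)\<^sup>2) = (\<Sum>f\<in>F. \<Sum>k<K. \<Sum>k'<K. w k * w k' * (c (f k) * c (f k')))"
      by (intro sum.cong refl) (simp add: D_def power2_eq_square sum_product mult_ac)
    also have "\<dots> = (\<Sum>k<K. \<Sum>f\<in>F. \<Sum>k'<K. w k * w k' * (c (f k) * c (f k')))" by (rule sum.swap)
    also have "\<dots> = (\<Sum>k<K. \<Sum>k'<K. \<Sum>f\<in>F. w k * w k' * (c (f k) * c (f k')))"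
      by (intro sum.cong refl sum.swap)
    also have "\<dots> = (\<Sum>k<K. \<Sum>k'<K. w k * w k' * (\<Sum>f\<in>F. c (f k) * c (f k')))"
      by (simp add: sum_distrib_left)
    also have "\<dots> = (\<Sum>k<K. w k * w k * (\<Sum>f\<in>F. c (f k) * c (f k)))"
    proof (intro sum.cong refl)
      fix k assume k: "k \<in> {..<K}"
      have "(\<Sum>k'<K. w k * w k' * (\<Sum>f\<in>F. c (f k) * c (f k')))
          = (\<Sum>k'\<in>{k}. w k * w k' * (\<Sum>f\<in>F. c (f k) * c (f k')))"
        using k cross by (intro sum.mono_neutral_right) auto
      then show "(\<Sum>k'<K. w k * w k' * (\<Sum>f\<in>F. c (f k) * c (f k'))) = w k * w k * (\<Sum>f\<in>F. c (f k) * c (f k))"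
        by simp
    qed
    also have "\<dots> \<le> (\<Sum>k<K. (real B / real K) * (real B / real K) * real (L ^ K))"
    proof (intro sum_mono mult_mono)
      fix k assume k: "k \<in> {..<K}"
      show "w k \<le> real B / real K" "w k \<le> real B / real K" using wle k by auto
      have "(\<Sum>f\<in>F. c (f k) * c (f k)) \<le> (\<Sum>f\<in>F. 1)"
        using c1 by (intro sum_mono) (simp add: power2_eq_square)
      then show "(\<Sum>f\<in>F. c (f k) * c (f k)) \<le> real (L ^ K)" by (simp add: cF)
    qed (auto simp: w_def intro!: sum_nonneg)
    also have "\<dots> = (real B)\<^sup>2 / real K * real (L ^ K)" using K0 by (simp add: power2_eq_square)
    finally have DF: "(\<Sum>f\<in>F. (D f)\<^sup>2) \<le> (real B)\<^sup>2 / real K * real (L ^ K)" .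
    have "(\<Sum>b2<B. (D (\<beta> b2))\<^sup>2) = (\<Sum>x\<in>X. (D (snd (snd x)))\<^sup>2)"
      unfolding \<beta>_def by (rule sum.reindex_bij_betw[OF \<phi>])
    also have "\<dots> = (\<Sum>i<q. \<Sum>y\<in>{..<K} \<times> F. (D (snd y))\<^sup>2)"
      unfolding X_def by (subst sum.cartesian_product) (simp add: case_prod_unfold)
    also have "\<dots> = (\<Sum>i<q. \<Sum>k<K. \<Sum>f\<in>F. (D f)\<^sup>2)"
      by (subst (2) sum.cartesian_product) (simp add: case_prod_unfold)
    also have "\<dots> = real (q * K) * (\<Sum>f\<in>F. (D f)\<^sup>2)" by simp
    also have "\<dots> \<le> real (q * K) * ((real B)\<^sup>2 / real K * real (L ^ K))" using DF by (intro mult_left_mono) auto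
    also have "\<dots> = real B * (real B)\<^sup>2 / real K" by (simp add: BX mult_ac)
    finally have sq: "(\<Sum>b2<B. (D (\<beta> b2))\<^sup>2) \<le> real B * (real B)\<^sup>2 / real K" .
    have "(\<Sum>b2\<in>S2. D (\<beta> b2))\<^sup>2 \<le> (\<Sum>b2\<in>S2. (D (\<beta> b2))\<^sup>2) * real (card S2)"
      by (rule sum_squared_le_sum_of_squares)
    also have "\<dots> \<le> (\<Sum>b2<B. (D (\<beta> b2))\<^sup>2) * real B"
    proof (intro mult_mono sum_mono2)
      show "real (card S2) \<le> real B" using card_mono[OF _ S2] by simp
    qed (use S2 in \<open>auto intro!: sum_nonneg\<close>)
    also have "\<dots> \<le> real B * (real B)\<^sup>2 / real K * real B" using sq by (intro mult_right_mono) auto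
    also have "\<dots> = (real B)\<^sup>2 * (real B)\<^sup>2 * (1 / real K)" by (simp add: power2_eq_square)
    also have "\<dots> \<le> (real B)\<^sup>2 * (real B)\<^sup>2 * \<eta>\<^sup>2"
      using K K0 \<eta> by (intro mult_left_mono) (auto simp: field_simps)
    also have "\<dots> = (\<eta> * (real B)\<^sup>2)\<^sup>2" by (simp add: power_mult_distrib power2_eq_square mult_ac)
    finally have dev: "(\<Sum>b2\<in>S2. D (\<beta> b2)) \<le> \<eta> * (real B)\<^sup>2"
      using \<eta> by (auto intro: power2_le_imp_le)
    have "(\<Sum>b1\<in>S1. \<Sum>b2\<in>S2. of_bool (h b1 b2 = \<sigma>)) = (\<Sum>b2\<in>S2. \<Sum>b1\<in>S1. c (h b1 b2) + 1 / real L)"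
      by (subst sum.swap) (simp add: c_def)
    also have "\<dots> = (\<Sum>b2\<in>S2. D (\<beta> b2) + real (card S1) / real L)"
      by (simp add: sum.distrib Dh)
    also have "\<dots> = (\<Sum>b2\<in>S2. D (\<beta> b2)) + real (card S1) * real (card S2) / real L"
      by (simp add: sum.distrib)
    finally show ?thesis using dev by (simp add: L_def)
  qed
  show ?thesis
    using B0 hP main by (intro exI[of _ B] exI[of _ h]) (auto simp: BX)
qed

text \<open>The average of \<open>f\<close> over all permutations of the coordinates; the value 0 at
  other lengths makes \<open>symm\<close>, which quantifies over all lists, hold outright.\<close>

definition smz :: "nat \<Rightarrow> (nat list \<Rightarrow> real) \<Rightarrow> nat list \<Rightarrow> real" where
  "smz t f z = (if length z = t
     then (\<Sum>p | p permutes {..<t}. f (permute_list (inv p) z)) / fact t else 0)"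

lemma symm_smz: "symm (smz t f)"
  unfolding symm_def
proof (intro allI impI)
  fix xs ys :: "nat list" assume m: "mset xs = mset ys"
  then have l: "length xs = length ys" by (metis size_mset)
  show "smz t f xs = smz t f ys"
  proof (cases "length ys = t")
    case True
    obtain p where p: "p permutes {..<length ys}" "permute_list p ys = xs"
      using mset_eq_permutation[OF m] by blast
    have pt: "p permutes {..<t}" using p True by simp
    have "(\<Sum>s | s permutes {..<t}. f (permute_list (inv s) xs))
        = (\<Sum>s | s permutes {..<t}. f (permute_list (inv s) ys))"
    proof (rule sum.reindex_bij_witness[of _ "\<lambda>s. s \<circ> p" "\<lambda>s. s \<circ> inv p"])
      fix s assume s: "s \<in> {s. s permutes {..<t}}"
      then show "s \<circ> inv p \<circ> p = s" using permutes_inv_o[OF pt] by (simp add: comp_assoc)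
      show "s \<circ> inv p \<in> {s. s permutes {..<t}}" using s pt by (auto intro: permutes_compose permutes_inv)
      have "inv (s \<circ> inv p) = p \<circ> inv s"
        using s pt by (subst o_inv_distrib) (auto simp: permutes_bij permutes_inv_inv permutes_bij[OF permutes_inv])
      then have "permute_list (inv (s \<circ> inv p)) ys = permute_list (inv s) (permute_list p ys)"
        using s True by (simp add: permute_list_compose permutes_inv)
      then show "f (permute_list (inv (s \<circ> inv p)) ys) = f (permute_list (inv s) xs)" using p by simp
    next
      fix s assume s: "s \<in> {s. s permutes {..<t}}"
      then show "s \<circ> p \<circ> inv p = s" using permutes_inv_o[OF pt] by (simp add: comp_assoc)
      show "s \<circ> p \<in> {s. s permutes {..<t}}" using s pt by (auto intro: permutes_compose)
    qed
    then show ?thesis using True l by (simp add: smz_def)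
  qed (simp add: smz_def l)
qed

lemma smz_bounds:
  assumes "\<And>x. 0 \<le> f x \<and> f x \<le> 1"
  shows "0 \<le> smz t f z \<and> smz t f z \<le> 1"
proof -
  have c: "card {p. p permutes {..<t}} = fact t" by (rule card_permutations) auto
  have "(\<Sum>p | p permutes {..<t}. f (permute_list (inv p) z)) \<le> (\<Sum>p | p permutes {..<t}. 1)"
    using assms by (intro sum_mono) auto
  then have "(\<Sum>p | p permutes {..<t}. f (permute_list (inv p) z)) \<le> fact t" by (simp add: c)
  moreover have "0 \<le> (\<Sum>p | p permutes {..<t}. f (permute_list (inv p) z))"
    using assms by (intro sum_nonneg) auto
  ultimately show ?thesis by (simp add: smz_def)
qed

section \<open>Counting transversals with linked coordinates\<close>

context regular_adj
begin

abbreviation Lst :: "nat \<Rightarrow> nat list set" where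
  "Lst t \<equiv> {xs. length xs = t \<and> set xs \<subseteq> {..<n}}"

lemma finite_Lst: "finite (Lst t)"
  using finite_lists_length_eq[of "{..<n}" t] by (simp add: conj_commute)

lemma card_Lst: "card (Lst t) = n ^ t"
  using card_lists_length_eq[of "{..<n}" t] by (simp add: conj_commute)

text \<open>\<open>\<tau> j i\<close> is the place of the i-th linked coordinate in row
  \<open>j\<close>.\<close>

definition pattern :: "nat \<Rightarrow> nat \<Rightarrow> (nat \<Rightarrow> nat \<Rightarrow> nat) \<Rightarrow> nat list list \<Rightarrow> bool" where
  "pattern r m \<tau> X \<longleftrightarrow> (\<forall>j \<in> {1..<r}. \<forall>i < m. X ! j ! \<tau> j i \<in> nb (X ! 0 ! \<tau> 0 i))"

lemma Dn_sum: "m \<le> t \<Longrightarrow> length z = t \<Longrightarrow> Dn m t (\<lambda>x. \<Sum>p\<in>A. g p x) z = (\<Sum>p\<in>A. Dn m t (g p) z)"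
proof (induction m arbitrary: t z g)
  case 0
  show ?case by (simp add: EL_sum)
next
  case (Suc m)
  obtain t' where t: "t = Suc t'" using Suc.prems(1) by (cases t) auto
  obtain u z' where z: "z = u # z'" "length z' = t'" using Suc.prems(2) t by (cases z) auto
  have "G (\<lambda>v. \<Sum>p\<in>A. g p (v # xs)) u = (\<Sum>p\<in>A. G (\<lambda>v. g p (v # xs)) u)" for xs
    unfolding G_def by (subst sum.swap) (simp add: sum_divide_distrib)
  then show ?case using Suc.IH[of t' z' "\<lambda>p xs. G (\<lambda>v. g p (v # xs)) u"] Suc.prems(1) t z by simp
qed

lemma Dn_cmult: "m \<le> t \<Longrightarrow> length z = t \<Longrightarrow> Dn m t (\<lambda>x. a * g x) z = a * Dn m t g z"
proof (induction m arbitrary: t z g)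
  case 0
  show ?case by (simp add: EL_cmult)
next
  case (Suc m)
  obtain t' where t: "t = Suc t'" using Suc.prems(1) by (cases t) auto
  obtain u z' where z: "z = u # z'" "length z' = t'" using Suc.prems(2) t by (cases z) auto
  show ?case using Suc.IH[of t' z' "\<lambda>xs. G (\<lambda>v. g (v # xs)) u"] Suc.prems(1) t z by (simp add: G_cmult)
qed

lemma Dn_mono:
  assumes "m \<le> t" "length z = t" "set z \<subseteq> {..<n}"
    "\<And>x. length x = t \<Longrightarrow> set x \<subseteq> {..<n} \<Longrightarrow> f x \<le> g x"
  shows "Dn m t f z \<le> Dn m t g z"
  using assms
proof (induction m arbitrary: t z f g)
  case 0
  then show ?case by (auto intro: EL_mono)
next
  case (Suc m)
  obtain t' where t: "t = Suc t'" using Suc.prems(1) by (cases t) auto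
  obtain u z' where z: "z = u # z'" "length z' = t'" using Suc.prems(2) t by (cases z) auto
  have "Dn m t' (\<lambda>xs. G (\<lambda>v. f (v # xs)) u) z' \<le> Dn m t' (\<lambda>xs. G (\<lambda>v. g (v # xs)) u) z'"
    using Suc.prems t z by (intro Suc.IH G_mono) auto
  then show ?case by (simp add: t z)
qed

lemma Dn_const:
  assumes "m \<le> t" "length z = t" "set z \<subseteq> {..<n}"
  shows "Dn m t (\<lambda>_. c) z = c"
  using assms
proof (induction m arbitrary: t z)
  case (Suc m)
  obtain t' where t: "t = Suc t'" using Suc.prems(1) by (cases t) auto
  obtain u z' where z: "z = u # z'" "length z' = t'" using Suc.prems(2) t by (cases z) auto
  show ?case using Suc.IH[of t' z'] Suc.prems t z by (simp add: G_const)
qed simp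

lemma Dn_add:
  assumes "m \<le> t" "length z = t"
  shows "Dn m t (\<lambda>x. f x + g x) z = Dn m t f z + Dn m t g z"
  using Dn_sum[OF assms, of "\<lambda>b. if b then f else g" "UNIV :: bool set"] by (simp add: UNIV_bool add.commute)

lemma Dn_cong:
  assumes "m \<le> t" "length z = t" "set z \<subseteq> {..<n}"
    "\<And>x. length x = t \<Longrightarrow> set x \<subseteq> {..<n} \<Longrightarrow> f x = g x"
  shows "Dn m t f z = Dn m t g z"
  using Dn_mono[OF assms(1-3), of f g] Dn_mono[OF assms(1-3), of g f] assms(4) by force

lemma sum_permute_Lst:
  assumes p: "p permutes {..<t}"
  shows "(\<Sum>x\<in>Lst t. f x) = (\<Sum>z\<in>Lst t. f (permute_list (inv p) z))"
proof (rule sum.reindex_bij_witness[of _ "permute_list (inv p)" "permute_list p"])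
  have inv1: "permute_list (inv p) (permute_list p x) = x" "permute_list p (permute_list (inv p) x) = x"
    if "length x = t" for x :: "nat list"
  proof -
    have "permute_list (inv p) (permute_list p x) = permute_list (p \<circ> inv p) x"
      using p that by (simp add: permute_list_compose permutes_inv)
    then show "permute_list (inv p) (permute_list p x) = x" using permutes_inv_o[OF p] by simp
    have "permute_list p (permute_list (inv p) x) = permute_list (inv p \<circ> p) x"
      using p that by (simp add: permute_list_compose)
    then show "permute_list p (permute_list (inv p) x) = x" using permutes_inv_o[OF p] by simp
  qed
  fix x assume x: "x \<in> Lst t"
  show "permute_list (inv p) (permute_list p x) = x" "permute_list p (permute_list (inv p) x) = x"
    using x inv1 by auto
  show "permute_list p x \<in> Lst t" using x p by (auto simp: set_permute_list)
  show "permute_list (inv p) x \<in> Lst t" using x permutes_inv[OF p] by (auto simp: set_permute_list)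
  show "f (permute_list (inv p) (permute_list p x)) = f x" using x inv1 by auto
qed

text \<open>The number of row families that satisfy a pattern; by \<open>pattern_count\<close> it
  does not depend on the permutations.\<close>

definition deg_total :: "nat \<Rightarrow> nat \<Rightarrow> nat \<Rightarrow> real" where
  "deg_total r m t = real n ^ t * (real d ^ m * real n ^ (t - m)) ^ (r - 1)"

text \<open>Substituting permuted rows moves the permutations from the pattern into the functions,
  so that the links sit on the first \<open>m\<close> coordinates everywhere. Given row 0, the other
  rows are then independent, and each of them is a \<open>Dn\<close>.\<close>

lemma pattern_sum:
  assumes r: "2 \<le> r" and m: "m \<le> t" and \<tau>: "\<And>j. j < r \<Longrightarrow> \<tau> j permutes {..<t}"
  shows "(\<Sum>X | length X = r \<and> set X \<subseteq> Lst t. of_bool (pattern r m \<tau> X) * (\<Prod>j<r. f j (X ! j)))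
    = deg_total r m t * EL t (\<lambda>z. f 0 (permute_list (inv (\<tau> 0)) z) *
        (\<Prod>j\<in>{1..<r}. Dn m t (\<lambda>x. f j (permute_list (inv (\<tau> j)) x)) z))"
proof -
  obtain k where k: "r = Suc k" using r by (cases r) auto
  define c where "c = real d ^ m * real n ^ (t - m)"
  define ok where "ok j x0 x \<longleftrightarrow> (\<forall>i < m. x ! \<tau> j i \<in> nb (x0 ! \<tau> 0 i))" for j and x0 x :: "nat list"
  have pat: "of_bool (pattern r m \<tau> (x0 # X)) * (\<Prod>j<r. f j ((x0 # X) ! j))
      = f 0 x0 * (\<Prod>j<k. of_bool (ok (Suc j) x0 (X ! j)) * f (Suc j) (X ! j))" for x0 X
  proof -
    have ball: "(\<forall>j\<in>{1..<Suc k}. Q j) \<longleftrightarrow> (\<forall>j < k. Q (Suc j))" for Q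
      by (auto simp: less_Suc_eq_0_disj)
    have "pattern r m \<tau> (x0 # X) \<longleftrightarrow> (\<forall>j < k. ok (Suc j) x0 (X ! j))"
      unfolding pattern_def ok_def k ball by simp
    then have "(of_bool (pattern r m \<tau> (x0 # X)) :: real) = (\<Prod>j<k. of_bool (ok (Suc j) x0 (X ! j)))"
      by (auto simp: of_bool_def)
    then show ?thesis
      by (simp add: k prod.lessThan_Suc_shift prod.distrib del: prod.lessThan_Suc)
  qed
  have inner: "(\<Sum>x\<in>Lst t. of_bool (ok j x0 x) * f j x)
      = Dn m t (\<lambda>x. f j (permute_list (inv (\<tau> j)) x)) (permute_list (\<tau> 0) x0) * c"
    if j: "j < r" and x0: "x0 \<in> Lst t" for j x0
  proof -
    have p0: "\<tau> 0 permutes {..<t}" and pj: "\<tau> j permutes {..<t}" using \<tau> j r by auto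
    define z0 where "z0 = permute_list (\<tau> 0) x0"
    have z0: "length z0 = t" "set z0 \<subseteq> {..<n}" using x0 p0 by (auto simp: z0_def set_permute_list)
    have "(\<Sum>x\<in>Lst t. of_bool (ok j x0 x) * f j x)
       = (\<Sum>z\<in>Lst t. of_bool (ok j x0 (permute_list (inv (\<tau> j)) z)) * f j (permute_list (inv (\<tau> j)) z))"
      by (rule sum_permute_Lst[OF pj])
    also have "\<dots> = (\<Sum>z\<in>Lst t. if \<forall>i < m. z ! i \<in> nb (z0 ! i) then f j (permute_list (inv (\<tau> j)) z) else 0)"
    proof (rule sum.cong[OF refl])
      fix z assume z: "z \<in> Lst t"
      have "permute_list (inv (\<tau> j)) z ! \<tau> j i = z ! i" "x0 ! \<tau> 0 i = z0 ! i" if "i < m" for i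
      proof -
        have i: "i < t" using that m by simp
        have "\<tau> j i < t" using permutes_in_image[OF pj, of i] i by simp
        then have "permute_list (inv (\<tau> j)) z ! \<tau> j i = z ! inv (\<tau> j) (\<tau> j i)"
          using z permutes_inv[OF pj] by (intro permute_list_nth) auto
        then show "permute_list (inv (\<tau> j)) z ! \<tau> j i = z ! i" using permutes_inverses[OF pj] by simp
        show "x0 ! \<tau> 0 i = z0 ! i" unfolding z0_def using x0 p0 i by (subst permute_list_nth) auto
      qed
      then have "ok j x0 (permute_list (inv (\<tau> j)) z) \<longleftrightarrow> (\<forall>i < m. z ! i \<in> nb (z0 ! i))"
        by (simp add: ok_def)
      then show "of_bool (ok j x0 (permute_list (inv (\<tau> j)) z)) * f j (permute_list (inv (\<tau> j)) z)
         = (if \<forall>i < m. z ! i \<in> nb (z0 ! i) then f j (permute_list (inv (\<tau> j)) z) else 0)" by simp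
    qed
    also have "\<dots> = (\<Sum>z | z \<in> Lst t \<and> (\<forall>i < m. z ! i \<in> nb (z0 ! i)). f j (permute_list (inv (\<tau> j)) z))"
      using finite_Lst by (simp add: sum.If_cases Int_def)
    also have "\<dots> = Dn m t (\<lambda>x. f j (permute_list (inv (\<tau> j)) x)) z0 * c"
      using Dn_eq_sum[OF m z0, of "\<lambda>x. f j (permute_list (inv (\<tau> j)) x)"] by (simp add: c_def conj_assoc)
    finally show ?thesis by (simp add: z0_def)
  qed
  have "(\<Sum>X | length X = r \<and> set X \<subseteq> Lst t. of_bool (pattern r m \<tau> X) * (\<Prod>j<r. f j (X ! j)))
     = (\<Sum>x0\<in>Lst t. \<Sum>X | length X = k \<and> set X \<subseteq> Lst t.
          f 0 x0 * (\<Prod>j<k. of_bool (ok (Suc j) x0 (X ! j)) * f (Suc j) (X ! j)))"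
    using pat by (subst k, subst sum_lists_Suc) (simp add: k)
  also have "\<dots> = (\<Sum>x0\<in>Lst t. f 0 x0 * (\<Prod>j<k. \<Sum>x\<in>Lst t. of_bool (ok (Suc j) x0 x) * f (Suc j) x))"
  proof (rule sum.cong[OF refl])
    fix x0
    show "(\<Sum>X | length X = k \<and> set X \<subseteq> Lst t.
          f 0 x0 * (\<Prod>j<k. of_bool (ok (Suc j) x0 (X ! j)) * f (Suc j) (X ! j)))
       = f 0 x0 * (\<Prod>j<k. \<Sum>x\<in>Lst t. of_bool (ok (Suc j) x0 x) * f (Suc j) x)"
      unfolding sum_distrib_left[symmetric]
      using sum_lists_prod[where k = k and A = "Lst t" and F = "\<lambda>j x. of_bool (ok (Suc j) x0 x) * f (Suc j) x"] by simp
  qed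
  also have "\<dots> = (\<Sum>x0\<in>Lst t. f 0 x0 * (\<Prod>j\<in>{1..<r}. \<Sum>x\<in>Lst t. of_bool (ok j x0 x) * f j x))"
  proof -
    have sh: "(\<Prod>j\<in>{1..<Suc k}. g j) = (\<Prod>j<k. g (Suc j))" for g :: "nat \<Rightarrow> real"
      by (simp add: prod.atLeast_Suc_lessThan_Suc_shift atLeast0LessThan comp_def del: prod.op_ivl_Suc)
    show ?thesis unfolding k sh ..
  qed
  also have "\<dots> = (\<Sum>x0\<in>Lst t. f 0 x0 *
      (\<Prod>j\<in>{1..<r}. Dn m t (\<lambda>x. f j (permute_list (inv (\<tau> j)) x)) (permute_list (\<tau> 0) x0) * c))"
    using inner by (intro sum.cong refl arg_cong2[where f = "(*)"] prod.cong) auto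
  also have "\<dots> = (\<Sum>z\<in>Lst t. f 0 (permute_list (inv (\<tau> 0)) z) *
      (\<Prod>j\<in>{1..<r}. Dn m t (\<lambda>x. f j (permute_list (inv (\<tau> j)) x)) z * c))"
  proof -
    have p0: "\<tau> 0 permutes {..<t}" using \<tau> r by auto
    have "permute_list (\<tau> 0) (permute_list (inv (\<tau> 0)) x) = x" if "x \<in> Lst t" for x
    proof -
      have "permute_list (\<tau> 0) (permute_list (inv (\<tau> 0)) x) = permute_list (inv (\<tau> 0) \<circ> \<tau> 0) x"
        using p0 that by (simp add: permute_list_compose)
      then show ?thesis using permutes_inv_o[OF p0] by simp
    qed
    then show ?thesis by (subst sum_permute_Lst[OF p0]) (auto intro!: sum.cong)
  qed
  also have "\<dots> = c ^ (r - 1) * (\<Sum>z\<in>Lst t. f 0 (permute_list (inv (\<tau> 0)) z) *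
      (\<Prod>j\<in>{1..<r}. Dn m t (\<lambda>x. f j (permute_list (inv (\<tau> j)) x)) z))"
    by (simp add: prod.distrib sum_distrib_left mult_ac)
  finally show ?thesis using n_pos by (simp add: EL_eq_sum deg_total_def c_def)
qed

lemma pattern_count:
  assumes r: "2 \<le> r" and m: "m \<le> t" and \<tau>: "\<And>j. j < r \<Longrightarrow> \<tau> j permutes {..<t}"
  shows "(\<Sum>X | length X = r \<and> set X \<subseteq> Lst t. of_bool (pattern r m \<tau> X)) = deg_total r m t"
proof -
  have "EL t (\<lambda>z. 1 * (\<Prod>j\<in>{1..<r}. Dn m t (\<lambda>x. 1) z)) \<le> EL t (\<lambda>_. 1)"
    by (rule EL_mono) (simp add: Dn_const[OF m])
  moreover have "EL t (\<lambda>_. 1) \<le> EL t (\<lambda>z. 1 * (\<Prod>j\<in>{1..<r}. Dn m t (\<lambda>x. 1) z))"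
    by (rule EL_mono) (simp add: Dn_const[OF m])
  ultimately have "EL t (\<lambda>z. 1 * (\<Prod>j\<in>{1..<r}. Dn m t (\<lambda>x. 1) z)) = 1" by simp
  then show ?thesis using pattern_sum[OF assms, where f = "\<lambda>_ _. 1"] by simp
qed

lemma EL_cong:
  assumes "\<And>xs. length xs = t \<Longrightarrow> set xs \<subseteq> {..<n} \<Longrightarrow> f xs = g xs"
  shows "EL t f = EL t g"
  using EL_mono[of t f g] EL_mono[of t g f] assms by force

abbreviation labels :: "nat \<Rightarrow> nat \<Rightarrow> nat list set" where
  "labels r B \<equiv> {bs. length bs = r \<and> set bs \<subseteq> {..<B}}"

abbreviation rows :: "nat \<Rightarrow> nat \<Rightarrow> nat list list set" where
  "rows r t \<equiv> {X. length X = r \<and> set X \<subseteq> Lst t}"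

abbreviation perms :: "nat \<Rightarrow> nat \<Rightarrow> (nat \<Rightarrow> nat \<Rightarrow> nat) set" where
  "perms r t \<equiv> {..<r} \<rightarrow>\<^sub>E {p. p permutes {..<t}}"

lemma finite_perms: "finite (perms r t)"
  by (intro finite_PiE) (auto simp: finite_permutations)

lemma card_perms: "card (perms r t) = fact t ^ r"
  by (simp add: card_PiE card_permutations)

lemma permsD: "\<tau> \<in> perms r t \<Longrightarrow> j < r \<Longrightarrow> \<tau> j permutes {..<t}"
  by (auto simp: PiE_iff)

lemma card_labels: "card (labels r B) = B ^ r"
  using card_lists_length_eq[of "{..<B}" r] by (simp add: conj_commute)

lemma labels_nth: "bs \<in> labels r B \<Longrightarrow> j < r \<Longrightarrow> bs ! j < B"
  using nth_mem by fastforce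

context
  fixes r m t B :: nat and h :: "nat \<Rightarrow> nat \<Rightarrow> nat \<Rightarrow> nat \<Rightarrow> nat"
  assumes r: "2 \<le> r" and m: "m \<le> t" and B: "0 < B"
    and h: "\<And>b1 b2. b1 < B \<Longrightarrow> b2 < B \<Longrightarrow> h b1 b2 \<in> perms r t"
begin

lemma h_labels: "bs \<in> labels r B \<Longrightarrow> h (bs ! 0) (bs ! 1) \<in> perms r t"
  using h labels_nth[of bs r B 0] labels_nth[of bs r B 1] r by simp

lemma total_count:
  "(\<Sum>bs\<in>labels r B. \<Sum>X\<in>rows r t. of_bool (pattern r m (h (bs ! 0) (bs ! 1)) X)) = real B ^ r * deg_total r m t"
proof -
  have "(\<Sum>bs\<in>labels r B. \<Sum>X\<in>rows r t. (of_bool (pattern r m (h (bs ! 0) (bs ! 1)) X) :: real))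
      = (\<Sum>bs\<in>labels r B. deg_total r m t)"
    using pattern_count[OF r m] permsD[OF h_labels] by (intro sum.cong refl) blast
  then show ?thesis by (simp add: card_labels)
qed

text \<open>\<open>q\<close> is the probability that one linked coordinate lands in \<open>S\<close>
  in all rows at once. These events are independent over the \<open>m\<close> linked coordinates,
  and one success makes all rows meet \<open>S\<close>; \<open>core\<close> proves the resulting
  bound 1 - (1 - q)^m by revealing the coordinates one at a time.\<close>

lemma completeness_count:
  assumes S: "S \<subseteq> {..<n}"
  defines "q \<equiv> Ev (\<lambda>u. of_bool (u \<in> S) * G (\<lambda>v. of_bool (v \<in> S)) u ^ (r - 1))"
  shows "real B ^ r * deg_total r m t * (1 - (1 - q) ^ m) \<le>
    (\<Sum>bs\<in>labels r B. \<Sum>X\<in>rows r t. of_bool (pattern r m (h (bs ! 0) (bs ! 1)) X) *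
       (\<Prod>j<r. of_bool (set (X ! j) \<inter> S \<noteq> {})))"
proof -
  define F where "F x = (of_bool (set x \<inter> S \<noteq> {}) :: real)" for x :: "nat list"
  have core: "1 - (1 - q) ^ k \<le> EL s (\<lambda>z. F z * (\<Prod>j\<in>{1..<r}. Dn k s F z))" if "k \<le> s" for k s
    using that
  proof (induction k arbitrary: s)
    case 0
    have "EL s F \<ge> 0" using EL_mono[of s "\<lambda>_. 0" F] by (simp add: F_def)
    then have "0 \<le> EL s (\<lambda>z. F z * (\<Prod>j\<in>{1..<r}. Dn 0 s F z))"
      using EL_mono[of s "\<lambda>_. 0" "\<lambda>z. F z * (\<Prod>j\<in>{1..<r}. Dn 0 s F z)"] by (simp add: F_def prod_nonneg)
    then show ?case by simp
  next
    case (Suc k)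
    obtain s' where s: "s = Suc s'" using Suc.prems by (cases s) auto
    define I where "I u = (of_bool (u \<in> S) :: real)" for u
    define A where "A u = I u * G I u ^ (r - 1)" for u
    have Iq: "q = Ev A" unfolding q_def A_def I_def by simp
    have Ib: "0 \<le> I u \<and> I u \<le> 1" for u by (simp add: I_def)
    have Gb: "0 \<le> G I u \<and> G I u \<le> 1" if "u < n" for u
      using G_nonneg[OF that, of I] G_mono[OF that, of I "\<lambda>_. 1"] G_const[OF that, of 1] Ib by auto
    \<comment> \<open>For independent events: if both first events or both second events occur, then
      in each of the two places one of them does. \<open>mixp\<close> iterates this over the rows
      other than row 0.\<close>
    have mix: "a * b + (1 - a * b) * (x * y) \<le> (a + (1 - a) * x) * (b + (1 - b) * y)"
      if "0 \<le> a \<and> a \<le> 1" "0 \<le> b \<and> b \<le> 1" "0 \<le> x \<and> x \<le> 1" "0 \<le> y \<and> y \<le> 1" for a b x y :: real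
    proof -
      have "0 \<le> a * (1 - b) * (y * (1 - x)) + (1 - a) * b * (x * (1 - y))"
        using that by (intro add_nonneg_nonneg mult_nonneg_nonneg) auto
      then show ?thesis by (simp add: algebra_simps)
    qed
    have mixp: "g ^ l + (1 - g ^ l) * y ^ l \<le> (g + (1 - g) * y) ^ l"
      if g: "0 \<le> g \<and> g \<le> 1" and y: "0 \<le> y \<and> y \<le> 1" for g y :: real and l :: nat
    proof (induction l)
      case (Suc l)
      have "g * g ^ l + (1 - g * g ^ l) * (y * y ^ l) \<le> (g + (1 - g) * y) * (g ^ l + (1 - g ^ l) * y ^ l)"
        using g y by (intro mix) (auto simp: power_le_one)
      also have "\<dots> \<le> (g + (1 - g) * y) * (g + (1 - g) * y) ^ l"
        using Suc g y by (intro mult_left_mono) auto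
      finally show ?case by simp
    qed simp
    define J where "J = EL s' (\<lambda>z. F z * (\<Prod>j\<in>{1..<r}. Dn k s' F z))"
    have "EL s (\<lambda>z. F z * (\<Prod>j\<in>{1..<r}. Dn (Suc k) s F z))
       = Ev (\<lambda>u. EL s' (\<lambda>z. F (u # z) * Dn k s' (\<lambda>xs. G (\<lambda>v. F (v # xs)) u) z ^ (r - 1)))"
      by (simp add: s)
    also have "\<dots> \<ge> Ev (\<lambda>u. EL s' (\<lambda>z. A u + (1 - A u) * (F z * (\<Prod>j\<in>{1..<r}. Dn k s' F z))))"
    proof (intro Ev_mono EL_mono)
      fix u and z :: "nat list" assume u: "u < n" and z: "length z = s'" "set z \<subseteq> {..<n}"
      have ks: "k \<le> s'" using Suc.prems s by simp
      have Fc: "F (v # xs) = I v + (1 - I v) * F xs" for v xs by (auto simp: F_def I_def)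
      have GF: "G (\<lambda>v. F (v # xs)) u = G I u + (1 - G I u) * F xs" for xs
      proof -
        have "F (v # xs) = (1 - F xs) * I v + F xs" for v by (simp add: Fc algebra_simps)
        then have "G (\<lambda>v. F (v # xs)) u = (1 - F xs) * G I u + F xs"
          by (simp only: G_add G_cmult G_const[OF u])
        then show ?thesis by (simp add: algebra_simps)
      qed
      let ?D = "Dn k s' F z"
      have D: "Dn k s' (\<lambda>xs. G (\<lambda>v. F (v # xs)) u) z = G I u + (1 - G I u) * ?D"
        unfolding GF using Dn_add[OF ks z(1)] Dn_cmult[OF ks z(1)] Dn_const[OF ks z] by simp
      have Db: "0 \<le> ?D \<and> ?D \<le> 1"
        using Dn_mono[OF ks z, of F "\<lambda>_. 1"] Dn_const[OF ks z, of 1] Dn_nonneg[OF z(2), of F k s'] by (auto simp: F_def)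
      have Fb: "0 \<le> F z \<and> F z \<le> 1" by (simp add: F_def)
      have "A u + (1 - A u) * (F z * ?D ^ (r - 1))
         \<le> (I u + (1 - I u) * F z) * (G I u ^ (r - 1) + (1 - G I u ^ (r - 1)) * ?D ^ (r - 1))"
        unfolding A_def using Ib Gb[OF u] Fb Db by (intro mix) (auto simp: power_le_one)
      also have "\<dots> \<le> (I u + (1 - I u) * F z) * (G I u + (1 - G I u) * ?D) ^ (r - 1)"
        using mixp[OF Gb[OF u] Db] Ib[of u] Fb by (intro mult_left_mono) auto
      finally show "A u + (1 - A u) * (F z * (\<Prod>j\<in>{1..<r}. Dn k s' F z))
        \<le> F (u # z) * Dn k s' (\<lambda>xs. G (\<lambda>v. F (v # xs)) u) z ^ (r - 1)"
        unfolding D Fc[of u z] by simp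
    qed
    moreover have "Ev (\<lambda>u. EL s' (\<lambda>z. A u + (1 - A u) * (F z * (\<Prod>j\<in>{1..<r}. Dn k s' F z)))) = q + (1 - q) * J"
    proof -
      have "Ev (\<lambda>u. A u + (1 - A u) * J) = Ev A + (1 - Ev A) * J"
        unfolding Ev_add Ev_multc Ev_diff by simp
      then show ?thesis unfolding EL_add EL_cmult EL_const J_def Iq by simp
    qed
    moreover have "1 - (1 - q) ^ Suc k \<le> q + (1 - q) * J"
    proof -
      have "Ev A \<le> Ev (\<lambda>_. 1)"
        using Ib Gb by (intro Ev_mono) (auto simp: A_def intro!: mult_le_one power_le_one)
      then have "q \<le> 1" by (simp add: Iq)
      moreover have "1 - (1 - q) ^ k \<le> J" unfolding J_def using Suc s by simp
      ultimately have "(1 - q) * (1 - (1 - q) ^ k) \<le> (1 - q) * J" by (intro mult_left_mono) auto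
      then show ?thesis by (simp add: algebra_simps)
    qed
    ultimately show ?case by linarith
  qed
  \<comment> \<open>Meeting \<open>S\<close> does not depend on the order of the coordinates, so
    every family of permutations gives the same value.\<close>
  have "(\<Sum>X\<in>rows r t. of_bool (pattern r m \<tau> X) * (\<Prod>j<r. F (X ! j)))
      = deg_total r m t * EL t (\<lambda>z. F z * (\<Prod>j\<in>{1..<r}. Dn m t F z))" if \<tau>: "\<tau> \<in> perms r t" for \<tau>
  proof -
    have Fp: "F (permute_list (inv (\<tau> j)) x) = F x" if "j < r" "length x = t" for j x
      using permutes_inv[OF permsD[OF \<tau> that(1)]] that by (simp add: F_def set_permute_list)
    have "EL t (\<lambda>z. F (permute_list (inv (\<tau> 0)) z) * (\<Prod>j\<in>{1..<r}. Dn m t (\<lambda>x. F (permute_list (inv (\<tau> j)) x)) z))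
        = EL t (\<lambda>z. F z * (\<Prod>j\<in>{1..<r}. Dn m t F z))"
    proof (rule EL_cong)
      fix z :: "nat list" assume z: "length z = t" "set z \<subseteq> {..<n}"
      have "Dn m t (\<lambda>x. F (permute_list (inv (\<tau> j)) x)) z = Dn m t F z" if "j \<in> {1..<r}" for j
        by (rule Dn_cong[OF m z]) (use Fp that in auto)
      then show "F (permute_list (inv (\<tau> 0)) z) * (\<Prod>j\<in>{1..<r}. Dn m t (\<lambda>x. F (permute_list (inv (\<tau> j)) x)) z)
         = F z * (\<Prod>j\<in>{1..<r}. Dn m t F z)" using Fp[of 0 z] r z by simp
    qed
    then show ?thesis using pattern_sum[OF r m permsD[OF \<tau>], where f = "\<lambda>_. F"] by simp
  qed
  then have "(\<Sum>bs\<in>labels r B. \<Sum>X\<in>rows r t. of_bool (pattern r m (h (bs ! 0) (bs ! 1)) X) * (\<Prod>j<r. F (X ! j)))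
     = (\<Sum>bs\<in>labels r B. deg_total r m t * EL t (\<lambda>z. F z * (\<Prod>j\<in>{1..<r}. Dn m t F z)))"
    using h_labels by (intro sum.cong refl) blast
  also have "\<dots> = real B ^ r * deg_total r m t * EL t (\<lambda>z. F z * (\<Prod>j\<in>{1..<r}. Dn m t F z))"
    by (simp add: card_labels)
  also have "\<dots> \<ge> real B ^ r * deg_total r m t * (1 - (1 - q) ^ m)"
    using core[OF m] by (intro mult_left_mono) (auto simp: deg_total_def)
  finally show ?thesis by (simp add: F_def)
qed

text \<open>For fixed rows and fixed \<tau>, the labels of parts 0 and 1 range over a rectangle on
  which quasirandomness controls how often \<tau> is selected, and the labels of the other parts are
  free. Summed over all \<tau>, the product form of \<open>perms\<close> splits the average into one
  symmetrisation per part; the error \<eta> is paid once for each of the \<open>fact t ^ r\<close>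
  families.\<close>

lemma soundness_count:
  fixes Q :: "nat \<Rightarrow> nat \<Rightarrow> nat list \<Rightarrow> bool" and \<eta> :: real
  assumes \<eta>: "0 \<le> \<eta>" and quasi: "\<And>\<sigma> S1 S2. \<sigma> \<in> perms r t \<Longrightarrow> S1 \<subseteq> {..<B} \<Longrightarrow> S2 \<subseteq> {..<B} \<Longrightarrow>
      (\<Sum>b1\<in>S1. \<Sum>b2\<in>S2. of_bool (h b1 b2 = \<sigma>))
        \<le> real (card S1) * real (card S2) / real (card (perms r t)) + \<eta> * (real B)\<^sup>2"
  defines "f \<equiv> \<lambda>j x. (\<Sum>b<B. of_bool (Q j b x)) / real B"
  shows "(\<Sum>bs\<in>labels r B. \<Sum>X\<in>rows r t. of_bool (pattern r m (h (bs ! 0) (bs ! 1)) X) *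
       (\<Prod>j<r. of_bool (Q j (bs ! j) (X ! j))))
    \<le> real B ^ r * deg_total r m t *
       (EL t (\<lambda>z. smz t (f 0) z * (\<Prod>j\<in>{1..<r}. Dn m t (smz t (f j)) z)) + fact t ^ r * \<eta>)"
proof -
  let ?P = "perms r t"
  define L where "L = real (card ?P)"
  have L: "L = fact t ^ r" unfolding L_def card_perms by simp
  have L0: "0 < L" by (simp add: L)
  have f01: "0 \<le> f j x \<and> f j x \<le> 1" for j x
  proof -
    have "(\<Sum>b<B. of_bool (Q j b x)) \<le> (\<Sum>b<B. (1::real))" by (intro sum_mono) auto
    then show ?thesis using B by (simp add: f_def sum_nonneg)
  qed
  \<comment> \<open>The count of labels selecting \<tau> is at most its share 1 / L of the product
    of the label densities, plus the error \<eta>.\<close>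
  have box: "(\<Sum>bs\<in>labels r B. of_bool (h (bs ! 0) (bs ! 1) = \<tau>) * (\<Prod>j<r. of_bool (Q j (bs ! j) (X ! j))))
      \<le> real B ^ r * ((\<Prod>j<r. f j (X ! j)) / L + \<eta>)" if \<tau>: "\<tau> \<in> ?P" for \<tau> X
  proof -
    obtain k where k: "r = Suc (Suc k)" using r by (metis add_2_eq_Suc le_Suc_ex)
    define s where "s j b = (of_bool (Q j b (X ! j)) :: real)" for j b
    have sf: "(\<Sum>b<B. s j b) = real B * f j (X ! j)" for j using B by (simp add: s_def f_def)
    have "(\<Sum>bs\<in>labels r B. of_bool (h (bs ! 0) (bs ! 1) = \<tau>) * (\<Prod>j<r. s j (bs ! j)))
       = (\<Sum>b0<B. \<Sum>b1<B. \<Sum>bs | length bs = k \<and> set bs \<subseteq> {..<B}.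
           of_bool (h b0 b1 = \<tau>) * (s 0 b0 * s 1 b1) * (\<Prod>j<k. s (Suc (Suc j)) (bs ! j)))"
      unfolding k sum_lists_Suc by (simp add: prod.lessThan_Suc_shift mult_ac del: prod.lessThan_Suc)
    also have "\<dots> = (\<Sum>b0<B. \<Sum>b1<B. of_bool (h b0 b1 = \<tau>) * (s 0 b0 * s 1 b1)) *
        (\<Prod>j<k. real B * f (Suc (Suc j)) (X ! Suc (Suc j)))"
      unfolding sum_distrib_left[symmetric] sum_distrib_right[symmetric]
      using sum_lists_prod[where k = k and A = "{..<B}" and F = "\<lambda>j. s (Suc (Suc j))"] by (simp add: sf)
    finally have e1: "(\<Sum>bs\<in>labels r B. of_bool (h (bs ! 0) (bs ! 1) = \<tau>) * (\<Prod>j<r. s j (bs ! j)))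
       = (\<Sum>b0<B. \<Sum>b1<B. of_bool (h b0 b1 = \<tau>) * (s 0 b0 * s 1 b1)) *
        (\<Prod>j<k. real B * f (Suc (Suc j)) (X ! Suc (Suc j)))" .
    define S where "S j = {b. b < B \<and> Q j b (X ! j)}" for j
    have cS: "real (card (S j)) = real B * f j (X ! j)" for j
    proof -
      have "(\<Sum>b<B. s j b) = real (card (S j))"
        by (simp add: s_def S_def of_bool_def sum.If_cases Int_def)
      then show ?thesis using sf by simp
    qed
    have "(\<Sum>b0<B. \<Sum>b1<B. of_bool (h b0 b1 = \<tau>) * (s 0 b0 * s 1 b1))
       = (\<Sum>b0\<in>S 0. \<Sum>b1\<in>S 1. of_bool (h b0 b1 = \<tau>))"
    proof -
      have "(\<Sum>b1\<in>S 1. of_bool (h b0 b1 = \<tau>)) = (\<Sum>b1<B. of_bool (h b0 b1 = \<tau>) * s 1 b1)" for b0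
        by (rule sum.mono_neutral_cong_left) (auto simp: S_def s_def)
      then have "(\<Sum>b0\<in>S 0. \<Sum>b1\<in>S 1. of_bool (h b0 b1 = \<tau>) :: real)
         = (\<Sum>b0\<in>S 0. \<Sum>b1<B. of_bool (h b0 b1 = \<tau>) * s 1 b1)" by simp
      also have "\<dots> = (\<Sum>b0<B. s 0 b0 * (\<Sum>b1<B. of_bool (h b0 b1 = \<tau>) * s 1 b1))"
        by (rule sum.mono_neutral_cong_left) (auto simp: S_def s_def)
      also have "\<dots> = (\<Sum>b0<B. \<Sum>b1<B. of_bool (h b0 b1 = \<tau>) * (s 0 b0 * s 1 b1))"
        unfolding sum_distrib_left by (intro sum.cong refl) (simp only: mult_ac)
      finally show ?thesis ..
    qed
    also have "\<dots> \<le> real (card (S 0)) * real (card (S 1)) / L + \<eta> * (real B)\<^sup>2"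
      unfolding L_def by (rule quasi[OF \<tau>]) (auto simp: S_def)
    finally have e2: "(\<Sum>b0<B. \<Sum>b1<B. of_bool (h b0 b1 = \<tau>) * (s 0 b0 * s 1 b1))
       \<le> (real B)\<^sup>2 * (f 0 (X ! 0) * f 1 (X ! 1) / L + \<eta>)"
      by (simp add: cS power2_eq_square algebra_simps)
    let ?R = "\<Prod>j<k. f (Suc (Suc j)) (X ! Suc (Suc j))"
    have R1: "0 \<le> ?R" "?R \<le> 1" using f01 by (auto intro!: prod_nonneg prod_le_1)
    have "(\<Sum>bs\<in>labels r B. of_bool (h (bs ! 0) (bs ! 1) = \<tau>) * (\<Prod>j<r. s j (bs ! j)))
       \<le> (real B)\<^sup>2 * (f 0 (X ! 0) * f 1 (X ! 1) / L + \<eta>) * (\<Prod>j<k. real B * f (Suc (Suc j)) (X ! Suc (Suc j)))"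
      unfolding e1 using e2 f01 by (intro mult_right_mono) (auto intro!: prod_nonneg)
    also have "\<dots> = real B ^ r * (f 0 (X ! 0) * f 1 (X ! 1) * ?R / L + \<eta> * ?R)"
      by (simp add: k prod.distrib power2_eq_square algebra_simps)
    also have "\<dots> \<le> real B ^ r * (f 0 (X ! 0) * f 1 (X ! 1) * ?R / L + \<eta>)"
      using R1 \<eta> by (intro mult_left_mono add_left_mono) (auto simp: mult_left_le)
    also have "f 0 (X ! 0) * f 1 (X ! 1) * ?R = (\<Prod>j<r. f j (X ! j))"
      unfolding k by (simp add: prod.lessThan_Suc_shift del: prod.lessThan_Suc)
    finally show ?thesis unfolding s_def .
  qed
  \<comment> \<open>Row \<open>j\<close> depends on \<tau> only through \<open>\<tau> j\<close>, so
    the sum over the families is a product of sums over single permutations.\<close>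
  have sumP: "(\<Sum>\<tau>\<in>?P. EL t (\<lambda>z. f 0 (permute_list (inv (\<tau> 0)) z) *
        (\<Prod>j\<in>{1..<r}. Dn m t (\<lambda>x. f j (permute_list (inv (\<tau> j)) x)) z)))
     = L * EL t (\<lambda>z. smz t (f 0) z * (\<Prod>j\<in>{1..<r}. Dn m t (smz t (f j)) z))"
  proof -
    have split: "{..<r} = insert 0 {1..<r}" using r by auto
    define A where "A j p z = (if j = 0 then f 0 (permute_list (inv p) z)
      else Dn m t (\<lambda>x. f j (permute_list (inv p) x)) z)" for j p z
    have Asum: "(\<Sum>p | p permutes {..<t}. A j p z) = fact t * (if j = 0 then smz t (f 0) z else Dn m t (smz t (f j)) z)"
      if z: "length z = t" "set z \<subseteq> {..<n}" for j z
    proof (cases "j = 0")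
      case True
      then show ?thesis using z by (simp add: A_def smz_def)
    next
      case False
      have "fact t * Dn m t (smz t (f j)) z = Dn m t (\<lambda>x. fact t * smz t (f j) x) z"
        using Dn_cmult[OF m z(1)] by simp
      also have "\<dots> = Dn m t (\<lambda>x. \<Sum>p | p permutes {..<t}. f j (permute_list (inv p) x)) z"
        by (rule Dn_cong[OF m z]) (simp add: smz_def)
      also have "\<dots> = (\<Sum>p | p permutes {..<t}. A j p z)"
        using False Dn_sum[OF m z(1)] by (simp add: A_def)
      finally show ?thesis using False by simp
    qed
    have "(\<Sum>\<tau>\<in>?P. EL t (\<lambda>z. f 0 (permute_list (inv (\<tau> 0)) z) *
        (\<Prod>j\<in>{1..<r}. Dn m t (\<lambda>x. f j (permute_list (inv (\<tau> j)) x)) z)))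
      = EL t (\<lambda>z. \<Sum>\<tau>\<in>?P. \<Prod>j<r. A j (\<tau> j) z)"
      unfolding EL_sum[symmetric] split by (simp add: A_def)
    also have "\<dots> = EL t (\<lambda>z. \<Prod>j<r. \<Sum>p | p permutes {..<t}. A j p z)"
      by (subst prod_sum_PiE) (auto simp: finite_permutations)
    also have "\<dots> = EL t (\<lambda>z. L * (smz t (f 0) z * (\<Prod>j\<in>{1..<r}. Dn m t (smz t (f j)) z)))"
    proof (rule EL_cong)
      fix z :: "nat list" assume z: "length z = t" "set z \<subseteq> {..<n}"
      have "(\<Prod>j<r. \<Sum>p | p permutes {..<t}. A j p z)
         = (\<Prod>j<r. fact t) * (\<Prod>j<r. if j = 0 then smz t (f 0) z else Dn m t (smz t (f j)) z)"
        unfolding Asum[OF z] prod.distrib ..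
      moreover have "(\<Prod>j<r. if j = 0 then smz t (f 0) z else Dn m t (smz t (f j)) z)
         = smz t (f 0) z * (\<Prod>j\<in>{1..<r}. Dn m t (smz t (f j)) z)"
        unfolding split by simp
      ultimately show "(\<Prod>j<r. \<Sum>p | p permutes {..<t}. A j p z)
         = L * (smz t (f 0) z * (\<Prod>j\<in>{1..<r}. Dn m t (smz t (f j)) z))"
        by (simp add: L)
    qed
    finally show ?thesis by (simp add: EL_cmult)
  qed
  have "(\<Sum>bs\<in>labels r B. \<Sum>X\<in>rows r t. of_bool (pattern r m (h (bs ! 0) (bs ! 1)) X) *
       (\<Prod>j<r. of_bool (Q j (bs ! j) (X ! j))))
    = (\<Sum>bs\<in>labels r B. \<Sum>X\<in>rows r t. \<Sum>\<tau>\<in>?P. of_bool (pattern r m \<tau> X) *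
       (of_bool (h (bs ! 0) (bs ! 1) = \<tau>) * (\<Prod>j<r. of_bool (Q j (bs ! j) (X ! j)))) :: real)"
  proof (intro sum.cong refl)
    fix bs X assume bs: "bs \<in> labels r B"
    let ?w = "\<Prod>j<r. of_bool (Q j (bs ! j) (X ! j)) :: real"
    have "(\<Sum>\<tau>\<in>?P. of_bool (pattern r m \<tau> X) * (of_bool (h (bs ! 0) (bs ! 1) = \<tau>) * ?w))
       = (\<Sum>\<tau>\<in>{h (bs ! 0) (bs ! 1)}. of_bool (pattern r m \<tau> X) * (of_bool (h (bs ! 0) (bs ! 1) = \<tau>) * ?w))"
      using h_labels[OF bs] finite_perms by (intro sum.mono_neutral_right) auto
    then show "of_bool (pattern r m (h (bs ! 0) (bs ! 1)) X) * ?w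
       = (\<Sum>\<tau>\<in>?P. of_bool (pattern r m \<tau> X) * (of_bool (h (bs ! 0) (bs ! 1) = \<tau>) * ?w))" by simp
  qed
  also have "\<dots> = (\<Sum>X\<in>rows r t. \<Sum>bs\<in>labels r B. \<Sum>\<tau>\<in>?P. of_bool (pattern r m \<tau> X) *
       (of_bool (h (bs ! 0) (bs ! 1) = \<tau>) * (\<Prod>j<r. of_bool (Q j (bs ! j) (X ! j)))))"
    by (rule sum.swap)
  also have "\<dots> = (\<Sum>X\<in>rows r t. \<Sum>\<tau>\<in>?P. \<Sum>bs\<in>labels r B. of_bool (pattern r m \<tau> X) *
       (of_bool (h (bs ! 0) (bs ! 1) = \<tau>) * (\<Prod>j<r. of_bool (Q j (bs ! j) (X ! j)))))"
    by (intro sum.cong refl sum.swap)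
  also have "\<dots> \<le> (\<Sum>X\<in>rows r t. \<Sum>\<tau>\<in>?P. of_bool (pattern r m \<tau> X) *
       (real B ^ r * ((\<Prod>j<r. f j (X ! j)) / L + \<eta>)))"
    unfolding sum_distrib_left[symmetric] using box by (intro sum_mono mult_left_mono) auto
  also have "\<dots> = (\<Sum>\<tau>\<in>?P. \<Sum>X\<in>rows r t. real B ^ r / L * (of_bool (pattern r m \<tau> X) * (\<Prod>j<r. f j (X ! j)))
       + real B ^ r * \<eta> * of_bool (pattern r m \<tau> X))"
    by (subst sum.swap) (simp add: algebra_simps)
  also have "\<dots> = (\<Sum>\<tau>\<in>?P. real B ^ r / L * (deg_total r m t * EL t (\<lambda>z. f 0 (permute_list (inv (\<tau> 0)) z) *
        (\<Prod>j\<in>{1..<r}. Dn m t (\<lambda>x. f j (permute_list (inv (\<tau> j)) x)) z))) + real B ^ r * \<eta> * deg_total r m t)"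
  proof (intro sum.cong refl)
    fix \<tau> assume \<tau>: "\<tau> \<in> ?P"
    have e1: "(\<Sum>X\<in>rows r t. of_bool (pattern r m \<tau> X) * (\<Prod>j<r. f j (X ! j)))
       = deg_total r m t * EL t (\<lambda>z. f 0 (permute_list (inv (\<tau> 0)) z) *
        (\<Prod>j\<in>{1..<r}. Dn m t (\<lambda>x. f j (permute_list (inv (\<tau> j)) x)) z))"
      by (rule pattern_sum[OF r m]) (rule permsD[OF \<tau>])
    have e2: "(\<Sum>X\<in>rows r t. of_bool (pattern r m \<tau> X)) = deg_total r m t"
      by (rule pattern_count[OF r m]) (rule permsD[OF \<tau>])
    show "(\<Sum>X\<in>rows r t. real B ^ r / L * (of_bool (pattern r m \<tau> X) * (\<Prod>j<r. f j (X ! j)))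
       + real B ^ r * \<eta> * of_bool (pattern r m \<tau> X))
      = real B ^ r / L * (deg_total r m t * EL t (\<lambda>z. f 0 (permute_list (inv (\<tau> 0)) z) *
        (\<Prod>j\<in>{1..<r}. Dn m t (\<lambda>x. f j (permute_list (inv (\<tau> j)) x)) z))) + real B ^ r * \<eta> * deg_total r m t"
      unfolding sum.distrib sum_distrib_left[symmetric] e1 e2 ..
  qed
  also have "\<dots> = real B ^ r / L * (deg_total r m t * (L * EL t (\<lambda>z. smz t (f 0) z * (\<Prod>j\<in>{1..<r}. Dn m t (smz t (f j)) z))))
      + L * (real B ^ r * \<eta> * deg_total r m t)"
    unfolding sum.distrib sum_distrib_left[symmetric] sumP by (simp add: L_def)
  also have "\<dots> = real B ^ r * deg_total r m t *
       (EL t (\<lambda>z. smz t (f 0) z * (\<Prod>j\<in>{1..<r}. Dn m t (smz t (f j)) z)) + fact t ^ r * \<eta>)"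
    using L0 unfolding L[symmetric] by (simp add: field_simps)
  finally show ?thesis .
qed

end

end

section \<open>Expansion and encoded hypergraphs\<close>

definition nbr :: "nat set set \<Rightarrow> nat \<Rightarrow> nat set" where
  "nbr E u = {v. {u, v} \<in> E}"

lemma regular_graph_adj:
  assumes "regular_graph {..<n} E"
  obtains d where "regular_adj n d (nbr E)" "card (arcs E) = n * d"
proof -
  obtain d where d: "0 < d" "\<And>v. v < n \<Longrightarrow> card {e \<in> E. v \<in> e} = d"
    and n: "{..<n} \<noteq> {}" and E: "\<And>e. e \<in> E \<Longrightarrow> e \<subseteq> {..<n} \<and> card e = 2"
    using assms unfolding regular_graph_def uniform_hypergraph_def by auto
  have irr: "{u} \<notin> E" for u using E[of "{u}"] by auto
  have sub: "nbr E u \<subseteq> {..<n}" for u using E by (auto simp: nbr_def)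
  have card: "card (nbr E u) = d" if u: "u < n" for u
  proof -
    have "bij_betw (\<lambda>v. {u, v}) (nbr E u) {e \<in> E. u \<in> e}"
      unfolding bij_betw_def
    proof
      show "inj_on (\<lambda>v. {u, v}) (nbr E u)" by (auto simp: inj_on_def doubleton_eq_iff)
      show "(\<lambda>v. {u, v}) ` nbr E u = {e \<in> E. u \<in> e}"
      proof (intro equalityI subsetI)
        fix e assume e: "e \<in> {e \<in> E. u \<in> e}"
        then have "card e = 2" using E by blast
        then obtain x y where xy: "e = {x, y}" by (auto simp: card_2_iff)
        then have "e = {u, if u = x then y else x}" using e by auto
        then show "e \<in> (\<lambda>v. {u, v}) ` nbr E u" using e by (auto simp: nbr_def)
      qed (auto simp: nbr_def)
    qed
    then show ?thesis using d(2)[OF u] bij_betw_same_card by metis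
  qed
  have "arcs E = Sigma {..<n} (nbr E)" using E by (force simp: arcs_def nbr_def)
  then have "card (arcs E) = (\<Sum>u<n. card (nbr E u))"
    using finite_subset[OF sub] by (simp add: card_SigmaI)
  also have "\<dots> = n * d" using card by simp
  finally have arcs: "card (arcs E) = n * d" .
  have "regular_adj n d (nbr E)"
  proof
    show "0 < n" using n by auto
    show "0 < d" by (rule d)
    show "\<And>u. u < n \<Longrightarrow> nbr E u \<subseteq> {..<n}" using sub .
    show "\<And>u. u < n \<Longrightarrow> card (nbr E u) = d" using card .
    show "\<And>u v. u < n \<Longrightarrow> v < n \<Longrightarrow> v \<in> nbr E u \<longleftrightarrow> u \<in> nbr E v" by (simp add: nbr_def insert_commute)
  qed
  then show ?thesis using arcs that by blast
qed

text \<open>The arcs leaving vertices of \<open>S\<close> make up the measure of \<open>S\<close>;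
  those that stay in \<open>S\<close> make up \<open>inside S\<close>.\<close>

lemma (in regular_adj) cut_eq:
  assumes nb: "nb = nbr E" and arcs: "card (arcs E) = n * d" and S: "S \<subseteq> {..<n}"
  shows "real (card {(i, j) \<in> arcs E. i \<in> S \<and> j \<notin> S}) / real (card (arcs E)) = vol {..<n} S - inside S"
proof -
  have fS: "finite S" using S finite_subset by blast
  have "{(i, j) \<in> arcs E. i \<in> S \<and> j \<notin> S} = Sigma S (\<lambda>i. nb i - S)"
    by (auto simp: arcs_def nb nbr_def)
  moreover have "finite (nb i - S)" if "i \<in> S" for i using that S nb_finite by auto
  ultimately have c: "card {(i, j) \<in> arcs E. i \<in> S \<and> j \<notin> S} = (\<Sum>i\<in>S. card (nb i - S))"
    using fS by (simp add: card_SigmaI)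
  have e: "real (card (nb i - S)) = real d * (1 - G (\<lambda>v. of_bool (v \<in> S)) i)" if "i \<in> S" for i
  proof -
    have i: "i < n" using that S by auto
    have "G (\<lambda>v. of_bool (v \<in> S)) i = real (card (nb i \<inter> S)) / real d"
      using nb_finite[OF i] by (simp add: G_def of_bool_def sum.If_cases)
    moreover have "card (nb i) = card (nb i \<inter> S) + card (nb i - S)"
      using nb_finite[OF i] by (simp add: card_Int_Diff)
    then have "real (card (nb i - S)) = real d - real (card (nb i \<inter> S))" using nb_card[OF i] by simp
    ultimately show ?thesis using d_pos by (simp only: right_diff_distrib) simp
  qed
  have "real (card {(i, j) \<in> arcs E. i \<in> S \<and> j \<notin> S}) = real d * (\<Sum>i\<in>S. 1 - G (\<lambda>v. of_bool (v \<in> S)) i)"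
    unfolding c of_nat_sum sum_distrib_left using e by (intro sum.cong refl)
  also have "(\<Sum>i\<in>S. 1 - G (\<lambda>v. of_bool (v \<in> S)) i)
      = (\<Sum>i<n. of_bool (i \<in> S) - of_bool (i \<in> S) * G (\<lambda>v. of_bool (v \<in> S)) i)"
    by (rule sum.mono_neutral_cong_left) (use S in auto)
  also have "\<dots> = real n * (vol {..<n} S - inside S)"
    using Ev_indicator[OF S] n_pos unfolding sum_subtractf inside_def vol_def
    by (simp add: Ev_def field_simps)
  finally show ?thesis using arcs n_pos d_pos by simp
qed

lemma vol_compl: "0 < (n::nat) \<Longrightarrow> S \<subseteq> {..<n} \<Longrightarrow> vol {..<n} ({..<n} - S) = 1 - vol {..<n} S"
  using card_mono[of "{..<n}" S] finite_subset[of S "{..<n}"]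
  by (simp add: vol_def card_Diff_subset of_nat_diff diff_divide_distrib)

lemma (in regular_adj) expansion_eq:
  assumes "nb = nbr E" "card (arcs E) = n * d" "S \<subseteq> {..<n}" "vol {..<n} S \<le> 1 / 2"
  shows "expansion {..<n} E S = (vol {..<n} S - inside S) / vol {..<n} S"
  using cut_eq[OF assms(1-3)] vol_compl[OF n_pos assms(3)] assms(4) by (simp add: expansion_def min_def)

lemma (in regular_adj) inside_mono:
  assumes "T \<subseteq> T'"
  shows "inside T \<le> inside T'"
  unfolding inside_def
proof (rule Ev_mono)
  fix u assume u: "u < n"
  have "G (\<lambda>v. of_bool (v \<in> T)) u \<le> G (\<lambda>v. of_bool (v \<in> T')) u" using u assms by (intro G_mono) auto
  moreover have "0 \<le> G (\<lambda>v. of_bool (v \<in> T')) u" using u by (intro G_nonneg) auto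
  ultimately show "of_bool (u \<in> T) * G (\<lambda>v. of_bool (v \<in> T)) u \<le> of_bool (u \<in> T') * G (\<lambda>v. of_bool (v \<in> T')) u"
    using assms by (cases "u \<in> T") auto
qed

text \<open>The hypothesis is silent about sets of measure below \<delta> / M. A smaller set is
  enlarged to the greatest admissible cardinality, as \<open>inside\<close> is monotone; rounding
  down loses at most a factor 2, which \<open>2 \<le> M\<close> absorbs.\<close>

lemma (in regular_adj) sse_no_inside:
  assumes nb: "nb = nbr E" and arcs: "card (arcs E) = n * d"
    and no: "\<And>S. S \<subseteq> {..<n} \<Longrightarrow> vol {..<n} S \<in> {\<delta> / M .. M * \<delta>} \<Longrightarrow> 1 - \<epsilon> \<le> expansion {..<n} E S"
    and c: "0 < \<delta>" "2 \<le> M" "M * \<delta> \<le> 1 / 2" "0 \<le> \<epsilon>"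
    and T: "T \<subseteq> {..<n}" "real (card T) \<le> M * \<delta> * real n"
  shows "inside T \<le> \<epsilon> * (M * \<delta>)"
proof -
  define k where "k = nat \<lfloor>M * \<delta> * real n\<rfloor>"
  have nn: "0 \<le> M * \<delta> * real n" using c by simp
  have kle: "real k \<le> M * \<delta> * real n" using nn by (simp add: k_def)
  have Tk: "card T \<le> k" using T(2) nn by (simp add: k_def le_nat_floor)
  have "M * \<delta> * real n \<le> 1 / 2 * real n" using c by (intro mult_right_mono) auto
  then have "real k \<le> real n" using kle n_pos by linarith
  then have kn: "k \<le> n" by simp
  obtain T' where T': "T \<subseteq> T'" "T' \<subseteq> {..<n}" "card T' = k"
    using exists_subset_between[of T k "{..<n}"] Tk kn T(1) by auto
  show ?thesis
  proof (cases "k = 0")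
    case True
    then have "T = {}" using Tk T(1) finite_subset[OF T(1)] by auto
    then show ?thesis using c by (simp add: inside_def)
  next
    case False
    have v: "vol {..<n} T' = real k / real n" using T' by (simp add: vol_def)
    have vle: "vol {..<n} T' \<le> M * \<delta>" unfolding v using kle n_pos by (simp add: field_simps)
    have "M * \<delta> * real n < real k + 1" unfolding k_def using nn by linarith
    then have "M * \<delta> * real n \<le> 2 * real k" using False by linarith
    moreover have "2 * \<delta> / M \<le> M * \<delta>"
    proof -
      have "2 * 1 \<le> M * M" using c by (intro mult_mono) auto
      then have "\<delta> * 2 \<le> \<delta> * (M * M)" using c by (intro mult_left_mono) auto
      then show ?thesis using c by (simp add: field_simps)
    qed
    then have "2 * \<delta> / M * real n \<le> M * \<delta> * real n" by (intro mult_right_mono) auto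
    ultimately have "2 * \<delta> / M * real n \<le> 2 * real k" by linarith
    then have "\<delta> / M * real n \<le> real k" by simp
    then have "\<delta> / M \<le> vol {..<n} T'" unfolding v using n_pos by (simp only: pos_le_divide_eq of_nat_0_less_iff)
    then have "1 - \<epsilon> \<le> expansion {..<n} E T'" using no[OF T'(2)] vle by simp
    then have "1 - \<epsilon> \<le> (vol {..<n} T' - inside T') / vol {..<n} T'"
      using expansion_eq[OF nb arcs T'(2)] vle c by simp
    moreover have v0: "0 < vol {..<n} T'" unfolding v using False n_pos by simp
    ultimately have "(1 - \<epsilon>) * vol {..<n} T' \<le> vol {..<n} T' - inside T'" by (simp add: pos_le_divide_eq)
    then have "inside T' \<le> \<epsilon> * vol {..<n} T'" by (simp add: algebra_simps)
    also have "\<dots> \<le> \<epsilon> * (M * \<delta>)" using vle c by (intro mult_left_mono) auto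
    finally show ?thesis using inside_mono[OF T'(1)] by linarith
  qed
qed

text \<open>Bernoulli's inequality linearises the power in the fraction of neighbours inside
  \<open>S\<close>, and the mean of the linear bound is expressed by the boundary of
  \<open>S\<close>.\<close>

lemma (in regular_adj) sse_yes_q:
  assumes nb: "nb = nbr E" and arcs: "card (arcs E) = n * d"
    and S: "S \<subseteq> {..<n}" "vol {..<n} S = \<delta>" "0 < \<delta>" "\<delta> \<le> 1 / 2" "expansion {..<n} E S \<le> \<epsilon>"
    and r: "1 \<le> r" "real (r - 1) * \<epsilon> \<le> 1 / 2"
  shows "\<delta> / 2 \<le> Ev (\<lambda>u. of_bool (u \<in> S) * G (\<lambda>v. of_bool (v \<in> S)) u ^ (r - 1))"
proof -
  let ?g = "G (\<lambda>v. of_bool (v \<in> S))"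
  have "(\<delta> - inside S) / \<delta> \<le> \<epsilon>" using expansion_eq[OF nb arcs S(1)] S by simp
  then have "\<delta> - inside S \<le> \<epsilon> * \<delta>" using S by (simp add: pos_divide_le_eq)
  then have "real (r - 1) * (\<delta> - inside S) \<le> real (r - 1) * (\<epsilon> * \<delta>)" by (intro mult_left_mono) auto
  also have "\<dots> \<le> 1 / 2 * \<delta>" unfolding mult.assoc[symmetric] using r S by (intro mult_right_mono) auto
  finally have 1: "real (r - 1) * (\<delta> - inside S) \<le> \<delta> / 2" by simp
  have "Ev (\<lambda>u. of_bool (u \<in> S) - real (r - 1) * (of_bool (u \<in> S) - of_bool (u \<in> S) * ?g u))
     \<le> Ev (\<lambda>u. of_bool (u \<in> S) * ?g u ^ (r - 1))"
  proof (rule Ev_mono)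
    fix u assume u: "u < n"
    have "0 \<le> ?g u" using u by (intro G_nonneg) auto
    then have "1 + real (r - 1) * (?g u - 1) \<le> (1 + (?g u - 1)) ^ (r - 1)" by (intro Bernoulli_inequality) simp
    then show "of_bool (u \<in> S) - real (r - 1) * (of_bool (u \<in> S) - of_bool (u \<in> S) * ?g u)
       \<le> of_bool (u \<in> S) * ?g u ^ (r - 1)" by (cases "u \<in> S") (auto simp: algebra_simps)
  qed
  moreover have "Ev (\<lambda>u. of_bool (u \<in> S) - real (r - 1) * (of_bool (u \<in> S) - of_bool (u \<in> S) * ?g u))
     = \<delta> - real (r - 1) * (\<delta> - inside S)"
    unfolding Ev_diff Ev_cmult using Ev_indicator[OF S(1)] S(2) by (simp add: inside_def vol_def)
  ultimately show ?thesis using 1 by linarith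
qed

text \<open>By averaging over all \<open>k\<close>-subsets.\<close>

lemma (in regular_adj) exists_dense_subset:
  assumes nb: "nb = nbr E" and irr: "\<And>u. {u} \<notin> E" and k: "2 \<le> k" "k \<le> n"
  shows "\<exists>T \<subseteq> {..<n}. card T = k \<and> real k / real n * ((real k - 1) / (real n - 1)) \<le> inside T"
proof (rule ccontr)
  assume a: "\<not> ?thesis"
  let ?K = "{T. T \<subseteq> {..<n} \<and> card T = k}"
  have finK: "finite ?K" by simp
  have cK: "card ?K = n choose k" using n_subsets[of "{..<n}" k] by simp
  have K0: "?K \<noteq> {}" using cK k by (metis card.empty zero_less_binomial less_irrefl)
  let ?c = "real k / real n * ((real k - 1) / (real n - 1))"
  have lt: "(\<Sum>T\<in>?K. inside T) < (\<Sum>T\<in>?K. ?c)"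
    using a K0 finK by (intro sum_strict_mono) (auto simp: not_le)
  have pairs: "card {T \<in> ?K. u \<in> T \<and> v \<in> T} = (n - 2) choose (k - 2)" if uv: "u < n" "v < n" "u \<noteq> v" for u v
  proof -
    have "bij_betw (\<lambda>T. T - {u, v}) {T \<in> ?K. u \<in> T \<and> v \<in> T} {T. T \<subseteq> {..<n} - {u, v} \<and> card T = k - 2}"
    proof (rule bij_betw_byWitness[where f' = "\<lambda>T. T \<union> {u, v}"])
      show "(\<lambda>T. T - {u, v}) ` {T \<in> ?K. u \<in> T \<and> v \<in> T} \<subseteq> {T. T \<subseteq> {..<n} - {u, v} \<and> card T = k - 2}"
        using uv by (auto simp: card_Diff_subset finite_subset[of _ "{..<n}"])
      show "(\<lambda>T. T \<union> {u, v}) ` {T. T \<subseteq> {..<n} - {u, v} \<and> card T = k - 2} \<subseteq> {T \<in> ?K. u \<in> T \<and> v \<in> T}"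
      proof (rule image_subsetI)
        fix T assume "T \<in> {T. T \<subseteq> {..<n} - {u, v} \<and> card T = k - 2}"
        then have T: "T \<subseteq> {..<n} - {u, v}" "card T = k - 2" by auto
        then have "finite T" using finite_subset by blast
        then have "card (T \<union> {u, v}) = card T + card {u, v}" using T by (intro card_Un_disjoint) auto
        then have "card (T \<union> {u, v}) = k" using T uv k by simp
        then show "T \<union> {u, v} \<in> {T \<in> ?K. u \<in> T \<and> v \<in> T}"
          using T uv by auto
      qed
    qed auto
    then have "card {T \<in> ?K. u \<in> T \<and> v \<in> T} = card {T. T \<subseteq> {..<n} - {u, v} \<and> card T = k - 2}"
      by (rule bij_betw_same_card)
    also have "\<dots> = card ({..<n} - {u, v}) choose (k - 2)" by (rule n_subsets) simp
    also have "card ({..<n} - {u, v}) = n - 2" using uv by (simp add: card_Diff_subset)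
    finally show ?thesis .
  qed
  have "(\<Sum>T\<in>?K. inside T) = (\<Sum>T\<in>?K. (\<Sum>u<n. \<Sum>v\<in>nb u. of_bool (u \<in> T \<and> v \<in> T)) / (real n * real d))"
  proof (intro sum.cong refl)
    fix T
    have "of_bool (u \<in> T) * G (\<lambda>v. of_bool (v \<in> T)) u = (\<Sum>v\<in>nb u. of_bool (u \<in> T \<and> v \<in> T)) / real d" for u
      by (simp add: G_def sum_distrib_left of_bool_conj)
    then show "inside T = (\<Sum>u<n. \<Sum>v\<in>nb u. of_bool (u \<in> T \<and> v \<in> T)) / (real n * real d)"
      by (simp add: inside_def Ev_def sum_divide_distrib[symmetric] mult.commute)
  qed
  also have "\<dots> = (\<Sum>u<n. \<Sum>v\<in>nb u. \<Sum>T\<in>?K. of_bool (u \<in> T \<and> v \<in> T)) / (real n * real d)"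
    unfolding sum_divide_distrib[symmetric]
    by (subst sum.swap, intro arg_cong2[where f = "(/)"] sum.cong refl, subst sum.swap, rule refl)
  also have "(\<Sum>u<n. \<Sum>v\<in>nb u. \<Sum>T\<in>?K. of_bool (u \<in> T \<and> v \<in> T)) = (\<Sum>u<n. \<Sum>v\<in>nb u. real ((n - 2) choose (k - 2)))"
  proof (intro sum.cong refl)
    fix u v assume u: "u \<in> {..<n}" and v: "v \<in> nb u"
    have uv: "u \<noteq> v" using irr v by (auto simp: nb nbr_def)
    have "(\<Sum>T\<in>?K. of_bool (u \<in> T \<and> v \<in> T) :: real) = real (card {T \<in> ?K. u \<in> T \<and> v \<in> T})"
      using finK by (simp add: of_bool_def sum.If_cases Int_def)
    also have "card {T \<in> ?K. u \<in> T \<and> v \<in> T} = (n - 2) choose (k - 2)"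
      using u v nb_sub uv by (intro pairs) auto
    finally show "(\<Sum>T\<in>?K. of_bool (u \<in> T \<and> v \<in> T)) = real ((n - 2) choose (k - 2))" .
  qed
  also have "\<dots> = real n * real d * real ((n - 2) choose (k - 2))" using nb_card by simp
  finally have "(\<Sum>T\<in>?K. inside T) = real ((n - 2) choose (k - 2))" using n_pos d_pos by simp
  moreover have "(\<Sum>T\<in>?K. ?c) = real ((n - 2) choose (k - 2))"
  proof -
    obtain k' n' where kn: "k = Suc (Suc k')" "n = Suc (Suc n')" using k
      by (metis add_2_eq_Suc le_Suc_ex le_trans)
    have "real (Suc n' choose Suc k') * real (Suc k') = real (Suc n') * real (n' choose k')"
      using Suc_times_binomial_eq[of n' k'] by (metis of_nat_mult mult.commute)
    moreover have "real (Suc (Suc n') choose Suc (Suc k')) * real (Suc (Suc k')) = real (Suc (Suc n')) * real (Suc n' choose Suc k')"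
      using Suc_times_binomial_eq[of "Suc n'" "Suc k'"] by (metis of_nat_mult mult.commute)
    ultimately have "real (n choose k) * real k * real (Suc k') = real n * real (Suc n') * real (n' choose k')"
      using kn by (metis (no_types, lifting) mult.assoc)
    moreover have "?c = real k * real (Suc k') / (real n * real (Suc n'))" using kn by simp
    moreover have "0 < real n * real (Suc n')" using n_pos by simp
    moreover have "n - 2 = n'" "k - 2 = k'" using kn by auto
    ultimately show ?thesis unfolding sum_constant cK using n_pos by (simp add: mult.assoc[symmetric])
  qed
  ultimately show False using lt by simp
qed

text \<open>Vertices may be of any type: \<open>vl\<close> lists them, and renaming by position
  gives the encoded hypergraph. For lower bounds a set of fewer than \<open>k\<close> vertices
  suffices, since it can be enlarged; for upper bounds all sets of exactly \<open>k\<close> vertices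
  matter.\<close>

lemma
  fixes vl :: "'a list" and es :: "'a set list"
  assumes vl: "distinct vl" "length vl = N" "0 < N" and es: "distinct es" "es \<noteq> []"
    and e: "\<And>e. e \<in> set es \<Longrightarrow> e \<subseteq> set vl \<and> card e = r"
    and mu: "0 \<le> \<mu>" "\<mu> \<le> 1" "\<mu> \<in> \<rat> \<longrightarrow> \<mu> * real N \<in> \<int>"
  defines "w \<equiv> replicate N True @ [False] @ concat (map (\<lambda>e. map (\<lambda>x. x \<in> e) vl) es)"
    and "k \<equiv> nat \<lfloor>\<mu> * real N\<rfloor>"
  shows hypergraph_transfer_ge: "S \<subseteq> set vl \<Longrightarrow> card S \<le> k \<Longrightarrow>
      \<alpha> \<le> real (card {e \<in> set es. e \<subseteq> S}) / real (length es) \<Longrightarrow> w \<in> dksh_at_least r \<mu> \<alpha>"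
    and hypergraph_transfer_le: "(\<And>S. S \<subseteq> set vl \<Longrightarrow> card S = k \<Longrightarrow>
      real (card {e \<in> set es. e \<subseteq> S}) / real (length es) \<le> \<beta>) \<Longrightarrow> w \<in> dksh_at_most r \<mu> \<beta>"
proof -
  define f where "f e = {v. v < N \<and> vl ! v \<in> e}" for e
  define E where "E = f ` set es"
  have nth_in: "v < N \<Longrightarrow> vl ! v \<in> set vl" for v using vl by simp
  have fimg: "(!) vl ` f e = e" if "e \<subseteq> set vl" for e
    using that vl by (auto simp: f_def image_iff in_set_conv_nth subset_iff)
  have injnth: "inj_on ((!) vl) {..<N}" using vl by (auto simp: inj_on_def nth_eq_iff_index_eq)
  have fcard: "card (f e) = card e" if "e \<subseteq> set vl" for e
  proof -
    have "f e \<subseteq> {..<N}" by (auto simp: f_def)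
    from card_image[OF inj_on_subset[OF injnth this]] show ?thesis using fimg[OF that] by simp
  qed
  have finj: "inj_on f (set es)" by (rule inj_on_inverseI[of _ "\<lambda>x. (!) vl ` x"]) (use fimg e in auto)
  have enc: "encodes w N E"
    unfolding encodes_def
  proof (intro exI[of _ "map f es"] conjI)
    show "distinct (map f es)" using es finj by (simp add: distinct_map)
    show "set (map f es) = E" by (simp add: E_def)
    have "map (\<lambda>x. x \<in> e) vl = map (\<lambda>v. v \<in> f e) [0..<N]" for e
      by (rule nth_equalityI) (auto simp: vl f_def)
    then show "w = replicate N True @ [False] @ concat (map (\<lambda>e. map (\<lambda>v. v \<in> e) [0..<N]) (map f es))"
      by (simp add: w_def comp_def)
  qed
  have inst: "dksh_instance r \<mu> N E"
    unfolding dksh_instance_def uniform_hypergraph_def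
    using vl es e fcard mu by (auto simp: E_def f_def)
  have cE: "card E = length es"
    unfolding E_def using card_image[OF finj] distinct_card[OF es(1)] by simp
  have cS: "card {x \<in> E. x \<subseteq> S} = card {x \<in> set es. x \<subseteq> (!) vl ` S}" if S: "S \<subseteq> {..<N}" for S
  proof -
    have "f x \<subseteq> S \<longleftrightarrow> x \<subseteq> (!) vl ` S" if x: "x \<in> set es" for x
    proof
      assume "f x \<subseteq> S"
      then show "x \<subseteq> (!) vl ` S" using fimg[of x] e[OF x] by blast
    next
      assume a: "x \<subseteq> (!) vl ` S"
      show "f x \<subseteq> S"
      proof
        fix v assume v: "v \<in> f x"
        then obtain v' where "v' \<in> S" "vl ! v = vl ! v'" using a by (auto simp: f_def)
        then show "v \<in> S" using v S injnth by (auto simp: f_def inj_on_def)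
      qed
    qed
    then have "{x \<in> E. x \<subseteq> S} = f ` {x \<in> set es. x \<subseteq> (!) vl ` S}" by (auto simp: E_def)
    then show ?thesis using card_image[OF inj_on_subset[OF finj]] by fastforce
  qed
  let ?V = "{real (card {e \<in> E. e \<subseteq> S}) / real (card E) | S. S \<subseteq> {..<N} \<and> card S = k}"
  have finV: "finite ?V"
    by (rule finite_subset[of _ "(\<lambda>S. real (card {e \<in> E. e \<subseteq> S}) / real (card E)) ` Pow {..<N}"]) auto
  have "\<mu> * real N \<le> 1 * real N" using mu by (intro mult_right_mono) auto
  then have kN: "k \<le> N" unfolding k_def by linarith
  have finE: "finite E" by (simp add: E_def)
  show "w \<in> dksh_at_least r \<mu> \<alpha>"
    if S: "S \<subseteq> set vl" "card S \<le> k" "\<alpha> \<le> real (card {e \<in> set es. e \<subseteq> S}) / real (length es)"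
  proof -
    have "card (f S) \<le> k" "f S \<subseteq> {..<N}" using fcard[OF S(1)] S(2) by (auto simp: f_def)
    then obtain S' where S': "f S \<subseteq> S'" "S' \<subseteq> {..<N}" "card S' = k"
      using exists_subset_between[of "f S" k "{..<N}"] kN by auto
    have "S \<subseteq> (!) vl ` S'" using fimg[OF S(1)] S'(1) by blast
    then have "card {e \<in> set es. e \<subseteq> S} \<le> card {x \<in> set es. x \<subseteq> (!) vl ` S'}"
      by (intro card_mono) auto
    then have "\<alpha> \<le> real (card {e \<in> E. e \<subseteq> S'}) / real (card E)"
      unfolding cS[OF S'(2)] cE using S(3) by (elim order_trans) (intro divide_right_mono, auto)
    also have "\<dots> \<le> Max ?V" using finV S' by (intro Max_ge) auto
    finally show ?thesis using enc inst unfolding dksh_at_least_def densest_value_def k_def by blast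
  qed
  show "w \<in> dksh_at_most r \<mu> \<beta>"
    if b: "\<And>S. S \<subseteq> set vl \<Longrightarrow> card S = k \<Longrightarrow> real (card {e \<in> set es. e \<subseteq> S}) / real (length es) \<le> \<beta>"
  proof -
    obtain S0 where "S0 \<subseteq> {..<N}" "card S0 = k" using exists_subset_between[of "{}" k "{..<N}"] kN by auto
    then have ne: "?V \<noteq> {}" by blast
    have "x \<le> \<beta>" if "x \<in> ?V" for x
    proof -
      obtain S where S: "S \<subseteq> {..<N}" "card S = k" "x = real (card {e \<in> E. e \<subseteq> S}) / real (card E)"
        using \<open>x \<in> ?V\<close> by blast
      have "(!) vl ` S \<subseteq> set vl" using S nth_in by auto
      moreover have "card ((!) vl ` S) = k" using card_image[OF inj_on_subset[OF injnth S(1)]] S(2) by simp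
      ultimately show ?thesis using b S(3) unfolding cS[OF S(1)] cE by simp
    qed
    then have "Max ?V \<le> \<beta>" using finV ne by simp
    then show ?thesis using enc inst unfolding dksh_at_most_def densest_value_def k_def by blast
  qed
qed

text \<open>The denominator of \<mu>, or 1 if \<mu> is irrational.\<close>

lemma rational_multiple:
  fixes \<mu> :: real
  obtains q :: nat where "0 < q" "\<And>k :: nat. \<mu> \<in> \<rat> \<longrightarrow> \<mu> * real (q * k) \<in> \<int>"
proof (cases "\<mu> \<in> \<rat>")
  case True
  then obtain a b :: int where ab: "\<mu> = of_int a / of_int b" "0 < b" by (metis Rats_cases')
  have "\<mu> * real (nat b * k) \<in> \<int>" for k
  proof -
    have "\<mu> * real (nat b * k) = of_int (a * int k)" using ab by simp
    then show ?thesis by (metis Ints_of_int)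
  qed
  then show ?thesis using that[of "nat b"] ab by auto
next
  case False
  then show ?thesis using that[of 1] by auto
qed

text \<open>A single hyperedge has value 1. In the complete hypergraph the value is a quotient of
  binomials, bounded by \<mu>^r factor by factor, since (k - i) / (N - i) \<le> \<mu>.\<close>

lemma fixed_instances:
  fixes \<mu> c C :: real
  assumes r: "2 \<le> r" and mu: "0 < \<mu>" "\<mu> \<le> 1" and c: "\<alpha> \<le> 1" and C: "\<mu> ^ r \<le> \<beta>"
  shows "\<exists>w. w \<in> dksh_at_least r \<mu> \<alpha>" "\<exists>w. w \<in> dksh_at_most r \<mu> \<beta>"
proof -
  obtain q :: nat where q: "0 < q" "\<And>k :: nat. \<mu> \<in> \<rat> \<longrightarrow> \<mu> * real (q * k) \<in> \<int>" by (rule rational_multiple[of \<mu>]) blast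
  \<comment> \<open>Ensures that a set of \<mu> N vertices, rounded down, has room for a
    hyperedge.\<close>
  obtain K :: nat where K: "real r / \<mu> < real K" using reals_Archimedean2 by blast
  define N where "N = q * K"
  define k where "k = nat \<lfloor>\<mu> * real N\<rfloor>"
  have "real r < \<mu> * real K" using K mu by (simp add: field_simps)
  also have "\<dots> \<le> \<mu> * real N"
  proof (rule mult_left_mono)
    have "K \<le> N" using q by (simp add: N_def)
    then show "real K \<le> real N" by simp
  qed (use mu in simp)
  finally have rN: "real r < \<mu> * real N" .
  then have kr: "r \<le> k" unfolding k_def by linarith
  have "\<mu> * real N \<le> 1 * real N" using mu by (intro mult_right_mono) auto
  then have rN': "r \<le> N" "k \<le> N" using rN unfolding k_def by linarith+
  have N0: "0 < N" using rN' r by simp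
  let ?vl = "[0..<N]"
  have muN: "\<mu> \<in> \<rat> \<longrightarrow> \<mu> * real N \<in> \<int>" using q(2)[of K] by (simp add: N_def)
  have "{..<r} \<subseteq> set ?vl" using rN' by auto
  moreover have "{e \<in> set [{..<r}]. e \<subseteq> {..<r}} = {{..<r}}" by auto
  then have "\<alpha> \<le> real (card {e \<in> set [{..<r}]. e \<subseteq> {..<r}}) / real (length [{..<r}])" using c by simp
  ultimately show "\<exists>w. w \<in> dksh_at_least r \<mu> \<alpha>"
    using hypergraph_transfer_ge[of ?vl N "[{..<r}]" r \<mu> "{..<r}" \<alpha>] N0 mu muN c kr
    by (auto simp: k_def)
  let ?F = "{e. e \<subseteq> {..<N} \<and> card e = r}"
  obtain es where es: "set es = ?F" "distinct es" using finite_distinct_list[of ?F] by auto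
  have les: "length es = N choose r" using es n_subsets[of "{..<N}" r] distinct_card[OF es(2)] by simp
  have Nr: "0 < N choose r" using rN' by simp
  have rat: "real (k choose r) / real (N choose r) \<le> \<beta>"
  proof -
    have "real (k choose r) = (\<Prod>i = 0..<r. real (k - i) / real (r - i))"
      using binomial_altdef_of_nat[OF kr, where 'a = real] by simp
    also have "\<dots> \<le> (\<Prod>i = 0..<r. \<mu> * (real (N - i) / real (r - i)))"
    proof (rule prod_mono)
      fix i assume i: "i \<in> {0..<r}"
      have "real k \<le> \<mu> * real N" using mu by (simp add: k_def)
      then have "real k - real i \<le> \<mu> * (real N - real i)"
        using mu mult_right_mono[of \<mu> 1 "real i"] by (simp add: algebra_simps)
      then have "real (k - i) \<le> \<mu> * real (N - i)" using i kr rN' by (simp add: of_nat_diff)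
      then have "real (k - i) / real (r - i) \<le> \<mu> * real (N - i) / real (r - i)" by (intro divide_right_mono) auto
      then show "0 \<le> real (k - i) / real (r - i) \<and> real (k - i) / real (r - i) \<le> \<mu> * (real (N - i) / real (r - i))" by simp
    qed
    also have "\<dots> = (\<Prod>i = 0..<r. \<mu>) * (\<Prod>i = 0..<r. real (N - i) / real (r - i))" by (rule prod.distrib)
    also have "\<dots> = \<mu> ^ r * real (N choose r)"
      unfolding binomial_altdef_of_nat[OF rN'(1), where 'a = real] by simp
    finally have "real (k choose r) / real (N choose r) \<le> \<mu> ^ r" using Nr by (simp add: pos_divide_le_eq)
    then show ?thesis using C by linarith
  qed
  have b: "real (card {e \<in> set es. e \<subseteq> S}) / real (length es) \<le> \<beta>" if S: "S \<subseteq> set ?vl" "card S = k" for S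
  proof -
    have "{e \<in> set es. e \<subseteq> S} = {e. e \<subseteq> S \<and> card e = r}" using S(1) es by auto
    then have "card {e \<in> set es. e \<subseteq> S} = k choose r"
      using n_subsets[of S r] S finite_subset[OF S(1)] by simp
    then show ?thesis using rat les by simp
  qed
  have ne: "es \<noteq> []" using les Nr by auto
  have ee: "e \<subseteq> set ?vl \<and> card e = r" if "e \<in> set es" for e using es that by auto
  show "\<exists>w. w \<in> dksh_at_most r \<mu> \<beta>"
    by (intro exI, rule hypergraph_transfer_le[OF _ _ N0 es(2) ne ee _ mu(2) muN b[unfolded k_def]])
      (use mu in simp_all)
qed

section \<open>The reduction as a loop program\<close>

text \<open>The first variable becomes the innermost loop, which is the order in which
  \<open>List.n_lists\<close> enumerates.\<close>

fun fors :: "nat list \<Rightarrow> cmd \<Rightarrow> cmd" where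
  "fors [] c = c"
| "fors (v # vs) c = fors vs (For v c)"

fun upds :: "(nat \<Rightarrow> nat) \<Rightarrow> nat list \<Rightarrow> nat list \<Rightarrow> nat \<Rightarrow> nat" where
  "upds env (v # vs) (y # ys) = (upds env vs ys)(v := y)"
| "upds env _ _ = env"

lemma concat_map_concat: "concat (map f (concat xss)) = concat (map (\<lambda>xs. concat (map f xs)) xss)"
  by (induction xss) auto

lemma concat_map_n_lists:
  "concat (map f (List.n_lists (Suc k) xs)) = concat (map (\<lambda>ys. concat (map (\<lambda>y. f (y # ys)) xs)) (List.n_lists k xs))"
  by (simp add: concat_map_concat comp_def)

lemma sem_fors:
  "sem n E (fors vs c) env = concat (map (\<lambda>ys. sem n E c (upds env vs ys)) (List.n_lists (length vs) [0..<n]))"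
proof (induction vs arbitrary: c)
  case (Cons v vs)
  show ?case unfolding length_Cons concat_map_n_lists by (simp add: Cons.IH)
qed simp

fun forsB :: "nat list list \<Rightarrow> cmd \<Rightarrow> cmd" where
  "forsB [] c = c"
| "forsB (vs # vss) c = forsB vss (fors vs c)"

fun updsB :: "(nat \<Rightarrow> nat) \<Rightarrow> nat list list \<Rightarrow> nat list list \<Rightarrow> nat \<Rightarrow> nat" where
  "updsB env (vs # vss) (y # ys) = upds (updsB env vss ys) vs y"
| "updsB env _ _ = env"

lemma sem_forsB:
  assumes "\<And>vs. vs \<in> set vss \<Longrightarrow> length vs = t"
  shows "sem n E (forsB vss c) env =
    concat (map (\<lambda>X. sem n E c (updsB env vss X)) (List.n_lists (length vss) (List.n_lists t [0..<n])))"
  using assms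
proof (induction vss arbitrary: c)
  case (Cons vs vss)
  then show ?case unfolding length_Cons concat_map_n_lists by (simp add: sem_fors)
qed simp

lemma upds_other: "v \<notin> set vs \<Longrightarrow> upds env vs ys v = env v"
  by (induction env vs ys rule: upds.induct) auto

lemma upds_nth:
  assumes "distinct vs" "length ys = length vs" "i < length vs"
  shows "upds env vs ys (vs ! i) = ys ! i"
  using assms
proof (induction env vs ys arbitrary: i rule: upds.induct)
  case (1 env v vs y ys)
  then show ?case by (cases i) auto
qed auto

lemma updsB_nth:
  assumes "distinct (concat vss)" "length X = length vss" "j < length vss" "length (X ! j) = length (vss ! j)"
    "i < length (vss ! j)"
  shows "updsB env vss X (vss ! j ! i) = X ! j ! i"
  using assms
proof (induction env vss X arbitrary: j rule: updsB.induct)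
  case (1 env vs vss y ys)
  show ?case
  proof (cases j)
    case 0
    then show ?thesis using 1 by (simp add: upds_nth)
  next
    case (Suc j')
    have "vss ! j' ! i \<in> set (concat vss)" using 1(4,6) Suc by (auto intro!: bexI[of _ "vss ! j'"])
    then have "vss ! j' ! i \<notin> set vs" using 1(2) by auto
    then show ?thesis using 1 Suc by (simp add: upds_other)
  qed
qed auto

lemma nth_subset: "set xs \<subseteq> A \<Longrightarrow> i < length xs \<Longrightarrow> xs ! i \<in> A"
  by (meson nth_mem subsetD)

fun catl :: "cmd list \<Rightarrow> cmd" where
  "catl [] = Nop"
| "catl (c # cs) = Cat c (catl cs)"

lemma concat_replicate_replicate: "concat (replicate a (replicate b x)) = replicate (a * b) x"
  by (induction a) (auto simp: replicate_add)

lemma sem_catl: "sem n E (catl cs) env = concat (map (\<lambda>c. sem n E c env) cs)"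
  by (induction cs) auto

text \<open>\<open>IfEq\<close> discards equal values, for which \<open>IfAdj\<close> would find any
  edge at the vertex.\<close>

fun all_adj :: "(nat \<times> nat) list \<Rightarrow> cmd \<Rightarrow> cmd" where
  "all_adj [] c = c"
| "all_adj ((u, v) # ps) c = IfEq u v Nop (IfAdj u v (all_adj ps c) Nop)"

lemma sem_all_adj:
  assumes E: "\<And>e. e \<in> E \<Longrightarrow> card e = 2"
  shows "sem n E (all_adj ps c) env = (if \<forall>(u, v) \<in> set ps. env v \<in> nbr E (env u) then sem n E c env else [])"
proof (induction ps c rule: all_adj.induct)
  case (2 u v ps c)
  have "(env u \<noteq> env v \<and> (\<exists>e \<in> E. env u \<in> e \<and> env v \<in> e)) \<longleftrightarrow> env v \<in> nbr E (env u)"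
  proof
    assume a: "env u \<noteq> env v \<and> (\<exists>e \<in> E. env u \<in> e \<and> env v \<in> e)"
    then obtain e where e: "e \<in> E" "env u \<in> e" "env v \<in> e" by blast
    obtain x y where "e = {x, y}" using E[OF e(1)] by (auto simp: card_2_iff)
    then have "e = {env u, env v}" using e a by auto
    then show "env v \<in> nbr E (env u)" using e by (simp add: nbr_def)
  next
    assume a: "env v \<in> nbr E (env u)"
    then have "card {env u, env v} = 2" using E by (simp add: nbr_def)
    then have "env u \<noteq> env v" by auto
    then show "env u \<noteq> env v \<and> (\<exists>e \<in> E. env u \<in> e \<and> env v \<in> e)" using a by (auto simp: nbr_def)
  qed
  then show ?case using 2 by auto
qed simp

fun all_eq :: "(nat \<times> nat) list \<Rightarrow> cmd" where
  "all_eq [] = Out True"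
| "all_eq ((u, v) # ps) = IfEq u v (all_eq ps) (Out False)"

lemma sem_all_eq: "sem n E (all_eq ps) env = [\<forall>(u, v) \<in> set ps. env u = env v]"
  by (induction ps rule: all_eq.induct) auto

lemma wfc_fors:
  "distinct vs \<Longrightarrow> set vs \<subseteq> {..<nv} \<Longrightarrow> set vs \<inter> A = {} \<Longrightarrow> wfc nv (A \<union> set vs) c \<Longrightarrow> wfc nv A (fors vs c)"
proof (induction vs arbitrary: c)
  case (Cons v vs)
  have "wfc nv (A \<union> set vs) (For v c)" using Cons.prems by auto
  then show ?case using Cons by simp
qed simp

lemma wfc_forsB:
  "distinct (concat vss) \<Longrightarrow> set (concat vss) \<subseteq> {..<nv} \<Longrightarrow> set (concat vss) \<inter> A = {} \<Longrightarrow>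
    wfc nv (A \<union> set (concat vss)) c \<Longrightarrow> wfc nv A (forsB vss c)"
proof (induction vss arbitrary: c)
  case (Cons vs vss)
  have "wfc nv (A \<union> set (concat vss)) (fors vs c)"
    using Cons.prems by (intro wfc_fors) (auto simp: Un_ac)
  then show ?case using Cons by (simp add: Int_Un_distrib2 Int_Un_distrib)
qed simp

lemma wfc_catl: "wfc nv A (catl cs) \<longleftrightarrow> (\<forall>c \<in> set cs. wfc nv A c)"
  by (induction cs) auto

lemma wfc_all_adj:
  "(\<And>u v. (u, v) \<in> set ps \<Longrightarrow> u < nv \<and> v < nv \<and> u \<in> A \<and> v \<in> A \<and> u \<noteq> v) \<Longrightarrow> wfc nv A c \<Longrightarrow> wfc nv A (all_adj ps c)"
  by (induction ps c rule: all_adj.induct) auto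

lemma wfc_all_eq:
  "(\<And>u v. (u, v) \<in> set ps \<Longrightarrow> u < nv \<and> v < nv \<and> u \<in> A \<and> v \<in> A \<and> u \<noteq> v) \<Longrightarrow> wfc nv A (all_eq ps)"
  by (induction ps rule: all_eq.induct) auto

text \<open>Block \<open>j\<close> of \<open>t\<close> variables holds row \<open>j\<close> of a
  transversal; the separate block \<open>yvars\<close> runs through the columns of the incidence
  matrix.\<close>

definition xvars :: "nat \<Rightarrow> nat \<Rightarrow> nat list list" where
  "xvars r t = map (\<lambda>j. map (\<lambda>i. j * t + i) [0..<t]) [0..<r]"

definition yvars :: "nat \<Rightarrow> nat \<Rightarrow> nat list" where
  "yvars r t = map (\<lambda>i. r * t + i) [0..<t]"

lemma concat_xvars: "concat (xvars r t) = [0..<r * t]"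
proof (induction r)
  case (Suc r)
  have "map (\<lambda>i. r * t + i) [0..<t] = [r * t..<r * t + t]"
    using map_add_upt[of "r * t" t] by (simp add: add.commute)
  moreover have "concat (xvars (Suc r) t) = concat (xvars r t) @ map (\<lambda>i. r * t + i) [0..<t]"
    by (simp add: xvars_def)
  ultimately show ?case using Suc upt_add_eq_append[of 0 "r * t" t] by (simp add: add.commute)
qed (simp add: xvars_def)

lemma xvar_less: "j < r \<Longrightarrow> i < t \<Longrightarrow> j * t + i < r * (t :: nat)"
proof -
  assume a: "j < r" "i < t"
  have "Suc j * t \<le> r * t" using a by (intro mult_le_mono1) simp
  then show ?thesis using a by simp
qed

context
  fixes r m t B :: nat and h :: "nat \<Rightarrow> nat \<Rightarrow> nat \<Rightarrow> nat \<Rightarrow> nat"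
begin

definition adj_pairs :: "nat list \<Rightarrow> (nat \<times> nat) list" where
  "adj_pairs bs = concat (map (\<lambda>j. map (\<lambda>i.
     (h (bs ! 0) (bs ! 1) 0 i, j * t + h (bs ! 0) (bs ! 1) j i)) [0..<m]) [1..<r])"

text \<open>The incidence row of one hyperedge: the vertex (j, b, y) belongs to it if
  \<open>b\<close> is the label of part \<open>j\<close> and \<open>y\<close> equals row
  \<open>j\<close>. Labels are constants of the program, so comparing them happens at compile time
  and only the tuples are loop variables.\<close>

definition row_cmd :: "nat list \<Rightarrow> cmd" where
  "row_cmd bs = catl (concat (map (\<lambda>j. map (\<lambda>b. fors (yvars r t)
     (if bs ! j = b then all_eq (map (\<lambda>i. (j * t + i, r * t + i)) [0..<t]) else Out False)) [0..<B]) [0..<r]))"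

definition reduction_cmd :: cmd where
  "reduction_cmd = Cat (catl (replicate (r * B) (fors (yvars r t) (Out True)))) (Cat (Out False)
     (forsB (xvars r t) (catl (map (\<lambda>bs. all_adj (adj_pairs bs) (row_cmd bs)) (List.n_lists r [0..<B])))))"

text \<open>The vertices in the order in which \<open>row_cmd\<close> writes the columns.\<close>

definition vlist :: "nat \<Rightarrow> (nat \<times> nat \<times> nat list) list" where
  "vlist n = concat (map (\<lambda>j. concat (map (\<lambda>b. map (\<lambda>y. (j, b, y)) (List.n_lists t [0..<n])) [0..<B])) [0..<r])"

definition pat :: "nat set set \<Rightarrow> nat list \<Rightarrow> nat list list \<Rightarrow> bool" where
  "pat E bs X \<longleftrightarrow> (\<forall>j \<in> {1..<r}. \<forall>i < m.
     X ! j ! h (bs ! 0) (bs ! 1) j i \<in> nbr E (X ! 0 ! h (bs ! 0) (bs ! 1) 0 i))"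

definition edge :: "nat list \<Rightarrow> nat list list \<Rightarrow> (nat \<times> nat \<times> nat list) set" where
  "edge bs X = (\<lambda>j. (j, bs ! j, X ! j)) ` {..<r}"

definition elist :: "nat \<Rightarrow> nat set set \<Rightarrow> (nat \<times> nat \<times> nat list) set list" where
  "elist n E = concat (map (\<lambda>X. map (\<lambda>bs. edge bs X) (filter (\<lambda>bs. pat E bs X) (List.n_lists r [0..<B])))
     (List.n_lists r (List.n_lists t [0..<n])))"

lemma set_vlist: "set (vlist n) = {..<r} \<times> {..<B} \<times> {x. length x = t \<and> set x \<subseteq> {..<n}}"
  by (auto simp: vlist_def set_n_lists atLeast0LessThan image_iff)

lemma length_vlist: "length (vlist n) = r * B * n ^ t"
  by (simp add: vlist_def length_concat comp_def length_n_lists sum_list_triv)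

lemma distinct_vlist: "distinct (vlist n)"
proof (rule card_distinct)
  have "card {x. length x = t \<and> set x \<subseteq> {..<n}} = n ^ t"
    using card_lists_length_eq[of "{..<n}" t] by (simp add: conj_commute)
  then show "card (set (vlist n)) = length (vlist n)"
    by (simp add: set_vlist length_vlist card_cartesian_product)
qed

text \<open>Vertices carry the index of their part, so a hyperedge determines the label and the row
  of each part.\<close>

lemma edge_inj:
  assumes "edge bs X = edge bs' X'" "length bs = r" "length bs' = r" "length X = r" "length X' = r"
  shows "bs = bs' \<and> X = X'"
proof -
  have "bs ! j = bs' ! j \<and> X ! j = X' ! j" if "j < r" for j
  proof -
    have "(j, bs ! j, X ! j) \<in> edge bs' X'" using that assms(1) by (auto simp: edge_def)
    then show ?thesis by (auto simp: edge_def)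
  qed
  then show ?thesis using assms by (auto intro!: nth_equalityI)
qed

text \<open>The index pairs of the hyperedges in the order of \<open>elist\<close>; distinctness and
  counting are easier for pairs and pass to hyperedges by injectivity.\<close>

definition plist :: "nat \<Rightarrow> nat set set \<Rightarrow> (nat list \<times> nat list list) list" where
  "plist n E = concat (map (\<lambda>X. map (\<lambda>bs. (bs, X)) (filter (\<lambda>bs. pat E bs X) (List.n_lists r [0..<B])))
     (List.n_lists r (List.n_lists t [0..<n])))"

lemma elist_plist: "elist n E = map (\<lambda>(bs, X). edge bs X) (plist n E)"
  by (simp add: elist_def plist_def map_concat comp_def)

lemma set_plist: "set (plist n E) = {(bs, X). length bs = r \<and> set bs \<subseteq> {..<B} \<and> length X = r \<and>
    set X \<subseteq> {x. length x = t \<and> set x \<subseteq> {..<n}} \<and> pat E bs X}"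
  by (auto simp: plist_def set_n_lists atLeast0LessThan image_iff)

lemma distinct_plist: "distinct (plist n E)"
proof -
  have dX: "distinct (List.n_lists r (List.n_lists t [0..<n]))" by (simp add: distinct_n_lists)
  have db: "distinct (List.n_lists r [0..<B])" by (simp add: distinct_n_lists)
  have "distinct (concat (map (\<lambda>X. map (\<lambda>bs. (bs, X)) (filter (\<lambda>bs. pat E bs X) (List.n_lists r [0..<B]))) Xs))"
    if "distinct Xs" for Xs
    using that
  proof (induction Xs)
    case (Cons X Xs)
    have "distinct (map (\<lambda>bs. (bs, X)) (filter (\<lambda>bs. pat E bs X) (List.n_lists r [0..<B])))"
      using db by (simp add: distinct_map inj_on_def)
    then show ?case using Cons by auto
  qed simp
  then show ?thesis using dX by (simp add: plist_def)
qed

lemma inj_edge: "inj_on (\<lambda>(bs, X). edge bs X) (set (plist n E))"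
  by (rule inj_onI) (use edge_inj in \<open>auto simp: set_plist\<close>)

lemma distinct_elist: "distinct (elist n E)"
  unfolding elist_plist distinct_map using distinct_plist inj_edge by blast

lemma elist_edges: "e \<in> set (elist n E) \<Longrightarrow> e \<subseteq> set (vlist n) \<and> card e = r"
proof -
  assume "e \<in> set (elist n E)"
  then obtain bs X where p: "(bs, X) \<in> set (plist n E)" "e = edge bs X" by (auto simp: elist_plist)
  have l: "length bs = r" "set bs \<subseteq> {..<B}" "length X = r" "set X \<subseteq> {x. length x = t \<and> set x \<subseteq> {..<n}}"
    using p(1) unfolding set_plist by auto
  have "bs ! j < B" "X ! j \<in> {x. length x = t \<and> set x \<subseteq> {..<n}}" if "j < r" for j
    using that nth_subset[OF l(2), of j] nth_subset[OF l(4), of j] l(1,3) by auto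
  moreover have "inj_on (\<lambda>j. (j, bs ! j, X ! j)) {..<r}" by (auto simp: inj_on_def)
  ultimately show ?thesis unfolding p(2) edge_def set_vlist by (auto simp: card_image)
qed

lemma count_elist:
  "real (card {e \<in> set (elist n E). e \<subseteq> S}) =
    (\<Sum>bs | length bs = r \<and> set bs \<subseteq> {..<B}. \<Sum>X | length X = r \<and> set X \<subseteq> {x. length x = t \<and> set x \<subseteq> {..<n}}.
       of_bool (pat E bs X) * (\<Prod>j<r. of_bool ((j, bs ! j, X ! j) \<in> S)))"
proof -
  let ?L = "{bs. length bs = r \<and> set bs \<subseteq> {..<B}}"
  let ?R = "{X. length X = r \<and> set X \<subseteq> {x. length x = t \<and> set x \<subseteq> {..<n}}}"
  have fin: "finite ?L" "finite ?R"
    using finite_lists_length_eq[of "{..<B}" r] finite_lists_length_eq[of "{..<n}" t]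
      finite_lists_length_eq[of "{x. length x = t \<and> set x \<subseteq> {..<n}}" r]
    by (simp_all add: conj_commute)
  have "{e \<in> set (elist n E). e \<subseteq> S} = (\<lambda>(bs, X). edge bs X) ` {(bs, X) \<in> set (plist n E). edge bs X \<subseteq> S}"
    by (auto simp: elist_plist)
  then have "card {e \<in> set (elist n E). e \<subseteq> S} = card {(bs, X) \<in> set (plist n E). edge bs X \<subseteq> S}"
    using card_image[OF inj_on_subset[OF inj_edge, of "{(bs, X) \<in> set (plist n E). edge bs X \<subseteq> S}" n E]] by auto
  also have "{(bs, X) \<in> set (plist n E). edge bs X \<subseteq> S}
     = {p \<in> ?L \<times> ?R. pat E (fst p) (snd p) \<and> (\<forall>j < r. (j, fst p ! j, snd p ! j) \<in> S)}"
    by (auto simp: set_plist edge_def)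
  finally have "real (card {e \<in> set (elist n E). e \<subseteq> S}) =
      (\<Sum>p\<in>?L \<times> ?R. of_bool (pat E (fst p) (snd p) \<and> (\<forall>j < r. (j, fst p ! j, snd p ! j) \<in> S)))"
    using fin by (simp add: of_bool_def sum.If_cases Int_def)
  also have "\<dots> = (\<Sum>p\<in>?L \<times> ?R. of_bool (pat E (fst p) (snd p)) * (\<Prod>j<r. of_bool ((j, fst p ! j, snd p ! j) \<in> S)))"
    by (intro sum.cong refl) (auto simp: of_bool_def)
  also have "\<dots> = (\<Sum>bs\<in>?L. \<Sum>X\<in>?R. of_bool (pat E bs X) * (\<Prod>j<r. of_bool ((j, bs ! j, X ! j) \<in> S)))"
    by (simp add: sum.cartesian_product case_prod_unfold)
  finally show ?thesis .
qed

lemma length_elist: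
  "real (length (elist n E)) =
    (\<Sum>bs | length bs = r \<and> set bs \<subseteq> {..<B}. \<Sum>X | length X = r \<and> set X \<subseteq> {x. length x = t \<and> set x \<subseteq> {..<n}}.
       of_bool (pat E bs X))"
  using count_elist[of n E UNIV] distinct_card[OF distinct_elist[of n E]] by simp

lemma reduction_cmd_sem:
  assumes E: "\<And>e. e \<in> E \<Longrightarrow> card e = 2" and m: "m \<le> t"
    and h: "\<And>b1 b2 j. b1 < B \<Longrightarrow> b2 < B \<Longrightarrow> j < r \<Longrightarrow> h b1 b2 j permutes {..<t}" and r: "2 \<le> r"
  shows "sem n E reduction_cmd env = replicate (r * B * n ^ t) True @ [False] @
    concat (map (\<lambda>e. map (\<lambda>x. x \<in> e) (vlist n)) (elist n E))"
proof -
  have ly: "length (yvars r t) = t" by (simp add: yvars_def)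
  have dy: "distinct (yvars r t)" by (simp add: yvars_def distinct_map inj_on_def)
  have lx: "length (xvars r t) = r" by (simp add: xvars_def)
  have dx: "distinct (concat (xvars r t))" by (simp add: concat_xvars)
  have lxj: "length (xvars r t ! j) = t" if "j < r" for j using that by (simp add: xvars_def)
  have "concat (map (\<lambda>ys. [True]) xs) = replicate (length xs) True" for xs :: "nat list list"
    by (induction xs) auto
  then have p1: "sem n E (catl (replicate (r * B) (fors (yvars r t) (Out True)))) env = replicate (r * B * n ^ t) True"
    by (simp add: sem_catl sem_fors ly length_n_lists concat_replicate_replicate)
  have row: "sem n E (row_cmd bs) (updsB env (xvars r t) X) = map (\<lambda>x. x \<in> edge bs X) (vlist n)"
    if X: "length X = r" "set X \<subseteq> {x. length x = t \<and> set x \<subseteq> {..<n}}" for bs X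
  proof -
    have cell: "sem n E (fors (yvars r t) (if bs ! j = b then all_eq (map (\<lambda>i. (j * t + i, r * t + i)) [0..<t]) else Out False))
        (updsB env (xvars r t) X) = map (\<lambda>y. (j, b, y) \<in> edge bs X) (List.n_lists t [0..<n])"
      if j: "j < r" for j b
    proof -
      have one: "sem n E (if bs ! j = b then all_eq (map (\<lambda>i. (j * t + i, r * t + i)) [0..<t]) else Out False)
          (upds (updsB env (xvars r t) X) (yvars r t) y) = [(j, b, y) \<in> edge bs X]"
        if y: "y \<in> set (List.n_lists t [0..<n])" for y
      proof -
        have lyy: "length y = t" using y by (simp add: set_n_lists)
        have Xj: "length (X ! j) = t" using X j nth_subset[OF X(2), of j] by auto
        let ?e = "upds (updsB env (xvars r t) X) (yvars r t) y"
        have "?e (r * t + i) = y ! i" if "i < t" for i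
          using upds_nth[OF dy, of y i] lyy ly that by (simp add: yvars_def)
        moreover have "?e (j * t + i) = X ! j ! i" if i: "i < t" for i
        proof -
          have "j * t + i < r * t" using j i by (rule xvar_less)
          then have "j * t + i \<notin> set (yvars r t)" by (auto simp: yvars_def)
          then have "?e (j * t + i) = updsB env (xvars r t) X (j * t + i)" by (rule upds_other)
          moreover have "j * t + i = xvars r t ! j ! i" using i j by (simp add: xvars_def)
          moreover have "updsB env (xvars r t) X (xvars r t ! j ! i) = X ! j ! i"
            by (rule updsB_nth[OF dx]) (use X(1) Xj i j lx lxj in auto)
          ultimately show ?thesis by simp
        qed
        ultimately have "(\<forall>(u, v) \<in> set (map (\<lambda>i. (j * t + i, r * t + i)) [0..<t]). ?e u = ?e v) \<longleftrightarrow> (\<forall>i < t. X ! j ! i = y ! i)"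
          by auto
        also have "\<dots> \<longleftrightarrow> X ! j = y" using Xj lyy by (auto simp: list_eq_iff_nth_eq)
        finally show ?thesis using j by (auto simp: sem_all_eq edge_def)
      qed
      have cs: "concat (map g xs) = map f xs" if "\<And>y. y \<in> set xs \<Longrightarrow> g y = [f y]" for g :: "nat list \<Rightarrow> bool list" and f xs
        using that by (induction xs) auto
      show ?thesis unfolding sem_fors ly by (rule cs) (rule one)
    qed
    have cc: "concat (concat (map g xs)) = concat (map (\<lambda>x. concat (g x)) xs)"
      for g :: "nat \<Rightarrow> bool list list" and xs
      by (induction xs) auto
    show ?thesis
      unfolding row_cmd_def sem_catl vlist_def concat_map_concat map_concat map_map comp_def cc
      by (intro arg_cong[where f = concat] map_cong refl) (use cell in auto)
  qed
  have adj: "(\<forall>(u, v) \<in> set (adj_pairs bs). updsB env (xvars r t) X v \<in> nbr E (updsB env (xvars r t) X u)) \<longleftrightarrow> pat E bs X"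
    if X: "length X = r" "set X \<subseteq> {x. length x = t \<and> set x \<subseteq> {..<n}}"
      and bs: "length bs = r" "set bs \<subseteq> {..<B}" for bs X
  proof -
    have b: "bs ! 0 < B" "bs ! 1 < B" using bs(1) r nth_subset[OF bs(2), of 0] nth_subset[OF bs(2), of 1] by auto
    have e: "updsB env (xvars r t) X (j * t + i) = X ! j ! i" if "j < r" "i < t" for i j
    proof -
      have "length (X ! j) = t" using X that nth_subset[OF X(2), of j] by auto
      moreover have "j * t + i = xvars r t ! j ! i" using that by (simp add: xvars_def)
      ultimately show ?thesis
        using updsB_nth[OF dx, of X j i env] X(1) that lx lxj by simp
    qed
    have hi: "h (bs ! 0) (bs ! 1) j i < t" if "j < r" "i < m" for i j
      using permutes_in_image[OF h[OF b that(1)], of i] that(2) m by auto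
    have "(\<forall>(u, v) \<in> set (adj_pairs bs). updsB env (xvars r t) X v \<in> nbr E (updsB env (xvars r t) X u)) \<longleftrightarrow>
      (\<forall>j \<in> {1..<r}. \<forall>i < m. updsB env (xvars r t) X (j * t + h (bs ! 0) (bs ! 1) j i)
         \<in> nbr E (updsB env (xvars r t) X (0 * t + h (bs ! 0) (bs ! 1) 0 i)))"
      by (auto simp: adj_pairs_def)
    also have "\<dots> \<longleftrightarrow> pat E bs X"
    proof -
      have 1: "updsB env (xvars r t) X (j * t + h (bs ! 0) (bs ! 1) j i) = X ! j ! h (bs ! 0) (bs ! 1) j i"
        if "j \<in> {1..<r}" "i < m" for j i
        by (rule e[OF _ hi]) (use that in auto)
      have 2: "updsB env (xvars r t) X (0 * t + h (bs ! 0) (bs ! 1) 0 i) = X ! 0 ! h (bs ! 0) (bs ! 1) 0 i"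
        if "i < m" for i
        by (rule e[OF _ hi]) (use that r in auto)
      show ?thesis unfolding pat_def using 1 2 by auto
    qed
    finally show ?thesis .
  qed
  have cm: "concat (map (\<lambda>x. if P x then g x else []) xs) = concat (map g (filter P xs))"
    for P :: "nat list \<Rightarrow> bool" and g :: "nat list \<Rightarrow> bool list" and xs
    by (induction xs) auto
  have body: "sem n E (catl (map (\<lambda>bs. all_adj (adj_pairs bs) (row_cmd bs)) (List.n_lists r [0..<B]))) (updsB env (xvars r t) X)
     = concat (map (\<lambda>bs. map (\<lambda>x. x \<in> edge bs X) (vlist n)) (filter (\<lambda>bs. pat E bs X) (List.n_lists r [0..<B])))"
    if X: "X \<in> set (List.n_lists r (List.n_lists t [0..<n]))" for X
  proof -
    have X': "length X = r" "set X \<subseteq> {x. length x = t \<and> set x \<subseteq> {..<n}}" using X by (auto simp: set_n_lists atLeast0LessThan)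
    have "sem n E (catl (map (\<lambda>bs. all_adj (adj_pairs bs) (row_cmd bs)) (List.n_lists r [0..<B]))) (updsB env (xvars r t) X)
      = concat (map (\<lambda>bs. if pat E bs X then map (\<lambda>x. x \<in> edge bs X) (vlist n) else []) (List.n_lists r [0..<B]))"
      unfolding sem_catl map_map comp_def
    proof (intro arg_cong[where f = concat] map_cong refl)
      fix bs assume "bs \<in> set (List.n_lists r [0..<B])"
      then have bs: "length bs = r" "set bs \<subseteq> {..<B}" by (auto simp: set_n_lists)
      have "sem n E (all_adj (adj_pairs bs) (row_cmd bs)) (updsB env (xvars r t) X)
         = (if \<forall>(u, v) \<in> set (adj_pairs bs). updsB env (xvars r t) X v \<in> nbr E (updsB env (xvars r t) X u)
            then sem n E (row_cmd bs) (updsB env (xvars r t) X) else [])"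
        by (rule sem_all_adj) (rule E)
      then show "sem n E (all_adj (adj_pairs bs) (row_cmd bs)) (updsB env (xvars r t) X)
         = (if pat E bs X then map (\<lambda>x. x \<in> edge bs X) (vlist n) else [])"
        unfolding adj[OF X' bs] row[OF X'] .
    qed
    then show ?thesis by (simp add: cm)
  qed
  have "\<And>vs. vs \<in> set (xvars r t) \<Longrightarrow> length vs = t" by (auto simp: xvars_def)
  then have "sem n E (forsB (xvars r t) (catl (map (\<lambda>bs. all_adj (adj_pairs bs) (row_cmd bs)) (List.n_lists r [0..<B])))) env
     = concat (map (\<lambda>X. concat (map (\<lambda>bs. map (\<lambda>x. x \<in> edge bs X) (vlist n)) (filter (\<lambda>bs. pat E bs X) (List.n_lists r [0..<B]))))
         (List.n_lists r (List.n_lists t [0..<n])))"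
    using body by (simp add: sem_forsB lx cong: map_cong)
  also have "\<dots> = concat (map (\<lambda>e. map (\<lambda>x. x \<in> e) (vlist n)) (elist n E))"
    by (simp add: elist_def concat_map_concat comp_def)
  finally show ?thesis unfolding reduction_cmd_def using p1 by simp
qed

lemma reduction_cmd_wfc:
  assumes m: "m \<le> t" and h: "\<And>b1 b2 j. b1 < B \<Longrightarrow> b2 < B \<Longrightarrow> j < r \<Longrightarrow> h b1 b2 j permutes {..<t}" and r: "2 \<le> r"
  shows "wfc (r * t + t) {} reduction_cmd"
proof -
  have dy: "distinct (yvars r t)" by (simp add: yvars_def distinct_map inj_on_def)
  have sy: "set (yvars r t) = {r * t..<r * t + t}"
    by (auto simp: yvars_def image_iff)
  have w1: "wfc (r * t + t) {} (fors (yvars r t) (Out True))" by (rule wfc_fors) (auto simp: dy sy)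
  have row: "wfc (r * t + t) {..<r * t} (row_cmd bs)" for bs
    unfolding row_cmd_def wfc_catl
  proof
    fix c assume "c \<in> set (concat (map (\<lambda>j. map (\<lambda>b. fors (yvars r t)
     (if bs ! j = b then all_eq (map (\<lambda>i. (j * t + i, r * t + i)) [0..<t]) else Out False)) [0..<B]) [0..<r]))"
    then obtain j b where j: "j < r" "c = fors (yvars r t)
       (if bs ! j = b then all_eq (map (\<lambda>i. (j * t + i, r * t + i)) [0..<t]) else Out False)" by auto
    have "wfc (r * t + t) ({..<r * t} \<union> set (yvars r t)) (all_eq (map (\<lambda>i. (j * t + i, r * t + i)) [0..<t]))"
    proof (rule wfc_all_eq)
      fix u v assume "(u, v) \<in> set (map (\<lambda>i. (j * t + i, r * t + i)) [0..<t])"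
      then obtain i where i: "i < t" "u = j * t + i" "v = r * t + i" by auto
      have "j * t + i < r * t" using xvar_less[OF j(1) i(1)] .
      then show "u < r * t + t \<and> v < r * t + t \<and> u \<in> {..<r * t} \<union> set (yvars r t) \<and>
          v \<in> {..<r * t} \<union> set (yvars r t) \<and> u \<noteq> v" using i by (auto simp: sy)
    qed
    then show "wfc (r * t + t) {..<r * t} c"
      unfolding j(2) by (intro wfc_fors) (auto simp: dy sy)
  qed
  have "wfc (r * t + t) {..<r * t} (all_adj (adj_pairs bs) (row_cmd bs))" if bs: "bs \<in> set (List.n_lists r [0..<B])" for bs
  proof (rule wfc_all_adj[OF _ row])
    fix u v assume uv: "(u, v) \<in> set (adj_pairs bs)"
    have l: "length bs = r" "set bs \<subseteq> {..<B}" using bs by (auto simp: set_n_lists)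
    have b: "bs ! 0 < B" "bs ! 1 < B" using l(1) r nth_subset[OF l(2), of 0] nth_subset[OF l(2), of 1] by auto
    obtain j i where ji: "1 \<le> j" "j < r" "i < m" "u = h (bs ! 0) (bs ! 1) 0 i" "v = j * t + h (bs ! 0) (bs ! 1) j i"
      using uv by (auto simp: adj_pairs_def)
    have hi: "h (bs ! 0) (bs ! 1) j' i < t" if "j' < r" for j'
      using permutes_in_image[OF h[OF b that], of i] ji m by auto
    have ut: "u < t" using hi[of 0] ji r by simp
    have "v < r * t" using xvar_less[OF ji(2) hi[OF ji(2)]] ji by simp
    moreover have "t \<le> j * t" using ji by simp
    then have "t \<le> v" using ji by linarith
    moreover have "t \<le> r * t" using r by simp
    ultimately show "u < r * t + t \<and> v < r * t + t \<and> u \<in> {..<r * t} \<and> v \<in> {..<r * t} \<and> u \<noteq> v"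
      using ut by auto
  qed
  then have "wfc (r * t + t) {} (forsB (xvars r t) (catl (map (\<lambda>bs. all_adj (adj_pairs bs) (row_cmd bs)) (List.n_lists r [0..<B]))))"
    by (intro wfc_forsB) (auto simp: concat_xvars wfc_catl atLeast0LessThan)
  then show ?thesis unfolding reduction_cmd_def using w1 by (simp add: wfc_catl)
qed

end

section \<open>Completeness and soundness\<close>

lemma table_poly_time:
  assumes f: "poly_time f" and F: "finite F"
  shows "poly_time (\<lambda>x. if f x \<in> F then ys else zs)"
proof -
  obtain l where l: "\<And>w. w \<in> F \<Longrightarrow> length w < l"
    using F by (metis finite_imageI finite_nat_set_iff_bounded imageI)
  define g where "g w = (if w \<in> F then ys else zs)" for w
  have "poly_time (\<lambda>x. g (f x))"
  proof (rule compose_poly_time[OF f, where D = UNIV])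
    fix i
    have wf: "wfp (i + 3) (trie i l P ys zs)" for P
      by (induction l arbitrary: P) (auto simp: write_word_def wfp_seqs)
    have "triple (\<lambda>T. T i = (word_contents w, 0) \<and> (\<forall>j > i + 1. T j = blank)) (trie i l (\<lambda>w. w \<in> F) ys zs)
        ((length ys + length zs + 1 + 3 * l) * (length w + 1) ^ 0)
        (\<lambda>T. fst (T (i + 3 - 1)) = word_contents (g w))" for w
      by (rule triple_conseq[OF trie_triple[of i "[]" w l "\<lambda>w. w \<in> F" ys zs]]) (use l in \<open>auto simp: g_def\<close>)
    then show "\<exists>p k a d. wfp k p \<and> i + 2 < k \<and>
       (\<forall>w \<in> UNIV. triple (\<lambda>T. T i = (word_contents w, 0) \<and> (\<forall>j > i + 1. T j = blank)) p
          (a * (length w + 1) ^ d) (\<lambda>T. fst (T (k - 1)) = word_contents (g w)))"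
      using wf by (intro exI[of _ "trie i l (\<lambda>w. w \<in> F) ys zs"] exI[of _ "i + 3"]
          exI[of _ "length ys + length zs + 1 + 3 * l"] exI[of _ 0]) simp
  qed simp
  then show ?thesis by (simp add: g_def)
qed

lemma (in regular_adj) EL_smz: "EL t (smz t f) = EL t f"
proof -
  have c: "card {p. p permutes {..<t}} = fact t" by (rule card_permutations) auto
  have "(\<Sum>z\<in>Lst t. smz t f z) = (\<Sum>z\<in>Lst t. (\<Sum>p | p permutes {..<t}. f (permute_list (inv p) z)) / fact t)"
    by (intro sum.cong refl) (simp add: smz_def)
  also have "\<dots> = (\<Sum>p | p permutes {..<t}. \<Sum>z\<in>Lst t. f (permute_list (inv p) z)) / fact t"
    unfolding sum_divide_distrib[symmetric] by (subst sum.swap) simp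
  also have "(\<Sum>p | p permutes {..<t}. \<Sum>z\<in>Lst t. f (permute_list (inv p) z)) = (\<Sum>p | p permutes {..<t}. \<Sum>z\<in>Lst t. f z)"
    by (intro sum.cong refl sum_permute_Lst[symmetric]) simp
  also have "\<dots> = fact t * (\<Sum>z\<in>Lst t. f z)" by (simp add: c)
  finally show ?thesis by (simp add: EL_eq_sum)
qed

text \<open>AM-GM with a prescribed bound on the mean: multiply x \<le> exp (x - 1) over x = a j /
  c.\<close>

lemma prod_le_power_of_mean:
  fixes a :: "nat \<Rightarrow> real"
  assumes "0 < c" "\<And>j. j < r \<Longrightarrow> 0 \<le> a j" "(\<Sum>j<r. a j) \<le> real r * c"
  shows "(\<Prod>j<r. a j) \<le> c ^ r"
proof -
  have "(\<Prod>j<r. a j / c) \<le> (\<Prod>j<r. exp (a j / c - 1))"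
  proof (rule prod_mono)
    fix j assume "j \<in> {..<r}"
    then show "0 \<le> a j / c \<and> a j / c \<le> exp (a j / c - 1)"
      using assms exp_ge_add_one_self[of "a j / c - 1"] by auto
  qed
  also have "\<dots> = exp ((\<Sum>j<r. a j) / c - real r)"
    by (simp add: exp_sum[symmetric] sum_subtractf sum_divide_distrib)
  also have "\<dots> \<le> 1" using assms by (simp add: pos_divide_le_eq)
  finally show ?thesis using assms(1) by (simp add: prod_dividef pos_divide_le_eq)
qed

context regular_adj
begin

context
  fixes r t m B :: nat and \<mu> \<delta> M \<epsilon> :: real and E :: "nat set set" and h :: "nat \<Rightarrow> nat \<Rightarrow> nat \<Rightarrow> nat \<Rightarrow> nat"
  assumes nbE: "nb = nbr E" and arcsE: "card (arcs E) = n * d"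
    and r: "2 \<le> r" and mu: "0 < \<mu>" "\<mu> < 1 / 2 ^ r" and del: "0 < \<delta>"
    and t: "real t \<le> \<mu> / \<delta>" "\<mu> / (2 * \<delta>) \<le> real t" "(real r)\<^sup>2 * ln (2 * real r / \<mu>) \<le> real t"
    and m: "m = nat \<lfloor>real t / ((real r)\<^sup>2 * ln (2 * real r / \<mu>))\<rfloor>"
    and B: "0 < B" and h: "\<And>b1 b2. b1 < B \<Longrightarrow> b2 < B \<Longrightarrow> h b1 b2 \<in> perms r t"
begin

text \<open>The place where \<mu> < 2^(-r) is used, through 2 r \<le> 2^r.\<close>

lemma two_r_le: "2 * real r \<le> 1 / \<mu>" "16 \<le> 2 * real r / \<mu>"
proof -
  have p: "2 * r \<le> 2 ^ r" using r
  proof (induction r rule: nat_induct_at_least)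
    case (Suc n)
    then show ?case by simp
  qed simp
  have "2 ^ r \<le> 1 / \<mu>" using mu by (simp add: field_simps)
  moreover have "real (2 * r) \<le> real (2 ^ r)" using p by (simp only: of_nat_le_iff)
  ultimately show a: "2 * real r \<le> 1 / \<mu>" by simp
  have "4 * 4 \<le> (2 * real r) * (1 / \<mu>)" using a r by (intro mult_mono) auto
  then show "16 \<le> 2 * real r / \<mu>" by simp
qed

lemma La: "2 \<le> ln (2 * real r / \<mu>)" "ln (2 * real r / \<mu>) \<le> 2 * ln (1 / \<mu>)"
proof -
  have "exp (2::real) = exp 1 * exp 1" by (simp add: exp_add[symmetric])
  also have "\<dots> \<le> 3 * 3" using exp_le by (intro mult_mono) auto
  finally have "exp 2 \<le> 2 * real r / \<mu>" using two_r_le(2) by linarith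
  then show "2 \<le> ln (2 * real r / \<mu>)" using ln_ge_iff[of "2 * real r / \<mu>" 2] r mu by simp
  have "2 * real r / \<mu> \<le> (1 / \<mu>) * (1 / \<mu>)"
    using mult_right_mono[OF two_r_le(1), of "1 / \<mu>"] mu by simp
  then have "ln (2 * real r / \<mu>) \<le> ln ((1 / \<mu>) * (1 / \<mu>))" using r mu by (subst ln_le_cancel_iff) auto
  also have "\<dots> = 2 * ln (1 / \<mu>)" using mu by (subst ln_mult_pos) auto
  finally show "ln (2 * real r / \<mu>) \<le> 2 * ln (1 / \<mu>)" .
qed

lemma r2La: "8 \<le> (real r)\<^sup>2 * ln (2 * real r / \<mu>)"
proof -
  have "2\<^sup>2 * 2 \<le> (real r)\<^sup>2 * ln (2 * real r / \<mu>)"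
    using r La by (intro mult_mono power_mono) auto
  then show ?thesis by simp
qed

text \<open>The number rounded down to \<open>m\<close> is at least 1, so rounding loses at most a
  factor 2. At most half of the coordinates are linked, which keeps the entropy bound of order 1 / t
  to the last round.\<close>

lemma m_bounds:
  "real m \<le> real t / ((real r)\<^sup>2 * ln (2 * real r / \<mu>))"
  "real t / ((real r)\<^sup>2 * ln (2 * real r / \<mu>)) \<le> 2 * real m" "2 * real m \<le> real t" "m \<le> t"
proof -
  let ?x = "real t / ((real r)\<^sup>2 * ln (2 * real r / \<mu>))"
  have x1: "1 \<le> ?x" using t(3) r2La by (subst le_divide_eq) auto
  show a: "real m \<le> ?x" unfolding m using x1 by linarith
  have "?x < real m + 1" "1 \<le> m" unfolding m using x1 by linarith+
  then show "?x \<le> 2 * real m" by linarith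
  have "?x \<le> real t / 2" using r2La by (intro divide_left_mono) auto
  then show b: "2 * real m \<le> real t" using a by linarith
  then show "m \<le> t" by linarith
qed

lemma Lst_card_pos: "0 < deg_total r m t"
  using n_pos d_pos by (simp add: deg_total_def)

lemma pat_eq: "pat r m h E bs X = pattern r m (h (bs ! 0) (bs ! 1)) X"
  unfolding pat_def pattern_def unfolding nbE ..

lemma length_elist_eq: "real (length (elist r m t B h n E)) = real B ^ r * deg_total r m t"
  unfolding length_elist pat_eq by (rule total_count[OF r m_bounds(4) B h])

text \<open>The dense set consists of all vertices whose tuple meets the nonexpanding set, with
  arbitrary part and label; it may fall short of the prescribed size.\<close>

lemma yes_case:
  assumes S: "S \<subseteq> {..<n}" "vol {..<n} S = \<delta>" "expansion {..<n} E S \<le> \<epsilon>"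
    and eps: "real (r - 1) * \<epsilon> \<le> 1 / 2" and d2: "\<delta> \<le> 1 / 2"
    and muN: "\<mu> \<in> \<rat> \<longrightarrow> \<mu> * real (r * B * n ^ t) \<in> \<int>"
  shows "replicate (r * B * n ^ t) True @ [False] @
    concat (map (\<lambda>e. map (\<lambda>x. x \<in> e) (vlist r t B n)) (elist r m t B h n E))
     \<in> dksh_at_least r \<mu> (1 / 32 * (\<mu> / (real r ^ 3 * ln (1 / \<mu>))))"
proof -
  let ?vl = "vlist r t B n" and ?es = "elist r m t B h n E"
  let ?I = "{x \<in> Lst t. set x \<inter> S \<noteq> {}}"
  let ?S = "{..<r} \<times> {..<B} \<times> ?I"
  have mu1: "\<mu> \<le> 1 / 4"
  proof -
    have "1 / 2 ^ r \<le> 1 / (2::real) ^ 2" using r by (intro divide_left_mono power_increasing) auto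
    also have "\<dots> = 1 / 4" by (simp add: power2_eq_square)
    finally show ?thesis using mu by linarith
  qed
  have fS: "finite S" using S finite_subset by blast
  have cI: "real (card ?I) \<le> \<mu> * real n ^ t"
  proof -
    have "Lst t - ?I = {x. set x \<subseteq> {..<n} - S \<and> length x = t}" by auto
    then have "card (Lst t - ?I) = (n - card S) ^ t"
      using card_lists_length_eq[of "{..<n} - S" t] S(1) fS by (simp add: card_Diff_subset)
    moreover have "card ?I + card (Lst t - ?I) = card (Lst t)"
    proof -
      have sub: "?I \<subseteq> Lst t" by blast
      have "card (Lst t - ?I) = card (Lst t) - card ?I"
        by (rule card_Diff_subset[OF finite_subset[OF sub finite_Lst] sub])
      then show ?thesis using card_mono[OF finite_Lst sub] by linarith
    qed
    ultimately have "card ?I + (n - card S) ^ t = n ^ t" by (simp add: card_Lst)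
    from arg_cong[where f = real, OF this]
    have a: "real (card ?I) + real (n - card S) ^ t = real n ^ t" by (simp only: of_nat_add of_nat_power)
    have "card S \<le> n" using card_mono[OF _ S(1)] by simp
    then have b: "real (n - card S) = real n * (1 - \<delta>)"
      using S(2) n_pos by (simp add: vol_def field_simps of_nat_diff)
    have "real (card ?I) = real n ^ t - (real n * (1 - \<delta>)) ^ t" using a unfolding b by linarith
    then have "real (card ?I) = real n ^ t * (1 - (1 - \<delta>) ^ t)"
      unfolding power_mult_distrib by (simp add: right_diff_distrib[of "real n ^ t"])
    moreover have "1 - (1 - \<delta>) ^ t \<le> \<mu>"
    proof -
      have "1 + real t * (- \<delta>) \<le> (1 + (- \<delta>)) ^ t" using d2 by (intro Bernoulli_inequality) simp
      moreover have "real t * \<delta> \<le> \<mu>" using t(1) del by (simp add: pos_le_divide_eq)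
      ultimately show ?thesis by simp
    qed
    ultimately show ?thesis using n_pos by (simp add: mult.commute mult_right_mono)
  qed
  have cS: "card ?S \<le> nat \<lfloor>\<mu> * real (r * B * n ^ t)\<rfloor>"
  proof -
    have "real (card ?S) = real r * real B * real (card ?I)" by (simp add: card_cartesian_product)
    also have "\<dots> \<le> real r * real B * (\<mu> * real n ^ t)" using cI by (intro mult_left_mono) auto
    finally have "real (card ?S) \<le> \<mu> * real (r * B * n ^ t)" by (simp add: mult_ac)
    then show ?thesis by (simp add: le_nat_floor)
  qed
  define q where "q = Ev (\<lambda>u. of_bool (u \<in> S) * G (\<lambda>v. of_bool (v \<in> S)) u ^ (r - 1))"
  have q: "\<delta> / 2 \<le> q" unfolding q_def
    by (rule sse_yes_q[OF nbE arcsE S(1,2) del d2 S(3)]) (use r eps in auto)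
  have q1: "q \<le> 1"
  proof -
    have "q \<le> Ev (\<lambda>_. 1)" unfolding q_def
    proof (rule Ev_mono)
      fix u assume u: "u < n"
      have "G (\<lambda>v. of_bool (v \<in> S)) u \<le> G (\<lambda>_. 1) u" using u by (intro G_mono) auto
      moreover have "0 \<le> G (\<lambda>v. of_bool (v \<in> S)) u" using u by (intro G_nonneg) auto
      ultimately show "of_bool (u \<in> S) * G (\<lambda>v. of_bool (v \<in> S)) u ^ (r - 1) \<le> 1"
        using G_const[OF u, of 1] by (auto intro!: mult_le_one power_le_one)
    qed
    then show ?thesis by simp
  qed
  have val: "1 / 32 * (\<mu> / (real r ^ 3 * ln (1 / \<mu>))) \<le> 1 - (1 - q) ^ m"
  proof -
    define y where "y = real m * \<delta> / 2"
    let ?L = "ln (2 * real r / \<mu>)"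
    have y0: "0 \<le> y" using del by (simp add: y_def)
    have y1: "y \<le> 1 / 4"
    proof -
      have "real m * \<delta> \<le> real t * \<delta>" using m_bounds(4) del by (intro mult_right_mono) auto
      also have "\<dots> \<le> \<mu>" using t(1) del by (simp add: pos_le_divide_eq)
      finally show ?thesis unfolding y_def using mu1 mu by linarith
    qed
    have "(1 - q) ^ m \<le> exp (- (\<delta> / 2)) ^ m"
      using q q1 exp_ge_add_one_self[of "- (\<delta> / 2)"] by (intro power_mono) auto
    also have "\<dots> = exp (- y)" by (simp add: y_def exp_of_nat_mult[symmetric])
    also have "\<dots> \<le> 1 - y + 2 * y\<^sup>2" using exp_le_quadratic[of "- y"] y0 by simp
    also have "2 * y\<^sup>2 \<le> y / 2" using mult_left_mono[OF y1 y0] by (simp add: power2_eq_square)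
    finally have "y / 2 \<le> 1 - (1 - q) ^ m" by simp
    \<comment> \<open>1 / 32 collects five factors 1 / 2: from \<open>q\<close>, from 1 - exp (-y)
      \<ge> y / 2, from rounding in \<open>t\<close>, from rounding in \<open>m\<close>, and from
      replacing ln (2 r / \<mu>) by ln (1 / \<mu>). In addition r^2 is weakened to r^3.\<close>
    moreover have "1 / 32 * (\<mu> / (real r ^ 3 * ln (1 / \<mu>))) \<le> y / 2"
    proof -
      have "\<mu> / (2 * \<delta>) / ((real r)\<^sup>2 * ?L) \<le> real t / ((real r)\<^sup>2 * ?L)"
        using t(2) r2La by (intro divide_right_mono) auto
      also have "\<dots> \<le> 2 * real m" by (rule m_bounds)
      finally have "\<delta> * (\<mu> / (2 * \<delta>) / ((real r)\<^sup>2 * ?L)) \<le> \<delta> * (2 * real m)" using del by (intro mult_left_mono) auto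
      moreover have "\<delta> * (\<mu> / (2 * \<delta>) / ((real r)\<^sup>2 * ?L)) = \<mu> / (2 * ((real r)\<^sup>2 * ?L))" using del by simp
      moreover have "\<mu> / (2 * (real r ^ 3 * (2 * ln (1 / \<mu>)))) \<le> \<mu> / (2 * ((real r)\<^sup>2 * ?L))"
      proof (intro divide_left_mono mult_left_mono mult_mono)
        show "(real r)\<^sup>2 \<le> real r ^ 3" using r by (intro power_increasing) auto
        show "?L \<le> 2 * ln (1 / \<mu>)" by (rule La)
        have "0 < ln (1 / \<mu>)" using La by linarith
        then show "0 < 2 * (real r ^ 3 * (2 * ln (1 / \<mu>))) * (2 * ((real r)\<^sup>2 * ?L))"
          using r La by (intro mult_pos_pos) auto
      qed (use mu La in auto)
      moreover have "\<mu> / (2 * (real r ^ 3 * (2 * ln (1 / \<mu>)))) = \<mu> / (real r ^ 3 * ln (1 / \<mu>)) / 4"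
        by (simp add: mult_ac)
      moreover have "\<delta> * (2 * real m) = 4 * y" by (simp add: y_def)
      ultimately show ?thesis by linarith
    qed
    ultimately show ?thesis by linarith
  qed
  have prodS: "(\<Prod>j<r. of_bool ((j, bs ! j, X ! j) \<in> ?S)) = (\<Prod>j<r. of_bool (set (X ! j) \<inter> S \<noteq> {}) :: real)"
    if "bs \<in> labels r B" "X \<in> rows r t" for bs X
  proof (rule prod.cong[OF refl])
    fix j assume j: "j \<in> {..<r}"
    have "bs ! j < B" using labels_nth[OF that(1)] j by simp
    moreover have "X ! j \<in> Lst t" using that(2) nth_subset[of X "Lst t" j] j by simp
    ultimately show "of_bool ((j, bs ! j, X ! j) \<in> ?S) = (of_bool (set (X ! j) \<inter> S \<noteq> {}) :: real)" using j by auto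
  qed
  have "real B ^ r * deg_total r m t * (1 - (1 - q) ^ m) \<le>
    (\<Sum>bs\<in>labels r B. \<Sum>X\<in>rows r t. of_bool (pattern r m (h (bs ! 0) (bs ! 1)) X) *
       (\<Prod>j<r. of_bool (set (X ! j) \<inter> S \<noteq> {})))"
    unfolding q_def by (rule completeness_count[OF r m_bounds(4) B h S(1)])
  also have "\<dots> = real (card {e \<in> set ?es. e \<subseteq> ?S})"
    unfolding count_elist pat_eq using prodS by (intro sum.cong refl arg_cong2[where f = "(*)"]) auto
  finally have "1 - (1 - q) ^ m \<le> real (card {e \<in> set ?es. e \<subseteq> ?S}) / real (length ?es)"
    unfolding length_elist_eq using Lst_card_pos B by (simp add: pos_le_divide_eq mult_ac)
  then have val2: "1 / 32 * (\<mu> / (real r ^ 3 * ln (1 / \<mu>))) \<le> real (card {e \<in> set ?es. e \<subseteq> ?S}) / real (length ?es)"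
    using val by linarith
  have N0: "0 < r * B * n ^ t" using r B n_pos by simp
  have ne: "?es \<noteq> []" using length_elist_eq Lst_card_pos B by force
  have sub: "?S \<subseteq> set ?vl" unfolding set_vlist by auto
  show ?thesis
    by (rule hypergraph_transfer_ge[OF distinct_vlist length_vlist N0 distinct_elist ne elist_edges _ _ muN sub cS val2])
      (use mu mu1 in auto)
qed

lemma no_case:
  assumes no: "\<And>T. T \<subseteq> {..<n} \<Longrightarrow> real (card T) \<le> M * \<delta> * real n \<Longrightarrow> inside T \<le> \<epsilon> * (M * \<delta>)"
    and M: "48 * (real r)\<^sup>2 * ln (2 * real r / \<mu>) / \<mu> \<le> M" and eps: "0 \<le> \<epsilon>"
    and small: "(real r)\<^sup>2 * (2 * real r / \<mu>) ^ Suc r * (\<epsilon> * M) \<le> 1"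
    and quasi: "\<And>\<sigma> S1 S2. \<sigma> \<in> perms r t \<Longrightarrow> S1 \<subseteq> {..<B} \<Longrightarrow> S2 \<subseteq> {..<B} \<Longrightarrow>
      (\<Sum>b1\<in>S1. \<Sum>b2\<in>S2. of_bool (h b1 b2 = \<sigma>))
        \<le> real (card S1) * real (card S2) / real (card (perms r t)) + \<mu> ^ r / fact t ^ r * (real B)\<^sup>2"
    and muN: "\<mu> \<in> \<rat> \<longrightarrow> \<mu> * real (r * B * n ^ t) \<in> \<int>"
  shows "replicate (r * B * n ^ t) True @ [False] @
    concat (map (\<lambda>e. map (\<lambda>x. x \<in> e) (vlist r t B n)) (elist r m t B h n E))
     \<in> dksh_at_most r \<mu> ((3 * exp 151 + 1) * \<mu> ^ r)"
proof -
  let ?vl = "vlist r t B n" and ?es = "elist r m t B h n E" and ?L = "ln (2 * real r / \<mu>)"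
  have mu1: "\<mu> \<le> 1"
  proof -
    have "1 / 2 ^ r \<le> (1::real)" by simp
    then show ?thesis using mu by linarith
  qed
  \<comment> \<open>Added to every part as a floor. It raises the mean measure from \<mu> to \<mu>
    (1 + 1 / r), so the r-th power grows by a factor of at most 3.\<close>
  define \<theta> where "\<theta> = \<mu> / real r"
  define H where "H = 2 * real r / \<mu>"
  \<comment> \<open>The entropy bound ln (2 / \<theta>) / (t - m), with \<open>t - m\<close>
    replaced by its lower bound t / 2.\<close>
  define \<tau> where "\<tau> = 2 * ?L / real t"
  define \<omega> where "\<omega> = \<epsilon> * (M * \<delta>)"
  have HK: "2 / \<theta> = H" by (simp add: \<theta>_def H_def)
  have th: "0 < \<theta>" "\<theta> \<le> 1" using mu mu1 r by (auto simp: \<theta>_def field_simps)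
  have t0: "0 < real t" using t(3) r2La by linarith
  have tau0: "0 \<le> \<tau>" using La t0 by (simp add: \<tau>_def)
  have H1: "1 \<le> H" using two_r_le(2) by (simp add: H_def)
  have taule: "12 * (real r)\<^sup>2 * \<tau> \<le> M * \<delta>"
  proof -
    have p: "0 < \<mu> / (2 * \<delta>)" using mu del by simp
    have "\<tau> \<le> 2 * ?L / (\<mu> / (2 * \<delta>))" unfolding \<tau>_def using t(2) La by (intro divide_left_mono mult_pos_pos t0 p) auto
    also have "\<dots> = 4 * ?L / \<mu> * \<delta>" by simp
    finally have "12 * (real r)\<^sup>2 * \<tau> \<le> 12 * (real r)\<^sup>2 * (4 * ?L / \<mu> * \<delta>)" by (intro mult_left_mono) auto
    also have "\<dots> = 48 * (real r)\<^sup>2 * ?L / \<mu> * \<delta>" by simp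
    also have "\<dots> \<le> M * \<delta>" using M del by (intro mult_right_mono) auto
    finally show ?thesis .
  qed
  have no': "inside T \<le> \<omega>" if "T \<subseteq> {..<n}" "real (card T) \<le> 12 * (real r)\<^sup>2 * \<tau> * real n" for T
  proof -
    have "12 * (real r)\<^sup>2 * \<tau> * real n \<le> M * \<delta> * real n" using taule by (intro mult_right_mono) auto
    then show ?thesis unfolding \<omega>_def using no[OF that(1)] that(2) by linarith
  qed
  have lnH: "ln (2 / \<theta>) \<le> \<tau> * real (t - m)"
  proof -
    have "real t / 2 \<le> real (t - m)" using m_bounds(3,4) by (simp add: of_nat_diff)
    then have "\<tau> * (real t / 2) \<le> \<tau> * real (t - m)" using tau0 by (intro mult_left_mono)
    moreover have "\<tau> * (real t / 2) = ?L" using t0 by (simp add: \<tau>_def)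
    ultimately show ?thesis by (simp add: HK H_def)
  qed
  define \<kappa> where "\<kappa> = 75 * (real r)\<^sup>2 * \<tau> + real r * (real r * H * \<omega>) * H ^ r"
  have om0: "0 \<le> \<omega>" using no'[of "{}"] tau0 by (simp add: inside_def)
  have kap0: "0 \<le> \<kappa>" using tau0 om0 H1 by (simp add: \<kappa>_def)
  \<comment> \<open>150 is 75 times the 2 in \<tau>: the choice of \<open>m\<close> cancels r^2, the
    logarithm and \<open>t\<close>. The remaining 1 pays for the exceptional vertices, where m
    \<delta> \<le> \<mu> cancels against the \<delta> in \<omega>.\<close>
  have kapm: "real m * \<kappa> \<le> 151"
  proof -
    have "real m * (75 * (real r)\<^sup>2 * \<tau>) \<le> real t / ((real r)\<^sup>2 * ?L) * (75 * (real r)\<^sup>2 * \<tau>)"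
      using m_bounds(1) tau0 by (intro mult_right_mono) auto
    also have "\<dots> = 150" using t0 La r by (simp add: \<tau>_def)
    finally have 1: "real m * (75 * (real r)\<^sup>2 * \<tau>) \<le> 150" .
    have "real m * \<delta> \<le> 1"
    proof -
      have "real m * \<delta> \<le> real t * \<delta>" using m_bounds(4) del by (intro mult_right_mono) auto
      also have "\<dots> \<le> \<mu>" using t(1) del by (simp add: pos_le_divide_eq)
      finally show ?thesis using mu1 by simp
    qed
    have sm: "0 \<le> (real r)\<^sup>2 * H ^ Suc r * (\<epsilon> * M)"
    proof -
      have "0 \<le> 48 * (real r)\<^sup>2 * ?L / \<mu>"
        using La mu by (intro divide_nonneg_nonneg mult_nonneg_nonneg) auto
      then have "0 \<le> M" using M by linarith
      then show ?thesis using eps H1 by simp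
    qed
    have "real m * (real r * (real r * H * \<omega>) * H ^ r) = (real m * \<delta>) * ((real r)\<^sup>2 * H ^ Suc r * (\<epsilon> * M))"
      by (simp add: \<omega>_def power2_eq_square mult_ac)
    also have "\<dots> \<le> 1 * 1" using \<open>real m * \<delta> \<le> 1\<close> small sm del unfolding H_def by (intro mult_mono) auto
    finally have "real m * (real r * (real r * H * \<omega>) * H ^ r) \<le> 1" by simp
    then show ?thesis unfolding \<kappa>_def distrib_left using 1 by linarith
  qed
  have kapp: "(1 + \<kappa>) ^ m \<le> exp 151"
  proof -
    have "(1 + \<kappa>) ^ m \<le> exp \<kappa> ^ m" using kap0 by (intro power_mono) auto
    also have "\<dots> = exp (real m * \<kappa>)" by (simp add: exp_of_nat_mult)
    also have "\<dots> \<le> exp 151" using kapm by simp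
    finally show ?thesis .
  qed
  have bnd: "real (card {e \<in> set ?es. e \<subseteq> S}) / real (length ?es) \<le> (3 * exp 151 + 1) * \<mu> ^ r"
    if S: "S \<subseteq> set ?vl" "card S = nat \<lfloor>\<mu> * real (r * B * n ^ t)\<rfloor>" for S
  proof -
    define f where "f j x = (\<Sum>b<B. of_bool ((j, b, x) \<in> S)) / real B" for j x
    define g where "g j x = smz t (f j) x + \<theta>" for j x
    have f01: "0 \<le> f j x \<and> f j x \<le> 1" for j x
    proof -
      have "(\<Sum>b<B. of_bool ((j, b, x) \<in> S)) \<le> (\<Sum>b<B. (1::real))" by (intro sum_mono) auto
      then show ?thesis using B by (simp add: f_def sum_nonneg)
    qed
    have sb: "0 \<le> smz t (f j) x \<and> smz t (f j) x \<le> 1" for j x using smz_bounds[of "f j"] f01 by blast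
    have summ: "(\<Sum>j<r. EL t (f j)) \<le> real r * \<mu>"
    proof -
      have finS: "finite S" using S(1) finite_subset by blast
      have "(\<Sum>j<r. EL t (f j)) = (\<Sum>j<r. \<Sum>x\<in>Lst t. \<Sum>b<B. of_bool ((j, b, x) \<in> S)) / (real B * real n ^ t)"
        by (simp add: EL_eq_sum f_def sum_divide_distrib[symmetric])
      also have "(\<Sum>j<r. \<Sum>x\<in>Lst t. \<Sum>b<B. of_bool ((j, b, x) \<in> S)) = (\<Sum>j<r. \<Sum>b<B. \<Sum>x\<in>Lst t. (of_bool ((j, b, x) \<in> S) :: real))"
        by (intro sum.cong refl sum.swap)
      also have "\<dots> = (\<Sum>v\<in>{..<r} \<times> {..<B} \<times> Lst t. of_bool (v \<in> S))"
        by (simp add: sum.cartesian_product case_prod_unfold)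
      also have "\<dots> = real (card S)"
        using S(1) finite_Lst unfolding set_vlist by (simp add: of_bool_def sum.If_cases Int_absorb1)
      also have "\<dots> \<le> \<mu> * real (r * B * n ^ t)" unfolding S(2) using mu by simp
      finally show ?thesis using B n_pos by (simp add: divide_right_mono pos_divide_le_eq mult_ac)
    qed
    have gsym: "symm (g j)" for j
      unfolding symm_def g_def
    proof (intro allI impI)
      fix xs ys :: "nat list" assume "mset xs = mset ys"
      then have "smz t (f j) xs = smz t (f j) ys" using symm_smz[of t "f j"] unfolding symm_def by blast
      then show "smz t (f j) xs + \<theta> = smz t (f j) ys + \<theta>" by simp
    qed
    have gb: "\<theta> \<le> g j x \<and> g j x \<le> 2" for j x using sb[of j x] th by (simp add: g_def)
    have "EL t (\<lambda>z. smz t (f 0) z * (\<Prod>j\<in>{1..<r}. Dn m t (smz t (f j)) z))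
        \<le> EL t (\<lambda>z. g 0 z * (\<Prod>j\<in>{1..<r}. Dn m t (g j) z))"
    proof (rule EL_mono)
      fix z :: "nat list" assume z: "length z = t" "set z \<subseteq> {..<n}"
      have "0 \<le> Dn m t (smz t (f j)) z \<and> Dn m t (smz t (f j)) z \<le> Dn m t (g j) z" for j
        using Dn_nonneg[OF z(2), of "smz t (f j)" m t] Dn_mono[OF m_bounds(4) z, of "smz t (f j)" "g j"] sb th
        by (auto simp: g_def)
      then show "smz t (f 0) z * (\<Prod>j\<in>{1..<r}. Dn m t (smz t (f j)) z) \<le> g 0 z * (\<Prod>j\<in>{1..<r}. Dn m t (g j) z)"
        using sb th gb[of 0 z] by (intro mult_mono prod_mono prod_nonneg) (auto simp: g_def)
    qed
    also have "\<dots> \<le> (\<Prod>j<r. EL t (g j)) * (1 + 75 * (real r)\<^sup>2 * \<tau> + real r * (real r * (2 / \<theta>) * \<omega>) * (2 / \<theta>) ^ r) ^ m"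
      by (rule Dn_prod_bound[OF r th(1) _ tau0 no' m_bounds(4) lnH]) (use th gsym gb in auto)
    also have "\<dots> = (\<Prod>j<r. EL t (g j)) * (1 + \<kappa>) ^ m" by (simp add: HK \<kappa>_def add.assoc)
    also have "\<dots> \<le> (3 * \<mu> ^ r) * exp 151"
    proof (rule mult_mono)
      have Eg: "EL t (g j) = EL t (f j) + \<theta>" for j
        unfolding g_def EL_add EL_const using EL_smz[of t "f j"] by simp
      have "(\<Prod>j<r. EL t (g j)) \<le> (\<mu> + \<theta>) ^ r"
      proof (rule prod_le_power_of_mean)
        show "0 \<le> EL t (g j)" for j
          using EL_mono[of t "\<lambda>_. 0" "f j"] f01 th by (simp add: Eg)
        show "(\<Sum>j<r. EL t (g j)) \<le> real r * (\<mu> + \<theta>)"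
          using summ by (simp add: Eg sum.distrib distrib_left)
      qed (use mu th in auto)
      also have "\<mu> + \<theta> = \<mu> * (1 + 1 / real r)" by (simp add: \<theta>_def distrib_left)
      also have "(\<mu> * (1 + 1 / real r)) ^ r = \<mu> ^ r * (1 + 1 / real r) ^ r" by (rule power_mult_distrib)
      also have "\<dots> \<le> \<mu> ^ r * 3"
      proof (rule mult_left_mono)
        have "(1 + 1 / real r) ^ r \<le> exp (1 / real r) ^ r" by (intro power_mono) auto
        also have "\<dots> = exp 1" using r by (simp add: exp_of_nat_mult[symmetric])
        finally show "(1 + 1 / real r) ^ r \<le> 3" using exp_le by linarith
      qed (use mu in simp)
      finally show "(\<Prod>j<r. EL t (g j)) \<le> 3 * \<mu> ^ r" by simp
    qed (use kapp kap0 mu in auto)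
    finally have core: "EL t (\<lambda>z. smz t (f 0) z * (\<Prod>j\<in>{1..<r}. Dn m t (smz t (f j)) z)) \<le> 3 * \<mu> ^ r * exp 151" .
    have "real (card {e \<in> set ?es. e \<subseteq> S}) = (\<Sum>bs\<in>labels r B. \<Sum>X\<in>rows r t. of_bool (pattern r m (h (bs ! 0) (bs ! 1)) X) *
       (\<Prod>j<r. of_bool ((j, bs ! j, X ! j) \<in> S)))"
      unfolding count_elist pat_eq ..
    also have "\<dots> \<le> real B ^ r * deg_total r m t *
       (EL t (\<lambda>z. smz t (f 0) z * (\<Prod>j\<in>{1..<r}. Dn m t (smz t (f j)) z)) + fact t ^ r * (\<mu> ^ r / fact t ^ r))"
      unfolding f_def by (rule soundness_count[OF r m_bounds(4) B h _ quasi, where Q = "\<lambda>j b x. (j, b, x) \<in> S"])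
        (use mu in auto)
    also have "\<dots> \<le> real B ^ r * deg_total r m t * ((3 * exp 151 + 1) * \<mu> ^ r)"
      using core Lst_card_pos by (intro mult_left_mono) (auto simp: algebra_simps)
    finally show ?thesis unfolding length_elist_eq using Lst_card_pos B by (simp add: pos_divide_le_eq mult_ac)
  qed
  have N0: "0 < r * B * n ^ t" using r B n_pos by simp
  have ne: "?es \<noteq> []" using length_elist_eq Lst_card_pos B by force
  show ?thesis
    by (rule hypergraph_transfer_le[OF distinct_vlist length_vlist N0 distinct_elist ne elist_edges _ _ muN bnd])
      (use mu mu1 in auto)
qed

end

end

section \<open>Hardness\<close>

lemma encodes_graph_word:
  assumes "encodes x n E" "regular_graph {..<n} E"
  shows "\<exists>es. distinct es \<and> set es = E \<and> x = graph_word n es \<and> 0 < n \<and>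
    (\<forall>e \<in> set es. e \<subseteq> {..<n}) \<and> (\<forall>e \<in> E. card e = 2)"
proof -
  obtain es where es: "distinct es" "set es = E"
    "x = replicate n True @ [False] @ concat (map (\<lambda>e. map (\<lambda>v. v \<in> e) [0..<n]) es)"
    using assms(1) unfolding encodes_def by blast
  have "{..<n} \<noteq> {}" "\<forall>e \<in> E. e \<subseteq> {..<n} \<and> card e = 2"
    using assms(2) unfolding regular_graph_def uniform_hypergraph_def by auto
  then show ?thesis using es by (intro exI[of _ es]) (auto simp: graph_word_def)
qed

text \<open>Compare a densest set of about \<beta> n vertices with the NO condition. Averaging gives
  an inside fraction of about \<beta> \<ge> 2 \<epsilon>, expansion allows only \<epsilon>; the two
  are compatible only as long as rounding matters, that is for small \<open>n\<close>.\<close>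

lemma sse_no_bounded:
  assumes eps: "\<epsilon> \<le> 1 / 16" "0 < \<epsilon>" and M: "4 \<le> M" and del: "0 < \<delta>" "\<delta> < 1" "2 * \<epsilon> / M < \<delta>"
    and G: "regular_graph {..<n} E"
    and no: "\<forall>S \<subseteq> {..<n}. vol {..<n} S \<in> {\<delta> / M .. M * \<delta>} \<longrightarrow> 1 - \<epsilon> \<le> expansion {..<n} E S"
  shows "real n < 4 / \<epsilon>"
proof (rule ccontr)
  assume "\<not> real n < 4 / \<epsilon>"
  then have n4: "4 \<le> real n * \<epsilon>" using eps by (simp add: field_simps)
  obtain d where ra: "regular_adj n d (nbr E)" and arcs: "card (arcs E) = n * d"
    using regular_graph_adj[OF G] by blast
  interpret regular_adj n d "nbr E" by (rule ra)
  \<comment> \<open>The cap 1 / 2 makes the set the smaller side of its cut, so that the minimum in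
    \<open>expansion\<close> is its own measure.\<close>
  define \<beta> where "\<beta> = min (M * \<delta>) (1 / 2)"
  have b2: "2 * \<epsilon> \<le> \<beta>" using del M eps by (simp add: \<beta>_def field_simps)
  have bd: "\<delta> / M \<le> \<beta> / 2"
  proof -
    have "\<delta> / M \<le> 1 / 4" using del M by (intro frac_le) auto
    moreover have "\<delta> / M \<le> M * \<delta> / 2"
    proof -
      have "2 * 1 \<le> M * M" using M by (intro mult_mono) auto
      then have "\<delta> * 2 \<le> \<delta> * (M * M)" using del by (intro mult_left_mono) auto
      then show ?thesis using M by (simp add: field_simps)
    qed
    ultimately show ?thesis unfolding \<beta>_def by linarith
  qed
  have nb8: "8 \<le> real n * \<beta>"
    using n4 mult_left_mono[OF b2, of "real n"] by simp
  define k where "k = nat \<lfloor>real n * \<beta>\<rfloor>"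
  have k1: "real k \<le> real n * \<beta>" "real n * \<beta> < real k + 1" using nb8 by (auto simp: k_def)
  have k2: "2 \<le> k" using k1 nb8 by linarith
  have "real n * \<beta> \<le> real n * (1 / 2)" by (intro mult_left_mono) (auto simp: \<beta>_def)
  then have kn: "2 * real k \<le> real n" using k1 by linarith
  then have kn': "k \<le> n" by linarith
  have irr: "{u} \<notin> E" for u
    using G unfolding regular_graph_def uniform_hypergraph_def by force
  obtain T where T: "T \<subseteq> {..<n}" "card T = k" "real k / real n * ((real k - 1) / (real n - 1)) \<le> inside T"
    using exists_dense_subset[OF refl irr k2 kn'] by blast
  have v: "vol {..<n} T = real k / real n" using T by (simp add: vol_def)
  have v0: "0 < vol {..<n} T" using v k2 n_pos by simp
  have vh: "vol {..<n} T \<le> 1 / 2" unfolding v using kn n_pos by (simp add: field_simps)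
  have "real k / real n \<le> \<beta>" using k1(1) n_pos by (simp add: pos_divide_le_eq mult.commute)
  then have vM: "vol {..<n} T \<le> M * \<delta>" unfolding v by (simp add: \<beta>_def)
  have "real n * (\<beta> / 2) \<le> real k" using k1 nb8 by linarith
  then have "\<beta> / 2 \<le> vol {..<n} T" unfolding v using n_pos by (simp add: pos_le_divide_eq mult.commute)
  then have "1 - \<epsilon> \<le> expansion {..<n} E T" using no T(1) vM order_trans[OF bd] by (metis atLeastAtMost_iff)
  then have "1 - \<epsilon> \<le> (vol {..<n} T - inside T) / vol {..<n} T" using expansion_eq[OF refl arcs T(1) vh] by simp
  then have "(1 - \<epsilon>) * vol {..<n} T \<le> vol {..<n} T - inside T" using v0 by (simp add: pos_le_divide_eq)
  then have "inside T \<le> \<epsilon> * vol {..<n} T" by (simp add: algebra_simps)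
  then have "vol {..<n} T * ((real k - 1) / (real n - 1)) \<le> vol {..<n} T * \<epsilon>"
    using T(3) unfolding v by (simp add: mult.commute)
  then have "(real k - 1) / (real n - 1) \<le> \<epsilon>" using v0 by (rule mult_left_le_imp_le)
  moreover have n1: "1 < real n" using k2 kn by linarith
  ultimately have "real k - 1 \<le> \<epsilon> * (real n - 1)" by (simp add: pos_divide_le_eq)
  moreover have "\<epsilon> * (real n - 1) \<le> real n * \<epsilon>" using eps by (simp add: algebra_simps)
  moreover have "2 * (real n * \<epsilon>) \<le> real n * \<beta>" using mult_left_mono[OF b2, of "real n"] by simp
  ultimately show False using k1 n4 by linarith
qed

lemma finite_sse_no:
  assumes "\<epsilon> \<le> 1 / 16" "0 < \<epsilon>" "4 \<le> M" "0 < \<delta>" "\<delta> < 1" "2 * \<epsilon> / M < \<delta>"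
  shows "finite (sse_no \<epsilon> M \<delta>)"
proof -
  define n0 where "n0 = nat \<lceil>4 / \<epsilon>\<rceil>"
  define l where "l = n0 + 1 + 2 ^ n0 * n0"
  have "sse_no \<epsilon> M \<delta> \<subseteq> {w. set w \<subseteq> UNIV \<and> length w \<le> l}"
  proof
    fix w assume "w \<in> sse_no \<epsilon> M \<delta>"
    then obtain n E where w: "encodes w n E" "regular_graph {..<n} E"
      and no: "\<forall>S \<subseteq> {..<n}. vol {..<n} S \<in> {\<delta> / M .. M * \<delta>} \<longrightarrow> 1 - \<epsilon> \<le> expansion {..<n} E S"
      unfolding sse_no_def by blast
    have "real n < 4 / \<epsilon>" by (rule sse_no_bounded[OF assms w(2) no])
    then have n: "n \<le> n0" unfolding n0_def by linarith
    obtain es where es: "distinct es" "set es = E" "w = graph_word n es" "\<forall>e \<in> set es. e \<subseteq> {..<n}"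
      using encodes_graph_word[OF w] by blast
    have "length es = card (set es)" using distinct_card[OF es(1)] by simp
    also have "\<dots> \<le> card (Pow {..<n})" using es by (intro card_mono) auto
    also have "\<dots> \<le> 2 ^ n0" using n by (simp add: card_Pow power_increasing)
    finally have "length es * n \<le> 2 ^ n0 * n0" using n by (intro mult_le_mono)
    then show "w \<in> {w. set w \<subseteq> UNIV \<and> length w \<le> l}" using n es(3) by (simp add: length_graph_word l_def)
  qed
  then show ?thesis by (rule finite_subset) (rule finite_lists_length_le[OF finite])
qed

text \<open>Lets membership in the finite NO side alone decide the table.\<close>

lemma sse_yes_no_disjoint:
  assumes eps: "\<epsilon> < 1 / 2" and M: "1 \<le> M" and del: "0 < \<delta>"
  shows "sse_yes \<epsilon> \<delta> \<inter> sse_no \<epsilon> M \<delta> = {}"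
proof (rule ccontr)
  assume "\<not> ?thesis"
  then obtain w n E n' E' S where y: "encodes w n E" "regular_graph {..<n} E"
      "S \<subseteq> {..<n}" "vol {..<n} S = \<delta>" "expansion {..<n} E S \<le> \<epsilon>"
    and z: "encodes w n' E'" "regular_graph {..<n'} E'"
      "\<forall>S \<subseteq> {..<n'}. vol {..<n'} S \<in> {\<delta> / M .. M * \<delta>} \<longrightarrow> 1 - \<epsilon> \<le> expansion {..<n'} E' S"
    unfolding sse_yes_def sse_no_def by blast
  obtain es where es: "set es = E" "w = graph_word n es" "0 < n" "\<forall>e \<in> set es. e \<subseteq> {..<n}"
    using encodes_graph_word[OF y(1,2)] by blast
  obtain es' where es': "set es' = E'" "w = graph_word n' es'" "\<forall>e \<in> set es'. e \<subseteq> {..<n'}"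
    using encodes_graph_word[OF z(1,2)] by blast
  have "n = n' \<and> es = es'"
    by (rule graph_word_inj) (use es es' in blast)+
  then have "n = n'" "E = E'" using es(1) es'(1) by blast+
  then have "S \<subseteq> {..<n'}" "vol {..<n'} S = \<delta>" using y(3,4) by simp_all
  moreover have "\<delta> / M \<le> \<delta>" "\<delta> \<le> M * \<delta>" using del M by (simp_all add: field_simps)
  ultimately have "1 - \<epsilon> \<le> expansion {..<n'} E' S" using z(3) by simp
  then have "1 - \<epsilon> \<le> expansion {..<n} E S" using \<open>n = n'\<close> \<open>E = E'\<close> by simp
  then show False using y(5) eps by linarith
qed

text \<open>The second reduction may be built from \<open>f\<close> and has to work only on outputs
  of \<open>f\<close>, which satisfy the promise; so malformed words need not be recognised.\<close>

lemma NP_hard_transfer: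
  assumes hard: "NP_hard_to_distinguish Y N"
    and red: "\<And>f. poly_time f \<Longrightarrow> (\<And>x. f x \<in> Y \<union> N) \<Longrightarrow>
      \<exists>h. poly_time h \<and> (\<forall>x. (f x \<in> Y \<longrightarrow> h x \<in> Y') \<and> (f x \<in> N \<longrightarrow> h x \<in> N'))"
  shows "NP_hard_to_distinguish Y' N'"
  unfolding NP_hard_to_distinguish_def
proof
  fix L assume "L \<in> NP"
  then obtain f where f: "poly_time f" "\<And>x. (x \<in> L \<longrightarrow> f x \<in> Y) \<and> (x \<notin> L \<longrightarrow> f x \<in> N)"
    using hard unfolding NP_hard_to_distinguish_def by blast
  then have "\<And>x. f x \<in> Y \<union> N" by blast
  then obtain h where "poly_time h" "\<forall>x. (f x \<in> Y \<longrightarrow> h x \<in> Y') \<and> (f x \<in> N \<longrightarrow> h x \<in> N')"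
    using red[OF f(1)] by blast
  then show "\<exists>f. poly_time f \<and> (\<forall>x. (x \<in> L \<longrightarrow> f x \<in> Y') \<and> (x \<notin> L \<longrightarrow> f x \<in> N'))" using f(2) by blast
qed

lemma reduction_small_delta:
  fixes r :: nat and \<mu> \<delta> A :: real
  assumes r: "2 \<le> r" and mu: "0 < \<mu>" "\<mu> < 1 / 2 ^ r"
    and A: "48 * (real r)\<^sup>2 * ln (2 * real r / \<mu>) / \<mu> \<le> A" "(real r)\<^sup>2 * (2 * real r / \<mu>) ^ Suc r \<le> A"
      "2 * real r \<le> A" "4 \<le> A"
    and del: "0 < \<delta>" "\<delta> \<le> 2 / A ^ 3"
    and f: "poly_time f" "\<And>x. f x \<in> sse_yes (1 / A\<^sup>2) \<delta> \<union> sse_no (1 / A\<^sup>2) A \<delta>"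
  shows "\<exists>h. poly_time h \<and> (\<forall>x.
    (f x \<in> sse_yes (1 / A\<^sup>2) \<delta> \<longrightarrow> h x \<in> dksh_at_least r \<mu> (1 / 32 * (\<mu> / (real r ^ 3 * ln (1 / \<mu>))))) \<and>
    (f x \<in> sse_no (1 / A\<^sup>2) A \<delta> \<longrightarrow> h x \<in> dksh_at_most r \<mu> ((3 * exp 151 + 1) * \<mu> ^ r)))"
proof -
  let ?L = "ln (2 * real r / \<mu>)"
  define t where "t = nat \<lfloor>\<mu> / \<delta>\<rfloor>"
  define m where "m = nat \<lfloor>real t / ((real r)\<^sup>2 * ?L)\<rfloor>"
  have mu1: "\<mu> < 1"
  proof -
    have "1 / 2 ^ r \<le> (1::real)" by simp
    then show ?thesis using mu by linarith
  qed
  have L1: "1 \<le> ?L"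
  proof -
    have "4 * \<mu> \<le> 2 * real r" using r mu1 by simp
    then have "4 \<le> 2 * real r / \<mu>" using mu by (simp add: pos_le_divide_eq)
    then have "exp 1 \<le> 2 * real r / \<mu>" using exp_le by linarith
    then show ?thesis using ln_ge_iff[of "2 * real r / \<mu>" 1] r mu by simp
  qed
  have rL: "4 \<le> (real r)\<^sup>2 * ?L"
  proof -
    have "2\<^sup>2 * 1 \<le> (real r)\<^sup>2 * ?L" using r L1 by (intro mult_mono power_mono) auto
    then show ?thesis by simp
  qed
  \<comment> \<open>Guarantees that \<open>m\<close> is positive after rounding. From the bounds on
    \<open>A\<close> and \<delta>, \<mu> / \<delta> is at least \<mu> A^3 / 2, that is, at least 48
    * 16 / 2 = 384 times r^2 ln (2 r / \<mu>).\<close>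
  have big: "2 * ((real r)\<^sup>2 * ?L) \<le> \<mu> / \<delta>"
  proof -
    have "48 * (real r)\<^sup>2 * ?L \<le> A * \<mu>" using A(1) mu by (simp add: pos_divide_le_eq)
    moreover have "16 \<le> A ^ 2" using power_mono[OF A(4), of 2] by simp
    ultimately have "(48 * (real r)\<^sup>2 * ?L) * 16 \<le> (A * \<mu>) * A ^ 2"
      by (rule mult_mono) (use A mu in auto)
    also have "\<dots> = \<mu> * A ^ 3" by (simp add: power2_eq_square power3_eq_cube)
    finally have "384 * ((real r)\<^sup>2 * ?L) \<le> \<mu> * (A ^ 3 / 2)" by simp
    also have "\<dots> \<le> \<mu> * (1 / \<delta>)"
    proof (rule mult_left_mono)
      have "0 < A ^ 3" using A by simp
      then have "\<delta> * A ^ 3 \<le> 2" using del by (simp add: pos_le_divide_eq)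
      then show "A ^ 3 / 2 \<le> 1 / \<delta>" using del by (simp add: field_simps)
    qed (use mu in simp)
    finally have "384 * ((real r)\<^sup>2 * ?L) \<le> \<mu> / \<delta>" by simp
    then show ?thesis using rL by linarith
  qed
  have tb: "real t \<le> \<mu> / \<delta>" "\<mu> / \<delta> < real t + 1"
    using big rL by (auto simp: t_def)
  have "\<mu> / (2 * \<delta>) = (\<mu> / \<delta>) / 2" by simp
  then have t2: "\<mu> / (2 * \<delta>) \<le> real t" using tb big rL by linarith
  have t3: "(real r)\<^sup>2 * ?L \<le> real t" using tb big rL by linarith
  have del4: "A * \<delta> \<le> 1 / 2" "\<delta> \<le> 1 / 2"
  proof -
    have a2: "16 \<le> A\<^sup>2" using power_mono[OF A(4), of 2] by simp
    have "A * \<delta> \<le> A * (2 / A ^ 3)" using del A by (intro mult_left_mono) auto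
    also have "\<dots> = 2 / A\<^sup>2" using A by (simp add: power2_eq_square power3_eq_cube)
    also have "\<dots> \<le> 2 / 16" using a2 by (intro divide_left_mono) auto
    finally show a: "A * \<delta> \<le> 1 / 2" by simp
    have "1 * \<delta> \<le> A * \<delta>" using A del by (intro mult_right_mono) auto
    then show "\<delta> \<le> 1 / 2" using a by linarith
  qed
  have eps_r: "real (r - 1) * (1 / A\<^sup>2) \<le> 1 / 2"
  proof -
    have "2 * real r * 1 \<le> A * A" using A r by (intro mult_mono) auto
    moreover have "real (r - 1) \<le> real r" by simp
    ultimately have "2 * real (r - 1) \<le> A\<^sup>2" by (simp add: power2_eq_square)
    then show ?thesis using A by (simp add: field_simps)
  qed
  have small: "(real r)\<^sup>2 * (2 * real r / \<mu>) ^ Suc r * (1 / A\<^sup>2 * A) \<le> 1"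
  proof -
    have "1 / A\<^sup>2 * A = 1 / A" using A by (simp add: power2_eq_square)
    moreover have "0 < A" using A by simp
    ultimately show ?thesis using A(2) by (simp only: mult_1_right times_divide_eq_right pos_divide_le_eq mult_1_left)
  qed
  \<comment> \<open>Multiplied by the number \<open>fact t ^ r\<close> of permutation families, the
    quasirandomness error is \<mu>^r: the summand 1 in the constant
    \<open>3 * exp 151 + 1\<close>.\<close>
  define \<eta> where "\<eta> = \<mu> ^ r / fact t ^ r"
  have eta: "0 < \<eta>" using mu by (simp add: \<eta>_def)
  obtain q :: nat where q: "0 < q" "\<And>k :: nat. \<mu> \<in> \<rat> \<longrightarrow> \<mu> * real (q * k) \<in> \<int>"
    by (rule rational_multiple[of \<mu>]) blast
  let ?P = "{..<r} \<rightarrow>\<^sub>E {p. p permutes {..<t}}"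
  have P: "finite ?P" "?P \<noteq> {}"
  proof -
    show "finite ?P" by (intro finite_PiE) (auto simp: finite_permutations)
    show "?P \<noteq> {}" using permutes_id[of "{..<t}"] by (subst PiE_eq_empty_iff) blast
  qed
  obtain B h where B: "0 < B" "q dvd B" and h: "\<forall>b1 < B. \<forall>b2 < B. h b1 b2 \<in> ?P"
    and quasi: "\<forall>\<sigma> \<in> ?P. \<forall>S1 \<subseteq> {..<B}. \<forall>S2 \<subseteq> {..<B}.
       (\<Sum>b1\<in>S1. \<Sum>b2\<in>S2. of_bool (h b1 b2 = \<sigma>)) \<le> real (card S1) * real (card S2) / real (card ?P) + \<eta> * (real B)\<^sup>2"
    using quasirandom_colouring[OF P eta q(1)] by blast
  \<comment> \<open>The number of vertices is a multiple of \<open>B\<close>, hence of the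
    denominator of a rational \<mu>.\<close>
  have muN: "\<mu> \<in> \<rat> \<longrightarrow> \<mu> * real (r * B * n ^ t) \<in> \<int>" for n :: nat
  proof -
    obtain B' where "B = q * B'" using B(2) by (auto elim: dvdE)
    then have e: "r * B * n ^ t = q * (r * B' * n ^ t)" by simp
    show ?thesis unfolding e by (rule q(2))
  qed
  have m_le: "m \<le> t"
  proof -
    have "real t / ((real r)\<^sup>2 * ?L) \<le> real t / 1" using rL by (intro divide_left_mono) auto
    then show ?thesis unfolding m_def by linarith
  qed
  have hp: "h b1 b2 j permutes {..<t}" if "b1 < B" "b2 < B" "j < r" for b1 b2 j
    using h that by (auto simp: PiE_iff)
  have fx: "\<exists>n es. 0 < n \<and> (\<forall>e \<in> set es. e \<subseteq> {..<n}) \<and> f x = graph_word n es" for x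
  proof -
    obtain n E where x: "encodes (f x) n E" "regular_graph {..<n} E"
      using f(2)[of x] unfolding sse_yes_def sse_no_def by blast
    show ?thesis using encodes_graph_word[OF x] by blast
  qed
  have wfc: "wfc (r * t + t) {} (reduction_cmd r m t B h)" by (rule reduction_cmd_wfc[OF m_le hp r])
  obtain g where g: "poly_time g" and gall: "\<forall>x n es. 0 < n \<longrightarrow> (\<forall>e \<in> set es. e \<subseteq> {..<n}) \<longrightarrow>
      f x = graph_word n es \<longrightarrow> g x = sem n (set es) (reduction_cmd r m t B h) (\<lambda>_. 0)"
    using cmd_poly_time[OF f(1) wfc fx] by (elim exE conjE)
  have gx: "g x = sem n (set es) (reduction_cmd r m t B h) (\<lambda>_. 0)"
    if "0 < n" "\<forall>e \<in> set es. e \<subseteq> {..<n}" "f x = graph_word n es" for x n es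
    using gall that by (simp only: simp_thms)
  have out: "g x = replicate (r * B * n ^ t) True @ [False] @
      concat (map (\<lambda>e. map (\<lambda>x. x \<in> e) (vlist r t B n)) (elist r m t B h n E))"
    if x: "encodes (f x) n E" "regular_graph {..<n} E" for x n E
  proof -
    obtain es where es: "set es = E" "f x = graph_word n es" "0 < n" "\<forall>e \<in> set es. e \<subseteq> {..<n}"
      and c: "\<forall>e \<in> E. card e = 2"
      using encodes_graph_word[OF x] by blast
    then have c2: "\<And>e. e \<in> E \<Longrightarrow> card e = 2" by simp
    have "g x = sem n E (reduction_cmd r m t B h) (\<lambda>_. 0)" using gx[OF es(3,4,2)] es(1) by simp
    also have "\<dots> = replicate (r * B * n ^ t) True @ [False] @
      concat (map (\<lambda>e. map (\<lambda>x. x \<in> e) (vlist r t B n)) (elist r m t B h n E))"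
      by (rule reduction_cmd_sem[OF c2 m_le hp r])
    finally show ?thesis .
  qed
  have hP: "\<And>b1 b2. b1 < B \<Longrightarrow> b2 < B \<Longrightarrow> h b1 b2 \<in> ?P" using h by blast
  have "(f x \<in> sse_yes (1 / A\<^sup>2) \<delta> \<longrightarrow> g x \<in> dksh_at_least r \<mu> (1 / 32 * (\<mu> / (real r ^ 3 * ln (1 / \<mu>))))) \<and>
    (f x \<in> sse_no (1 / A\<^sup>2) A \<delta> \<longrightarrow> g x \<in> dksh_at_most r \<mu> ((3 * exp 151 + 1) * \<mu> ^ r))" for x
  proof (intro conjI impI)
    assume "f x \<in> sse_yes (1 / A\<^sup>2) \<delta>"
    then obtain n E S where x: "encodes (f x) n E" "regular_graph {..<n} E"
      and S: "S \<subseteq> {..<n}" "vol {..<n} S = \<delta>" "expansion {..<n} E S \<le> 1 / A\<^sup>2"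
      unfolding sse_yes_def by blast
    obtain d where ra: "regular_adj n d (nbr E)" and arcs: "card (arcs E) = n * d"
      using regular_graph_adj[OF x(2)] by blast
    show "g x \<in> dksh_at_least r \<mu> (1 / 32 * (\<mu> / (real r ^ 3 * ln (1 / \<mu>))))"
      unfolding out[OF x]
      by (rule regular_adj.yes_case[OF ra refl arcs r mu del(1) tb(1) t2 t3 m_def B(1) hP S eps_r del4(2) muN])
  next
    assume "f x \<in> sse_no (1 / A\<^sup>2) A \<delta>"
    then obtain n E where x: "encodes (f x) n E" "regular_graph {..<n} E"
      and no: "\<forall>S \<subseteq> {..<n}. vol {..<n} S \<in> {\<delta> / A .. A * \<delta>} \<longrightarrow> 1 - 1 / A\<^sup>2 \<le> expansion {..<n} E S"
      unfolding sse_no_def by blast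
    obtain d where ra: "regular_adj n d (nbr E)" and arcs: "card (arcs E) = n * d"
      using regular_graph_adj[OF x(2)] by blast
    have ins: "regular_adj.inside n d (nbr E) T \<le> 1 / A\<^sup>2 * (A * \<delta>)"
      if "T \<subseteq> {..<n}" "real (card T) \<le> A * \<delta> * real n" for T
      by (rule regular_adj.sse_no_inside[OF ra refl arcs _ del(1) _ del4(1) _ that]) (use no A in auto)
    have quasi': "(\<Sum>b1\<in>S1. \<Sum>b2\<in>S2. of_bool (h b1 b2 = \<sigma>))
        \<le> real (card S1) * real (card S2) / real (card ?P) + \<mu> ^ r / fact t ^ r * (real B)\<^sup>2"
      if "\<sigma> \<in> ?P" "S1 \<subseteq> {..<B}" "S2 \<subseteq> {..<B}" for \<sigma> S1 S2
      using quasi that unfolding \<eta>_def by blast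
    show "g x \<in> dksh_at_most r \<mu> ((3 * exp 151 + 1) * \<mu> ^ r)"
      unfolding out[OF x]
      by (rule regular_adj.no_case[OF ra refl arcs r mu del(1) tb(1) t2 t3 m_def B(1) hP ins A(1) _ small quasi' muN]) simp_all
  qed
  then show ?thesis using g by blast
qed

text \<open>Only finitely many words are NO instances; they are mapped to one fixed NO instance and
  all other words to one fixed YES instance.\<close>

lemma reduction_large_delta:
  fixes r :: nat and \<mu> \<delta> A :: real
  assumes r: "2 \<le> r" and mu: "0 < \<mu>" "\<mu> \<le> 1" and A: "4 \<le> A" and del: "0 < \<delta>" "\<delta> < 1" "2 / A ^ 3 < \<delta>"
    and ab: "\<alpha> \<le> 1" "\<mu> ^ r \<le> \<beta>" and f: "poly_time f"
  shows "\<exists>h. poly_time h \<and> (\<forall>x. (f x \<in> sse_yes (1 / A\<^sup>2) \<delta> \<longrightarrow> h x \<in> dksh_at_least r \<mu> \<alpha>) \<and>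
    (f x \<in> sse_no (1 / A\<^sup>2) A \<delta> \<longrightarrow> h x \<in> dksh_at_most r \<mu> \<beta>))"
proof -
  obtain w w' where w: "w \<in> dksh_at_least r \<mu> \<alpha>" "w' \<in> dksh_at_most r \<mu> \<beta>"
    using fixed_instances[OF r mu ab] by blast
  have "16 \<le> A\<^sup>2" using power_mono[OF A, of 2] by simp
  then have e: "1 / A\<^sup>2 \<le> 1 / 16" "0 < 1 / A\<^sup>2" using A by (auto intro: divide_left_mono)
  have d: "2 * (1 / A\<^sup>2) / A < \<delta>" using del(3) by (simp add: power2_eq_square power3_eq_cube mult.assoc)
  have fin: "finite (sse_no (1 / A\<^sup>2) A \<delta>)" by (rule finite_sse_no[OF e A del(1,2) d])
  have dis: "sse_yes (1 / A\<^sup>2) \<delta> \<inter> sse_no (1 / A\<^sup>2) A \<delta> = {}"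
    by (rule sse_yes_no_disjoint) (use e A del in auto)
  show ?thesis
    by (rule exI[of _ "\<lambda>x. if f x \<in> sse_no (1 / A\<^sup>2) A \<delta> then w' else w"])
      (use table_poly_time[OF f fin] w dis in auto)
qed

theorem theorem1p3:
  assumes "SSEH"
  shows "\<exists>c C :: real. 0 < c \<and> 0 < C \<and>
    (\<forall>(r :: nat) (\<mu> :: real). 2 \<le> r \<and> 0 < \<mu> \<and> \<mu> < 1 / 2 ^ r \<longrightarrow>
       NP_hard_to_distinguish
         (dksh_at_least r \<mu> (c * (\<mu> / (real r ^ 3 * ln (1 / \<mu>)))))
         (dksh_at_most r \<mu> (C * \<mu> ^ r)))"
proof (rule exI[of _ "1 / 32"], rule exI[of _ "3 * exp 151 + 1"], intro conjI allI impI)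
  show "0 < (1 / 32 :: real)" "0 < (3 * exp 151 + 1 :: real)" by (simp_all add: add_pos_pos)
  fix r :: nat and \<mu> :: real
  assume "2 \<le> r \<and> 0 < \<mu> \<and> \<mu> < 1 / 2 ^ r"
  then have r: "2 \<le> r" and mu: "0 < \<mu>" "\<mu> < 1 / 2 ^ r" by auto
  have mu4: "\<mu> \<le> 1 / 4"
  proof -
    have "1 / 2 ^ r \<le> 1 / (2::real) ^ 2" using r by (intro divide_left_mono power_increasing) auto
    also have "\<dots> = 1 / 4" by (simp add: power2_eq_square)
    finally show ?thesis using mu by linarith
  qed
  have a0: "0 \<le> 48 * (real r)\<^sup>2 * ln (2 * real r / \<mu>) / \<mu>"
  proof -
    have "1 \<le> 2 * real r / \<mu>" using r mu mu4 by (subst pos_le_divide_eq) auto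
    then have "0 \<le> ln (2 * real r / \<mu>)" by simp
    then show ?thesis using mu by simp
  qed
  have b0: "0 \<le> (real r)\<^sup>2 * (2 * real r / \<mu>) ^ Suc r" using mu by simp
  \<comment> \<open>The sum of nonnegative terms, one for each of the four lower bounds that the
    small case requires. With \<epsilon> = 1 / A^2, the value M = A is the largest that the
    hypothesis admits.\<close>
  define A where "A = 48 * (real r)\<^sup>2 * ln (2 * real r / \<mu>) / \<mu> + (real r)\<^sup>2 * (2 * real r / \<mu>) ^ Suc r + 2 * real r + 4"
  have A: "48 * (real r)\<^sup>2 * ln (2 * real r / \<mu>) / \<mu> \<le> A" "(real r)\<^sup>2 * (2 * real r / \<mu>) ^ Suc r \<le> A"
      "2 * real r \<le> A" "4 \<le> A" unfolding A_def using a0 b0 by linarith+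
  have "0 < 1 / A\<^sup>2" using A by simp
  moreover have "1 / A\<^sup>2 < 1"
  proof -
    have "16 \<le> A\<^sup>2" using power_mono[OF A(4), of 2] by simp
    then have "1 < A\<^sup>2" "0 < A\<^sup>2" by linarith+
    then show ?thesis by (simp only: pos_divide_less_eq mult_1_left)
  qed
  moreover have "1 \<le> A" using A by simp
  moreover have "A \<le> 1 / sqrt (1 / A\<^sup>2)" using A by (simp add: real_sqrt_divide)
  ultimately obtain \<delta> where del: "0 < \<delta>" "\<delta> < 1"
    and hard: "NP_hard_to_distinguish (sse_yes (1 / A\<^sup>2) \<delta>) (sse_no (1 / A\<^sup>2) A \<delta>)"
    using assms unfolding SSEH_def by blast
  show "NP_hard_to_distinguish
         (dksh_at_least r \<mu> (1 / 32 * (\<mu> / (real r ^ 3 * ln (1 / \<mu>)))))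
         (dksh_at_most r \<mu> ((3 * exp 151 + 1) * \<mu> ^ r))"
  \<comment> \<open>The threshold is 2 \<epsilon> / M, above which NO instances have bounded
    size.\<close>
  proof (cases "\<delta> \<le> 2 / A ^ 3")
    case True
    show ?thesis
      by (rule NP_hard_transfer[OF hard]) (rule reduction_small_delta[OF r mu A del(1) True])
  next
    case False
    have alpha: "1 / 32 * (\<mu> / (real r ^ 3 * ln (1 / \<mu>))) \<le> 1"
    proof -
      have "exp 1 \<le> (4 :: real)" using exp_le by linarith
      also have "4 \<le> 1 / \<mu>" using mu mu4 by (simp add: pos_le_divide_eq)
      finally have "exp 1 \<le> 1 / \<mu>" .
      then have "1 \<le> ln (1 / \<mu>)" using ln_ge_iff[of "1 / \<mu>" 1] mu by simp
      moreover have "1 \<le> real r ^ 3" using r by simp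
      ultimately have "1 * 1 \<le> real r ^ 3 * ln (1 / \<mu>)" by (intro mult_mono) auto
      then have "\<mu> / (real r ^ 3 * ln (1 / \<mu>)) \<le> \<mu> / 1" using mu by (intro divide_left_mono) auto
      then show ?thesis using mu4 by simp
    qed
    have beta: "\<mu> ^ r \<le> (3 * exp 151 + 1) * \<mu> ^ r"
      using mu by (simp add: distrib_right)
    show ?thesis
      by (rule NP_hard_transfer[OF hard])
        (rule reduction_large_delta[OF r mu(1) _ A(4) del _ alpha beta], use mu4 False in auto)
  qed
qed

end
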